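(* Let $\widetilde A\in M_n(\mathbb{C}(x))$ be holomorphic at $\infty$ with $\widetilde A_0=\widetilde A(\infty)$ non-resonant (no two eigenvalues differ by a nonzero integer). Let $A^{(h)}\in M_n(\mathbb{C}(x))$, $h\in]0,h_0[$, be a family converging uniformly to $\widetilde A$, as $h\to0^+$, on every compact subset of $\mathbb{P}^1(\mathbb{C})\setminus\{\text{poles of }\widetilde A\}$ (it is understood that every $x_0\in\mathbb{P}^1(\mathbb{C})$ that is not a pole of $\widetilde A$ has a neighbourhood on which the $A^{(h)}$ have no pole for $h>0$ small enough). Suppose that a Jordan reduction of $\widetilde A_0$ unfolds into Jordan reductions of the $A_0^{(h)}=A^{(h)}(\infty)$. Then, for $h_0'\in]0,h_0[$ small enough, the family of systems $\delta_{-h}Y=A^{(h)}Y$, $h\in]0,h_0'[$, is Fuchsian $(C,\lambda)$ at $+\infty$ for some $C,\lambda$, and non-resonant; and, as $h\to0^+$, the canonical solution $e^{(h)+}_{A^{(h)}}$ at $+\infty$ tends to $e_{\widetilde A}$ on $\widetilde\Omega^+$, where $\widetilde\Omega^+$ is $\mathbb{C}$ minus the horizontal closed half-lines issued from $0$ and from each pole of $\widetilde A$ and directed towards $-\infty$, and $e_{\widetilde A}$ is the continuation to $\widetilde\Omega^+$ of the canonical Frobenius solution at $\infty$ of $x\frac{d}{dx}\widetilde Y=\widetilde A\widetilde Y$.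
   Context: $\|\cdot\|$ is an algebra norm on $M_n(\mathbb{C})$. $\delta_{-h}Y(x)=(x-h)\frac{Y(x)-Y(x-h)}{h}$. $x^{[s]_h}=x(x+h)\cdots(x+(s-1)h)$ ($=1$ for $s=0$), $x^{-[s]_h}=1/x^{[s]_h}$. $\mathcal{O}_{fact}^{(h)}$ is the ring of functions given on some right half-plane by convergent series $\sum_{s\ge0}a_sx^{-[s]_h}$. A family of systems $\delta_{-h}Y=A^{(h)}Y$, $h\in]0,h_0[$, is Fuchsian $(C,\lambda)$ at $+\infty$ ($C,\lambda\ge0$) if each $A^{(h)}=\sum_sA_s^{(h)}x^{-[s]_h}\in M_n(\mathcal{O}_{fact}^{(h)})$ and the family is of type $(C,\lambda)$: there is $h_0''\in]0,h_0[$ with $\|A_s^{(h)}\|\le C\lambda^{[s-1]_h}$ for all $h\in]0,h_0''[$, $s\ge1$, and $\{\|A_0^{(h)}\|\}_h$ is bounded. It is non-resonant if for every $h$ no two eigenvalues of $A^{(h)}(+\infty)$ differ by a nonzero integer. Unfolding: there exist Jordan reductions $\widetilde A_0=\widetilde Q\widetilde J\widetilde Q^{-1}$ and $A_0^{(h)}=Q^{(h)}J^{(h)}(Q^{(h)})^{-1}$ with $Q^{(h)}\to\widetilde Q$ and $J^{(h)}\to\widetilde J$ as $h\to0^+$. Canonical solution: put $e_c^{(h)+}(x)=h^c\,\Gamma(x/h)/\Gamma(x/h-c)$, $l_c^{(k,h)}=\frac1{k!}\partial_c^ke_c^{(h)+}$. For a Jordan block $cI_\mu+N_\mu$ ($N_\mu$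 with ones on the superdiagonal), $e^{(h)+}_{cI_\mu+N_\mu}$ is the upper triangular Toeplitz matrix with $(i,j)$ entry $l_c^{(j-i,h)}$ for $j\ge i$; extend blockwise to Jordan matrices and set $e^{(h)+}_{QJQ^{-1}}=Qe^{(h)+}_JQ^{-1}$ (independent of the reduction). When $A_0^{(h)}$ is non-resonant there is a unique $F^{(h)}\in GL_n(\mathcal{O}_{fact}^{(h)})$ with $F^{(h)}(+\infty)=I$ such that $e^{(h)+}_{A^{(h)}}:=F^{(h)}e^{(h)+}_{A_0^{(h)}}$ is a solution of $\delta_{-h}Y=A^{(h)}Y$; it is meromorphic on $\mathbb{C}$ and is called the canonical solution at $+\infty$. Frobenius solution: $e_{\widetilde A}=\widetilde F(x)\,x^{\widetilde A_0}$ near $\infty$, where $x^{\widetilde A_0}=\exp(\widetilde A_0\log x)$ with the principal logarithm and $\widetilde F$ is the unique convergent power series in $1/x$ with $\widetilde F(\infty)=I$ making this a solution of $x\frac{d}{dx}\widetilde Y=\widetilde A\widetilde Y$. *)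

theory Defs
  imports
    "HOL-Complex_Analysis.Complex_Analysis"
    "HOL-Computational_Algebra.Computational_Algebra"
    "HOL-Computational_Algebra.Field_as_Ring"
    "Jordan_Normal_Form.Jordan_Normal_Form"
begin

text \<open>
  Square matrices of size n are elements of \<open>carrier_mat n n\<close>; limits and regularity of
  matrix-valued functions are entrywise (all norms on n by n matrices are equivalent).
\<close>

definition algebra_norm :: "nat \<Rightarrow> (complex mat \<Rightarrow> real) \<Rightarrow> bool" where
  "algebra_norm n nrm \<longleftrightarrow>
     (\<forall>A \<in> carrier_mat n n. 0 \<le> nrm A \<and> (nrm A = 0 \<longleftrightarrow> A = 0\<^sub>m n n)) \<and>
     (\<forall>A \<in> carrier_mat n n. \<forall>c. nrm (c \<cdot>\<^sub>m A) = cmod c * nrm A) \<and>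
     (\<forall>A \<in> carrier_mat n n. \<forall>B \<in> carrier_mat n n. nrm (A + B) \<le> nrm A + nrm B) \<and>
     (\<forall>A \<in> carrier_mat n n. \<forall>B \<in> carrier_mat n n. nrm (A * B) \<le> nrm A * nrm B)"

definition nonresonant :: "complex mat \<Rightarrow> bool" where
  "nonresonant A \<longleftrightarrow> (\<forall>a b. eigenvalue A a \<longrightarrow> eigenvalue A b \<longrightarrow> a - b \<in> \<int> \<longrightarrow> a = b)"


section \<open>Rational functions on the Riemann sphere\<close>

text \<open>
  The sphere is the one-point compactification of the complex plane, with \<open>None\<close> as the point at
  infinity.  The pair \<open>quot_of_fract r\<close> is the numerator and denominator of r in lowest terms.
\<close>

abbreviation riemann_sphere :: "complex option topology" where
  "riemann_sphere \<equiv> Alexandroff_compactification euclidean"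

definition rf_pole :: "complex poly fract \<Rightarrow> complex option \<Rightarrow> bool" where
  "rf_pole r p =
     (case quot_of_fract r of (a, b) \<Rightarrow>
       (case p of Some x \<Rightarrow> poly b x = 0 | None \<Rightarrow> degree a > degree b))"

text \<open>The values are meaningful away from the poles only.\<close>

definition rf_eval :: "complex poly fract \<Rightarrow> complex option \<Rightarrow> complex" where
  "rf_eval r p =
     (case quot_of_fract r of (a, b) \<Rightarrow>
       (case p of Some x \<Rightarrow> poly a x / poly b x
                | None \<Rightarrow> coeff a (degree b) / lead_coeff b))"

definition rm_poles :: "complex poly fract mat \<Rightarrow> complex option set" where
  "rm_poles A = {p. \<exists>r \<in> elements_mat A. rf_pole r p}"

definition rm_eval :: "complex poly fract mat \<Rightarrow> complex option \<Rightarrow> complex mat" where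
  "rm_eval A p = map_mat (\<lambda>r. rf_eval r p) A"


section \<open>Factorial series\<close>

definition h_rising :: "real \<Rightarrow> nat \<Rightarrow> 'a \<Rightarrow> 'a :: real_normed_field" where
  "h_rising h s x = (\<Prod>k<s. x + of_nat k * of_real h)"

text \<open>
  Elements of \<open>O_fact\<close> are germs at \<open>Re x = +\<infinity>\<close>: f is only constrained on some right
  half-plane.  Taking the bound c nonnegative keeps the zeros of \<open>h_rising h s\<close> out of it.
\<close>

definition has_fact_series :: "real \<Rightarrow> (nat \<Rightarrow> complex) \<Rightarrow> (complex \<Rightarrow> complex) \<Rightarrow> bool" where
  "has_fact_series h a f \<longleftrightarrow>
     (\<exists>c\<ge>0. \<forall>x. Re x > c \<longrightarrow> (\<lambda>s. a s * inverse (h_rising h s x)) sums f x)"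

definition O_fact :: "real \<Rightarrow> (complex \<Rightarrow> complex) set" where
  "O_fact h = {f. \<exists>a. has_fact_series h a f}"

definition mat_has_fact_series ::
    "nat \<Rightarrow> real \<Rightarrow> (nat \<Rightarrow> complex mat) \<Rightarrow> (complex \<Rightarrow> complex mat) \<Rightarrow> bool" where
  "mat_has_fact_series n h As F \<longleftrightarrow>
     (\<forall>s. As s \<in> carrier_mat n n) \<and> (\<forall>x. F x \<in> carrier_mat n n) \<and>
     (\<forall>i<n. \<forall>j<n. has_fact_series h (\<lambda>s. As s $$ (i, j)) (\<lambda>x. F x $$ (i, j)))"

definition M_O_fact :: "nat \<Rightarrow> real \<Rightarrow> (complex \<Rightarrow> complex mat) set" where
  "M_O_fact n h = {F. (\<forall>x. F x \<in> carrier_mat n n) \<and>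
                      (\<forall>i<n. \<forall>j<n. (\<lambda>x. F x $$ (i, j)) \<in> O_fact h)}"

definition GL_O_fact :: "nat \<Rightarrow> real \<Rightarrow> (complex \<Rightarrow> complex mat) set" where
  "GL_O_fact n h = {F \<in> M_O_fact n h. \<exists>G \<in> M_O_fact n h. \<exists>c. \<forall>x. Re x > c \<longrightarrow>
                      F x * G x = 1\<^sub>m n \<and> G x * F x = 1\<^sub>m n}"

definition fuchsian_family ::
    "nat \<Rightarrow> (complex mat \<Rightarrow> real) \<Rightarrow> real \<Rightarrow> (real \<Rightarrow> complex \<Rightarrow> complex mat) \<Rightarrow>
      real \<Rightarrow> real \<Rightarrow> bool" where
  "fuchsian_family n nrm h0 A C lam \<longleftrightarrow> 0 \<le> C \<and> 0 \<le> lam \<and>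
     (\<exists>As. (\<forall>h \<in> {0<..<h0}. mat_has_fact_series n h (As h) (A h)) \<and>
           (\<exists>h2 \<in> {0<..<h0}. \<forall>h \<in> {0<..<h2}. \<forall>s\<ge>1.
              nrm (As h s) \<le> C * h_rising h (s - 1) lam) \<and>
           bounded ((\<lambda>h. nrm (As h 0)) ` {0<..<h0}))"


section \<open>Jordan reductions\<close>

text \<open>The list bs contains the pairs (size, eigenvalue) of the Jordan blocks.\<close>

definition jordan_reduction ::
    "complex mat \<Rightarrow> complex mat \<Rightarrow> complex mat \<Rightarrow> (nat \<times> complex) list \<Rightarrow> bool" where
  "jordan_reduction A Q Qinv bs \<longleftrightarrow>
     0 \<notin> fst ` set bs \<and> similar_mat_wit A (jordan_matrix bs) Q Qinv"

definition jordan_unfolds ::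
    "nat \<Rightarrow> real \<Rightarrow> complex mat \<Rightarrow> (real \<Rightarrow> complex mat) \<Rightarrow> bool" where
  "jordan_unfolds n h0 At0 A0 \<longleftrightarrow>
     (\<exists>Qt Qtinv bst Q Qinv bs.
        jordan_reduction At0 Qt Qtinv bst \<and>
        (\<forall>h \<in> {0<..<h0}. jordan_reduction (A0 h) (Q h) (Qinv h) (bs h)) \<and>
        (\<forall>i<n. \<forall>j<n.
          ((\<lambda>h. Q h $$ (i, j)) \<longlongrightarrow> Qt $$ (i, j)) (at_right 0) \<and>
          ((\<lambda>h. jordan_matrix (bs h) $$ (i, j)) \<longlongrightarrow> jordan_matrix bst $$ (i, j)) (at_right 0)))"


section \<open>The canonical solution at \<open>+\<infinity>\<close> of the difference system\<close>

definition h_char :: "real \<Rightarrow> complex \<Rightarrow> complex \<Rightarrow> complex" where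
  "h_char h c x = of_real h powr c * Gamma (x / of_real h) / Gamma (x / of_real h - c)"

text \<open>
  HOL's Gamma is 0 at its poles, so division by Gamma agrees with multiplication by the entire
  function 1/Gamma and \<open>h_char h c x\<close> is entire in c for every x.
\<close>

definition h_log :: "real \<Rightarrow> nat \<Rightarrow> complex \<Rightarrow> complex \<Rightarrow> complex" where
  "h_log h k c x = (deriv ^^ k) (\<lambda>c. h_char h c x) c / fact k"

definition h_exp_block :: "real \<Rightarrow> nat \<Rightarrow> complex \<Rightarrow> complex \<Rightarrow> complex mat" where
  "h_exp_block h m c x = Matrix.mat m m (\<lambda>(i, j). if i \<le> j then h_log h (j - i) c x else 0)"

definition h_exp_jordan :: "real \<Rightarrow> (nat \<times> complex) list \<Rightarrow> complex \<Rightarrow> complex mat" where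
  "h_exp_jordan h bs x = diag_block_mat (map (\<lambda>(m, c). h_exp_block h m c x) bs)"

text \<open>The choice is immaterial: the value does not depend on the Jordan reduction.\<close>

definition h_exp_mat :: "real \<Rightarrow> complex mat \<Rightarrow> complex \<Rightarrow> complex mat" where
  "h_exp_mat h A x =
     (SOME E. \<exists>Q Qinv bs. jordan_reduction A Q Qinv bs \<and> E = Q * h_exp_jordan h bs x * Qinv)"

definition delta :: "real \<Rightarrow> (complex \<Rightarrow> complex mat) \<Rightarrow> complex \<Rightarrow> complex mat" where
  "delta h Y x = ((x - of_real h) / of_real h) \<cdot>\<^sub>m (Y x - Y (x - of_real h))"

text \<open>
  A meromorphic function on the plane is represented by its nicely meromorphic version (value 0
  at poles, no removable singularities), and equations between meromorphic functions are required
  outside a discrete closed set.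
\<close>

definition is_canonical_solution ::
    "nat \<Rightarrow> real \<Rightarrow> complex poly fract mat \<Rightarrow> (complex \<Rightarrow> complex mat) \<Rightarrow> bool" where
  "is_canonical_solution n h A Y \<longleftrightarrow>
     (\<forall>x. Y x \<in> carrier_mat n n) \<and>
     (\<forall>i<n. \<forall>j<n. (\<lambda>x. Y x $$ (i, j)) nicely_meromorphic_on UNIV) \<and>
     (\<forall>\<^sub>\<approx>x\<in>UNIV. delta h Y x = rm_eval A (Some x) * Y x) \<and>
     (\<exists>F Fs. F \<in> GL_O_fact n h \<and> mat_has_fact_series n h Fs F \<and> Fs 0 = 1\<^sub>m n \<and>
        (\<exists>c. \<forall>x. Re x > c \<longrightarrow> Y x = F x * h_exp_mat h (rm_eval A None) x))"

definition canonical_solution ::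
    "nat \<Rightarrow> real \<Rightarrow> complex poly fract mat \<Rightarrow> complex \<Rightarrow> complex mat" where
  "canonical_solution n h A = (THE Y. is_canonical_solution n h A Y)"


section \<open>The Frobenius solution of the differential system\<close>

text \<open>The entries of \<open>exp (Ln x A)\<close>.\<close>

definition mat_cpow :: "nat \<Rightarrow> complex \<Rightarrow> complex mat \<Rightarrow> complex mat" where
  "mat_cpow n x A =
     Matrix.mat n n (\<lambda>(i, j). \<Sum>k. (A ^\<^sub>m k) $$ (i, j) * Ln x ^ k / fact k)"

definition left_ray :: "complex \<Rightarrow> complex set" where
  "left_ray a = {z. Im z = Im a \<and> Re z \<le> Re a}"

definition Omega_plus :: "complex poly fract mat \<Rightarrow> complex set" where
  "Omega_plus A = - (\<Union>a \<in> insert 0 {a. Some a \<in> rm_poles A}. left_ray a)"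

text \<open>
  Y is holomorphic on the connected open set \<open>Omega_plus A\<close> and extends the local solution
  \<open>F(x) x^A(\<infinity>)\<close> from a right half-plane.  Far to the left, between two of the removed
  half-lines, the continuation may differ from \<open>F(x) x^A(\<infinity>)\<close>.
\<close>

definition is_frobenius_continuation ::
    "nat \<Rightarrow> complex poly fract mat \<Rightarrow> (complex \<Rightarrow> complex mat) \<Rightarrow> bool" where
  "is_frobenius_continuation n A Y \<longleftrightarrow>
     (\<forall>x. Y x \<in> carrier_mat n n) \<and>
     (\<forall>i<n. \<forall>j<n. (\<lambda>x. Y x $$ (i, j)) holomorphic_on Omega_plus A) \<and>
     (\<exists>Fs F R. R > 0 \<and>
        (\<forall>k. Fs k \<in> carrier_mat n n) \<and> Fs 0 = 1\<^sub>m n \<and> (\<forall>x. F x \<in> carrier_mat n n) \<and>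
        (\<forall>a. Some a \<in> rm_poles A \<longrightarrow> cmod a \<le> R) \<and>
        (\<forall>x. cmod x > R \<longrightarrow>
          (\<forall>i<n. \<forall>j<n. (\<lambda>k. Fs k $$ (i, j) * inverse x ^ k) sums (F x $$ (i, j)))) \<and>
        (\<forall>x. cmod x > R \<longrightarrow> x \<notin> \<real>\<^sub>\<le>\<^sub>0 \<longrightarrow>
          (\<forall>i<n. \<forall>j<n.
            ((\<lambda>z. (F z * mat_cpow n z (rm_eval A None)) $$ (i, j)) has_field_derivative
               (rm_eval A (Some x) * (F x * mat_cpow n x (rm_eval A None))) $$ (i, j) / x)
              (at x))) \<and>
        (\<forall>x. Re x > R \<longrightarrow> Y x = F x * mat_cpow n x (rm_eval A None)))"

text \<open>Only the values on \<open>Omega_plus A\<close> are determined.\<close>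

definition frobenius_solution ::
    "nat \<Rightarrow> complex poly fract mat \<Rightarrow> complex \<Rightarrow> complex mat" where
  "frobenius_solution n A = (SOME Y. is_frobenius_continuation n A Y)"

end

theory Submission imports Defs
begin

text \<open>
  Both solutions are put in the form "regular factor times character", and the two factors are
  compared far to the right.  The regular factor \<open>F = 1 + U\<close> solves a gauge equation; in the basis
  of inverse rising factorials this becomes a triangular recursion whose diagonal blocks are the
  Sylvester operators \<open>X \<mapsto> - s X - A0 X + X A0\<close>.  Non-resonance bounds their inverses by
  \<open>\<kappa>/s\<close>, uniformly for small \<open>h\<close>, and for \<open>\<rho>\<close> large the remaining terms are small in the norm
  \<open>\<Sum> |U_s| \<rho>^{-[s]_h}\<close>.  This gives existence, convergence for \<open>Re x \<ge> \<rho>\<close>, and stability with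
  constants independent of \<open>h\<close>; the case \<open>h = 0\<close> is the Frobenius solution.  Its regular factor
  satisfies the gauge equation of step \<open>h\<close> up to a residual that tends to 0 with \<open>h\<close>, so stability
  shows that the regular factors converge.  The characters converge because they are the entire
  functions \<open>c \<mapsto> h^c \<Gamma>(x/h)/\<Gamma>(x/h - c)\<close> of the residue matrix, which tend to \<open>exp (c Ln x)\<close> locally
  uniformly.  To the left, the difference system read from right to left is the Euler scheme
  \<open>Y(x) = (1 - (h/x) A(x + h)) Y(x + h)\<close> for the differential system along horizontal lines, and a
  discrete Gronwall estimate propagates the convergence over any compact subset of the cut plane.
\<close>

section \<open>Inverse rising factorials\<close>

text \<open>The operator \<open>delta h\<close> multiplies \<open>fe h s\<close> by -s whatever h
  is, as x d/dx does with x^{-s}. Hence the leading operators of the recursion do not change with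
  the step, and h = 0 can be treated as a member of the family. Products of two basis elements
  expand with nonnegative coefficients, so evaluation at the real point \<rho> makes the weighted
  l^1 norm multiplicative on them with constant 1, again for every h; this takes the place of x^{-s}
  x^{-t} = x^{-(s+t)}.

  The Leibniz rule of the difference is \<delta>(F E) = (\<delta> F) E + F(x - h) \<delta> E.
  Writing F(x - h) = F - h/(x - h) \<delta> F produces the extra term h/(x - h) (\<delta> U) A0,
  whose coefficients carry a factor s. Therefore the gain \<kappa>/s is kept, and the stability
  estimate bounds the sum of s |U_s|.

  Block sizes of a Jordan form may jump as h tends to 0, so the characters are compared as power
  series in the residue matrix. Convergence of the Jordan matrices enters through the eigenvalues,
  to keep the family non-resonant.\<close>

definition fe :: "real \<Rightarrow> nat \<Rightarrow> 'a :: real_normed_field \<Rightarrow> 'a" where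
  "fe h s x = inverse (h_rising h s x)"

text \<open>The region on which every \<open>fe h s\<close> is bounded by its value at the real point r.\<close>

definition hdom :: "real \<Rightarrow> real \<Rightarrow> 'a :: real_normed_field \<Rightarrow> bool" where
  "hdom h r x \<longleftrightarrow> (\<forall>k. r + of_nat k * h \<le> norm (x + of_nat k * of_real h))"

lemma h_rising_0 [simp]: "h_rising h 0 x = 1"
  by (simp add: h_rising_def)

lemma h_rising_Suc: "h_rising h (Suc s) x = h_rising h s x * (x + of_nat s * of_real h)"
  by (simp add: h_rising_def)

lemma h_rising_add: "h_rising h (s + t) x = h_rising h s x * h_rising h t (x + of_nat s * of_real h)"
  by (induction t) (simp_all add: h_rising_Suc algebra_simps)

lemma h_rising_of_real: "h_rising h s (of_real x) = of_real (h_rising h s x)"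
  by (simp add: h_rising_def)

lemma fe_of_real: "fe h s (of_real x) = of_real (fe h s x)"
  by (simp add: fe_def h_rising_of_real)

lemma fe_0 [simp]: "fe h 0 x = 1"
  by (simp add: fe_def)

lemma fe_Suc: "fe h (Suc s) x = fe h s x * inverse (x + of_nat s * of_real h)"
  by (simp add: fe_def h_rising_Suc)

lemma fe_add: "fe h (s + t) x = fe h s x * fe h t (x + of_nat s * of_real h)"
  by (simp add: fe_def h_rising_add)

lemma h_rising_nonneg: "0 \<le> h \<Longrightarrow> 0 \<le> r \<Longrightarrow> 0 \<le> h_rising h s (r::real)"
  by (auto simp: h_rising_def intro!: prod_nonneg)

lemma h_rising_pos: "0 \<le> h \<Longrightarrow> 0 < r \<Longrightarrow> 0 < h_rising h s (r::real)"
  unfolding h_rising_def by (intro prod_pos) (simp add: add_pos_nonneg)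

lemma fe_pos: "0 \<le> h \<Longrightarrow> 0 < r \<Longrightarrow> 0 < fe h s (r::real)"
  by (simp add: fe_def h_rising_pos)

lemma norm_h_rising_le:
  assumes "norm r \<le> R" "0 \<le> h"
  shows "norm (h_rising h s r) \<le> h_rising h s R"
proof -
  have "norm (r + of_nat k * of_real h) \<le> R + of_nat k * h" for k
    using assms norm_triangle_ineq[of r "of_nat k * of_real h"] by (simp add: norm_mult)
  thus ?thesis
    unfolding h_rising_def prod_norm[symmetric] by (intro prod_mono) auto
qed

lemma hdomD: "hdom h r x \<Longrightarrow> r + of_nat k * h \<le> norm (x + of_nat k * of_real h)"
  by (simp add: hdom_def)

lemma hdom_Re: "r \<le> Re x \<Longrightarrow> hdom h r x"
  unfolding hdom_def
  using complex_Re_le_cmod order_trans by (smt (verit) Re_complex_of_real of_real_mult of_real_of_nat_eq plus_complex.sel(1))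

lemma hdom_real: "hdom h r (r::real)"
  unfolding hdom_def by (auto intro: abs_ge_self)

lemma hdom_mono: "hdom h r x \<Longrightarrow> r' \<le> r \<Longrightarrow> hdom h r' x"
  unfolding hdom_def by (metis add_mono_thms_linordered_semiring(3) order_trans)

lemma hdom_shift: "hdom h r x \<Longrightarrow> hdom h (r + of_nat m * h) (x + of_nat m * of_real h)"
  unfolding hdom_def
proof
  fix k assume *: "\<forall>k. r + real k * h \<le> norm (x + of_nat k * of_real h)"
  show "r + real m * h + real k * h \<le> norm (x + of_nat m * of_real h + of_nat k * of_real h)"
    using *[rule_format, of "m + k"] by (simp add: algebra_simps)
qed

lemma hdom_nonzero:
  assumes "hdom h r x" "0 \<le> h" "0 < r"
  shows "x + of_nat k * of_real h \<noteq> 0"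
  using hdomD[OF assms(1), of k] assms(2,3) add_pos_nonneg[of r "real k * h"] by auto

lemma h_rising_nonzero: "hdom h r x \<Longrightarrow> 0 \<le> h \<Longrightarrow> 0 < r \<Longrightarrow> h_rising h s x \<noteq> 0"
  using hdom_nonzero by (auto simp: h_rising_def)

lemma norm_fe_le:
  assumes "hdom h r x" "0 \<le> h" "0 < r"
  shows "norm (fe h s x) \<le> fe h s r"
proof -
  have "h_rising h s r \<le> norm (h_rising h s x)"
    unfolding h_rising_def prod_norm[symmetric] using assms
    by (intro prod_mono) (auto simp: hdom_def add_pos_nonneg less_imp_le)
  thus ?thesis
    using h_rising_pos[OF assms(2,3)] by (simp add: fe_def norm_inverse le_imp_inverse_le)
qed

text \<open>Each factor of the product is 1 - (r - R)/(r + k h), and r + k h grows at most linearly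
  in k, so the product is dominated by the exponential of a negative multiple of the harmonic
  sum.\<close>

lemma h_rising_ratio_tendsto_0:
  fixes R r h :: real
  assumes R: "0 \<le> R" and r: "R < r" and h: "0 \<le> h"
  shows "(\<lambda>N. h_rising h N R * fe h N r) \<longlonglongrightarrow> 0"
proof -
  \<comment> \<open>From r + N h \<le> (r + h)(N + 1): the factor of index N is at most exp(- c/(N +
    1)).\<close>
  define c where "c = (r - R) / (r + h)"
  have c: "c > 0" using assms by (simp add: c_def add_pos_nonneg)
  have le: "h_rising h N R * fe h N r \<le> exp (- c * harm N)" for N
  proof (induction N)
    case 0 show ?case by (simp add: harm_def)
  next
    case (Suc N)
    have p: "r + real N * h > 0" using assms by (simp add: add_pos_nonneg)
    have "r + real N * h \<le> (r + h) * real (Suc N)"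
      using assms by (simp add: algebra_simps)
    hence "c * inverse (real (Suc N)) \<le> (r - R) / (r + real N * h)"
      using p r unfolding c_def
      using assms by (simp add: divide_simps mult_left_mono del: of_nat_Suc)
    hence "(R + real N * h) * inverse (r + real N * h) \<le> 1 + (- c * inverse (real (Suc N)))"
      using p by (simp add: field_simps)
    also have "\<dots> \<le> exp (- c * inverse (real (Suc N)))" by (rule exp_ge_add_one_self)
    finally have s: "(R + real N * h) * inverse (r + real N * h) \<le> exp (- c * inverse (real (Suc N)))" .
    have "h_rising h (Suc N) R * fe h (Suc N) r
        = (h_rising h N R * fe h N r) * ((R + real N * h) * inverse (r + real N * h))"
      by (simp add: h_rising_Suc fe_Suc)
    also have "\<dots> \<le> exp (- c * harm N) * exp (- c * inverse (real (Suc N)))"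
      using Suc s p assms h_rising_nonneg[OF h R] fe_pos[OF h, of r]
      by (intro mult_mono) (auto intro!: mult_nonneg_nonneg)
    also have "\<dots> = exp (- c * harm (Suc N))"
      by (simp add: harm_Suc exp_add[symmetric] algebra_simps)
    finally show ?case .
  qed
  have "filterlim (\<lambda>N. c * harm N :: real) at_top sequentially"
    using c harm_at_top by (rule filterlim_tendsto_pos_mult_at_top[OF tendsto_const])
  hence "filterlim (\<lambda>N. - c * harm N :: real) at_bot sequentially"
    by (simp add: filterlim_uminus_at_top)
  hence lim: "(\<lambda>N. exp (- c * harm N)) \<longlonglongrightarrow> (0::real)"
    by (rule filterlim_compose[OF exp_at_bot])
  show ?thesis
    by (rule tendsto_sandwich[OF _ _ tendsto_const lim])
       (use le h_rising_nonneg[OF h R] fe_pos[OF h, of r] assms in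
         \<open>auto intro!: always_eventually mult_nonneg_nonneg simp: less_imp_le\<close>)
qed

text \<open>Telescoping: the remainder after N terms is \<open>r^[N] / (x^[N] (x - r))\<close>.\<close>

lemma geometric_fe_sums:
  fixes x r :: "'a :: real_normed_field"
  assumes "hdom h \<rho> x" "0 \<le> h" "norm r \<le> R" "R < \<rho>"
  shows "(\<lambda>s. h_rising h s r * fe h (Suc s) x) sums inverse (x - r)"
proof -
  have R0: "0 \<le> R" using assms(3) norm_ge_zero order_trans by blast
  have rho: "0 < \<rho>" using R0 assms by simp
  have ne: "x - r \<noteq> 0"
    using hdomD[OF assms(1), of 0] assms(3,4) by auto
  define T where "T = (\<lambda>N. inverse (x - r) * (h_rising h N r * fe h N x))"
  have tel: "T n - T (Suc n) = h_rising h n r * fe h (Suc n) x" for n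
  proof -
    have n0: "x + of_nat n * of_real h \<noteq> 0" using hdom_nonzero[OF assms(1,2) rho] .
    have "inverse (x - r) * (1 - (r + of_nat n * of_real h) * inverse (x + of_nat n * of_real h))
        = inverse (x + of_nat n * of_real h)"
      using ne n0 by (simp add: divide_simps)
    hence "inverse (x - r) * (h_rising h n r * fe h n x) * (1 - (r + of_nat n * of_real h) * inverse (x + of_nat n * of_real h))
        = (h_rising h n r * fe h n x) * inverse (x + of_nat n * of_real h)"
      by (metis mult.assoc mult.commute)
    thus ?thesis
      by (simp add: T_def h_rising_Suc fe_Suc ring_distribs mult_ac)
  qed
  have "T \<longlonglongrightarrow> 0"
  proof (rule Lim_null_comparison)
    show "(\<lambda>N. norm (inverse (x - r)) * (h_rising h N R * fe h N \<rho>)) \<longlonglongrightarrow> 0"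
      using tendsto_mult_left[OF h_rising_ratio_tendsto_0[OF R0 assms(4,2)], of "norm (inverse (x - r))"] by simp
    show "\<forall>\<^sub>F N in sequentially. norm (T N) \<le> norm (inverse (x - r)) * (h_rising h N R * fe h N \<rho>)"
      unfolding T_def norm_mult
      using norm_fe_le[OF assms(1,2) rho] norm_h_rising_le[OF assms(3,2)] h_rising_nonneg[OF assms(2) R0]
      by (intro always_eventually allI mult_left_mono mult_mono) auto
  qed
  hence "(\<lambda>n. T n - T (Suc n)) sums (T 0 - 0)" by (rule telescope_sums')
  thus ?thesis unfolding tel by (simp add: T_def)
qed

section \<open>Products in the basis of inverse rising factorials\<close>

definition shiftc :: "real \<Rightarrow> nat \<Rightarrow> real \<Rightarrow> nat \<Rightarrow> real" where
  "shiftc h m r s = (if s < Suc m then 0 else h_rising h (s - Suc m) r)"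

lemma shiftc_nonneg: "0 \<le> h \<Longrightarrow> 0 \<le> r \<Longrightarrow> 0 \<le> shiftc h m r s"
  by (simp add: shiftc_def h_rising_nonneg)

text \<open>The telescoping identity is applied at x + m h. Multiplied by \<open>fe h m x\<close>,
  its s-th term becomes \<open>fe h (s + Suc m) x\<close>, which explains the shift by
  \<open>Suc m\<close>. The shift also relaxes the condition on r from r < \<rho> to r < \<rho> + m
  h; \<open>fe_mult_expansion\<close> and \<open>gk_sums\<close> rely on this.\<close>

lemma shiftc_sums:
  fixes x :: "'a :: real_normed_field"
  assumes "hdom h \<rho> x" "0 \<le> h" "0 \<le> r" "r < \<rho> + of_nat m * h"
  shows "(\<lambda>s. of_real (shiftc h m r s) * fe h s x) sums
     (inverse (x + of_nat m * of_real h - of_real r) * fe h m x)"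
proof -
  have "(\<lambda>s. h_rising h s (of_real r) * fe h (Suc s) (x + of_nat m * of_real h)) sums
     inverse (x + of_nat m * of_real h - of_real r)"
    by (rule geometric_fe_sums[OF hdom_shift[OF assms(1)] assms(2) _ assms(4)]) (use assms in simp)
  from sums_mult2[OF this, of "fe h m x"]
  have "(\<lambda>s. of_real (shiftc h m r (s + Suc m)) * fe h (s + Suc m) x) sums
     (inverse (x + of_nat m * of_real h - of_real r) * fe h m x)"
  proof (rule back_subst[where P = "\<lambda>f. f sums _"], intro ext)
    fix s
    show "h_rising h s (of_real r) * fe h (Suc s) (x + of_nat m * of_real h) * fe h m x =
        of_real (shiftc h m r (s + Suc m)) * fe h (s + Suc m) x"
      using fe_add[of h m "Suc s" x]
      by (simp add: shiftc_def h_rising_of_real add_ac mult_ac)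
  qed
  thus ?thesis by (subst (asm) sums_zero_iff_shift) (auto simp: shiftc_def)
qed

lemma sums_of_real_cancel: "(\<lambda>s. complex_of_real (f s)) sums complex_of_real c \<Longrightarrow> f sums c"
  by (simp add: sums_of_real_iff)

text \<open>Fubini for an absolutely summable family. For fixed s the support lies in t \<le> s, so
  the rearranged inner sums are finite and the result is an ordinary series in s.\<close>

lemma triangular_double_sum:
  fixes f :: "nat \<Rightarrow> nat \<Rightarrow> 'a :: {banach}"
  assumes 1: "\<And>t. summable (\<lambda>s. norm (f t s))"
    and 2: "summable (\<lambda>t. \<Sum>s. norm (f t s))"
    and tri: "\<And>t s. s < t \<Longrightarrow> f t s = 0"
  shows "(\<lambda>s. \<Sum>t\<le>s. f t s) sums (\<Sum>t. \<Sum>s. f t s)"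
proof -
  have a1: "(\<lambda>s. norm (f t s)) summable_on UNIV" for t
    using 1[of t] by (simp add: norm_summable_imp_summable_on)
  have inf1: "infsum (\<lambda>s. norm (f t s)) UNIV = (\<Sum>s. norm (f t s))" for t
    using 1[of t] by (intro infsumI norm_summable_imp_has_sum) (auto simp: summable_sums)
  have inf2: "infsum (\<lambda>s. f t s) UNIV = (\<Sum>s. f t s)" for t
    using 1[of t] by (intro infsumI norm_summable_imp_has_sum) (auto simp: summable_sums summable_norm_cancel)
  have "(\<lambda>t. norm (infsum (\<lambda>s. norm (f t s)) UNIV)) summable_on UNIV"
    unfolding inf1 using 2 by (intro norm_summable_imp_summable_on) (simp add: abs_of_nonneg suminf_nonneg[OF 1])
  hence abs: "(\<lambda>p. norm (case p of (t,s) \<Rightarrow> f t s)) summable_on UNIV \<times> UNIV"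
    using a1 by (subst Infinite_Sum.abs_summable_on_Sigma_iff) auto
  have summ: "(\<lambda>(t,s). f t s) summable_on UNIV \<times> UNIV"
    using abs_summable_summable[OF abs] .
  have hs: "((\<lambda>(t,s). f t s) has_sum (\<Sum>t. \<Sum>s. f t s)) (UNIV \<times> UNIV)"
  proof -
    have "infsum (\<lambda>(t,s). f t s) (UNIV \<times> UNIV) = infsum (\<lambda>t. infsum (f t) UNIV) UNIV"
      using infsum_Sigma'_banach[OF summ] by simp
    also have "\<dots> = infsum (\<lambda>t. \<Sum>s. f t s) UNIV" by (simp add: inf2)
    also have "\<dots> = (\<Sum>t. \<Sum>s. f t s)"
    proof (intro infsumI norm_summable_imp_has_sum)
      show "summable (\<lambda>t. norm (\<Sum>s. f t s))"
        by (rule summable_comparison_test'[OF 2]) (simp add: summable_norm[OF 1])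
      thus "(\<lambda>t. \<Sum>s. f t s) sums (\<Sum>t. \<Sum>s. f t s)"
        by (rule summable_sums[OF summable_norm_cancel])
    qed
    finally show ?thesis using has_sum_infsum[OF summ] by simp
  qed
  hence "((\<lambda>(s,t). f t s) has_sum (\<Sum>t. \<Sum>s. f t s)) (UNIV \<times> UNIV)"
    by (subst has_sum_reindex_bij_betw[where g = prod.swap and A = "UNIV \<times> UNIV", symmetric])
       (auto simp: case_prod_unfold bij_betw_def inj_on_def)
  hence "((\<lambda>s. \<Sum>t\<le>s. f t s) has_sum (\<Sum>t. \<Sum>s. f t s)) UNIV"
  proof (rule has_sum_SigmaD)
    fix s
    have "((\<lambda>t. f t s) has_sum (\<Sum>t\<le>s. f t s)) {..s}" by (rule has_sum_finite) simp
    thus "((\<lambda>y. case (s, y) of (s, t) \<Rightarrow> f t s) has_sum (\<Sum>t\<le>s. f t s)) UNIV"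
      by (subst has_sum_cong_neutral[where T = "{..s}"]) (auto simp: tri)
  qed
  thus ?thesis by (rule has_sum_imp_sums)
qed


text \<open>
  In the applications \<open>\<tau> t\<close> holds the coefficients of \<open>g * fe h t\<close> and \<open>w s = fe h s \<rho>\<close>; the
  lemma then bounds the coefficients of the product of \<open>g\<close> with the series given by \<open>a\<close>.
\<close>

lemma kernel_norm:
  fixes \<rho> q :: real
  assumes w: "\<And>s. 0 \<le> w s"
    and sa: "summable (\<lambda>t. cmod (a t) * w t)"
    and tri: "\<And>t s. s < t \<Longrightarrow> \<tau> t s = (0::complex)"
    and ker: "\<And>t. a t \<noteq> 0 \<Longrightarrow> summable (\<lambda>s. cmod (\<tau> t s) * w s)"
    and kerq: "\<And>t. a t \<noteq> 0 \<Longrightarrow> (\<Sum>s. cmod (\<tau> t s) * w s) \<le> q * w t"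
  shows "summable (\<lambda>s. (\<Sum>t\<le>s. cmod (a t) * cmod (\<tau> t s)) * w s)"
    and "(\<Sum>s. (\<Sum>t\<le>s. cmod (a t) * cmod (\<tau> t s)) * w s) \<le> q * (\<Sum>t. cmod (a t) * w t)"
    and "summable (\<lambda>t. \<Sum>s. cmod (a t) * cmod (\<tau> t s) * w s)"
    and "\<And>t. summable (\<lambda>s. cmod (a t) * cmod (\<tau> t s) * w s)"
proof -
  define f where "f = (\<lambda>t s. cmod (a t) * cmod (\<tau> t s) * w s)"
  have f0: "0 \<le> f t s" for t s using w by (simp add: f_def)
  show s1': "summable (\<lambda>s. cmod (a t) * cmod (\<tau> t s) * w s)" for t
    using summable_mult[OF ker, of t "cmod (a t)"] by (cases "a t = 0") (auto simp: mult_ac)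
  have s1: "summable (f t)" for t using s1'[of t] by (simp add: f_def)
  have le: "(\<Sum>s. f t s) \<le> q * (cmod (a t) * w t)" for t
  proof (cases "a t = 0")
    case False
    have "(\<Sum>s. f t s) = cmod (a t) * (\<Sum>s. cmod (\<tau> t s) * w s)"
      using suminf_mult[OF ker[OF False], of "cmod (a t)"] by (simp add: f_def mult_ac)
    also have "\<dots> \<le> cmod (a t) * (q * w t)"
      by (intro mult_left_mono kerq[OF False]) simp
    finally show ?thesis by (simp add: mult_ac)
  qed (simp add: f_def)
  have s2: "summable (\<lambda>t. \<Sum>s. f t s)"
    by (rule summable_comparison_test'[OF summable_mult[OF sa, of q]])
       (use le suminf_nonneg[OF s1 f0] in auto)
  thus "summable (\<lambda>t. \<Sum>s. cmod (a t) * cmod (\<tau> t s) * w s)" by (simp add: f_def)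
  have "(\<lambda>s. \<Sum>t\<le>s. f t s) sums (\<Sum>t. \<Sum>s. f t s)"
    by (rule triangular_double_sum) (use s1 s2 f0 tri in \<open>auto simp: f_def\<close>)
  moreover have "(\<Sum>t. \<Sum>s. f t s) \<le> (\<Sum>t. q * (cmod (a t) * w t))"
    by (intro suminf_le le s2 summable_mult sa)
  moreover have "(\<lambda>s. \<Sum>t\<le>s. f t s) = (\<lambda>s. (\<Sum>t\<le>s. cmod (a t) * cmod (\<tau> t s)) * w s)"
    by (simp add: f_def sum_distrib_right)
  ultimately show "summable (\<lambda>s. (\<Sum>t\<le>s. cmod (a t) * cmod (\<tau> t s)) * w s)"
    and "(\<Sum>s. (\<Sum>t\<le>s. cmod (a t) * cmod (\<tau> t s)) * w s) \<le> q * (\<Sum>t. cmod (a t) * w t)"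
    using suminf_mult[OF sa, of q] by (auto simp: sums_iff)
qed

text \<open>Multiplication by the number g is known on each basis element and is extended to the
  series. The bounds at the real point \<rho> dominate the terms at x by \<open>norm_fe_le\<close>,
  so the order of summation may be exchanged. The guard \<open>a t \<noteq> 0\<close> lets
  \<open>fe_mult_expansion\<close> use expansions that are available only for large indices.\<close>

lemma kernel_apply:
  fixes x :: complex
  assumes x: "hdom h \<rho> x" "0 \<le> h" "0 < \<rho>"
    and sa: "summable (\<lambda>t. cmod (a t) * fe h t \<rho>)"
    and tri: "\<And>t s. s < t \<Longrightarrow> \<tau> t s = 0"
    and ker: "\<And>t. a t \<noteq> 0 \<Longrightarrow> summable (\<lambda>s. cmod (\<tau> t s) * fe h s \<rho>)"
    and kerq: "\<And>t. a t \<noteq> 0 \<Longrightarrow> (\<Sum>s. cmod (\<tau> t s) * fe h s \<rho>) \<le> q * fe h t \<rho>"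
    and ev: "\<And>t. a t \<noteq> 0 \<Longrightarrow> (\<lambda>s. \<tau> t s * fe h s x) sums (g * fe h t x)"
  shows "(\<lambda>s. (\<Sum>t\<le>s. a t * \<tau> t s) * fe h s x) sums (g * (\<Sum>t. a t * fe h t x))"
proof -
  define f where "f = (\<lambda>t s. a t * \<tau> t s * fe h s x)"
  have w: "0 \<le> fe h s \<rho>" for s using fe_pos[OF x(2,3)] less_imp_le by blast
  note K = kernel_norm[of "\<lambda>s. fe h s \<rho>" a \<tau> q, OF w sa tri ker kerq]
  have nf: "norm (f t s) \<le> cmod (a t) * cmod (\<tau> t s) * fe h s \<rho>" for t s
    unfolding f_def norm_mult using norm_fe_le[OF x] by (intro mult_left_mono) auto
  have s1: "summable (\<lambda>s. norm (f t s))" for t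
    by (rule summable_comparison_test'[OF K(4)]) (use nf in auto)
  have s2: "summable (\<lambda>t. \<Sum>s. norm (f t s))"
    by (rule summable_comparison_test'[OF K(3)])
       (use suminf_le[OF nf s1 K(4)] suminf_nonneg[OF s1] in auto)
  have "(\<lambda>s. \<Sum>t\<le>s. f t s) sums (\<Sum>t. \<Sum>s. f t s)"
    by (rule triangular_double_sum[OF s1 s2]) (simp add: f_def tri)
  moreover have "(\<Sum>s. f t s) = g * (a t * fe h t x)" for t
  proof (cases "a t = 0")
    case False
    show ?thesis using sums_mult[OF ev[OF False], of "a t"] by (simp add: f_def sums_iff mult_ac)
  qed (simp add: f_def)
  moreover have "summable (\<lambda>t. a t * fe h t x)"
    by (rule summable_comparison_test'[OF sa])
       (auto simp: norm_mult intro!: mult_left_mono norm_fe_le[OF x])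
  ultimately show ?thesis
    by (simp add: f_def sum_distrib_right suminf_mult)
qed

text \<open>Induction on t: passing from t to t + 1 multiplies each \<open>fe h m x\<close> by 1/(x
  + t h) = 1/((x + m h) - (m - t) h). Only m \<ge> p + t occur, so (m - t) h \<ge> 0 and
  \<open>shiftc\<close> supplies nonnegative coefficients. Their sign is the point: absolute sums at
  a real \<rho> are then values of the product.\<close>

lemma fe_mult_expansion:
  assumes h: "0 \<le> h"
  shows "\<exists>\<gamma>::nat \<Rightarrow> real. (\<forall>s. 0 \<le> \<gamma> s) \<and> (\<forall>s<p+t. \<gamma> s = 0) \<and>
    (\<forall>\<rho> x::complex. 0 < \<rho> \<longrightarrow> hdom h \<rho> x \<longrightarrow> (\<lambda>s. of_real (\<gamma> s) * fe h s x) sums (fe h p x * fe h t x))"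
proof (induction t)
  case 0
  have "(\<lambda>s. of_real (if s = p then 1 else 0) * fe h s x) sums (fe h p x * fe h 0 x)" for x :: complex
    using sums_single[of p "\<lambda>s. fe h s x"] by (simp add: if_distrib if_distribR cong: if_cong)
  thus ?case by (intro exI[of _ "\<lambda>s. if s = p then 1 else 0"]) auto
next
  case (Suc t)
  then obtain \<gamma> :: "nat \<Rightarrow> real" where g0: "\<And>s. 0 \<le> \<gamma> s" and gz: "\<And>s. s < p+t \<Longrightarrow> \<gamma> s = 0"
    and gs: "\<And>\<rho> x::complex. 0 < \<rho> \<Longrightarrow> hdom h \<rho> x \<Longrightarrow> (\<lambda>s. of_real (\<gamma> s) * fe h s x) sums (fe h p x * fe h t x)"
    by blast
  define \<beta> where "\<beta> m s = shiftc h m (real (m - t) * h) s" for m s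
  have b0: "0 \<le> \<beta> m s" for m s using h by (simp add: \<beta>_def shiftc_nonneg)
  define \<gamma>' where "\<gamma>' s = (\<Sum>m\<le>s. \<gamma> m * \<beta> m s)" for s
  have bs: "(\<lambda>s. of_real (\<beta> m s) * fe h s x) sums (inverse (x + of_nat t * of_real h) * fe h m x)"
    if "\<gamma> m \<noteq> 0" "0 < \<rho>" "hdom h \<rho> x" for m \<rho> and x :: complex
  proof -
    have "m \<ge> t" using gz[of m] that(1) by (meson not_le trans_less_add2)
    have "real (m - t) * h \<le> real m * h" using h by (intro mult_right_mono) auto
    hence "(\<lambda>s. of_real (\<beta> m s) * fe h s x) sums
      (inverse (x + of_nat m * of_real h - of_real (real (m - t) * h)) * fe h m x)"
      unfolding \<beta>_def using that h by (intro shiftc_sums[of h \<rho>]) auto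
    thus ?thesis using \<open>m \<ge> t\<close> by (simp add: of_nat_diff algebra_simps)
  qed
  show ?case
  proof (intro exI[of _ \<gamma>'] conjI allI impI)
    show "0 \<le> \<gamma>' s" for s using g0 b0 by (auto simp: \<gamma>'_def intro!: sum_nonneg)
    show "\<gamma>' s = 0" if "s < p + Suc t" for s
    proof -
      have "\<gamma> m * \<beta> m s = 0" if "m \<le> s" for m
        using gz[of m] \<open>s < p + Suc t\<close> that by (cases "m < p + t") (auto simp: \<beta>_def shiftc_def)
      thus ?thesis unfolding \<gamma>'_def by (intro sum.neutral) auto
    qed
    fix \<rho> and x :: complex assume rx: "0 < \<rho>" "hdom h \<rho> x"
    have d: "hdom h \<rho> (complex_of_real \<rho>)" by (rule hdom_Re) simp
    have r1: "(\<lambda>s. \<gamma> s * fe h s \<rho>) sums (fe h p \<rho> * fe h t \<rho>)"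
      using gs[OF rx(1) d] unfolding fe_of_real
      by (intro sums_of_real_cancel) simp
    have r2: "(\<lambda>s. \<beta> m s * fe h s \<rho>) sums (inverse (\<rho> + real t * h) * fe h m \<rho>)" if "\<gamma> m \<noteq> 0" for m
    proof -
      have e: "complex_of_real (inverse (\<rho> + real t * h)) = inverse (of_real \<rho> + of_nat t * of_real h)"
        by simp
      show ?thesis
        using bs[OF that rx(1) d] unfolding fe_of_real e[symmetric]
        by (intro sums_of_real_cancel) (simp del: of_real_inverse)
    qed
    have "(\<lambda>s. (\<Sum>m\<le>s. complex_of_real (\<gamma> m) * of_real (\<beta> m s)) * fe h s x) sums
       (inverse (x + of_nat t * of_real h) * (\<Sum>m. of_real (\<gamma> m) * fe h m x))"
    proof (rule kernel_apply[OF rx(2) h rx(1), where q = "inverse (\<rho> + real t * h)"])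
      show "summable (\<lambda>m. cmod (of_real (\<gamma> m)) * fe h m \<rho>)"
        using r1 g0 by (simp add: sums_iff)
      show "complex_of_real (\<beta> m s) = 0" if "s < m" for m s
        using that by (simp add: \<beta>_def shiftc_def)
    qed (use bs rx r2 b0 in \<open>auto simp: sums_iff\<close>)
    moreover have "(\<Sum>m. of_real (\<gamma> m) * fe h m x) = fe h p x * fe h t x"
      using gs[OF rx] by (simp add: sums_iff)
    ultimately show "(\<lambda>s. of_real (\<gamma>' s) * fe h s x) sums (fe h p x * fe h (Suc t) x)"
      by (simp add: \<gamma>'_def fe_Suc mult_ac)
  qed
qed

definition fe_coeff :: "real \<Rightarrow> nat \<Rightarrow> nat \<Rightarrow> nat \<Rightarrow> real" where
  "fe_coeff h p t = (SOME \<gamma>. (\<forall>s. 0 \<le> \<gamma> s) \<and> (\<forall>s<p+t. \<gamma> s = 0) \<and>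
    (\<forall>\<rho> x::complex. 0 < \<rho> \<longrightarrow> hdom h \<rho> x \<longrightarrow> (\<lambda>s. of_real (\<gamma> s) * fe h s x) sums (fe h p x * fe h t x)))"

lemma
  assumes "0 \<le> h"
  shows fe_coeff_nonneg: "0 \<le> fe_coeff h p t s"
    and fe_coeff_eq_0: "s < p + t \<Longrightarrow> fe_coeff h p t s = 0"
    and fe_coeff_sums: "0 < \<rho> \<Longrightarrow> hdom h \<rho> x \<Longrightarrow> (\<lambda>s. of_real (fe_coeff h p t s) * fe h s x) sums (fe h p x * fe h t (x::complex))"
  using someI_ex[OF fe_mult_expansion[OF assms, of p t]] unfolding fe_coeff_def[symmetric] by auto

text \<open>As the coefficients are nonnegative, this computes the weighted norm of a product of
  basis elements; with \<open>kernel_norm\<close> it makes multiplication bounded with constant 1,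
  independently of h.\<close>

lemma fe_coeff_sums_real:
  assumes "0 \<le> h" "0 < \<rho>"
  shows "(\<lambda>s. fe_coeff h p t s * fe h s \<rho>) sums (fe h p \<rho> * fe h t \<rho>)"
proof -
  have d: "hdom h \<rho> (complex_of_real \<rho>)" by (rule hdom_Re) simp
  show ?thesis
    using fe_coeff_sums[OF assms(1) assms(2) d, of p t] unfolding fe_of_real
    by (intro sums_of_real_cancel) simp
qed

text \<open>The index ranges exceed p + t \<le> s, but \<open>fe_coeff\<close> vanishes outside it.
  The nested form matches two successive uses of \<open>kernel_apply\<close>.\<close>

definition fprod :: "real \<Rightarrow> (nat \<Rightarrow> complex) \<Rightarrow> (nat \<Rightarrow> complex) \<Rightarrow> nat \<Rightarrow> complex" where
  "fprod h a b s = (\<Sum>t\<le>s. b t * (\<Sum>p\<le>s. a p * of_real (fe_coeff h p t s)))"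

text \<open>\<open>kernel_apply\<close> is used twice: first with g = \<open>fe h t x\<close> on the
  series a, which gives the kernel K, then on the series b with g the sum of the first
  series.\<close>

lemma fprod_sums:
  fixes x :: complex
  assumes h: "0 \<le> h" and \<rho>: "0 < \<rho>" and x: "hdom h \<rho> x"
    and sa: "summable (\<lambda>t. cmod (a t) * fe h t \<rho>)"
    and sb: "summable (\<lambda>t. cmod (b t) * fe h t \<rho>)"
  shows "(\<lambda>s. fprod h a b s * fe h s x) sums ((\<Sum>t. a t * fe h t x) * (\<Sum>t. b t * fe h t x))"
    and "summable (\<lambda>s. cmod (fprod h a b s) * fe h s \<rho>)"
proof -
  define K where "K t s = (\<Sum>p\<le>s. a p * of_real (fe_coeff h p t s))" for t s
  define K' where "K' t s = (\<Sum>p\<le>s. cmod (a p) * cmod (of_real (fe_coeff h p t s)))" for t s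
  have w: "0 \<le> fe h s \<rho>" for s using fe_pos[OF h \<rho>] less_imp_le by blast
  have c0: "cmod (of_real (fe_coeff h p t s)) = fe_coeff h p t s" for p t s
    using fe_coeff_nonneg[OF h] by simp
  have k1: "summable (\<lambda>s. cmod (of_real (fe_coeff h p t s)) * fe h s \<rho>)"
    "(\<Sum>s. cmod (of_real (fe_coeff h p t s)) * fe h s \<rho>) \<le> fe h t \<rho> * fe h p \<rho>" for p t
    using fe_coeff_sums_real[OF h \<rho>, of p t] unfolding c0 by (simp_all add: sums_iff mult_ac)
  have k0: "complex_of_real (fe_coeff h p t s) = 0" if "s < p" for p t s
    using fe_coeff_eq_0[OF h, of s p t] that by simp
  have 1: "summable (\<lambda>s. K' t s * fe h s \<rho>)" "(\<Sum>s. K' t s * fe h s \<rho>) \<le> fe h t \<rho> * (\<Sum>p. cmod (a p) * fe h p \<rho>)" for t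
    unfolding K'_def
    by (rule kernel_norm(1)[OF w sa k0 k1(1) k1(2)], assumption)
       (rule kernel_norm(2)[OF w sa k0 k1(1) k1(2)], assumption)
  have KK': "cmod (K t s) \<le> K' t s" for t s
    unfolding K_def K'_def norm_mult[symmetric] by (rule norm_sum)
  have 2: "(\<lambda>s. K t s * fe h s x) sums (fe h t x * (\<Sum>p. a p * fe h p x))" for t
    unfolding K_def
  proof (rule kernel_apply[where \<tau> = "\<lambda>p s. of_real (fe_coeff h p t s)" and q = "fe h t \<rho>", OF x h \<rho> sa k0 k1(1) k1(2)])
    show "(\<lambda>s. complex_of_real (fe_coeff h p t s) * fe h s x) sums (fe h t x * fe h p x)" for p
      unfolding mult.commute[of "fe h t x" "fe h p x"] by (rule fe_coeff_sums[OF h \<rho> x])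
  qed
  have 3: "K t s = 0" if "s < t" for t s
    unfolding K_def using that by (intro sum.neutral) (simp add: fe_coeff_eq_0[OF h])
  have 4: "summable (\<lambda>s. cmod (K t s) * fe h s \<rho>)" for t
    by (rule summable_comparison_test'[OF 1(1)[of t]]) (use KK' w in \<open>auto intro!: mult_right_mono\<close>)
  have 5: "(\<Sum>s. cmod (K t s) * fe h s \<rho>) \<le> (\<Sum>p. cmod (a p) * fe h p \<rho>) * fe h t \<rho>" for t
  proof -
    have "(\<Sum>s. cmod (K t s) * fe h s \<rho>) \<le> (\<Sum>s. K' t s * fe h s \<rho>)"
      by (intro suminf_le 4 1(1) mult_right_mono KK' w)
    thus ?thesis using 1(2)[of t] by (simp add: mult.commute)
  qed
  show "(\<lambda>s. fprod h a b s * fe h s x) sums ((\<Sum>t. a t * fe h t x) * (\<Sum>t. b t * fe h t x))"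
    unfolding fprod_def K_def[symmetric]
  proof (rule kernel_apply[OF x h \<rho> sb 3 4 5])
    show "(\<lambda>s. K t s * fe h s x) sums ((\<Sum>p. a p * fe h p x) * fe h t x)" for t
      unfolding mult.commute[of _ "fe h t x"] by (rule 2)
  qed
  have "summable (\<lambda>s. (\<Sum>t\<le>s. cmod (b t) * cmod (K t s)) * fe h s \<rho>)"
    by (rule kernel_norm(1)[OF w sb 3 4 5])
  thus "summable (\<lambda>s. cmod (fprod h a b s) * fe h s \<rho>)"
  proof (rule summable_comparison_test')
    fix s
    have "cmod (fprod h a b s) \<le> (\<Sum>t\<le>s. cmod (b t) * cmod (K t s))"
      unfolding fprod_def K_def[symmetric] norm_mult[symmetric] by (rule norm_sum)
    thus "norm (cmod (fprod h a b s) * fe h s \<rho>) \<le> (\<Sum>t\<le>s. cmod (b t) * cmod (K t s)) * fe h s \<rho>"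
      using w[of s] by (simp add: mult_right_mono)
  qed
qed

section \<open>Absolute convergence, uniqueness and bounds of the coefficients\<close>

lemma geometric_fe_sums_real:
  fixes R \<rho> :: real
  assumes "0 \<le> h" "0 \<le> R" "R < \<rho>"
  shows "(\<lambda>s. h_rising h s R * fe h (Suc s) \<rho>) sums inverse (\<rho> - R)"
  using geometric_fe_sums[OF hdom_real, of h R R \<rho>] assms by simp

text \<open>\<open>fe h (Suc s) (\<rho> - h)\<close> equals \<open>fe h s \<rho>\<close> divided by
  \<rho> - h, so the geometric identity at \<rho> - h gives the unshifted series. This costs the gap
  h in the hypothesis.\<close>

lemma h_rising_fe_summable:
  assumes "0 < h" "0 \<le> R" "R + h < \<rho>"
  shows "summable (\<lambda>s. h_rising h s R * fe h s \<rho>)"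
proof -
  have "(\<lambda>s. h_rising h s R * fe h (Suc s) (\<rho> - h)) sums inverse (\<rho> - h - R)"
    using assms by (intro geometric_fe_sums_real) simp_all
  moreover have "fe h (Suc s) (\<rho> - h) = inverse (\<rho> - h) * fe h s \<rho>" for s
    using fe_add[of h 1 s "\<rho> - h"] by (simp add: fe_Suc)
  ultimately have "summable (\<lambda>s. inverse (\<rho> - h) * (h_rising h s R * fe h s \<rho>))"
    by (simp add: sums_iff mult_ac)
  thus ?thesis using assms by (subst (asm) summable_cmult_iff) auto
qed

text \<open>Abel's argument: convergence at one real point R bounds \<open>a s\<close> by a multiple
  of \<open>h_rising h s R\<close>, and such a sequence is absolutely summable at every point beyond
  R + h.\<close>

lemma has_fact_series_abs_summable:
  assumes "0 < h" and "has_fact_series h a f"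
  obtains c where "0 < c" "\<And>\<rho>. c < \<rho> \<Longrightarrow> summable (\<lambda>s. cmod (a s) * fe h s \<rho>)"
    "\<And>x. c < Re x \<Longrightarrow> (\<lambda>s. a s * fe h s x) sums f x"
proof -
  obtain c where c: "0 \<le> c" "\<And>x. c < Re x \<Longrightarrow> (\<lambda>s. a s * fe h s x) sums f x"
    using assms(2) by (auto simp: has_fact_series_def fe_def)
  have "summable (\<lambda>s. cmod (a s) * fe h s \<rho>)" if r: "c + 2 * h < \<rho>" for \<rho>
  proof -
    \<comment> \<open>The midpoint of c and \<rho> - 2 h satisfies both c < R and R + h <
      \<rho>.\<close>
    define R where "R = (c + (\<rho> - 2*h)) / 2"
    have R: "c < R" "R + h < \<rho>" using r assms(1) by (simp_all add: R_def field_simps)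
    have "(\<lambda>s. a s * fe h s (complex_of_real R)) \<longlonglongrightarrow> 0"
      using c(2)[of "of_real R"] R by (intro summable_LIMSEQ_zero) (auto simp: sums_iff)
    hence "Bseq (\<lambda>s. a s * fe h s (complex_of_real R))"
      by (intro convergent_imp_Bseq) (auto simp: convergent_def)
    then obtain M where M: "\<And>s. cmod (a s * fe h s (complex_of_real R)) \<le> M" by (auto simp: Bseq_def)
    have pos: "0 < h_rising h s R" for s using R c(1) assms(1) by (intro h_rising_pos) auto
    have "cmod (a s) \<le> M * h_rising h s R" for s
      using M[of s] pos[of s] by (simp add: fe_of_real norm_mult fe_def h_rising_of_real norm_divide field_simps)
    hence *: "norm (cmod (a s) * fe h s \<rho>) \<le> M * (h_rising h s R * fe h s \<rho>)" for s
      using fe_pos[of h \<rho> s] R c(1) assms(1) by (simp add: mult_right_mono mult.assoc[symmetric])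
    show ?thesis
      by (rule summable_comparison_test'[OF summable_mult[OF h_rising_fe_summable[of h R \<rho>], of M]])
         (use R c(1) assms(1) * in auto)
  qed
  thus ?thesis using c assms(1) by (intro that[of "c + 2 * h"]) auto
qed

text \<open>By strong induction the coefficients below m vanish. Dividing by \<open>fe h m x\<close>
  leaves \<open>a m\<close> plus a tail that is O(1/x) along the real axis, so \<open>a m\<close> is
  smaller in modulus than every positive number.\<close>

lemma fe_series_unique:
  assumes h: "0 \<le> h" and \<rho>: "0 < \<rho>" and sa: "summable (\<lambda>s. cmod (a s) * fe h s \<rho>)"
    and z: "\<And>x. \<rho> \<le> x \<Longrightarrow> (\<lambda>s. a s * fe h s (complex_of_real x)) sums 0"
  shows "a m = 0"
proof (induction m rule: less_induct)
  case (less m)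
  define r where "r = \<rho> + real m * h"
  have r: "0 < r" using h \<rho> by (simp add: r_def add_pos_nonneg)
  define T where "T = (\<Sum>s. cmod (a (Suc s + m)) * fe h (Suc s) r)"
  have fr: "fe h (s + m) \<rho> = fe h m \<rho> * fe h s r" for s
    using fe_add[of h m s \<rho>] by (simp add: r_def add.commute)
  have "summable (\<lambda>s. fe h m \<rho> * (cmod (a (Suc s + m)) * fe h (Suc s) r))"
    using summable_ignore_initial_segment[OF sa, of "Suc m"] fr[of "Suc _"]
    by (simp add: mult_ac)
  hence sT: "summable (\<lambda>s. cmod (a (Suc s + m)) * fe h (Suc s) r)"
    using fe_pos[OF h \<rho>, of m] by (subst (asm) summable_cmult_iff) auto
  have bound: "cmod (a m) \<le> T * r / (x + real m * h)" if x: "\<rho> \<le> x" for x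
  proof -
    define y where "y = x + real m * h"
    have y: "r \<le> y" "0 < y" using x r by (auto simp: y_def r_def)
    have x0: "0 < x" using x \<rho> by simp
    have fe: "fe h (s + m) (complex_of_real x) = of_real (fe h m x) * fe h s (of_real y)" for s
      using fe_add[of h m s x] by (simp add: y_def add.commute[of s m] fe_of_real del: of_real_add of_real_mult)
        (simp only: of_real_mult)
    have "(\<lambda>s. a (s + m) * fe h (s + m) (complex_of_real x)) sums 0"
      using z[OF x] less by (subst sums_zero_iff_shift) auto
    hence "(\<lambda>s. of_real (fe h m x) * (a (s + m) * fe h s (complex_of_real y))) sums (of_real (fe h m x) * 0)"
      by (simp add: fe mult_ac)
    hence "(\<lambda>s. a (s + m) * fe h s (complex_of_real y)) sums 0"
      using fe_pos[OF h x0, of m] by (subst (asm) sums_mult_iff) auto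
    hence s1: "(\<lambda>s. a (Suc s + m) * fe h (Suc s) (complex_of_real y)) sums (- a m)"
      using sums_Suc_iff[of "\<lambda>s. a (s + m) * fe h s (complex_of_real y)" "- a m"] by simp
    \<comment> \<open>Only the first factor 1/y of \<open>fe h (Suc s) y\<close> is used for decay;
      the remaining ones are compared with their values at r.\<close>
    have le: "cmod (a (Suc s + m) * fe h (Suc s) (complex_of_real y)) \<le> (r / y) * (cmod (a (Suc s + m)) * fe h (Suc s) r)" for s
    proof -
      have 1: "fe h (Suc s) y = inverse y * fe h s (y + h)" for y :: real
        using fe_add[of h 1 s y] by (simp add: fe_Suc)
      have "norm (fe h s (y + h)) \<le> fe h s (r + h)"
        using y r h by (intro norm_fe_le) (auto simp: hdom_def)
      hence "norm (fe h (Suc s) y) \<le> inverse y * fe h s (r + h)"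
        using y unfolding 1 by (simp add: abs_mult mult_left_mono)
      also have "\<dots> = r / y * fe h (Suc s) r"
        using r y unfolding 1 by (simp add: field_simps)
      finally have "cmod (fe h (Suc s) (complex_of_real y)) \<le> r / y * fe h (Suc s) r"
        unfolding fe_of_real by simp
      from mult_left_mono[OF this, of "cmod (a (Suc s + m))"] show ?thesis
        by (simp add: norm_mult mult_ac)
    qed
    have "cmod (a m) = cmod (\<Sum>s. a (Suc s + m) * fe h (Suc s) (complex_of_real y))"
      using s1 by (simp add: sums_iff)
    also have "\<dots> \<le> (\<Sum>s. (r / y) * (cmod (a (Suc s + m)) * fe h (Suc s) r))"
      by (rule norm_suminf_le) (use sT le summable_mult in auto)
    also have "\<dots> = (r / y) * T" unfolding T_def by (rule suminf_mult[OF sT])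
    finally show ?thesis by (simp add: y_def mult_ac)
  qed
  have "((\<lambda>x. T * r / (x + real m * h)) \<longlongrightarrow> 0) at_top" by real_asymp
  moreover have "\<forall>\<^sub>F x in at_top. cmod (a m) \<le> T * r / (x + real m * h)"
    using eventually_ge_at_top[of \<rho>] by eventually_elim (rule bound)
  ultimately have "cmod (a m) \<le> 0"
    by (intro tendsto_lowerbound[of _ 0]) auto
  thus ?case by simp
qed

text \<open>
  Cauchy's formula on the circle of radius \<open>R\<close> in the variable \<open>r = 1/w\<close>, with the kernel
  \<open>1/(x - r)\<close> expanded by the telescoping identity.
\<close>

lemma holomorphic_at_infinity_fe_expansion:
  assumes h: "0 \<le> h" and R: "0 < R" and g: "g holomorphic_on cball 0 (1 / R)"
    and M: "\<And>w. cmod w = 1 / R \<Longrightarrow> cmod (g w) \<le> M"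
  obtains a where "a 0 = g 0" "\<And>s. cmod (a (Suc s)) \<le> R * M * h_rising h s R"
    "\<And>\<rho> x. R < \<rho> \<Longrightarrow> hdom h \<rho> x \<Longrightarrow> (\<lambda>s. a s * fe h s x) sums g (1 / x)"
proof -
  define C where "C = circlepath 0 (1 / R)"
  define G where "G s w = g w / w\<^sup>2 * h_rising h s (1 / w)" for s w
  define c where "c s = contour_integral C (G s) / (2 * of_real pi * \<i>)" for s
  have cont: "continuous_on (sphere 0 (1/R)) g"
    using holomorphic_on_imp_continuous_on[OF g] by (rule continuous_on_subset) (simp add: subset_iff)
  have M0: "0 \<le> M" using M[of "of_real (1 / R)"] R norm_ge_zero order_trans
    by (metis abs_of_pos norm_of_real zero_less_divide_1_iff)
  have Gc: "continuous_on (sphere 0 (1/R)) (G s)" for s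
    unfolding G_def h_rising_def using R by (intro continuous_intros cont) auto
  have Gi: "G s contour_integrable_on C" for s
    unfolding C_def using R Gc by (intro contour_integrable_continuous_circlepath) simp
  have w1: "cmod (1 / w) \<le> R" if "cmod w = 1 / R" for w
    using that R by (simp add: norm_divide)
  have GM: "cmod (G s w) \<le> M * R\<^sup>2 * h_rising h s R" if "cmod w = 1 / R" for s w
  proof -
    have "cmod (G s w) = cmod (g w) * R\<^sup>2 * cmod (h_rising h s (1 / w))"
      using that R by (simp add: G_def norm_mult norm_divide norm_power power_divide)
    also have "\<dots> \<le> M * R\<^sup>2 * h_rising h s R"
      using M[OF that] norm_h_rising_le[OF w1[OF that] h] M0 by (intro mult_mono) auto
    finally show ?thesis .
  qed
  have cb: "cmod (c s) \<le> R * M * h_rising h s R" for s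
  proof -
    have "cmod (contour_integral C (G s)) \<le> M * R\<^sup>2 * h_rising h s R * (2 * pi * (1 / R))"
      using has_contour_integral_integral[OF Gi[of s]] unfolding C_def
      by (rule has_contour_integral_bound_circlepath) (use GM M0 R h_rising_nonneg[OF h, of R s] in auto)
    thus ?thesis using R by (simp add: c_def norm_divide norm_mult field_simps power2_eq_square)
  qed
  have main: "(\<lambda>s. c s * fe h (Suc s) x) sums (g (1 / x) - g 0)" if r: "R < \<rho>" and x: "hdom h \<rho> x" for \<rho> x
  proof -
    have r0: "0 < \<rho>" using R r by simp
    have nx: "\<rho> \<le> cmod x" using hdomD[OF x, of 0] by simp
    have x0: "x \<noteq> 0" using nx r0 by auto
    define u where "u = 1 / x"
    have u: "cmod u < 1 / R" using nx r R r0 x0 by (simp add: u_def norm_divide frac_less2)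
    \<comment> \<open>Subtracting the value at 0 turns the Cauchy kernel into u/(w (w - u)), which
      for u = 1/x equals 1/(w^2 (x - 1/w)). This is the origin of the weight 1/w^2 in G, and the
      reason why the expansion starts at \<open>fe h 1\<close>.\<close>
    define L where "L w = g w / (w - u) - g w / (w - 0)" for w
    have hc: "(L has_contour_integral (2 * of_real pi * \<i> * g u - 2 * of_real pi * \<i> * g 0)) C"
      unfolding L_def C_def
      by (rule has_contour_integral_diff; rule Cauchy_integral_circlepath_simple[OF g]) (use u R in auto)
    define S where "S N w = (\<Sum>s<N. G s w * fe h (Suc s) x)" for N w
    have Leq: "(\<lambda>s. G s w * fe h (Suc s) x) sums L w" if "cmod w = 1 / R" for w
    proof -
      have w0: "w \<noteq> 0" using that R by auto
      have wu: "w \<noteq> u" using that u by auto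
      have "(\<lambda>s. g w / w\<^sup>2 * (h_rising h s (1 / w) * fe h (Suc s) x)) sums (g w / w\<^sup>2 * inverse (x - 1 / w))"
        by (intro sums_mult geometric_fe_sums[OF x h w1[OF that] r])
      moreover have "g w / w\<^sup>2 * inverse (x - 1 / w) = L w"
      proof -
        have xw: "x * w - 1 \<noteq> 0" using wu w0 x0 by (auto simp: u_def field_simps)
        have "inverse (x - 1 / w) = w / (x * w - 1)" using w0 xw by (simp add: field_simps)
        moreover have "w - u = (x * w - 1) / x" using x0 by (simp add: u_def field_simps)
        ultimately show ?thesis using w0 x0 xw wu unfolding L_def
          by (simp add: divide_simps power2_eq_square) (simp add: algebra_simps)
      qed
      ultimately show ?thesis by (simp add: G_def mult_ac)
    qed
    have gs: "(\<lambda>s. h_rising h s R * fe h (Suc s) \<rho>) sums inverse (\<rho> - R)"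
      using R h r by (intro geometric_fe_sums_real) simp_all
    have bnd: "cmod (G s w * fe h (Suc s) x) \<le> M * R\<^sup>2 * (h_rising h s R * fe h (Suc s) \<rho>)" if "cmod w = 1 / R" for s w
      using mult_mono[OF GM[OF that, of s] norm_fe_le[OF x h r0, of "Suc s"]] M0 R h_rising_nonneg[OF h, of R s]
      by (simp add: norm_mult mult_ac)
    have "uniform_limit (sphere 0 (1/R)) S (\<lambda>w. \<Sum>s. G s w * fe h (Suc s) x) sequentially"
      unfolding S_def
      by (rule Weierstrass_m_test[OF bnd summable_mult]) (use gs in \<open>auto simp: sums_iff\<close>)
    hence ul: "uniform_limit (sphere 0 (1/R)) S L sequentially"
      by (rule uniform_limit_cong'[THEN iffD1, rotated -1]) (use Leq in \<open>auto simp: sums_iff\<close>)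
    have Sint: "contour_integral C (S N) = (\<Sum>s<N. contour_integral C (G s) * fe h (Suc s) x)"
      and Sable: "S N contour_integrable_on C" for N
      unfolding S_def
      by (subst contour_integral_sum, use Gi in \<open>auto intro!: contour_integrable_rmul sum.cong contour_integral_rmul contour_integrable_sum\<close>)+
    have "(\<lambda>N. contour_integral C (S N)) \<longlonglongrightarrow> contour_integral C L"
      unfolding C_def
      by (rule contour_integral_uniform_limit_circlepath(2)[OF _ ul])
         (use Sable R in \<open>auto simp: C_def[symmetric]\<close>)
    hence "(\<lambda>s. contour_integral C (G s) * fe h (Suc s) x) sums (2 * of_real pi * \<i> * (g u - g 0))"
      unfolding Sint contour_integral_unique[OF hc] by (simp add: sums_def algebra_simps)
    from sums_divide[OF this, of "2 * of_real pi * \<i>"] show ?thesis by (simp add: c_def u_def mult_ac)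
  qed
  show ?thesis
  proof (rule that[of "\<lambda>s. case s of 0 \<Rightarrow> g 0 | Suc s \<Rightarrow> c s"])
    fix \<rho> :: real and x :: complex assume "R < \<rho>" "hdom h \<rho> x"
    from main[OF this] show "(\<lambda>s. (case s of 0 \<Rightarrow> g 0 | Suc s \<Rightarrow> c s) * fe h s x) sums g (1 / x)"
      by (subst (asm) sums_Suc_iff[of "\<lambda>s. (case s of 0 \<Rightarrow> g 0 | Suc s \<Rightarrow> c s) * fe h s x", simplified]) simp
  qed (use cb in auto)
qed

text \<open>The bound does not depend on h and becomes small when \<rho> grows. It controls the
  coefficient matrix in \<open>gauge_system_of_bounds\<close> and the residual in
  \<open>F_close\<close>.\<close>

lemma fe_coeffs_bound:
  fixes R M \<rho> :: real and a :: "nat \<Rightarrow> real"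
  assumes h: "0 \<le> h" and R: "0 < R" "R < \<rho>" and a: "\<And>s. \<bar>a (Suc s)\<bar> \<le> R * M * h_rising h s R" and a0: "a 0 = 0"
  shows "summable (\<lambda>s. \<bar>a s\<bar> * fe h s \<rho>)" "(\<Sum>s. \<bar>a s\<bar> * fe h s \<rho>) \<le> R * M / (\<rho> - R)"
proof -
  have gs: "(\<lambda>s. R * M * (h_rising h s R * fe h (Suc s) \<rho>)) sums (R * M * inverse (\<rho> - R))"
    by (rule sums_mult[OF geometric_fe_sums_real]) (use R h in simp_all)
  have r0: "0 < \<rho>" using R by simp
  have le: "\<bar>a (Suc s)\<bar> * fe h (Suc s) \<rho> \<le> R * M * (h_rising h s R * fe h (Suc s) \<rho>)" for s
    using mult_right_mono[OF a[of s] less_imp_le[OF fe_pos[OF h r0, of "Suc s"]]] by (simp add: mult_ac)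
  have s1: "summable (\<lambda>s. \<bar>a (Suc s)\<bar> * fe h (Suc s) \<rho>)"
    by (rule summable_comparison_test'[of "\<lambda>s. R * M * (h_rising h s R * fe h (Suc s) \<rho>)" 0])
       (use gs le in \<open>auto simp: sums_iff abs_mult abs_of_pos[OF fe_pos[OF h r0]]\<close>)
  thus s: "summable (\<lambda>s. \<bar>a s\<bar> * fe h s \<rho>)" by (subst (asm) summable_Suc_iff[of "\<lambda>s. \<bar>a s\<bar> * fe h s \<rho>"])
  have "(\<Sum>s. \<bar>a s\<bar> * fe h s \<rho>) = (\<Sum>s. \<bar>a (Suc s)\<bar> * fe h (Suc s) \<rho>)"
    using suminf_split_head[OF s] a0 by simp
  also have "\<dots> \<le> (\<Sum>s. R * M * (h_rising h s R * fe h (Suc s) \<rho>))"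
    by (rule suminf_le[OF le s1]) (use gs in \<open>simp add: sums_iff\<close>)
  also have "\<dots> = R * M / (\<rho> - R)" using gs by (simp add: sums_iff divide_inverse)
  finally show "(\<Sum>s. \<bar>a s\<bar> * fe h s \<rho>) \<le> R * M / (\<rho> - R)" .
qed

section \<open>Matrix-valued factorial series\<close>

text \<open>Matrices are treated as functions of two indices, read only for indices below n; this
  keeps the analysis free of dimension conditions. The link to \<open>carrier_mat\<close> is
  \<open>mat_mult_mm\<close>.\<close>

definition mm :: "nat \<Rightarrow> (nat \<Rightarrow> nat \<Rightarrow> complex) \<Rightarrow> (nat \<Rightarrow> nat \<Rightarrow> complex) \<Rightarrow> nat \<Rightarrow> nat \<Rightarrow> complex" where
  "mm n X Y i j = (\<Sum>k<n. X i k * Y k j)"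

definition mn :: "nat \<Rightarrow> (nat \<Rightarrow> nat \<Rightarrow> complex) \<Rightarrow> real" where
  "mn n X = (\<Sum>i<n. \<Sum>j<n. cmod (X i j))"

lemma mn_nonneg [simp]: "0 \<le> mn n X"
  by (simp add: mn_def sum_nonneg)

lemma entry_le_mn: "i < n \<Longrightarrow> j < n \<Longrightarrow> cmod (X i j) \<le> mn n X"
  unfolding mn_def
  by (rule order_trans[OF member_le_sum[of j "{..<n}" "\<lambda>j. cmod (X i j)"]
        member_le_sum[of i "{..<n}" "\<lambda>i. \<Sum>j<n. cmod (X i j)"]]) (auto intro: sum_nonneg)

lemma mn_cong: "(\<And>i j. i < n \<Longrightarrow> j < n \<Longrightarrow> X i j = Y i j) \<Longrightarrow> mn n X = mn n Y"
  by (simp add: mn_def)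

lemma mn_le: "(\<And>i j. i < n \<Longrightarrow> j < n \<Longrightarrow> cmod (X i j) \<le> c) \<Longrightarrow> mn n X \<le> of_nat n * of_nat n * c"
  unfolding mn_def by (rule order_trans[OF sum_mono[OF sum_bounded_above]]) auto

lemma mn_add_le: "mn n (\<lambda>i j. X i j + Y i j) \<le> mn n X + mn n Y"
  by (simp add: mn_def sum.distrib[symmetric] sum_mono norm_triangle_ineq)

lemma mn_diff_le: "mn n (\<lambda>i j. X i j - Y i j) \<le> mn n X + mn n Y"
  by (simp add: mn_def sum.distrib[symmetric] sum_mono norm_triangle_ineq4)

lemma mn_scale: "mn n (\<lambda>i j. c * X i j) = cmod c * mn n X"
  by (simp add: mn_def norm_mult sum_distrib_left)

lemma mn_sum_le: "mn n (\<lambda>i j. \<Sum>t\<in>T. X t i j) \<le> (\<Sum>t\<in>T. mn n (X t))"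
  by (induction T rule: infinite_finite_induct)
     (simp_all add: mn_def order_trans[OF mn_add_le[unfolded mn_def]] del: sum.distrib)

lemma mn_mm_le: "mn n (mm n X Y) \<le> mn n X * mn n Y"
proof -
  have "mn n (mm n X Y) \<le> (\<Sum>i<n. \<Sum>j<n. \<Sum>k<n. cmod (X i k) * cmod (Y k j))"
    unfolding mn_def mm_def
    by (intro sum_mono order_trans[OF norm_sum]) (simp add: norm_mult)
  also have "\<dots> = (\<Sum>i<n. \<Sum>k<n. cmod (X i k) * (\<Sum>j<n. cmod (Y k j)))"
    by (rule sum.cong[OF refl], subst sum.swap) (simp add: sum_distrib_left)
  also have "\<dots> \<le> (\<Sum>i<n. \<Sum>k<n. cmod (X i k) * mn n Y)"
    unfolding mn_def
    by (intro sum_mono mult_left_mono member_le_sum[of _ "{..<n}" "\<lambda>k. \<Sum>j<n. cmod (Y k j)"]) (auto intro: sum_nonneg)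
  also have "\<dots> = mn n X * mn n Y" by (simp add: mn_def sum_distrib_right)
  finally show ?thesis .
qed

lemma mm_cong: "(\<And>i j. i < n \<Longrightarrow> j < n \<Longrightarrow> X i j = X' i j) \<Longrightarrow> (\<And>i j. i < n \<Longrightarrow> j < n \<Longrightarrow> Y i j = Y' i j) \<Longrightarrow>
    i < n \<Longrightarrow> j < n \<Longrightarrow> mm n X Y i j = mm n X' Y' i j"
  by (simp add: mm_def)

definition ev :: "real \<Rightarrow> (nat \<Rightarrow> nat \<Rightarrow> nat \<Rightarrow> complex) \<Rightarrow> complex \<Rightarrow> nat \<Rightarrow> nat \<Rightarrow> complex" where
  "ev h U x i j = (\<Sum>s. U s i j * fe h s x)"

lemma sum_triangle_le:
  fixes f :: "nat \<Rightarrow> nat \<Rightarrow> real"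
  assumes "\<And>t s. 0 \<le> f t s"
  shows "(\<Sum>s\<le>S. \<Sum>t<s. f t s) \<le> (\<Sum>t\<le>S. \<Sum>s\<le>S. f t s)"
proof -
  have "(\<Sum>s\<le>S. \<Sum>t<s. f t s) \<le> (\<Sum>s\<le>S. \<Sum>t\<le>S. f t s)"
    using assms by (intro sum_mono sum_mono2) auto
  thus ?thesis by (subst sum.swap)
qed

locale fact_kernel =
  fixes n :: nat and h \<rho> :: real and B :: "nat \<Rightarrow> nat \<Rightarrow> nat \<Rightarrow> complex"
  assumes h: "0 \<le> h" and \<rho>: "0 < \<rho>"
    and B0: "\<And>i j. B 0 i j = 0"
    and Bsum: "summable (\<lambda>s. mn n (B s) * fe h s \<rho>)"
begin

definition \<beta> :: real where "\<beta> = (\<Sum>s. mn n (B s) * fe h s \<rho>)"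

text \<open>The coefficients of the product of the series B with \<open>fe h t\<close>.\<close>

definition Kb :: "nat \<Rightarrow> nat \<Rightarrow> nat \<Rightarrow> nat \<Rightarrow> complex" where
  "Kb t s i k = (\<Sum>p\<le>s. B p i k * of_real (fe_coeff h p t s))"

lemma fe0: "0 \<le> fe h s \<rho>" using fe_pos[OF h \<rho>] less_imp_le by blast

lemma entry_summable:
  assumes "summable (\<lambda>s. mn n (U s) * fe h s \<rho>)" "i < n" "j < n"
  shows "summable (\<lambda>s. cmod (U s i j) * fe h s \<rho>)"
  by (rule summable_comparison_test'[OF assms(1), of 0])
     (use entry_le_mn[OF assms(2,3)] fe0 in \<open>auto intro!: mult_right_mono simp: abs_mult\<close>)

lemma eval_summable:
  assumes "summable (\<lambda>s. cmod (a s) * fe h s \<rho>)" "hdom h \<rho> x"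
  shows "summable (\<lambda>s. a s * fe h s x)"
  by (rule summable_comparison_test'[OF assms(1), of 0])
     (use norm_fe_le[OF assms(2) h \<rho>] in \<open>auto intro!: mult_left_mono simp: norm_mult\<close>)

lemma ev_sums:
  assumes "summable (\<lambda>s. mn n (U s) * fe h s \<rho>)" "i < n" "j < n" "hdom h \<rho> x"
  shows "(\<lambda>s. U s i j * fe h s x) sums ev h U x i j"
  unfolding ev_def using eval_summable[OF entry_summable[OF assms(1-3)] assms(4)] by (rule summable_sums)

lemma mn_ev_le:
  assumes "summable (\<lambda>s. mn n (U s) * fe h s \<rho>)" "hdom h \<rho> x"
  shows "mn n (ev h U x) \<le> (\<Sum>s. mn n (U s) * fe h s \<rho>)"
proof -
  have s: "summable (\<lambda>s. cmod (U s i j) * fe h s \<rho>)" if "i < n" "j < n" for i j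
    using entry_summable[OF assms(1) that] .
  have 1: "cmod (ev h U x i j) \<le> (\<Sum>s. cmod (U s i j) * fe h s \<rho>)" if "i < n" "j < n" for i j
    unfolding ev_def
    by (rule norm_suminf_le[OF _ s[OF that]])
       (use norm_fe_le[OF assms(2) h \<rho>] in \<open>auto intro!: mult_left_mono simp: norm_mult\<close>)
  have "mn n (ev h U x) \<le> (\<Sum>i<n. \<Sum>j<n. \<Sum>s. cmod (U s i j) * fe h s \<rho>)"
    unfolding mn_def by (intro sum_mono 1) auto
  also have "\<dots> = (\<Sum>i<n. \<Sum>s. \<Sum>j<n. cmod (U s i j) * fe h s \<rho>)"
    by (intro sum.cong refl suminf_sum[symmetric] s) auto
  also have "\<dots> = (\<Sum>s. \<Sum>i<n. \<Sum>j<n. cmod (U s i j) * fe h s \<rho>)"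
    by (intro suminf_sum[symmetric] summable_sum s) auto
  also have "\<dots> = (\<Sum>s. mn n (U s) * fe h s \<rho>)"
    by (simp add: mn_def sum_distrib_right)
  finally show ?thesis .
qed

text \<open>Partial sums are estimated, because \<open>conv_norm\<close> and
  \<open>stability\<close> apply the bound to solutions of a recursion whose summability is not yet
  known.\<close>

lemma Kb_norm: "(\<Sum>s\<le>S. mn n (Kb t s) * fe h s \<rho>) \<le> \<beta> * fe h t \<rho>"
proof -
  have c0: "0 \<le> fe_coeff h p t s" for p s using fe_coeff_nonneg[OF h] .
  have 1: "mn n (Kb t s) \<le> (\<Sum>p\<le>s. mn n (B p) * fe_coeff h p t s)" for s
  proof -
    have "mn n (Kb t s) \<le> (\<Sum>p\<le>s. mn n (\<lambda>i k. of_real (fe_coeff h p t s) * B p i k))"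
      unfolding Kb_def by (rule order_trans[OF _ mn_sum_le]) (simp add: mult.commute)
    thus ?thesis unfolding mn_scale using c0 by (simp add: mult.commute)
  qed
  have "(\<Sum>s\<le>S. mn n (Kb t s) * fe h s \<rho>) \<le> (\<Sum>s\<le>S. \<Sum>p\<le>s. mn n (B p) * fe_coeff h p t s * fe h s \<rho>)"
    unfolding sum_distrib_right[symmetric] by (intro sum_mono mult_right_mono 1 fe0)
  also have "\<dots> \<le> (\<Sum>s\<le>S. \<Sum>p\<le>S. mn n (B p) * fe_coeff h p t s * fe h s \<rho>)"
    by (intro sum_mono sum_mono2) (auto intro!: mult_nonneg_nonneg c0 fe0)
  also have "\<dots> = (\<Sum>p\<le>S. mn n (B p) * (\<Sum>s\<le>S. fe_coeff h p t s * fe h s \<rho>))"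
    by (subst sum.swap) (simp add: sum_distrib_left mult.assoc)
  also have "\<dots> \<le> (\<Sum>p\<le>S. mn n (B p) * (fe h p \<rho> * fe h t \<rho>))"
  proof (intro sum_mono mult_left_mono)
    fix p
    have "(\<lambda>s. fe_coeff h p t s * fe h s \<rho>) sums (fe h p \<rho> * fe h t \<rho>)" by (rule fe_coeff_sums_real[OF h \<rho>])
    thus "(\<Sum>s\<le>S. fe_coeff h p t s * fe h s \<rho>) \<le> fe h p \<rho> * fe h t \<rho>"
      using sum_le_suminf[of "\<lambda>s. fe_coeff h p t s * fe h s \<rho>" "{..S}"] c0 fe0 by (simp add: sums_iff)
  qed simp
  also have "\<dots> = (\<Sum>p\<le>S. mn n (B p) * fe h p \<rho>) * fe h t \<rho>" by (simp add: sum_distrib_left sum_distrib_right mult_ac)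
  also have "\<dots> \<le> \<beta> * fe h t \<rho>"
    unfolding \<beta>_def by (intro mult_right_mono sum_le_suminf Bsum fe0) (auto intro!: mult_nonneg_nonneg fe0)
  finally show ?thesis .
qed

definition conv :: "(nat \<Rightarrow> nat \<Rightarrow> nat \<Rightarrow> complex) \<Rightarrow> nat \<Rightarrow> nat \<Rightarrow> nat \<Rightarrow> complex" where
  "conv U s i j = (\<Sum>t<s. mm n (Kb t s) (U t) i j)"

lemma conv_norm: "(\<Sum>s\<le>S. mn n (conv U s) * fe h s \<rho>) \<le> \<beta> * (\<Sum>t\<le>S. mn n (U t) * fe h t \<rho>)"
proof -
  have 1: "mn n (conv U s) \<le> (\<Sum>t<s. mn n (U t) * mn n (Kb t s))" for s
    unfolding conv_def
    by (rule order_trans[OF mn_sum_le]) (auto intro!: sum_mono order_trans[OF mn_mm_le] simp: mult.commute)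
  have "(\<Sum>s\<le>S. mn n (conv U s) * fe h s \<rho>) \<le> (\<Sum>s\<le>S. \<Sum>t<s. mn n (U t) * mn n (Kb t s) * fe h s \<rho>)"
    unfolding sum_distrib_right[symmetric] by (intro sum_mono mult_right_mono 1 fe0)
  also have "\<dots> \<le> (\<Sum>t\<le>S. \<Sum>s\<le>S. mn n (U t) * mn n (Kb t s) * fe h s \<rho>)"
    by (rule sum_triangle_le) (auto intro!: mult_nonneg_nonneg fe0)
  also have "\<dots> = (\<Sum>t\<le>S. mn n (U t) * (\<Sum>s\<le>S. mn n (Kb t s) * fe h s \<rho>))"
    by (simp add: sum_distrib_left mult.assoc)
  also have "\<dots> \<le> (\<Sum>t\<le>S. mn n (U t) * (\<beta> * fe h t \<rho>))"
    by (intro sum_mono mult_left_mono Kb_norm) simp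
  also have "\<dots> = \<beta> * (\<Sum>t\<le>S. mn n (U t) * fe h t \<rho>)" by (simp add: sum_distrib_left mult_ac)
  finally show ?thesis .
qed

text \<open>In the product series the term t = s drops out: \<open>B 0\<close> is zero, and
  \<open>fe_coeff h p s s\<close> vanishes for p \<ge> 1. So the strict sum in \<open>conv\<close>
  is the whole product.\<close>

lemma conv_fprod:
  "conv U s i j = (\<Sum>k<n. fprod h (\<lambda>p. B p i k) (\<lambda>t. U t k j) s)"
proof -
  have top: "(\<Sum>p\<le>s. B p i k * of_real (fe_coeff h p s s)) = 0" for k
  proof (rule sum.neutral, intro ballI)
    fix p show "B p i k * of_real (fe_coeff h p s s) = 0"
      by (cases "p = 0") (auto simp: B0 fe_coeff_eq_0[OF h])
  qed
  have "{..s} = insert s {..<s}" by auto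
  hence "fprod h (\<lambda>p. B p i k) (\<lambda>t. U t k j) s = (\<Sum>t<s. U t k j * Kb t s i k)" for k
    unfolding fprod_def Kb_def using top[of k] by (simp only: sum.insert[OF finite_lessThan] lessThan_iff less_irrefl not_False_eq_True mult_zero_right add_0)
  thus ?thesis unfolding conv_def mm_def by (subst sum.swap) (simp add: mult.commute)
qed

lemma conv_sums:
  assumes U: "summable (\<lambda>s. mn n (U s) * fe h s \<rho>)" and ij: "i < n" "j < n"
  shows "summable (\<lambda>s. cmod (conv U s i j) * fe h s \<rho>)"
    and "hdom h \<rho> x \<Longrightarrow> (\<lambda>s. conv U s i j * fe h s x) sums mm n (ev h B x) (ev h U x) i j"
proof -
  note e = entry_summable[OF Bsum ij(1)] entry_summable[OF U _ ij(2)]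
  have r: "hdom h \<rho> (complex_of_real \<rho>)" by (rule hdom_Re) simp
  show "hdom h \<rho> x \<Longrightarrow> (\<lambda>s. conv U s i j * fe h s x) sums mm n (ev h B x) (ev h U x) i j"
    unfolding conv_fprod mm_def sum_distrib_right ev_def
    by (intro sums_sum fprod_sums(1)[OF h \<rho> _ e]) auto
  have "summable (\<lambda>s. \<Sum>k<n. cmod (fprod h (\<lambda>p. B p i k) (\<lambda>t. U t k j) s) * fe h s \<rho>)"
    by (intro summable_sum fprod_sums(2)[OF h \<rho> r e]) auto
  thus "summable (\<lambda>s. cmod (conv U s i j) * fe h s \<rho>)"
    by (rule summable_comparison_test')
       (auto simp: conv_fprod fe0 sum_distrib_right[symmetric] abs_mult intro!: mult_right_mono norm_sum)
qed

lemma partial_bound_summable: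
  assumes "\<And>S. (\<Sum>s\<le>S. f s) \<le> c" "\<And>s. (0::real) \<le> f s"
  shows "summable f" "suminf f \<le> c"
proof -
  have le: "sum f {..<N} \<le> c" for N
    by (rule order_trans[OF sum_mono2[of "{..N}" "{..<N}" f] assms(1)[of N]]) (use assms(2) in auto)
  thus s: "summable f" by (rule summableI_nonneg_bounded[OF assms(2)])
  show "suminf f \<le> c" by (rule suminf_le_const[OF s le])
qed

text \<open>The inverse of \<open>1 + B\<close>, computed by the triangular recursion \<open>W = - B - B W\<close>.\<close>

lemma inverse_series:
  assumes small: "\<beta> \<le> 1 / 2"
  obtains W :: "nat \<Rightarrow> nat \<Rightarrow> nat \<Rightarrow> complex" where "\<And>i j. W 0 i j = 0" "summable (\<lambda>s. mn n (W s) * fe h s \<rho>)"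
    "\<And>x i j. hdom h \<rho> x \<Longrightarrow> i < n \<Longrightarrow> j < n \<Longrightarrow>
       ev h B x i j + ev h W x i j + mm n (ev h B x) (ev h W x) i j = 0"
proof -
  \<comment> \<open>\<open>conv W s\<close> uses only values of W below s, so the recursion is well
    founded.\<close>
  have "\<exists>W. \<forall>s. W s = (\<lambda>i j. - B s i j - conv W s i j)"
    by (rule dependent_wellorder_choice) (auto simp: conv_def mm_def)
  then obtain W where W: "\<And>s i j. W s i j = - B s i j - conv W s i j" by metis
  have W0: "W 0 i j = 0" for i j by (simp add: W[of 0] B0 conv_def)
  have "(\<Sum>s\<le>S. mn n (W s) * fe h s \<rho>) \<le> 2 * \<beta>" for S
  proof -
    have "mn n (W s) \<le> mn n (B s) + mn n (conv W s)" for s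
    proof -
      have "mn n (W s) = mn n (\<lambda>i j. B s i j + conv W s i j)"
        unfolding mn_def W[of s] by (intro sum.cong refl) (metis minus_add_distrib norm_minus_cancel uminus_add_conv_diff diff_conv_add_uminus)
      thus ?thesis using mn_add_le[of n "B s" "conv W s"] by simp
    qed
    hence "(\<Sum>s\<le>S. mn n (W s) * fe h s \<rho>) \<le> (\<Sum>s\<le>S. mn n (B s) * fe h s \<rho> + mn n (conv W s) * fe h s \<rho>)"
      by (intro sum_mono) (simp add: distrib_right[symmetric] mult_right_mono fe0)
    also have "\<dots> \<le> \<beta> + \<beta> * (\<Sum>s\<le>S. mn n (W s) * fe h s \<rho>)"
      unfolding sum.distrib
      by (intro add_mono conv_norm, unfold \<beta>_def, intro sum_le_suminf Bsum) (auto intro!: mult_nonneg_nonneg fe0)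
    also have "\<beta> * (\<Sum>s\<le>S. mn n (W s) * fe h s \<rho>) \<le> 1/2 * (\<Sum>s\<le>S. mn n (W s) * fe h s \<rho>)"
      by (intro mult_right_mono small sum_nonneg mult_nonneg_nonneg fe0) simp
    finally show ?thesis by simp
  qed
  hence sW: "summable (\<lambda>s. mn n (W s) * fe h s \<rho>)"
    by (rule partial_bound_summable) (simp add: fe0)
  show ?thesis
  proof (rule that[OF W0 sW])
    fix x :: complex and i j assume x: "hdom h \<rho> x" and ij: "i < n" "j < n"
    have "(\<lambda>s. - (B s i j * fe h s x) - conv W s i j * fe h s x) sums (- ev h B x i j - mm n (ev h B x) (ev h W x) i j)"
      by (intro sums_diff sums_minus ev_sums[OF Bsum ij x] conv_sums(2)[OF sW ij x])
    moreover have "(\<lambda>s. - (B s i j * fe h s x) - conv W s i j * fe h s x) = (\<lambda>s. W s i j * fe h s x)"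
      by (intro ext, subst W) (simp add: algebra_simps)
    ultimately have "ev h W x i j = - ev h B x i j - mm n (ev h B x) (ev h W x) i j"
      using ev_sums[OF sW ij x] sums_unique2 by metis
    thus "ev h B x i j + ev h W x i j + mm n (ev h B x) (ev h W x) i j = 0" by simp
  qed
qed

end

section \<open>The gauge recursion and its stability\<close>

definition sylv :: "nat \<Rightarrow> nat \<Rightarrow> (nat \<Rightarrow> nat \<Rightarrow> complex) \<Rightarrow> (nat \<Rightarrow> nat \<Rightarrow> complex) \<Rightarrow> nat \<Rightarrow> nat \<Rightarrow> complex" where
  "sylv n s A X i j = - of_nat s * X i j - mm n A X i j + mm n X A i j"

text \<open>
  The gauge equation \<open>\<delta> U - A0 U + U A0 = E + B U + h/(x - h) (\<delta> U) A0\<close> on coefficients: it is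
  triangular, because both B and \<open>h/(x - h)\<close> raise the order.
\<close>

locale gauge_system = fact_kernel +
  fixes \<kappa> :: real and A0 :: "nat \<Rightarrow> nat \<Rightarrow> complex"
  assumes h\<rho>: "h < \<rho>" and \<kappa>: "0 \<le> \<kappa>"
    and sylv_ex: "\<And>s C. 1 \<le> s \<Longrightarrow> \<exists>X. \<forall>i<n. \<forall>j<n. sylv n s A0 X i j = C i j"
    and sylv_bd: "\<And>s X. 1 \<le> s \<Longrightarrow> real s * mn n X \<le> \<kappa> * mn n (sylv n s A0 X)"
    and small: "\<kappa> * (\<beta> + h / (\<rho> - h) * mn n A0) \<le> 1 / 2"
begin

text \<open>Coefficients of h/(x - h) times \<open>fe h t\<close>: in \<open>shiftc_sums\<close> the
  denominator x + t h - (t + 1) h is x - h.\<close>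

definition gk :: "nat \<Rightarrow> nat \<Rightarrow> real" where
  "gk t s = h * shiftc h t (real (Suc t) * h) s"

text \<open>Coefficients of h/(x - h) (\<delta> U) A0, where \<delta> multiplies the t-th term by
  -t.\<close>

definition gterm :: "(nat \<Rightarrow> nat \<Rightarrow> nat \<Rightarrow> complex) \<Rightarrow> nat \<Rightarrow> nat \<Rightarrow> nat \<Rightarrow> complex" where
  "gterm U s i j = (\<Sum>t<s. - (of_real (gk t s) * of_nat t) * mm n (U t) A0 i j)"

definition rhs :: "(nat \<Rightarrow> nat \<Rightarrow> nat \<Rightarrow> complex) \<Rightarrow> (nat \<Rightarrow> nat \<Rightarrow> nat \<Rightarrow> complex) \<Rightarrow> nat \<Rightarrow> nat \<Rightarrow> nat \<Rightarrow> complex" where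
  "rhs E U s i j = E s i j + conv U s i j + gterm U s i j"

lemma gk_nonneg: "0 \<le> gk t s"
  using h by (simp add: gk_def shiftc_nonneg)

lemma gk_sums:
  fixes x :: complex
  assumes "hdom h \<rho> x"
  shows "(\<lambda>s. of_real (gk t s) * fe h s x) sums (of_real h / (x - of_real h) * fe h t x)"
proof -
  have "(\<lambda>s. of_real h * (of_real (shiftc h t (real (Suc t) * h) s) * fe h s x)) sums
     (of_real h * (inverse (x + of_nat t * of_real h - of_real (real (Suc t) * h)) * fe h t x))"
    using h h\<rho> by (intro sums_mult shiftc_sums[OF assms]) (auto simp: algebra_simps)
  thus ?thesis by (simp add: gk_def algebra_simps divide_inverse)
qed

lemma gk_sums_real: "(\<lambda>s. gk t s * fe h s \<rho>) sums (h / (\<rho> - h) * fe h t \<rho>)"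
proof -
  have r: "hdom h \<rho> (complex_of_real \<rho>)" by (rule hdom_Re) simp
  have e: "complex_of_real (h / (\<rho> - h)) = of_real h / (of_real \<rho> - of_real h)" by simp
  show ?thesis using gk_sums[OF r, of t] unfolding fe_of_real e[symmetric]
    by (intro sums_of_real_cancel) (simp only: of_real_mult)
qed

text \<open>The factor t from \<delta> survives, so this term is bounded by the sum weighted with t;
  the constant h/(\<rho> - h) makes up for it, being small with h.\<close>

lemma gterm_norm:
  "(\<Sum>s\<le>S. mn n (gterm U s) * fe h s \<rho>) \<le> h / (\<rho> - h) * mn n A0 * (\<Sum>t\<le>S. real t * mn n (U t) * fe h t \<rho>)"
proof -
  have 1: "mn n (gterm U s) \<le> (\<Sum>t<s. real t * mn n (U t) * mn n A0 * gk t s)" for s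
  proof -
    have "mn n (gterm U s) \<le> (\<Sum>t<s. mn n (\<lambda>i j. - (of_real (gk t s) * of_nat t) * mm n (U t) A0 i j))"
      unfolding gterm_def by (rule mn_sum_le)
    also have "\<dots> \<le> (\<Sum>t<s. gk t s * real t * (mn n (U t) * mn n A0))"
      unfolding mn_scale using gk_nonneg
      by (intro sum_mono mult_mono mn_mm_le) (auto simp: norm_mult)
    finally show ?thesis by (simp add: mult_ac)
  qed
  have "(\<Sum>s\<le>S. mn n (gterm U s) * fe h s \<rho>) \<le> (\<Sum>s\<le>S. \<Sum>t<s. real t * mn n (U t) * mn n A0 * gk t s * fe h s \<rho>)"
    unfolding sum_distrib_right[symmetric] by (intro sum_mono mult_right_mono 1 fe0)
  also have "\<dots> \<le> (\<Sum>t\<le>S. \<Sum>s\<le>S. real t * mn n (U t) * mn n A0 * gk t s * fe h s \<rho>)"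
    by (rule sum_triangle_le) (auto intro!: mult_nonneg_nonneg fe0 gk_nonneg)
  also have "\<dots> = (\<Sum>t\<le>S. real t * mn n (U t) * mn n A0 * (\<Sum>s\<le>S. gk t s * fe h s \<rho>))"
    by (simp add: sum_distrib_left mult.assoc)
  also have "\<dots> \<le> (\<Sum>t\<le>S. real t * mn n (U t) * mn n A0 * (h / (\<rho> - h) * fe h t \<rho>))"
  proof (intro sum_mono mult_left_mono)
    fix t show "(\<Sum>s\<le>S. gk t s * fe h s \<rho>) \<le> h / (\<rho> - h) * fe h t \<rho>"
      using sum_le_suminf[of "\<lambda>s. gk t s * fe h s \<rho>" "{..S}"] gk_nonneg fe0 gk_sums_real[of t]
      by (simp add: sums_iff)
  qed simp
  also have "\<dots> = h / (\<rho> - h) * mn n A0 * (\<Sum>t\<le>S. real t * mn n (U t) * fe h t \<rho>)"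
    by (simp add: sum_distrib_left mult_ac)
  finally show ?thesis .
qed

text \<open>With P the weighted partial sum, \<open>sylv_bd\<close> and the two norm bounds give P
  \<le> \<kappa> |E| + P/2, where 1/2 comes from \<open>small\<close>. A partial sum is finite, so
  P/2 may be subtracted. The vanishing of \<open>D 0\<close> makes the unweighted sum at most
  P.\<close>

lemma stability:
  assumes D0: "\<And>i j. i < n \<Longrightarrow> j < n \<Longrightarrow> D 0 i j = 0"
    and eq: "\<And>s i j. 1 \<le> s \<Longrightarrow> i < n \<Longrightarrow> j < n \<Longrightarrow> sylv n s A0 (D s) i j = rhs E D s i j"
  shows "(\<Sum>s\<le>S. real s * mn n (D s) * fe h s \<rho>) \<le> 2 * \<kappa> * (\<Sum>s\<le>S. mn n (E s) * fe h s \<rho>)"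
proof -
  define P where "P = (\<Sum>s\<le>S. real s * mn n (D s) * fe h s \<rho>)"
  have P0: "0 \<le> P" unfolding P_def by (intro sum_nonneg mult_nonneg_nonneg fe0) auto
  have \<beta>0: "0 \<le> \<beta>" unfolding \<beta>_def by (intro suminf_nonneg Bsum mult_nonneg_nonneg fe0) auto
  have ND: "(\<Sum>s\<le>S. mn n (D s) * fe h s \<rho>) \<le> P"
    unfolding P_def
  proof (intro sum_mono mult_right_mono fe0)
    fix s show "mn n (D s) \<le> real s * mn n (D s)"
    proof (cases "s = 0")
      case True
      have "mn n (D 0) = 0" using D0 by (simp add: mn_def)
      thus ?thesis using True by simp
    qed (use mult_right_mono[of 1 "real s" "mn n (D s)"] in auto)
  qed
  have step: "real s * mn n (D s) \<le> \<kappa> * (mn n (E s) + mn n (conv D s) + mn n (gterm D s))" for s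
  proof (cases "s = 0")
    case True thus ?thesis using \<kappa> by simp
  next
    case False
    hence s: "1 \<le> s" by simp
    have "mn n (sylv n s A0 (D s)) = mn n (rhs E D s)"
      by (intro mn_cong eq s)
    also have "\<dots> \<le> mn n (\<lambda>i j. E s i j + conv D s i j) + mn n (gterm D s)"
      unfolding rhs_def by (rule mn_add_le)
    also have "\<dots> \<le> mn n (E s) + mn n (conv D s) + mn n (gterm D s)"
      by (intro add_mono mn_add_le) auto
    finally have "mn n (sylv n s A0 (D s)) \<le> mn n (E s) + mn n (conv D s) + mn n (gterm D s)" .
    thus ?thesis using sylv_bd[OF s, of "D s"] \<kappa> mult_left_mono order_trans by blast
  qed
  have "P \<le> (\<Sum>s\<le>S. \<kappa> * (mn n (E s) * fe h s \<rho> + mn n (conv D s) * fe h s \<rho> + mn n (gterm D s) * fe h s \<rho>))"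
    unfolding P_def
    by (intro sum_mono order_trans[OF mult_right_mono[OF step fe0]]) (simp add: algebra_simps)
  also have "\<dots> = \<kappa> * ((\<Sum>s\<le>S. mn n (E s) * fe h s \<rho>) + (\<Sum>s\<le>S. mn n (conv D s) * fe h s \<rho>) + (\<Sum>s\<le>S. mn n (gterm D s) * fe h s \<rho>))"
    by (simp add: sum_distrib_left[symmetric] sum.distrib)
  also have "\<dots> \<le> \<kappa> * ((\<Sum>s\<le>S. mn n (E s) * fe h s \<rho>) + \<beta> * P + h / (\<rho> - h) * mn n A0 * P)"
  proof (intro mult_left_mono \<kappa> add_mono order_refl)
    show "(\<Sum>s\<le>S. mn n (conv D s) * fe h s \<rho>) \<le> \<beta> * P"
      by (rule order_trans[OF conv_norm mult_left_mono[OF ND \<beta>0]])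
    show "(\<Sum>s\<le>S. mn n (gterm D s) * fe h s \<rho>) \<le> h / (\<rho> - h) * mn n A0 * P"
      unfolding P_def by (rule gterm_norm)
  qed
  also have "\<dots> = \<kappa> * (\<Sum>s\<le>S. mn n (E s) * fe h s \<rho>) + \<kappa> * (\<beta> + h / (\<rho> - h) * mn n A0) * P"
    by (simp add: algebra_simps)
  also have "\<kappa> * (\<beta> + h / (\<rho> - h) * mn n A0) * P \<le> 1/2 * P"
    by (intro mult_right_mono small P0)
  finally show ?thesis unfolding P_def by simp
qed

lemma stability_summable:
  assumes "\<And>i j. i < n \<Longrightarrow> j < n \<Longrightarrow> D 0 i j = 0"
    and "\<And>s i j. 1 \<le> s \<Longrightarrow> i < n \<Longrightarrow> j < n \<Longrightarrow> sylv n s A0 (D s) i j = rhs E D s i j"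
    and E: "summable (\<lambda>s. mn n (E s) * fe h s \<rho>)"
  shows "summable (\<lambda>s. real s * mn n (D s) * fe h s \<rho>)"
    and "summable (\<lambda>s. mn n (D s) * fe h s \<rho>)"
    and "(\<Sum>s. mn n (D s) * fe h s \<rho>) \<le> 2 * \<kappa> * (\<Sum>s. mn n (E s) * fe h s \<rho>)"
proof -
  have le: "(\<Sum>s\<le>S. real s * mn n (D s) * fe h s \<rho>) \<le> 2 * \<kappa> * (\<Sum>s. mn n (E s) * fe h s \<rho>)" for S
  proof (rule order_trans[OF stability])
    show "2 * \<kappa> * (\<Sum>s\<le>S. mn n (E s) * fe h s \<rho>) \<le> 2 * \<kappa> * (\<Sum>s. mn n (E s) * fe h s \<rho>)"
      using \<kappa> by (intro mult_left_mono sum_le_suminf E) (auto intro!: mult_nonneg_nonneg fe0)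
  qed (use assms(1,2) in auto)
  have f0: "0 \<le> real s * mn n (D s) * fe h s \<rho>" for s by (simp add: fe0)
  note P = partial_bound_summable[OF le f0]
  show "summable (\<lambda>s. real s * mn n (D s) * fe h s \<rho>)" by (rule P(1))
  have mle: "mn n (D s) * fe h s \<rho> \<le> real s * mn n (D s) * fe h s \<rho>" for s
  proof (cases "s = 0")
    case True
    have "mn n (D 0) = 0" using assms(1) by (simp add: mn_def)
    thus ?thesis using True by simp
  next
    case False
    thus ?thesis using mult_right_mono[of 1 "real s" "mn n (D s)"] by (intro mult_right_mono fe0) auto
  qed
  show s: "summable (\<lambda>s. mn n (D s) * fe h s \<rho>)"
    by (rule summable_comparison_test'[OF P(1), of 0]) (use mle fe0 in \<open>auto simp: abs_mult\<close>)
  show "(\<Sum>s. mn n (D s) * fe h s \<rho>) \<le> 2 * \<kappa> * (\<Sum>s. mn n (E s) * fe h s \<rho>)"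
    by (rule order_trans[OF suminf_le[OF mle s P(1)] P(2)])
qed

lemma solution_exists:
  obtains U where "\<And>i j. U 0 i j = 0"
    "\<And>s i j. 1 \<le> s \<Longrightarrow> i < n \<Longrightarrow> j < n \<Longrightarrow> sylv n s A0 (U s) i j = rhs B U s i j"
proof -
  define Q where "Q U s X \<longleftrightarrow> (if s = 0 then X = (\<lambda>i j. 0) else \<forall>i<n. \<forall>j<n. sylv n s A0 X i j = rhs B U s i j)"
    for U :: "nat \<Rightarrow> nat \<Rightarrow> nat \<Rightarrow> complex" and s :: nat and X :: "nat \<Rightarrow> nat \<Rightarrow> complex"
  have "\<exists>U. \<forall>s. Q U s (U s)"
  proof (rule dependent_wellorder_choice)
    fix X f g and s :: nat assume "\<And>t. t < s \<Longrightarrow> f t = (g t :: nat \<Rightarrow> nat \<Rightarrow> complex)"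
    hence "rhs B f s i j = rhs B g s i j" for i j
      by (simp add: rhs_def conv_def gterm_def mm_def)
    thus "Q f s X = Q g s X" by (simp add: Q_def)
  next
    fix s f show "\<exists>X. Q f s X"
      using sylv_ex[of s "rhs B f s"] by (cases "s = 0") (auto simp: Q_def)
  qed
  then obtain U where U: "\<And>s. Q U s (U s)" by blast
  show ?thesis
    by (rule that[of U]) (use U in \<open>force simp: Q_def split: if_splits\<close>)+
qed

text \<open>\<delta> applied term by term. \<open>dev_eq\<close> identifies it with the difference
  quotient when h > 0; for h = 0 it is x d/dx of a power series in 1/x.\<close>

definition dev :: "(nat \<Rightarrow> nat \<Rightarrow> nat \<Rightarrow> complex) \<Rightarrow> complex \<Rightarrow> nat \<Rightarrow> nat \<Rightarrow> complex" where
  "dev D x i j = (\<Sum>s. - of_nat s * D s i j * fe h s x)"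

lemma tri6:
  fixes a :: complex
  shows "cmod (a - b + c - (d + e + f)) \<le> cmod a + (cmod b + cmod c) + (cmod d + (cmod e + cmod f))"
  using norm_triangle_ineq4[of "a - b + c" "d + e + f"] norm_triangle_ineq[of "a - b" c]
    norm_triangle_ineq4[of a b] norm_triangle_ineq[of "d + e" f] norm_triangle_ineq[of d e]
  by linarith

text \<open>The defect of the recursion is the coefficient sequence of the defect of the gauge
  equation. This serves in both directions: \<open>gauge_function\<close> derives the equation,
  \<open>gauge_coeffs\<close> the recursion.\<close>

lemma gauge_sums:
  assumes sD: "summable (\<lambda>s. real s * mn n (D s) * fe h s \<rho>)"
    and sD': "summable (\<lambda>s. mn n (D s) * fe h s \<rho>)"
    and sE: "summable (\<lambda>s. mn n (E s) * fe h s \<rho>)"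
    and ij: "i < n" "j < n"
  shows "summable (\<lambda>s. cmod (sylv n s A0 (D s) i j - rhs E D s i j) * fe h s \<rho>)"
    and "hdom h \<rho> x \<Longrightarrow> (\<lambda>s. (sylv n s A0 (D s) i j - rhs E D s i j) * fe h s x) sums
      (dev D x i j - mm n A0 (ev h D x) i j + mm n (ev h D x) A0 i j
        - (ev h E x i j + mm n (ev h B x) (ev h D x) i j + of_real h / (x - of_real h) * mm n (dev D x) A0 i j))"
proof -
  define \<tau> where "\<tau> t s = (if t < s then complex_of_real (gk t s) else 0)" for t s
  define a where "a t = - of_nat t * mm n (D t) A0 i j" for t
  have gk0: "gk t s = 0" if "\<not> t < s" for t s using that by (simp add: gk_def shiftc_def)
  have \<tau>: "\<tau> t s = of_real (gk t s)" for t s using gk0 by (auto simp: \<tau>_def)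
  have \<tau>n: "cmod (\<tau> t s) = gk t s" for t s using gk_nonneg by (simp add: \<tau>)
  have nsD: "(\<lambda>s. mn n (\<lambda>i j. - of_nat s * D s i j) * fe h s \<rho>) = (\<lambda>s. real s * mn n (D s) * fe h s \<rho>)"
    by (simp only: mn_scale norm_minus_cancel norm_of_nat)
  note sD1 = sD[folded nsD]
  have dv: "dev D x i j = ev h (\<lambda>s i j. - of_nat s * D s i j) x i j" for x i j
    by (simp add: dev_def ev_def)
  have sa: "summable (\<lambda>t. cmod (a t) * fe h t \<rho>)"
  proof (rule summable_comparison_test'[OF summable_mult2[OF sD, of "mn n A0"], of 0])
    fix t
    have "cmod (mm n (D t) A0 i j) \<le> mn n (D t) * mn n A0"
      by (rule order_trans[OF entry_le_mn[OF ij] mn_mm_le])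
    hence "cmod (a t) \<le> real t * (mn n (D t) * mn n A0)"
      by (auto simp: a_def norm_mult intro!: mult_left_mono)
    from mult_right_mono[OF this fe0]
    show "norm (cmod (a t) * fe h t \<rho>) \<le> real t * mn n (D t) * fe h t \<rho> * mn n A0"
      by (simp add: fe0 abs_mult mult_ac)
  qed
  have gt: "gterm D s i j = (\<Sum>t\<le>s. a t * \<tau> t s)" for s
  proof -
    have "(\<Sum>t\<le>s. a t * \<tau> t s) = (\<Sum>t<s. a t * \<tau> t s)"
      by (rule sum.mono_neutral_right) (auto simp: \<tau>_def)
    thus ?thesis by (simp add: gterm_def a_def \<tau> mult_ac)
  qed
  have kt: "\<tau> t s = 0" if "s < t" for t s using that by (simp add: \<tau>_def)
  have k1: "summable (\<lambda>s. cmod (\<tau> t s) * fe h s \<rho>)"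
      "(\<Sum>s. cmod (\<tau> t s) * fe h s \<rho>) \<le> h / (\<rho> - h) * fe h t \<rho>" for t
    using gk_sums_real[of t] by (simp_all add: \<tau>n sums_iff)
  have G1: "summable (\<lambda>s. cmod (gterm D s i j) * fe h s \<rho>)"
  proof (rule summable_comparison_test'[OF kernel_norm(1)[where a = a and \<tau> = \<tau>, OF fe0 sa kt k1(1) k1(2)], of 0])
    fix s show "norm (cmod (gterm D s i j) * fe h s \<rho>) \<le> (\<Sum>t\<le>s. cmod (a t) * cmod (\<tau> t s)) * fe h s \<rho>"
      unfolding gt by (auto simp: abs_mult fe0 norm_mult[symmetric] intro!: mult_right_mono norm_sum)
  qed
  have E1: "summable (\<lambda>s. cmod (E s i j) * fe h s \<rho>)" by (rule entry_summable[OF sE ij])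
  have D1: "summable (\<lambda>s. cmod (- of_nat s * D s i j) * fe h s \<rho>)" by (rule entry_summable[OF sD1 ij])
  have A1: "summable (\<lambda>s. (\<Sum>k<n. cmod (A0 i k) * (cmod (D s k j) * fe h s \<rho>)))"
    by (intro summable_sum summable_mult entry_summable[OF sD'] ij) auto
  have A2: "summable (\<lambda>s. (\<Sum>k<n. cmod (D s i k) * fe h s \<rho> * cmod (A0 k j)))"
    by (intro summable_sum summable_mult2 entry_summable[OF sD'] ij) auto
  note C1 = conv_sums(1)[OF sD' ij]
  show "summable (\<lambda>s. cmod (sylv n s A0 (D s) i j - rhs E D s i j) * fe h s \<rho>)"
  proof (rule summable_comparison_test'[OF summable_add[OF summable_add[OF D1 summable_add[OF A1 A2]] summable_add[OF E1 summable_add[OF C1 G1]]], of 0])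
    fix s
    have m1: "cmod (mm n A0 (D s) i j) \<le> (\<Sum>k<n. cmod (A0 i k) * cmod (D s k j))"
      and m2: "cmod (mm n (D s) A0 i j) \<le> (\<Sum>k<n. cmod (D s i k) * cmod (A0 k j))"
      unfolding mm_def norm_mult[symmetric] by (rule norm_sum)+
    have "cmod (sylv n s A0 (D s) i j - rhs E D s i j)
      \<le> cmod (- of_nat s * D s i j) + (cmod (mm n A0 (D s) i j) + cmod (mm n (D s) A0 i j))
        + (cmod (E s i j) + (cmod (conv D s i j) + cmod (gterm D s i j)))"
      unfolding sylv_def rhs_def
      by (rule tri6)
    also have "\<dots> \<le> cmod (- of_nat s * D s i j) + ((\<Sum>k<n. cmod (A0 i k) * cmod (D s k j)) + (\<Sum>k<n. cmod (D s i k) * cmod (A0 k j)))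
        + (cmod (E s i j) + (cmod (conv D s i j) + cmod (gterm D s i j)))"
      by (intro add_mono m1 m2 order_refl)
    finally have "cmod (sylv n s A0 (D s) i j - rhs E D s i j) \<le> \<dots>" .
    from mult_right_mono[OF this fe0[of s]]
    show "norm (cmod (sylv n s A0 (D s) i j - rhs E D s i j) * fe h s \<rho>) \<le>
      cmod (- of_nat s * D s i j) * fe h s \<rho> + ((\<Sum>k<n. cmod (A0 i k) * (cmod (D s k j) * fe h s \<rho>)) + (\<Sum>k<n. cmod (D s i k) * fe h s \<rho> * cmod (A0 k j)))
        + (cmod (E s i j) * fe h s \<rho> + (cmod (conv D s i j) * fe h s \<rho> + cmod (gterm D s i j) * fe h s \<rho>))"
      by (simp add: abs_mult fe0 distrib_left distrib_right sum_distrib_left sum_distrib_right mult_ac)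
  qed
  assume x: "hdom h \<rho> x"
  have "(\<lambda>s. (\<Sum>t\<le>s. a t * \<tau> t s) * fe h s x) sums (of_real h / (x - of_real h) * (\<Sum>t. a t * fe h t x))"
  proof (rule kernel_apply[OF x h \<rho> sa kt k1(1) k1(2)])
    show "(\<lambda>s. \<tau> t s * fe h s x) sums (of_real h / (x - of_real h) * fe h t x)" for t
      unfolding \<tau> by (rule gk_sums[OF x])
  qed
  moreover have "(\<Sum>t. a t * fe h t x) = mm n (dev D x) A0 i j"
  proof -
    have "(\<lambda>t. \<Sum>k<n. (- of_nat t * D t i k * fe h t x) * A0 k j) sums (\<Sum>k<n. dev D x i k * A0 k j)"
      unfolding dv by (intro sums_sum sums_mult2 ev_sums[OF sD1 _ _ x] ij) auto
    thus ?thesis by (simp add: sums_iff a_def mm_def sum_distrib_left sum_distrib_right sum_negf mult_ac)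
  qed
  ultimately have G2: "(\<lambda>s. gterm D s i j * fe h s x) sums (of_real h / (x - of_real h) * mm n (dev D x) A0 i j)"
    by (simp add: gt)
  have S1: "(\<lambda>s. \<Sum>k<n. A0 i k * (D s k j * fe h s x)) sums mm n A0 (ev h D x) i j"
    unfolding mm_def by (intro sums_sum sums_mult ev_sums[OF sD' _ _ x] ij) auto
  have S2: "(\<lambda>s. \<Sum>k<n. D s i k * fe h s x * A0 k j) sums mm n (ev h D x) A0 i j"
    unfolding mm_def by (intro sums_sum sums_mult2 ev_sums[OF sD' _ _ x] ij) auto
  have S0: "(\<lambda>s. - of_nat s * D s i j * fe h s x) sums dev D x i j"
    unfolding dv by (rule ev_sums[OF sD1 ij x])
  have "(\<lambda>s. - of_nat s * D s i j * fe h s x - (\<Sum>k<n. A0 i k * (D s k j * fe h s x)) + (\<Sum>k<n. D s i k * fe h s x * A0 k j)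
      - (E s i j * fe h s x + conv D s i j * fe h s x + gterm D s i j * fe h s x)) sums
      (dev D x i j - mm n A0 (ev h D x) i j + mm n (ev h D x) A0 i j
        - (ev h E x i j + mm n (ev h B x) (ev h D x) i j + of_real h / (x - of_real h) * mm n (dev D x) A0 i j))"
    by (intro sums_diff sums_add S0 S1 S2 G2 ev_sums[OF sE ij x] conv_sums(2)[OF sD' ij x])
  moreover have "(\<lambda>s. - of_nat s * D s i j * fe h s x - (\<Sum>k<n. A0 i k * (D s k j * fe h s x)) + (\<Sum>k<n. D s i k * fe h s x * A0 k j)
      - (E s i j * fe h s x + conv D s i j * fe h s x + gterm D s i j * fe h s x))
     = (\<lambda>s. (sylv n s A0 (D s) i j - rhs E D s i j) * fe h s x)"
    by (simp add: sylv_def rhs_def mm_def algebra_simps sum_distrib_left sum_distrib_right)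
  ultimately show "(\<lambda>s. (sylv n s A0 (D s) i j - rhs E D s i j) * fe h s x) sums
      (dev D x i j - mm n A0 (ev h D x) i j + mm n (ev h D x) A0 i j
        - (ev h E x i j + mm n (ev h B x) (ev h D x) i j + of_real h / (x - of_real h) * mm n (dev D x) A0 i j))"
    by simp
qed

end

section \<open>Entire functions of a matrix\<close>

definition tc :: "(complex \<Rightarrow> complex) \<Rightarrow> nat \<Rightarrow> complex" where
  "tc f k = (deriv ^^ k) f 0 / fact k"

text \<open>The Taylor series at 0 is used so that the value involves no Jordan form and can be
  compared for two matrices with different block sizes.\<close>

definition mfun :: "nat \<Rightarrow> (complex \<Rightarrow> complex) \<Rightarrow> complex mat \<Rightarrow> complex mat" where
  "mfun n f A = Matrix.mat n n (\<lambda>(i, j). \<Sum>k. tc f k * (A ^\<^sub>m k) $$ (i, j))"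

abbreviation fm :: "complex mat \<Rightarrow> nat \<Rightarrow> nat \<Rightarrow> complex" where
  "fm M \<equiv> (\<lambda>i j. M $$ (i, j))"

lemma mat_mult_mm:
  assumes "M \<in> carrier_mat n n" "N \<in> carrier_mat n n" "i < n" "j < n"
  shows "(M * N) $$ (i, j) = mm n (fm M) (fm N) i j"
  using assms by (simp add: mm_def scalar_prod_def lessThan_atLeast0)

lemma mn_mult_le:
  assumes "M \<in> carrier_mat n n" "N \<in> carrier_mat n n"
  shows "mn n (fm (M * N)) \<le> mn n (fm M) * mn n (fm N)"
proof -
  have "mn n (fm (M * N)) = mn n (mm n (fm M) (fm N))"
    by (rule mn_cong) (rule mat_mult_mm[OF assms])
  thus ?thesis using mn_mm_le[of n "fm M" "fm N"] by (simp only:)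
qed

lemma tc_sums:
  assumes "f holomorphic_on UNIV"
  shows "(\<lambda>k. tc f k * c ^ k) sums f c"
proof -
  have "(\<lambda>k. (deriv ^^ k) f 0 / fact k * (c - 0) ^ k) sums f c"
    by (rule holomorphic_power_series[of f 0 "cmod c + 1"])
       (use assms in \<open>auto intro: holomorphic_on_subset\<close>)
  thus ?thesis by (simp add: tc_def)
qed

lemma tc_deriv: "tc (deriv f) k = of_nat (Suc k) * tc f (Suc k)"
  by (simp add: tc_def funpow_Suc_right del: funpow.simps of_nat_Suc)

text \<open>The weights are the entries of the k-th power of a Jordan block. Induction on l replaces
  f by its derivative, with (k + 1) binomial(k, l) = (l + 1) binomial(k + 1, l + 1).\<close>

lemma tc_higher_deriv_sums:
  assumes "f holomorphic_on UNIV"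
  shows "(\<lambda>k. tc f k * (of_nat (k choose l) * c ^ (k - l))) sums ((deriv ^^ l) f c / fact l)"
  using assms
proof (induction l arbitrary: f)
  case 0 thus ?case using tc_sums[OF 0] by simp
next
  case (Suc l)
  have "(\<lambda>k. tc (deriv f) k * (of_nat (k choose l) * c ^ (k - l))) sums ((deriv ^^ l) (deriv f) c / fact l)"
    by (rule Suc.IH) (intro holomorphic_deriv Suc.prems open_UNIV)
  moreover have "tc (deriv f) k * (of_nat (k choose l) * c ^ (k - l))
     = of_nat (Suc l) * (tc f (Suc k) * (of_nat (Suc k choose Suc l) * c ^ (Suc k - Suc l)))" for k
  proof -
    have "complex_of_nat (Suc k) * of_nat (k choose l) = of_nat (Suc l) * of_nat (Suc k choose Suc l)"
      using Suc_times_binomial[of l k] by (metis of_nat_mult)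
    thus ?thesis unfolding tc_deriv by (simp add: mult_ac del: of_nat_Suc binomial_Suc_Suc)
  qed
  ultimately have "(\<lambda>k. of_nat (Suc l) * (tc f (Suc k) * (of_nat (Suc k choose Suc l) * c ^ (Suc k - Suc l))))
     sums ((deriv ^^ l) (deriv f) c / fact l)" by simp
  from sums_divide[OF this, of "of_nat (Suc l)"]
  have "(\<lambda>k. tc f (Suc k) * (of_nat (Suc k choose Suc l) * c ^ (Suc k - Suc l)))
     sums ((deriv ^^ Suc l) f c / fact (Suc l))"
    by (simp add: funpow_Suc_right mult_ac del: funpow.simps of_nat_Suc binomial_Suc_Suc diff_Suc_Suc)
  thus ?case by (subst (asm) sums_Suc_iff) simp
qed

lemma diag_block_mat_sums:
  assumes "\<And>k b. b \<in> set bs \<Longrightarrow> F k b \<in> carrier_mat (fst b) (fst b)"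
    and "\<And>b. b \<in> set bs \<Longrightarrow> G b \<in> carrier_mat (fst b) (fst b)"
    and "\<And>b i j. b \<in> set bs \<Longrightarrow> i < fst b \<Longrightarrow> j < fst b \<Longrightarrow> (\<lambda>k. f k * F k b $$ (i, j)) sums (G b $$ (i, j) :: complex)"
    and "i < sum_list (map fst bs)" "j < sum_list (map fst bs)"
  shows "(\<lambda>k. f k * diag_block_mat (map (F k) bs) $$ (i, j)) sums (diag_block_mat (map G bs) $$ (i, j))"
  using assms
proof (induction bs arbitrary: i j)
  case Nil thus ?case by simp
next
  case (Cons b bs)
  have bF': "dim_row (F k b') = fst b'" "dim_col (F k b') = fst b'" if "b' \<in> set (b # bs)" for k b'
    using carrier_matD[OF Cons.prems(1)[OF that]] by simp_all
  have bG': "dim_row (G b') = fst b'" "dim_col (G b') = fst b'" if "b' \<in> set (b # bs)" for b'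
    using carrier_matD[OF Cons.prems(2)[OF that]] by simp_all
  have dF: "dim_row (diag_block_mat (map (F k) bs)) = sum_list (map fst bs)"
     "dim_col (diag_block_mat (map (F k) bs)) = sum_list (map fst bs)" for k
  proof -
    have "map dim_row (map (F k) bs) = map fst bs" "map dim_col (map (F k) bs) = map fst bs"
      using bF' by simp_all
    thus "dim_row (diag_block_mat (map (F k) bs)) = sum_list (map fst bs)"
      "dim_col (diag_block_mat (map (F k) bs)) = sum_list (map fst bs)"
      unfolding dim_diag_block_mat by (simp_all only:)
  qed
  have dG: "dim_row (diag_block_mat (map G bs)) = sum_list (map fst bs)"
     "dim_col (diag_block_mat (map G bs)) = sum_list (map fst bs)"
  proof -
    have "map dim_row (map G bs) = map fst bs" "map dim_col (map G bs) = map fst bs"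
      using bG' by simp_all
    thus "dim_row (diag_block_mat (map G bs)) = sum_list (map fst bs)"
      "dim_col (diag_block_mat (map G bs)) = sum_list (map fst bs)"
      unfolding dim_diag_block_mat by (simp_all only:)
  qed
  have bF: "dim_row (F k b) = fst b" "dim_col (F k b) = fst b" for k using bF'[of b k] by auto
  have bG: "dim_row (G b) = fst b" "dim_col (G b) = fst b" using bG'[of b] by auto
  have IH: "(\<lambda>k. f k * diag_block_mat (map (F k) bs) $$ (i, j)) sums (diag_block_mat (map G bs) $$ (i, j))"
    if "i < sum_list (map fst bs)" "j < sum_list (map fst bs)" for i j
    using Cons.prems that by (intro Cons.IH) auto
  show ?case
    using Cons.prems(3)[of b i j] IH[of "i - fst b" "j - fst b"] Cons.prems(4,5)
    by (auto simp: Let_def dF dG bF bG)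
qed

lemma mat_triple_index:
  fixes Q :: "complex mat"
  assumes "Q \<in> carrier_mat n n" "J \<in> carrier_mat n n" "R \<in> carrier_mat n n" "i < n" "j < n"
  shows "(Q * J * R) $$ (i, j) = (\<Sum>q<n. \<Sum>p<n. Q $$ (i, p) * J $$ (p, q) * R $$ (q, j))"
  using assms by (subst mat_mult_mm[where n = n]) (auto simp: mm_def mat_mult_mm[where n = n] sum_distrib_right simp del: index_mult_mat)

definition mfun_jordan :: "(complex \<Rightarrow> complex) \<Rightarrow> (nat \<times> complex) list \<Rightarrow> complex mat" where
  "mfun_jordan f bs = diag_block_mat (map (\<lambda>(m, c).
     Matrix.mat m m (\<lambda>(i, j). if i \<le> j then (deriv ^^ (j - i)) f c / fact (j - i) else 0)) bs)"

lemma jordan_reductionD: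
  assumes "jordan_reduction A Q R bs" "A \<in> carrier_mat n n"
  shows "Q \<in> carrier_mat n n" "R \<in> carrier_mat n n" "Q * R = 1\<^sub>m n" "R * Q = 1\<^sub>m n"
    "sum_list (map fst bs) = n" "A = Q * jordan_matrix bs * R" "jordan_matrix bs \<in> carrier_mat n n"
proof -
  have w: "similar_mat_wit A (jordan_matrix bs) Q R"
    using assms(1) by (simp only: jordan_reduction_def)
  note D = similar_mat_witD2[OF assms(2) w]
  show "Q \<in> carrier_mat n n" "R \<in> carrier_mat n n" "Q * R = 1\<^sub>m n" "R * Q = 1\<^sub>m n"
    "A = Q * jordan_matrix bs * R" "jordan_matrix bs \<in> carrier_mat n n"
    by (rule D)+
  show "sum_list (map fst bs) = n" using carrier_matD(1)[OF D(5)] by simp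
qed

lemma mfun_jordan_carrier: "mfun_jordan f bs \<in> carrier_mat (sum_list (map fst bs)) (sum_list (map fst bs))"
proof -
  let ?Bs = "map (\<lambda>(m, c). Matrix.mat m m (\<lambda>(i, j). if i \<le> j then (deriv ^^ (j - i)) f c / fact (j - i) else 0)) bs"
  have "map dim_row ?Bs = map fst bs" "map dim_col ?Bs = map fst bs" by auto
  thus ?thesis unfolding mfun_jordan_def by (intro carrier_matI) (simp_all only: dim_diag_block_mat)
qed

text \<open>Powers respect similarity and act blockwise, and on a block the series sums to the
  Taylor coefficients of f at the eigenvalue. In particular the right-hand side does not depend on
  the chosen reduction.\<close>

lemma mfun_eq_jordan:
  assumes A: "A \<in> carrier_mat n n" and J: "jordan_reduction A Q R bs" and f: "f holomorphic_on UNIV"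
  shows "mfun n f A = Q * mfun_jordan f bs * R"
    and "i < n \<Longrightarrow> j < n \<Longrightarrow> (\<lambda>k. tc f k * (A ^\<^sub>m k) $$ (i, j)) sums (mfun n f A $$ (i, j))"
proof -
  note D = jordan_reductionD[OF J A]
  have mc: "mfun_jordan f bs \<in> carrier_mat n n" using mfun_jordan_carrier[of f bs] D(5) by simp
  have Js: "(\<lambda>k. tc f k * (jordan_matrix bs ^\<^sub>m k) $$ (p, q)) sums (mfun_jordan f bs $$ (p, q))" if "p < n" "q < n" for p q
    unfolding jordan_matrix_pow mfun_jordan_def
  proof (rule diag_block_mat_sums)
    fix b i j assume b: "b \<in> set bs" and ij: "i < fst b" "j < fst b"
    obtain m c where mc: "b = (m, c)" by (cases b)
    show "(\<lambda>k. tc f k * (case b of (n, a) \<Rightarrow> jordan_block n a ^\<^sub>m k) $$ (i, j)) sums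
        ((case b of (m, c) \<Rightarrow> Matrix.mat m m (\<lambda>(i, j). if i \<le> j then (deriv ^^ (j - i)) f c / fact (j - i) else 0)) $$ (i, j))"
    proof (cases "i \<le> j")
      case True
      hence kk: "k - (j - i) = k + i - j" for k by simp
      have "(\<lambda>k. tc f k * (of_nat (k choose (j - i)) * c ^ (k + i - j))) sums ((deriv ^^ (j - i)) f c / fact (j - i))"
        using tc_higher_deriv_sums[OF f, of "j - i" c] unfolding kk .
      thus ?thesis using ij True by (simp add: mc jordan_block_pow)
    qed (use ij in \<open>simp add: mc jordan_block_pow\<close>)
  qed (use that D(5) in auto)
  have pow: "A ^\<^sub>m k = Q * (jordan_matrix bs ^\<^sub>m k) * R" for k
    using J similar_mat_wit_pow_id by (auto simp: jordan_reduction_def)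
  have s: "(\<lambda>k. tc f k * (A ^\<^sub>m k) $$ (i, j)) sums ((Q * mfun_jordan f bs * R) $$ (i, j))" if "i < n" "j < n" for i j
  proof -
    have "(\<lambda>k. \<Sum>q<n. \<Sum>p<n. Q $$ (i, p) * (tc f k * (jordan_matrix bs ^\<^sub>m k) $$ (p, q)) * R $$ (q, j)) sums
      (\<Sum>q<n. \<Sum>p<n. Q $$ (i, p) * mfun_jordan f bs $$ (p, q) * R $$ (q, j))"
      by (intro sums_sum sums_mult sums_mult2 Js) auto
    thus ?thesis
      using that D(1,2,7) mc unfolding pow
      by (simp add: mat_triple_index[where n = n] sum_distrib_left mult_ac del: index_mult_mat assoc_mult_mat)
  qed
  have dims: "dim_row (Q * mfun_jordan f bs * R) = n" "dim_col (Q * mfun_jordan f bs * R) = n"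
    using carrier_matD[OF D(1)] carrier_matD[OF D(2)] by simp_all
  show 1: "mfun n f A = Q * mfun_jordan f bs * R"
  proof (rule eq_matI)
    fix i j assume "i < dim_row (Q * mfun_jordan f bs * R)" "j < dim_col (Q * mfun_jordan f bs * R)"
    hence "i < n" "j < n" unfolding dims .
    thus "mfun n f A $$ (i, j) = (Q * mfun_jordan f bs * R) $$ (i, j)"
      using sums_unique[OF s[of i j]] by (simp only: mfun_def index_mat case_prod_conv)
  qed (simp_all only: dims, simp_all add: mfun_def)
  show "i < n \<Longrightarrow> j < n \<Longrightarrow> (\<lambda>k. tc f k * (A ^\<^sub>m k) $$ (i, j)) sums (mfun n f A $$ (i, j))"
    unfolding 1 by (rule s)
qed

lemma diag_block_mat_diag_nonzero:
  assumes "\<And>B. B \<in> set Bs \<Longrightarrow> dim_row B = dim_col B"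
    and "\<And>B i. B \<in> set Bs \<Longrightarrow> i < dim_row B \<Longrightarrow> B $$ (i, i) \<noteq> (0 :: complex)"
    and "i < dim_row (diag_block_mat Bs)"
  shows "diag_block_mat Bs $$ (i, i) \<noteq> 0"
  using assms
proof (induction Bs arbitrary: i)
  case (Cons B Bs)
  have "dim_row (diag_block_mat Bs) = dim_col (diag_block_mat Bs)"
  proof -
    have "map dim_row Bs = map dim_col Bs" using Cons.prems(1) by simp
    thus ?thesis unfolding dim_diag_block_mat by (simp only:)
  qed
  thus ?case
    using Cons.IH[of "i - dim_row B"] Cons.prems by (auto simp: Let_def)
qed simp

text \<open>In a Jordan basis the matrix is triangular, and its diagonal consists of the values of f
  at the eigenvalues.\<close>

lemma mfun_det_nonzero:
  assumes A: "A \<in> carrier_mat n n" and J: "jordan_reduction A Q R bs" and f: "f holomorphic_on UNIV"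
    and nz: "\<And>m c. (m, c) \<in> set bs \<Longrightarrow> f c \<noteq> 0"
  shows "det (mfun n f A) \<noteq> 0"
proof -
  note D = jordan_reductionD[OF J A]
  have mc: "mfun_jordan f bs \<in> carrier_mat n n" using mfun_jordan_carrier[of f bs] D(5) by simp
  have ut: "upper_triangular (mfun_jordan f bs)"
    unfolding mfun_jordan_def by (rule upper_triangularI, rule diag_block_upper_triangular) auto
  have "mfun_jordan f bs $$ (i, i) \<noteq> 0" if "i < n" for i
    unfolding mfun_jordan_def
    by (rule diag_block_mat_diag_nonzero)
       (use nz that mc in \<open>auto simp: mfun_jordan_def[symmetric]\<close>)
  hence "det (mfun_jordan f bs) \<noteq> 0"
    using mc by (auto simp: det_upper_triangular[OF ut mc] prod_list_zero_iff diag_mat_def)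
  moreover have "det Q * det R = 1"
    using det_mult[OF D(1,2)] D(3) by simp
  hence "det Q \<noteq> 0" "det R \<noteq> 0" by auto
  ultimately show ?thesis
    unfolding mfun_eq_jordan(1)[OF A J f]
    using D(1,2) mc by (simp add: det_mult[where n = n])
qed

lemma pow_mat_commute:
  assumes "A \<in> carrier_mat n n"
  shows "A * A ^\<^sub>m k = A ^\<^sub>m k * (A :: complex mat)"
proof (induction k)
  case (Suc k)
  have "A * (A ^\<^sub>m k * A) = A * A ^\<^sub>m k * A" using assms by (simp add: assoc_mult_mat[of _ n n _ n _ n])
  thus ?case using Suc by simp
qed (use assms in simp)

text \<open>The factor n is the entrywise norm of the identity matrix.\<close>

lemma pow_mat_norm:
  assumes "A \<in> carrier_mat n n" "mn n (fm A) \<le> a"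
  shows "mn n (fm (A ^\<^sub>m k)) \<le> real n * a ^ k"
proof (induction k)
  case 0
  have "mn n (fm (A ^\<^sub>m 0)) = (\<Sum>i<n. \<Sum>j<n. if i = j then 1 else 0)"
    unfolding mn_def using assms(1) by (intro sum.cong refl) auto
  hence "mn n (fm (A ^\<^sub>m 0)) = real n" by simp
  thus ?case by simp
next
  case (Suc k)
  have "mn n (fm (A ^\<^sub>m Suc k)) \<le> mn n (fm (A ^\<^sub>m k)) * mn n (fm A)"
    using mn_mult_le[of "A ^\<^sub>m k" n A] assms(1) by simp
  also have "\<dots> \<le> real n * a ^ k * a"
    using Suc assms(2) order_trans[OF mn_nonneg Suc] by (intro mult_mono) auto
  finally show ?case by (simp add: mult_ac)
qed

lemma pow_mat_diff_norm:
  assumes A: "A \<in> carrier_mat n n" "mn n (fm A) \<le> a" and A': "A' \<in> carrier_mat n n" "mn n (fm A') \<le> a"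
  shows "mn n (\<lambda>i j. (A ^\<^sub>m k) $$ (i, j) - (A' ^\<^sub>m k) $$ (i, j)) \<le> real n * (real k * a ^ (k - 1)) * mn n (\<lambda>i j. A $$ (i, j) - A' $$ (i, j))"
proof (induction k)
  case 0
  have "mn n (\<lambda>i j. (A ^\<^sub>m 0) $$ (i, j) - (A' ^\<^sub>m 0) $$ (i, j)) = mn n (\<lambda>i j. 0)"
    using A A' by (intro mn_cong) auto
  thus ?case by (simp add: mn_def)
next
  case (Suc k)
  define d where "d = mn n (\<lambda>i j. A $$ (i, j) - A' $$ (i, j))"
  have a0: "0 \<le> a" using A(2) mn_nonneg order_trans by blast
  have d0: "0 \<le> d" by (simp add: d_def)
  have "mn n (\<lambda>i j. (A ^\<^sub>m Suc k) $$ (i, j) - (A' ^\<^sub>m Suc k) $$ (i, j))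
     = mn n (\<lambda>i j. mm n (fm (A ^\<^sub>m k)) (\<lambda>i j. A $$ (i, j) - A' $$ (i, j)) i j
            + mm n (\<lambda>i j. (A ^\<^sub>m k) $$ (i, j) - (A' ^\<^sub>m k) $$ (i, j)) (fm A') i j)"
    using A A' by (intro mn_cong) (simp add: mat_mult_mm[where n = n] mm_def sum.distrib[symmetric] sum_subtractf[symmetric] algebra_simps del: index_mult_mat)
  also have "\<dots> \<le> mn n (fm (A ^\<^sub>m k)) * d + mn n (\<lambda>i j. (A ^\<^sub>m k) $$ (i, j) - (A' ^\<^sub>m k) $$ (i, j)) * mn n (fm A')"
    unfolding d_def by (rule order_trans[OF mn_add_le add_mono[OF mn_mm_le mn_mm_le]])
  also have "\<dots> \<le> (real n * a ^ k) * d + (real n * (real k * a ^ (k - 1)) * d) * a"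
    using Suc A'(2) a0 d0 by (intro add_mono mult_mono pow_mat_norm A) (auto simp: d_def)
  also have "\<dots> = real n * (real (Suc k) * a ^ (Suc k - 1)) * d"
    by (cases k) (auto simp: algebra_simps)
  finally show ?case by (simp add: d_def)
qed

lemma tc_bound:
  assumes "f holomorphic_on UNIV" "0 < M" "\<And>c. cmod c \<le> M \<Longrightarrow> cmod (f c) \<le> G"
  shows "cmod (tc f k) \<le> G / M ^ k"
proof -
  have "cmod ((deriv ^^ k) f 0) \<le> fact k * G / M ^ k"
    by (rule Cauchy_inequality)
       (use assms in \<open>auto intro: holomorphic_on_subset holomorphic_on_imp_continuous_on continuous_on_subset\<close>)
  thus ?thesis by (simp add: tc_def norm_divide divide_le_eq mult_ac)
qed

text \<open>The difference is (f - g)(A) + (g(A) - g(A')). Cauchy's inequality on the disc of radius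
  M together with 2 a \<le> M gives the ratio 1/2 in both series; the constants 2 and 4 are the sums
  of 2^{-k} and of k 2^{-(k-1)}.\<close>

lemma mfun_perturbation:
  assumes f: "f holomorphic_on UNIV" and g: "g holomorphic_on UNIV" and M: "0 < M"
    and fg: "\<And>c. cmod c \<le> M \<Longrightarrow> cmod (f c - g c) \<le> \<epsilon>" and G: "\<And>c. cmod c \<le> M \<Longrightarrow> cmod (g c) \<le> G"
    and A: "A \<in> carrier_mat n n" "mn n (fm A) \<le> a" and A': "A' \<in> carrier_mat n n" "mn n (fm A') \<le> a" and a: "2 * a \<le> M"
    and J: "jordan_reduction A Q R bs" and J': "jordan_reduction A' Q' R' bs'" and ij: "i < n" "j < n"
  shows "cmod (mfun n f A $$ (i, j) - mfun n g A' $$ (i, j))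
     \<le> 2 * real n * \<epsilon> + 4 * real n / M * G * mn n (\<lambda>i j. A $$ (i, j) - A' $$ (i, j))"
proof -
  define d where "d = mn n (\<lambda>i j. A $$ (i, j) - A' $$ (i, j))"
  have a0: "0 \<le> a" using A(2) mn_nonneg order_trans by blast
  have G0: "0 \<le> G" using order_trans[OF norm_ge_zero G[of 0]] M by simp
  have e0: "0 \<le> \<epsilon>" using order_trans[OF norm_ge_zero fg[of 0]] M by simp
  have aM: "a / M \<le> 1 / 2" using a M by (simp add: field_simps)
  have fgh: "(\<lambda>c. f c - g c) holomorphic_on UNIV" by (rule holomorphic_on_diff[OF f g])
  have tcd: "tc (\<lambda>c. f c - g c) k = tc f k - tc g k" for k
  proof -
    have "(deriv ^^ k) (\<lambda>c. f c - g c) 0 = (deriv ^^ k) f 0 - (deriv ^^ k) g 0"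
      by (rule higher_deriv_diff[OF f g]) auto
    thus ?thesis by (simp add: tc_def diff_divide_distrib)
  qed
  have S: "(\<lambda>k. tc f k * (A ^\<^sub>m k) $$ (i, j) - tc g k * (A' ^\<^sub>m k) $$ (i, j)) sums (mfun n f A $$ (i, j) - mfun n g A' $$ (i, j))"
    by (intro sums_diff mfun_eq_jordan(2)[OF A(1) J f ij] mfun_eq_jordan(2)[OF A'(1) J' g ij])
  have le: "cmod (tc f k * (A ^\<^sub>m k) $$ (i, j) - tc g k * (A' ^\<^sub>m k) $$ (i, j))
     \<le> \<epsilon> * real n * (1/2) ^ k + G * real n * d / M * (real k * (1/2) ^ (k - 1))" for k
  proof -
    have e: "tc f k * (A ^\<^sub>m k) $$ (i, j) - tc g k * (A' ^\<^sub>m k) $$ (i, j)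
      = tc (\<lambda>c. f c - g c) k * (A ^\<^sub>m k) $$ (i, j) + tc g k * ((A ^\<^sub>m k) $$ (i, j) - (A' ^\<^sub>m k) $$ (i, j))"
      by (simp add: tcd algebra_simps)
    have 1: "cmod (tc (\<lambda>c. f c - g c) k * (A ^\<^sub>m k) $$ (i, j)) \<le> (\<epsilon> / M ^ k) * (real n * a ^ k)"
      unfolding norm_mult
      using e0 M order_trans[OF entry_le_mn[OF ij, of "fm (A ^\<^sub>m k)"] pow_mat_norm[OF A]]
      by (intro mult_mono tc_bound fgh fg) auto
    also have "\<dots> = \<epsilon> * real n * (a / M) ^ k" by (simp add: power_divide)
    also have "\<dots> \<le> \<epsilon> * real n * (1/2) ^ k"
      using e0 a0 M aM by (intro mult_left_mono power_mono) auto
    finally have 1: "cmod (tc (\<lambda>c. f c - g c) k * (A ^\<^sub>m k) $$ (i, j)) \<le> \<epsilon> * real n * (1/2) ^ k" .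
    have "cmod (tc g k * ((A ^\<^sub>m k) $$ (i, j) - (A' ^\<^sub>m k) $$ (i, j))) \<le> (G / M ^ k) * (real n * (real k * a ^ (k - 1)) * d)"
      unfolding norm_mult d_def
      using G0 M order_trans[OF entry_le_mn[OF ij, of "\<lambda>i j. (A ^\<^sub>m k) $$ (i, j) - (A' ^\<^sub>m k) $$ (i, j)"] pow_mat_diff_norm[OF A A']]
      by (intro mult_mono tc_bound g G) auto
    also have "\<dots> = G * real n * d / M * (real k * (a / M) ^ (k - 1))"
      using M by (cases k) (auto simp: power_divide field_simps)
    also have "\<dots> \<le> G * real n * d / M * (real k * (1/2) ^ (k - 1))"
      using G0 a0 M aM by (intro mult_left_mono power_mono) (auto simp: d_def)
    finally show ?thesis unfolding e using 1 by (intro order_trans[OF norm_triangle_ineq] add_mono)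
  qed
  have g1: "(\<lambda>k. \<epsilon> * real n * (1/2) ^ k) sums (\<epsilon> * real n * 2)"
    using geometric_sums[of "1/2 :: real"] by (intro sums_mult) simp
  have "(\<lambda>k. real (Suc k) * (1/2) ^ k) sums (1 / (1 - 1/2)\<^sup>2)"
    by (rule geometric_deriv_sums) simp
  hence "(\<lambda>k. real (Suc k) * (1/2) ^ (Suc k - 1)) sums 4" by (simp add: power2_eq_square)
  hence "(\<lambda>k. real k * (1/2) ^ (k - 1)) sums 4"
    by (subst (asm) sums_Suc_iff[of "\<lambda>k. real k * (1/2) ^ (k - 1)"]) simp
  hence g2: "(\<lambda>k. G * real n * d / M * (real k * (1/2) ^ (k - 1))) sums (G * real n * d / M * 4)"
    by (rule sums_mult)
  have "cmod (mfun n f A $$ (i, j) - mfun n g A' $$ (i, j)) \<le> (\<Sum>k. \<epsilon> * real n * (1/2) ^ k + G * real n * d / M * (real k * (1/2) ^ (k - 1)))"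
    unfolding sums_unique[OF S]
    by (rule norm_suminf_le[OF le]) (use sums_add[OF g1 g2] in \<open>simp add: sums_iff\<close>)
  also have "\<dots> = \<epsilon> * real n * 2 + G * real n * d / M * 4"
    using sums_unique[OF sums_add[OF g1 g2]] by simp
  finally show ?thesis by (simp add: d_def mult_ac)
qed

lemma mfun_times:
  assumes A: "A \<in> carrier_mat n n" and J: "jordan_reduction A Q R bs" and f: "f holomorphic_on UNIV" and ij: "i < n" "j < n"
  shows "mfun n (\<lambda>c. c * f c) A $$ (i, j) = mm n (fm A) (fm (mfun n f A)) i j"
proof -
  have h: "(\<lambda>c. c * f c) holomorphic_on UNIV"
    by (rule holomorphic_on_mult[OF holomorphic_on_ident f])
  have tcS: "tc (\<lambda>c. c * f c) (Suc k) = tc f k" and tc0: "tc (\<lambda>c. c * f c) 0 = 0" for k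
  proof -
    have "(deriv ^^ Suc k) (\<lambda>c. c * f c) 0 = (\<Sum>l = 0..Suc k. of_nat (Suc k choose l) * (deriv ^^ l) (\<lambda>c. c) 0 * (deriv ^^ (Suc k - l)) f 0)"
      by (subst higher_deriv_mult[where S = UNIV]) (auto intro: f)
    also have "\<dots> = (\<Sum>l\<in>{1}. of_nat (Suc k choose l) * (deriv ^^ l) (\<lambda>c. c) 0 * (deriv ^^ (Suc k - l)) f 0)"
      by (rule sum.mono_neutral_right) (auto simp: higher_deriv_ident)
    also have "\<dots> = of_nat (Suc k) * (deriv ^^ k) f 0"
      by (simp del: of_nat_Suc)
    finally show "tc (\<lambda>c. c * f c) (Suc k) = tc f k"
      by (simp add: tc_def del: funpow.simps of_nat_Suc)
  qed (simp add: tc_def)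
  have "(\<lambda>k. \<Sum>p<n. A $$ (i, p) * (tc f k * (A ^\<^sub>m k) $$ (p, j))) sums mm n (fm A) (fm (mfun n f A)) i j"
    unfolding mm_def by (intro sums_sum sums_mult mfun_eq_jordan(2)[OF A J f _ ij(2)]) auto
  moreover have "(\<Sum>p<n. A $$ (i, p) * (tc f k * (A ^\<^sub>m k) $$ (p, j))) = tc (\<lambda>c. c * f c) (Suc k) * (A ^\<^sub>m Suc k) $$ (i, j)" for k
    unfolding tcS pow_mat.simps pow_mat_commute[OF A, symmetric] using A ij
    by (subst mat_mult_mm[where n = n]) (auto simp: mm_def sum_distrib_left mult_ac)
  ultimately have "(\<lambda>k. tc (\<lambda>c. c * f c) (Suc k) * (A ^\<^sub>m Suc k) $$ (i, j)) sums mm n (fm A) (fm (mfun n f A)) i j"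
    by simp
  hence "(\<lambda>k. tc (\<lambda>c. c * f c) k * (A ^\<^sub>m k) $$ (i, j)) sums mm n (fm A) (fm (mfun n f A)) i j"
    by (subst (asm) sums_Suc_iff[of "\<lambda>k. tc (\<lambda>c. c * f c) k * (A ^\<^sub>m k) $$ (i, j)"]) (simp add: tc0)
  thus ?thesis by (rule sums_unique2[OF mfun_eq_jordan(2)[OF A J h ij]])
qed

lemma mfun_lin:
  assumes A: "A \<in> carrier_mat n n" and J: "jordan_reduction A Q R bs" and f: "f holomorphic_on UNIV" and g: "g holomorphic_on UNIV" and ij: "i < n" "j < n"
  shows "mfun n (\<lambda>c. f c + b * g c) A $$ (i, j) = mfun n f A $$ (i, j) + b * mfun n g A $$ (i, j)"
proof -
  have h: "(\<lambda>c. f c + b * g c) holomorphic_on UNIV"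
    by (rule holomorphic_on_add[OF f holomorphic_on_mult[OF holomorphic_on_const g]])
  have "tc (\<lambda>c. f c + b * g c) k = tc f k + b * tc g k" for k
  proof -
    have bg: "(\<lambda>c. b * g c) holomorphic_on UNIV" by (rule holomorphic_on_mult[OF holomorphic_on_const g])
    have "(deriv ^^ k) (\<lambda>c. f c + b * g c) 0 = (deriv ^^ k) f 0 + (deriv ^^ k) (\<lambda>c. b * g c) 0"
      by (rule higher_deriv_add[OF f bg]) auto
    also have "(deriv ^^ k) (\<lambda>c. b * g c) 0 = b * (deriv ^^ k) g 0"
      by (rule higher_deriv_cmult[OF g]) auto
    finally show ?thesis by (simp add: tc_def add_divide_distrib)
  qed
  hence "(\<lambda>k. tc (\<lambda>c. f c + b * g c) k * (A ^\<^sub>m k) $$ (i, j)) = (\<lambda>k. tc f k * (A ^\<^sub>m k) $$ (i, j) + b * (tc g k * (A ^\<^sub>m k) $$ (i, j)))"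
    by (simp add: algebra_simps)
  moreover have "\<dots> sums (mfun n f A $$ (i, j) + b * mfun n g A $$ (i, j))"
    by (intro sums_add sums_mult mfun_eq_jordan(2)[OF A J _ ij] f g)
  ultimately have "(\<lambda>k. tc (\<lambda>c. f c + b * g c) k * (A ^\<^sub>m k) $$ (i, j)) sums (mfun n f A $$ (i, j) + b * mfun n g A $$ (i, j))"
    by simp
  thus ?thesis by (rule sums_unique2[OF mfun_eq_jordan(2)[OF A J h ij]])
qed

text \<open>Puts x^A into the same calculus as \<open>h_exp_mat\<close>, so that comparing the two
  characters means comparing entire functions of c.\<close>

lemma mat_cpow_mfun:
  "mat_cpow n x A = mfun n (\<lambda>c. exp (c * Ln x)) A"
proof -
  have "(deriv ^^ k) (\<lambda>c. exp (c * L)) = (\<lambda>c. L ^ k * exp (c * L))" for k and L :: complex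
  proof (induction k)
    case (Suc k)
    have "deriv (\<lambda>c. L ^ k * exp (c * L)) = (\<lambda>c. L ^ Suc k * exp (c * L))"
      by (intro ext DERIV_imp_deriv) (rule derivative_eq_intros refl | simp)+
    thus ?case using Suc by simp
  qed simp
  hence "tc (\<lambda>c. exp (c * Ln x)) k = Ln x ^ k / fact k" for k by (simp add: tc_def)
  thus ?thesis by (simp add: mat_cpow_def mfun_def mult_ac)
qed

text \<open>Each entry is an everywhere convergent power series in L = Ln x, which is differentiated
  termwise before the chain rule is applied.\<close>

lemma mat_cpow_has_field_derivative:
  assumes A: "A \<in> carrier_mat n n" and J: "jordan_reduction A Q R bs" and ij: "i < n" "j < n" and x: "x \<notin> \<real>\<^sub>\<le>\<^sub>0"
  shows "((\<lambda>x. mat_cpow n x A $$ (i, j)) has_field_derivative mm n (fm A) (fm (mat_cpow n x A)) i j / x) (at x)"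
proof -
  define a where "a k = (A ^\<^sub>m k) $$ (i, j) / fact k" for k
  define p where "p L = (\<Sum>k. a k * L ^ k)" for L
  have x0: "x \<noteq> 0" using x by auto
  have dexp: "(deriv ^^ k) (\<lambda>c. exp (c * L)) = (\<lambda>c. L ^ k * exp (c * L))" for k and L :: complex
  proof (induction k)
    case (Suc k)
    have "deriv (\<lambda>c. L ^ k * exp (c * L)) = (\<lambda>c. L ^ Suc k * exp (c * L))"
      by (intro ext DERIV_imp_deriv) (rule derivative_eq_intros refl | simp)+
    thus ?case using Suc by simp
  qed simp
  have hol: "(\<lambda>c. exp (c * L)) holomorphic_on UNIV" for L by (intro holomorphic_intros)
  have aL: "(\<lambda>k. a k * L ^ k) sums mfun n (\<lambda>c. exp (c * L)) A $$ (i, j)" for L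
    using mfun_eq_jordan(2)[OF A J hol ij, of L] by (simp add: a_def tc_def dexp mult_ac)
  have pL: "p L = mfun n (\<lambda>c. exp (c * L)) A $$ (i, j)" for L using aL[of L] by (simp add: p_def sums_iff)
  have "(p has_field_derivative (\<Sum>k. diffs a k * L ^ k)) (at L)" for L
    unfolding p_def by (rule termdiffs_strong_converges_everywhere) (use aL in \<open>auto simp: sums_iff\<close>)
  moreover have "(\<Sum>k. diffs a k * L ^ k) = mm n (fm A) (fm (mfun n (\<lambda>c. exp (c * L)) A)) i j" for L
  proof -
    have "(\<lambda>k. \<Sum>p<n. A $$ (i, p) * (tc (\<lambda>c. exp (c * L)) k * (A ^\<^sub>m k) $$ (p, j))) sums mm n (fm A) (fm (mfun n (\<lambda>c. exp (c * L)) A)) i j"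
      unfolding mm_def by (intro sums_sum sums_mult mfun_eq_jordan(2)[OF A J hol _ ij(2)]) auto
    moreover have "(\<Sum>p<n. A $$ (i, p) * (tc (\<lambda>c. exp (c * L)) k * (A ^\<^sub>m k) $$ (p, j))) = diffs a k * L ^ k" for k
    proof -
      have "diffs a k = (A ^\<^sub>m Suc k) $$ (i, j) / fact k"
        by (simp add: diffs_def a_def field_simps del: of_nat_Suc pow_mat.simps)
      also have "(A ^\<^sub>m Suc k) $$ (i, j) = mm n (fm A) (fm (A ^\<^sub>m k)) i j"
        unfolding pow_mat.simps pow_mat_commute[OF A, symmetric] using A ij
        by (subst mat_mult_mm[where n = n]) auto
      finally show ?thesis
        by (simp add: tc_def dexp mm_def sum_distrib_left sum_distrib_right sum_divide_distrib mult_ac)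
    qed
    ultimately show ?thesis by (simp add: sums_iff)
  qed
  ultimately have "((\<lambda>x. p (Ln x)) has_field_derivative mm n (fm A) (fm (mfun n (\<lambda>c. exp (c * Ln x)) A)) i j * (1 / x)) (at x)"
    by (intro DERIV_chain2[where f = p]) (use x in \<open>auto intro!: derivative_eq_intros simp: divide_inverse\<close>)
  thus ?thesis by (simp add: pL mat_cpow_mfun)
qed

section \<open>Asymptotics of ratios of Gamma values\<close>

definition gamma_quot :: "complex \<Rightarrow> complex \<Rightarrow> complex" where
  "gamma_quot c z = Gamma z / Gamma (z - c) * exp (- c * Ln z)"

text \<open>A logarithm of the ratio of \<open>gamma_quot c\<close> at z to its value at z +
  1.\<close>

definition gamma_step :: "complex \<Rightarrow> complex \<Rightarrow> complex" where
  "gamma_step c z = Ln (1 - c / z) + c * Ln (1 + 1 / z)"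

lemma Ln_mult_Re_pos:
  assumes "0 < Re a" "0 < Re b"
  shows "Ln (a * b) = Ln a + Ln b"
proof -
  have "a \<noteq> 0" "b \<noteq> 0" using assms by auto
  moreover have "\<bar>Im (Ln a)\<bar> < pi / 2" "\<bar>Im (Ln b)\<bar> < pi / 2"
    using Re_Ln_pos_lt[of a] Re_Ln_pos_lt[of b] assms calculation by auto
  ultimately show ?thesis by (intro Ln_times_simple) linarith+
qed

lemma not_nonpos_Int_Re: "0 < Re z \<Longrightarrow> z \<notin> \<int>\<^sub>\<le>\<^sub>0"
  by (auto elim!: nonpos_Ints_cases)

lemma gamma_quot_step:
  assumes "cmod c < Re z"
  shows "gamma_quot c z = gamma_quot c (z + 1) * exp (gamma_step c z)"
proof -
  have R: "0 < Re z" "0 < Re (z - c)"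
    using assms complex_Re_le_cmod[of c] by auto (metis norm_ge_zero order_le_less_trans)
  have z0: "z \<noteq> 0" "z - c \<noteq> 0" using R by auto
  have G: "Gamma (z + 1) = z * Gamma z" "Gamma (z - c + 1) = (z - c) * Gamma (z - c)"
    using not_nonpos_Int_Re[OF R(1)] not_nonpos_Int_Re[OF R(2)] by (auto intro!: Gamma_plus1)
  have "0 < Re (1 + 1 / z)" using R(1) by (simp add: Re_divide add_pos_nonneg)
  hence L: "Ln (z + 1) = Ln z + Ln (1 + 1 / z)"
    using Ln_mult_Re_pos[OF R(1), of "1 + 1 / z"] z0 by (simp add: algebra_simps)
  have "1 - c / z = (z - c) / z" using z0 by (simp add: field_simps)
  hence e: "exp (gamma_step c z) = (z - c) / z * exp (c * Ln (1 + 1 / z))"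
    using z0 by (simp add: gamma_step_def exp_add)
  have "gamma_quot c (z + 1) = z * Gamma z / ((z - c) * Gamma (z - c)) * exp (- c * Ln z - c * Ln (1 + 1 / z))"
  proof -
    have "z + 1 - c = z - c + 1" by simp
    thus ?thesis unfolding gamma_quot_def by (simp only: G L) (simp add: ring_distribs)
  qed
  also have "\<dots> * exp (gamma_step c z) = Gamma z / Gamma (z - c) * (exp (- c * Ln z - c * Ln (1 + 1 / z)) * exp (c * Ln (1 + 1 / z)))"
    using z0 unfolding e by (simp add: divide_simps)
  also have "\<dots> = gamma_quot c z"
    unfolding gamma_quot_def exp_add[symmetric] by simp
  finally show ?thesis by simp
qed

text \<open>The terms - c/z and c/z of first order cancel; two quadratic remainders are left, each
  an instance of the bound for Ln (1 + w) with |w| \<le> 1/2.\<close>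

lemma gamma_step_bound:
  assumes "cmod c \<le> M" "2 * M + 2 \<le> cmod z"
  shows "cmod (gamma_step c z) \<le> (2 * M\<^sup>2 + 2 * M) / (cmod z)\<^sup>2"
proof -
  have M: "0 \<le> M" using assms(1) norm_ge_zero order_trans by blast
  have z0: "0 < cmod z" using assms M by linarith
  have b: "cmod (Ln (1 + w) - w) \<le> 2 * (cmod w)\<^sup>2" if "cmod w \<le> 1 / 2" for w
  proof -
    have "cmod (Ln (1 + w) - w) \<le> (cmod w)\<^sup>2 / (1 - cmod w)" using that by (intro Ln_approx_linear) auto
    also have "\<dots> \<le> (cmod w)\<^sup>2 / (1 / 2)" using that by (intro divide_left_mono) auto
    finally show ?thesis by simp
  qed
  have 1: "cmod (- c / z) \<le> 1 / 2" "cmod (1 / z) \<le> 1 / 2"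
    using assms z0 M by (auto simp: norm_divide divide_simps)
  have "gamma_step c z = (Ln (1 + (- c / z)) - (- c / z)) + c * (Ln (1 + 1 / z) - 1 / z)"
    by (simp add: gamma_step_def algebra_simps)
  also have "cmod \<dots> \<le> 2 * (cmod (- c / z))\<^sup>2 + cmod c * (2 * (cmod (1 / z))\<^sup>2)"
    using b[OF 1(1)] b[OF 1(2)]
    by (intro order_trans[OF norm_triangle_ineq] add_mono) (auto simp: norm_mult intro!: mult_left_mono)
  also have "\<dots> \<le> 2 * (M / cmod z)\<^sup>2 + M * (2 * (1 / cmod z)\<^sup>2)"
    using assms(1) M z0 by (intro add_mono mult_mono power_mono) (auto simp: norm_divide divide_right_mono)
  finally show ?thesis by (simp add: power_divide add_divide_distrib mult.commute)
qed

text \<open>Quotient of Euler's limit formulas for Gamma at z - c and at z. They contain a power of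
  N in place of the same power of z + N + 1, and the ratio of the two tends to 1.\<close>

lemma gamma_quot_tendsto_1:
  assumes "cmod c < Re z"
  shows "(\<lambda>N. gamma_quot c (z + of_nat N)) \<longlonglongrightarrow> 1"
proof -
  have R: "0 < Re z" "0 < Re (z - c)"
    using assms complex_Re_le_cmod[of c] by auto (metis norm_ge_zero order_le_less_trans)
  have G0: "Gamma z \<noteq> 0" "Gamma (z - c) \<noteq> 0"
    using R not_nonpos_Int_Re by (auto simp: Gamma_eq_zero_iff)
  have poch: "pochhammer z N \<noteq> 0" "pochhammer (z - c) N \<noteq> 0" for N
    using R not_nonpos_Int_Re by (auto simp: pochhammer_eq_0_iff intro!: notI dest!: arg_cong[where f = Re])
  \<comment> \<open>\<open>Suc N\<close> because \<open>Gamma_series z N\<close> has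
    \<open>pochhammer z (Suc N)\<close> in the denominator.\<close>
  define r where "r N = pochhammer z (Suc N) / pochhammer (z - c) (Suc N)" for N
  have "(\<lambda>N. Gamma_series (z - c) N / Gamma_series z N) \<longlonglongrightarrow> Gamma (z - c) / Gamma z"
    by (intro tendsto_divide Gamma_series_LIMSEQ G0)
  moreover have "\<forall>\<^sub>F N in sequentially. Gamma_series (z - c) N / Gamma_series z N = r N * exp (- c * of_real (ln (real N)))"
    using eventually_gt_at_top[of 0]
  proof eventually_elim
    case (elim N)
    have "exp ((z - c) * complex_of_real (ln (real N))) = exp (z * of_real (ln (real N))) * exp (- c * of_real (ln (real N)))"
      by (simp add: exp_add[symmetric] algebra_simps)
    thus ?case using poch[of "Suc N"] by (simp add: Gamma_series_def r_def field_simps)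
  qed
  ultimately have 1: "(\<lambda>N. r N * exp (- c * of_real (ln (real N)))) \<longlonglongrightarrow> Gamma (z - c) / Gamma z"
    by (rule Lim_transform_eventually)
  have 2: "(\<lambda>N. exp (- c * Ln ((z + of_nat (Suc N)) / of_nat N))) \<longlonglongrightarrow> exp (- c * Ln 1)"
  proof (intro tendsto_intros)
    have "(\<lambda>N. (z + 1) * (1 / of_nat N) + 1) \<longlonglongrightarrow> (z + 1) * 0 + 1"
      by (intro tendsto_add tendsto_mult tendsto_const lim_1_over_n)
    moreover have "\<forall>\<^sub>F N in sequentially. (z + 1) * (1 / of_nat N) + 1 = (z + of_nat (Suc N)) / of_nat N"
      using eventually_gt_at_top[of 0] by eventually_elim (simp add: field_simps)
    ultimately have "(\<lambda>N. (z + of_nat (Suc N)) / of_nat N) \<longlonglongrightarrow> (z + 1) * 0 + 1"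
      by (rule Lim_transform_eventually)
    thus "(\<lambda>N. (z + of_nat (Suc N)) / of_nat N) \<longlonglongrightarrow> 1" by simp
  qed auto
  have "(\<lambda>N. r N * exp (- c * of_real (ln (real N))) * (Gamma z / Gamma (z - c)) * exp (- c * Ln ((z + of_nat (Suc N)) / of_nat N)))
      \<longlonglongrightarrow> Gamma (z - c) / Gamma z * (Gamma z / Gamma (z - c)) * exp (- c * Ln 1)"
    by (intro tendsto_mult 1 2 tendsto_const)
  moreover have "\<forall>\<^sub>F N in sequentially. r N * exp (- c * of_real (ln (real N))) * (Gamma z / Gamma (z - c)) * exp (- c * Ln ((z + of_nat (Suc N)) / of_nat N))
     = gamma_quot c (z + of_nat (Suc N))"
    using eventually_gt_at_top[of 0]
  proof eventually_elim
    case (elim N)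
    have zn: "z + of_nat (Suc N) \<noteq> 0" using R(1) by (auto dest!: arg_cong[where f = Re])
    have L: "Ln ((z + of_nat (Suc N)) / of_nat N) = Ln (z + of_nat (Suc N)) - of_real (ln (real N))"
      using Ln_divide_of_real[of "real N" "z + of_nat (Suc N)"] elim zn by simp
    have "Gamma (z + of_nat (Suc N)) = pochhammer z (Suc N) * Gamma z"
      using pochhammer_Gamma[of z "Suc N"] R not_nonpos_Int_Re G0 by (simp add: field_simps)
    moreover have "Gamma (z + of_nat (Suc N) - c) = pochhammer (z - c) (Suc N) * Gamma (z - c)"
      using pochhammer_Gamma[of "z - c" "Suc N"] R not_nonpos_Int_Re G0 by (simp add: field_simps)
    moreover have "exp (- c * Ln (z + of_nat (Suc N))) = exp (- c * of_real (ln (real N))) * exp (- c * Ln ((z + of_nat (Suc N)) / of_nat N))"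
      unfolding L exp_add[symmetric] by (simp add: algebra_simps)
    ultimately show ?case by (simp add: gamma_quot_def r_def)
  qed
  ultimately have "(\<lambda>N. gamma_quot c (z + of_nat (Suc N))) \<longlonglongrightarrow> Gamma (z - c) / Gamma z * (Gamma z / Gamma (z - c)) * exp (- c * Ln 1)"
    by (rule Lim_transform_eventually)
  moreover have "Gamma (z - c) / Gamma z * (Gamma z / Gamma (z - c)) * exp (- c * Ln 1) = 1"
    using G0 by simp
  ultimately have "(\<lambda>N. gamma_quot c (z + of_nat (Suc N))) \<longlonglongrightarrow> 1"
    by (simp only:)
  thus ?thesis by (subst (asm) filterlim_sequentially_Suc)
qed

lemma norm_exp_minus_1_le: "cmod (exp w - 1) \<le> exp (cmod w) - 1"
proof -
  have c: "(\<lambda>n. w ^ Suc n /\<^sub>R fact (Suc n)) sums (exp w - 1)"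
    using exp_converges[of w] by (subst sums_Suc_iff) simp
  have r: "(\<lambda>n. cmod w ^ Suc n /\<^sub>R fact (Suc n)) sums (exp (cmod w) - 1)"
    using exp_converges[of "cmod w"] by (subst sums_Suc_iff) simp
  have "cmod (\<Sum>n. w ^ Suc n /\<^sub>R fact (Suc n)) \<le> (\<Sum>n. cmod w ^ Suc n /\<^sub>R fact (Suc n))"
    by (rule norm_suminf_le) (use r in \<open>auto simp: sums_iff norm_mult norm_power simp del: power_Suc fact_Suc\<close>)
  thus ?thesis using c r by (simp add: sums_iff)
qed

text \<open>As the quotient tends to 1 along z + N, iterating the step equation expresses
  \<open>gamma_quot c z\<close> as the limit of the exponentials of the summed steps, and the steps
  are summable like 1/|z + k|^2.\<close>

lemma gamma_quot_bound:
  assumes c: "cmod c \<le> M" and z: "2 * M + 2 \<le> Re z"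
  shows "cmod (gamma_quot c z - 1) \<le> exp ((2 * M\<^sup>2 + 2 * M) / (Re z - 1)) - 1"
proof -
  define B where "B = 2 * M\<^sup>2 + 2 * M"
  have M: "0 \<le> M" using c norm_ge_zero order_trans by blast
  have B: "0 \<le> B" using M by (simp add: B_def)
  have cz: "cmod c < Re z" using c z M by linarith
  have q: "gamma_quot c z = gamma_quot c (z + of_nat N) * exp (\<Sum>k<N. gamma_step c (z + of_nat k))" for N
  proof (induction N)
    case (Suc N)
    have "gamma_quot c (z + of_nat N) = gamma_quot c (z + of_nat N + 1) * exp (gamma_step c (z + of_nat N))"
      using cz by (intro gamma_quot_step) simp
    thus ?case using Suc by (simp add: exp_add add_ac mult_ac)
  qed simp
  have S: "cmod (\<Sum>k<N. gamma_step c (z + of_nat k)) \<le> B / (Re z - 1)" for N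
  proof -
    have "cmod (gamma_step c (z + of_nat k)) \<le> B * (1 / (Re z - 1 + real k) - 1 / (Re z - 1 + real (Suc k)))" for k
    proof -
      have rz: "Re z + real k \<le> cmod (z + of_nat k)" using complex_Re_le_cmod[of "z + of_nat k"] by simp
      have p: "0 < Re z - 1 + real k" using z M by simp
      have "cmod (gamma_step c (z + of_nat k)) \<le> B / (cmod (z + of_nat k))\<^sup>2"
        unfolding B_def using rz z by (intro gamma_step_bound c) linarith
      \<comment> \<open>Replacing |z + k|^2 by (Re z - 1 + k)(Re z + k) makes the sum over k
        telescope.\<close>
      also have "\<dots> \<le> B / ((Re z - 1 + real k) * (Re z + real k))"
      proof (intro divide_left_mono B)
        show "(Re z - 1 + real k) * (Re z + real k) \<le> (cmod (z + of_nat k))\<^sup>2"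
          unfolding power2_eq_square using rz p by (intro mult_mono) auto
      qed (use p rz in \<open>auto intro!: mult_pos_pos\<close>)
      also have "\<dots> = B * (1 / (Re z - 1 + real k) - 1 / (Re z - 1 + real (Suc k)))"
        using p by (simp add: field_simps)
      finally show ?thesis .
    qed
    hence "cmod (\<Sum>k<N. gamma_step c (z + of_nat k)) \<le> (\<Sum>k<N. B * (1 / (Re z - 1 + real k) - 1 / (Re z - 1 + real (Suc k))))"
      by (intro sum_norm_le) auto
    also have "\<dots> = B * (1 / (Re z - 1) - 1 / (Re z - 1 + real N))"
      unfolding sum_distrib_left[symmetric] by (subst sum_lessThan_telescope') simp
    also have "\<dots> \<le> B * (1 / (Re z - 1))"
      using z M by (intro mult_left_mono B) auto
    finally show ?thesis by simp
  qed
  have "(\<lambda>N. gamma_quot c (z + of_nat N)) \<longlonglongrightarrow> 1" by (rule gamma_quot_tendsto_1[OF cz])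
  hence "(\<lambda>N. gamma_quot c z / gamma_quot c (z + of_nat N)) \<longlonglongrightarrow> gamma_quot c z / 1"
    by (intro tendsto_divide tendsto_const) auto
  moreover have "\<forall>\<^sub>F N in sequentially. gamma_quot c (z + of_nat N) \<noteq> 0"
    using tendsto_imp_eventually_ne[OF gamma_quot_tendsto_1[OF cz]] by simp
  hence "\<forall>\<^sub>F N in sequentially. gamma_quot c z / gamma_quot c (z + of_nat N) = exp (\<Sum>k<N. gamma_step c (z + of_nat k))"
    by eventually_elim (use q in \<open>simp add: field_simps\<close>)
  ultimately have "(\<lambda>N. exp (\<Sum>k<N. gamma_step c (z + of_nat k))) \<longlonglongrightarrow> gamma_quot c z / 1"
    by (rule Lim_transform_eventually)
  hence "(\<lambda>N. exp (\<Sum>k<N. gamma_step c (z + of_nat k))) \<longlonglongrightarrow> gamma_quot c z" by simp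
  hence "(\<lambda>N. cmod (exp (\<Sum>k<N. gamma_step c (z + of_nat k)) - 1)) \<longlonglongrightarrow> cmod (gamma_quot c z - 1)"
    by (intro tendsto_intros)
  moreover have "cmod (exp (\<Sum>k<N. gamma_step c (z + of_nat k)) - 1) \<le> exp (B / (Re z - 1)) - 1" for N
    by (rule order_trans[OF norm_exp_minus_1_le]) (use S[of N] in simp)
  ultimately show ?thesis unfolding B_def
    by (intro tendsto_upperbound) auto
qed

lemma h_char_eq:
  assumes "0 < h" "0 < Re x"
  shows "h_char h c x = exp (c * Ln x) * gamma_quot c (x / of_real h)"
proof -
  have "Ln (x / of_real h) = Ln x - of_real (ln h)"
    using assms by (intro Ln_divide_of_real) auto
  moreover have "complex_of_real h powr c = exp (c * of_real (ln h))"
    using assms by (simp add: powr_def Ln_of_real)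
  moreover have "exp (c * of_real (ln h)) = exp (c * Ln x) * exp (- c * (Ln x - of_real (ln h)))"
    unfolding exp_add[symmetric] by (simp add: algebra_simps)
  ultimately show ?thesis by (simp add: h_char_def gamma_quot_def)
qed

text \<open>On K the real part of x/h is at least r/h, with r the least real part on K, so
  \<open>gamma_quot_bound\<close> is uniform in x and in c.\<close>

lemma h_char_tendsto:
  assumes K: "compact K" "\<And>x. x \<in> K \<Longrightarrow> 0 < Re x" and M: "0 \<le> M" and e: "0 < \<epsilon>"
  shows "\<forall>\<^sub>F h in at_right 0. \<forall>x\<in>K. \<forall>c. cmod c \<le> M \<longrightarrow> cmod (h_char h c x - exp (c * Ln x)) \<le> \<epsilon>"
proof (cases "K = {}")
  case False
  have "continuous_on K Ln"
    using K(2) by (intro continuous_on_Ln continuous_on_id) (auto simp: complex_nonpos_Reals_iff dest!: K(2))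
  hence "bounded (Ln ` K)" by (intro compact_imp_bounded compact_continuous_image K(1))
  then obtain L where L: "\<And>x. x \<in> K \<Longrightarrow> cmod (Ln x) \<le> L" by (auto simp: bounded_iff)
  have "continuous_on K Re" by (intro continuous_intros)
  then obtain x0 where x0: "x0 \<in> K" "\<And>x. x \<in> K \<Longrightarrow> Re x0 \<le> Re x"
    using continuous_attains_inf[OF K(1) False] by blast
  define r where "r = Re x0"
  have r: "0 < r" using K(2) x0 by (simp add: r_def)
  have "((\<lambda>h. exp (M * L) * (exp ((2 * M\<^sup>2 + 2 * M) / (r / h - 1)) - 1)) \<longlongrightarrow> 0) (at_right 0)"
    using r by real_asymp
  hence "\<forall>\<^sub>F h in at_right 0. exp (M * L) * (exp ((2 * M\<^sup>2 + 2 * M) / (r / h - 1)) - 1) < \<epsilon>"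
    using e by (rule order_tendstoD)
  moreover have "\<forall>\<^sub>F h in at_right 0. 2 * M + 2 \<le> r / h"
    using r by real_asymp
  moreover have "\<forall>\<^sub>F h in at_right 0. (0::real) < h" by (simp add: eventually_at_right_less)
  ultimately show ?thesis
  proof eventually_elim
    case (elim h)
    show ?case
    proof (intro ballI allI impI)
      fix x c assume x: "x \<in> K" and c: "cmod c \<le> M"
      have h: "0 < h" by fact
      have rx: "r / h \<le> Re (x / of_real h)"
        using x0(2)[OF x] h by (simp add: r_def divide_right_mono)
      have gb: "cmod (gamma_quot c (x / of_real h) - 1) \<le> exp ((2 * M\<^sup>2 + 2 * M) / (r / h - 1)) - 1"
      proof (rule order_trans[OF gamma_quot_bound[OF c]])
        show "2 * M + 2 \<le> Re (x / of_real h)" using elim rx by linarith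
        have "1 < r / h" using elim M by linarith
        thus "exp ((2 * M\<^sup>2 + 2 * M) / (Re (x / of_real h) - 1)) - 1 \<le> exp ((2 * M\<^sup>2 + 2 * M) / (r / h - 1)) - 1"
          using rx M by (simp add: divide_left_mono del: Re_divide_of_real)
      qed
      have "cmod (exp (c * Ln x)) \<le> exp (M * L)"
        unfolding norm_exp_eq_Re
        using order_trans[OF complex_Re_le_cmod[of "c * Ln x"]] c L[OF x] M by (simp add: norm_mult mult_mono')
      hence "cmod (exp (c * Ln x) * (gamma_quot c (x / of_real h) - 1)) \<le> exp (M * L) * (exp ((2 * M\<^sup>2 + 2 * M) / (r / h - 1)) - 1)"
        unfolding norm_mult using gb by (intro mult_mono) auto
      also have "\<dots> \<le> \<epsilon>" using elim by linarith
      finally show "cmod (h_char h c x - exp (c * Ln x)) \<le> \<epsilon>"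
        unfolding h_char_eq[OF h K(2)[OF x]] by (simp add: algebra_simps)
    qed
  qed
qed simp

section \<open>The Sylvester operators of a non-resonant matrix\<close>

lemma mm_assoc: "mm n (mm n X Y) Z = mm n X (mm n Y Z)"
  unfolding mm_def sum_distrib_left sum_distrib_right
  by (intro ext, subst sum.swap) (simp add: mult_ac)

lemma mm_lin:
  "mm n (\<lambda>i j. X i j + Y i j) Z i j = mm n X Z i j + mm n Y Z i j"
  "mm n (\<lambda>i j. X i j - Y i j) Z i j = mm n X Z i j - mm n Y Z i j"
  "mm n (\<lambda>i j. c * X i j) Z i j = c * mm n X Z i j"
  "mm n Z (\<lambda>i j. X i j + Y i j) i j = mm n Z X i j + mm n Z Y i j"
  "mm n Z (\<lambda>i j. X i j - Y i j) i j = mm n Z X i j - mm n Z Y i j"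
  "mm n Z (\<lambda>i j. c * X i j) i j = c * mm n Z X i j"
  by (simp_all add: mm_def ring_distribs sum.distrib sum_subtractf sum_distrib_left mult_ac)

lemma noneigenvalue_solve:
  assumes A: "A \<in> carrier_mat n n" and c: "\<not> eigenvalue A c"
  shows "\<exists>w. \<forall>i<n. c * w i - (\<Sum>l<n. A $$ (i, l) * w l) = (b i :: complex)"
proof -
  define M where "M = char_matrix A c"
  have M: "M \<in> carrier_mat n n" using A by (simp add: M_def)
  have d: "det M \<noteq> 0" using c eigenvalue_det[OF A, of c] by (simp add: M_def)
  define v where "v = adj_mat M *\<^sub>v (Matrix.vec n (\<lambda>i. - b i / det M))"
  have v: "v \<in> carrier_vec n" using adj_mat(1)[OF M] by (simp add: v_def)
  have "M *\<^sub>v v = (det M \<cdot>\<^sub>m 1\<^sub>m n) *\<^sub>v Matrix.vec n (\<lambda>i. - b i / det M)"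
    unfolding v_def using adj_mat(1,2)[OF M] M
    by (subst assoc_mult_mat_vec[symmetric, where n\<^sub>1 = n and n\<^sub>2 = n and n\<^sub>3 = n]) auto
  also have "\<dots> = Matrix.vec n (\<lambda>i. - b i)"
    using d by (intro eq_vecI) (auto simp: scalar_prod_def if_distrib if_distribR cong: if_cong)
  finally have Mv: "M *\<^sub>v v = Matrix.vec n (\<lambda>i. - b i)" .
  have "c * v $ i - (\<Sum>l<n. A $$ (i, l) * v $ l) = b i" if i: "i < n" for i
  proof -
    have "(M *\<^sub>v v) $ i = (\<Sum>l<n. (A $$ (i, l) - (if i = l then c else 0)) * v $ l)"
      using A M v i unfolding M_def char_matrix_def
      by (auto simp: scalar_prod_def lessThan_atLeast0 intro!: sum.cong)
    also have "\<dots> = (\<Sum>l<n. A $$ (i, l) * v $ l) - c * v $ i"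
    proof -
      have "(\<Sum>l<n. (if i = l then c else 0) * vec_index v l) = (\<Sum>l<n. if i = l then c * vec_index v l else 0)"
        by (intro sum.cong) auto
      thus ?thesis using i by (simp only: left_diff_distrib sum_subtractf) simp
    qed
    finally show ?thesis using Mv i by (simp add: algebra_simps)
  qed
  thus ?thesis by blast
qed

lemma eigenvalueI_fun:
  assumes A: "A \<in> carrier_mat n n" and w: "\<And>i. i < n \<Longrightarrow> (\<Sum>l<n. A $$ (i, l) * w l) = c * (w i :: complex)"
    and ne: "i0 < n" "w i0 \<noteq> 0"
  shows "eigenvalue A c"
proof -
  define v where "v = Matrix.vec n w"
  have "v \<noteq> 0\<^sub>v n"
  proof
    assume "v = 0\<^sub>v n"
    hence "vec_index v i0 = 0" using ne(1) by simp
    thus False using ne by (simp add: v_def)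
  qed
  moreover have "A *\<^sub>v v = c \<cdot>\<^sub>v v"
    using A w by (intro eq_vecI) (auto simp: v_def scalar_prod_def lessThan_atLeast0)
  moreover have "v \<in> carrier_vec n" by (simp add: v_def)
  ultimately show ?thesis using A unfolding eigenvalue_def eigenvector_def by auto
qed

lemma jordan_reduction_eigenvalue:
  assumes J: "jordan_reduction A Q R bs" and A: "A \<in> carrier_mat n n" and k: "k < n"
  shows "eigenvalue A (jordan_matrix bs $$ (k, k))"
proof -
  note D = jordan_reductionD[OF J A]
  have "similar_mat A (jordan_matrix bs)"
    using J by (auto simp: jordan_reduction_def similar_mat_def)
  hence cp: "char_poly A = char_poly (jordan_matrix bs)" by (rule char_poly_similar)
  have ut: "upper_triangular (jordan_matrix bs)"
    by (rule upper_triangularI) (auto intro: jordan_matrix_upper_triangular)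
  have "jordan_matrix bs $$ (k, k) \<in> set (diag_mat (jordan_matrix bs))"
    using D(7) k by (auto simp: diag_mat_def)
  hence "poly (char_poly (jordan_matrix bs)) (jordan_matrix bs $$ (k, k)) = 0"
    unfolding char_poly_upper_triangular[OF D(7) ut]
    by (auto simp: poly_prod_list prod_list_zero_iff)
  thus ?thesis using eigenvalue_root_char_poly[OF A] cp by simp
qed

lemma jordan_matrix_lower_zero:
  assumes "jordan_matrix bs \<in> carrier_mat n n" "p < n" "k < p"
  shows "jordan_matrix bs $$ (p, k) = (0 :: complex)"
  using jordan_matrix_upper_triangular[of p bs k] carrier_matD(1)[OF assms(1)] assms(2,3) by simp

context
  fixes A :: "complex mat" and n s :: nat and Q R :: "complex mat" and bs :: "(nat \<times> complex) list"
  assumes A: "A \<in> carrier_mat n n" and J: "jordan_reduction A Q R bs" and nr: "nonresonant A" and s: "1 \<le> s"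
begin

lemma shifted_not_eigenvalue: "k < n \<Longrightarrow> \<not> eigenvalue A (jordan_matrix bs $$ (k, k) - of_nat s)"
proof
  assume k: "k < n" and e: "eigenvalue A (jordan_matrix bs $$ (k, k) - of_nat s)"
  have "jordan_matrix bs $$ (k, k) - (jordan_matrix bs $$ (k, k) - of_nat s) \<in> \<int>" by simp
  hence "jordan_matrix bs $$ (k, k) = jordan_matrix bs $$ (k, k) - of_nat s"
    using nr jordan_reduction_eigenvalue[OF J A k] e unfolding nonresonant_def by blast
  thus False using s by simp
qed

lemma jordan_intertwine:
  assumes "i < n" "j < n"
  shows "mm n (fm A) (fm Q) i j = mm n (fm Q) (fm (jordan_matrix bs)) i j"
    and "mm n (fm R) (fm A) i j = mm n (fm (jordan_matrix bs)) (fm R) i j"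
    and "mm n (fm Q) (fm R) i j = (if i = j then 1 else 0)"
proof -
  note D = jordan_reductionD[OF J A]
  have "A * Q = Q * jordan_matrix bs * (R * Q)"
    unfolding D(6) using D(1,2,7) by (simp add: assoc_mult_mat[where n\<^sub>1 = n and n\<^sub>2 = n and n\<^sub>3 = n and n\<^sub>4 = n])
  also have "\<dots> = Q * jordan_matrix bs"
    unfolding D(4) by (rule right_mult_one_mat[OF mult_carrier_mat[OF D(1,7)]])
  finally have "A * Q = Q * jordan_matrix bs" .
  thus "mm n (fm A) (fm Q) i j = mm n (fm Q) (fm (jordan_matrix bs)) i j"
    using mat_mult_mm[OF A D(1) assms] mat_mult_mm[OF D(1,7) assms] by simp
  have "R * A = (R * Q) * jordan_matrix bs * R"
    unfolding D(6) using D(1,2,7) by (simp add: assoc_mult_mat[where n\<^sub>1 = n and n\<^sub>2 = n and n\<^sub>3 = n and n\<^sub>4 = n])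
  also have "\<dots> = jordan_matrix bs * R"
    unfolding D(4) left_mult_one_mat[OF D(7)] ..
  finally have "R * A = jordan_matrix bs * R" .
  thus "mm n (fm R) (fm A) i j = mm n (fm (jordan_matrix bs)) (fm R) i j"
    using mat_mult_mm[OF D(2) A assms] mat_mult_mm[OF D(7,2) assms] by simp
  show "mm n (fm Q) (fm R) i j = (if i = j then 1 else 0)"
    using mat_mult_mm[OF D(1,2) assms] D(3) assms by simp
qed

lemma mm_id_right:
  assumes "i < n" "j < n"
  shows "mm n X (mm n (fm Q) (fm R)) i j = X i j"
proof -
  have "mm n X (mm n (fm Q) (fm R)) i j = mm n X (\<lambda>i j. if i = j then 1 else 0) i j"
    by (rule mm_cong) (use assms jordan_intertwine(3) in auto)
  thus ?thesis using assms by (simp add: mm_def if_distrib cong: if_cong)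
qed

text \<open>With W = X Q the equation reads W J = (s + A) W. As J is triangular, the first nonzero
  column of W would be an eigenvector of A for an eigenvalue lowered by s, which non-resonance
  forbids.\<close>

lemma sylv_inj:
  assumes X: "\<And>i j. i < n \<Longrightarrow> j < n \<Longrightarrow> sylv n s (fm A) X i j = 0" and ij: "i < n" "j < n"
  shows "X i j = 0"
proof -
  note D = jordan_reductionD[OF J A]
  define W where "W = mm n X (fm Q)"
  have eq: "mm n W (fm (jordan_matrix bs)) i k = of_nat s * W i k + mm n (fm A) W i k" if "i < n" "k < n" for i k
  proof -
    have "mm n W (fm (jordan_matrix bs)) i k = mm n X (mm n (fm A) (fm Q)) i k"
      unfolding W_def mm_assoc by (rule mm_cong) (use that jordan_intertwine(1) in auto)
    also have "\<dots> = mm n (mm n X (fm A)) (fm Q) i k" by (simp add: mm_assoc)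
    also have "\<dots> = mm n (\<lambda>i j. of_nat s * X i j + mm n (fm A) X i j) (fm Q) i k"
      by (rule mm_cong) (use that X in \<open>auto simp: sylv_def algebra_simps\<close>)
    also have "\<dots> = of_nat s * W i k + mm n (mm n (fm A) X) (fm Q) i k"
      by (simp add: W_def mm_lin)
    finally show ?thesis by (simp add: mm_assoc W_def)
  qed
  have W0: "k < n \<Longrightarrow> \<forall>i<n. W i k = 0" for k
  proof (induction k rule: less_induct)
    case (less k)
    show ?case
    proof (rule ccontr)
      assume "\<not> (\<forall>i<n. W i k = 0)"
      then obtain i0 where i0: "i0 < n" "W i0 k \<noteq> 0" by auto
      have "(\<Sum>l<n. A $$ (i, l) * W l k) = (jordan_matrix bs $$ (k, k) - of_nat s) * W i k" if i: "i < n" for i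
      proof -
        have "mm n W (fm (jordan_matrix bs)) i k = (\<Sum>p\<in>{k}. W i p * jordan_matrix bs $$ (p, k))"
          unfolding mm_def
        proof (rule sum.mono_neutral_right)
          show "\<forall>p\<in>{..<n} - {k}. W i p * jordan_matrix bs $$ (p, k) = 0"
          proof
            fix p assume "p \<in> {..<n} - {k}"
            thus "W i p * jordan_matrix bs $$ (p, k) = 0"
              using less.IH[of p] jordan_matrix_lower_zero[OF D(7), of p k] i by (cases "p < k") auto
          qed
        qed (use less.prems in auto)
        thus ?thesis using eq[OF i less.prems] by (simp add: mm_def algebra_simps)
      qed
      hence "eigenvalue A (jordan_matrix bs $$ (k, k) - of_nat s)"
        by (rule eigenvalueI_fun[OF A, where w = "\<lambda>l. W l k" and ?i0.0 = i0]) (use i0 in auto)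
      thus False using shifted_not_eigenvalue[OF less.prems] by simp
    qed
  qed
  have "X i j = mm n W (fm R) i j" using mm_id_right[OF ij, of X] by (simp add: W_def mm_assoc)
  also have "\<dots> = 0" using W0 ij by (simp add: mm_def)
  finally show ?thesis .
qed

text \<open>Same triangular structure as in \<open>sylv_inj\<close>: the columns of W are found one
  after the other, each from a linear system whose matrix is a non-eigenvalue minus A.\<close>

lemma sylv_surj: "\<exists>X. \<forall>i<n. \<forall>j<n. sylv n s (fm A) X i j = C i j"
proof -
  note D = jordan_reductionD[OF J A]
  define C' where "C' = mm n C (fm Q)"
  define P where "P f k w \<longleftrightarrow> (k < n \<longrightarrow> (\<forall>i<n. (jordan_matrix bs $$ (k, k) - of_nat s) * w i - (\<Sum>l<n. A $$ (i, l) * w l)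
      = C' i k - (\<Sum>p<k. f p i * jordan_matrix bs $$ (p, k))))" for f :: "nat \<Rightarrow> nat \<Rightarrow> complex" and k :: nat and w :: "nat \<Rightarrow> complex"
  have "\<exists>f. \<forall>k. P f k (f k)"
  proof (rule dependent_wellorder_choice)
    fix w f g and k :: nat assume "\<And>t. t < k \<Longrightarrow> f t = (g t :: nat \<Rightarrow> complex)"
    thus "P f k w = P g k w" by (simp add: P_def)
  next
    fix k f show "\<exists>w. P f k w"
      using noneigenvalue_solve[OF A shifted_not_eigenvalue, of k "\<lambda>i. C' i k - (\<Sum>p<k. f p i * jordan_matrix bs $$ (p, k))"]
      by (cases "k < n") (auto simp: P_def)
  qed
  then obtain f where f: "\<And>k. P f k (f k)" by blast
  define W where "W i k = f k i" for i k
  have eq: "mm n W (fm (jordan_matrix bs)) i k - of_nat s * W i k - mm n (fm A) W i k = C' i k" if ik: "i < n" "k < n" for i k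
  proof -
    have "mm n W (fm (jordan_matrix bs)) i k = (\<Sum>p\<in>insert k {..<k}. W i p * jordan_matrix bs $$ (p, k))"
      unfolding mm_def
    proof (rule sum.mono_neutral_right)
      show "\<forall>p\<in>{..<n} - insert k {..<k}. W i p * jordan_matrix bs $$ (p, k) = 0"
        using jordan_matrix_lower_zero[OF D(7)] by auto
    qed (use ik in auto)
    also have "\<dots> = W i k * jordan_matrix bs $$ (k, k) + (\<Sum>p<k. W i p * jordan_matrix bs $$ (p, k))" by simp
    finally have e: "mm n W (fm (jordan_matrix bs)) i k = W i k * jordan_matrix bs $$ (k, k) + (\<Sum>p<k. W i p * jordan_matrix bs $$ (p, k))" .
    have "(jordan_matrix bs $$ (k, k) - of_nat s) * W i k - (\<Sum>l<n. A $$ (i, l) * W l k) = C' i k - (\<Sum>p<k. W i p * jordan_matrix bs $$ (p, k))"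
      using f[of k] ik unfolding P_def W_def by blast
    thus ?thesis unfolding e by (simp add: mm_def algebra_simps)
  qed
  define X where "X = mm n W (fm R)"
  have "sylv n s (fm A) X i j = C i j" if ij: "i < n" "j < n" for i j
  proof -
    have "mm n X (fm A) i j = mm n W (mm n (fm (jordan_matrix bs)) (fm R)) i j"
      unfolding X_def mm_assoc by (rule mm_cong) (use ij jordan_intertwine(2) in auto)
    hence XA: "mm n X (fm A) i j = mm n (mm n W (fm (jordan_matrix bs))) (fm R) i j" by (simp only: mm_assoc)
    have AX: "mm n (fm A) X i j = mm n (mm n (fm A) W) (fm R) i j" by (simp only: X_def mm_assoc)
    have "sylv n s (fm A) X i j = mm n (\<lambda>i k. mm n W (fm (jordan_matrix bs)) i k - of_nat s * W i k - mm n (fm A) W i k) (fm R) i j"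
      unfolding sylv_def XA AX mm_lin by (simp add: X_def)
    also have "\<dots> = mm n C' (fm R) i j"
      by (rule mm_cong) (use ij eq in auto)
    also have "\<dots> = C i j" unfolding C'_def mm_assoc by (rule mm_id_right[OF ij])
    finally show ?thesis .
  qed
  thus ?thesis by blast
qed

text \<open>Solving for the matrix units gives a right inverse. By linearity and
  \<open>sylv_inj\<close> every X is the corresponding combination of these solutions, and the sum
  of their norms bounds the inverse.\<close>

lemma sylv_bound: "\<exists>\<kappa>\<ge>0. \<forall>X. mn n X \<le> \<kappa> * mn n (sylv n s (fm A) X)"
proof -
  have "\<forall>p. \<exists>X. \<forall>i<n. \<forall>j<n. sylv n s (fm A) X i j = (if (i, j) = p then 1 else 0)"
    by (intro allI sylv_surj)
  from choice[OF this] obtain Z where "\<forall>p. \<forall>i<n. \<forall>j<n. sylv n s (fm A) (Z p) i j = (if (i, j) = p then 1 else 0)" ..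
  hence Z: "\<And>p i j. i < n \<Longrightarrow> j < n \<Longrightarrow> sylv n s (fm A) (Z p) i j = (if (i, j) = p then 1 else 0)"
    by blast
  define T where "T = {..<n} \<times> {..<n}"
  have T: "finite T" by (simp add: T_def)
  define \<kappa> where "\<kappa> = (\<Sum>p\<in>T. mn n (Z p))"
  have "mn n X \<le> \<kappa> * mn n (sylv n s (fm A) X)" for X
  proof -
    define C where "C p = sylv n s (fm A) X (fst p) (snd p)" for p
    define Y where "Y i j = (\<Sum>p\<in>T. C p * Z p i j)" for i j
    have lin: "sylv n s (fm A) (\<lambda>i j. X i j - Y i j) i j = sylv n s (fm A) X i j - (\<Sum>p\<in>T. C p * sylv n s (fm A) (Z p) i j)" for i j
    proof -
      have 1: "mm n (fm A) Y i j = (\<Sum>p\<in>T. C p * mm n (fm A) (Z p) i j)"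
        unfolding mm_def Y_def sum_distrib_left by (subst sum.swap) (simp add: mult_ac)
      have 2: "mm n Y (fm A) i j = (\<Sum>p\<in>T. C p * mm n (Z p) (fm A) i j)"
        unfolding mm_def Y_def sum_distrib_left sum_distrib_right by (subst sum.swap) (simp add: mult_ac)
      have 3: "mm n (fm A) (\<lambda>i j. X i j - Y i j) i j = mm n (fm A) X i j - mm n (fm A) Y i j"
        "mm n (\<lambda>i j. X i j - Y i j) (fm A) i j = mm n X (fm A) i j - mm n Y (fm A) i j"
        by (simp_all add: mm_def right_diff_distrib left_diff_distrib sum_subtractf)
      have 4: "(\<Sum>p\<in>T. C p * sylv n s (fm A) (Z p) i j) = - of_nat s * Y i j - mm n (fm A) Y i j + mm n Y (fm A) i j"
      proof -
        have 0: "- of_nat s * Y i j = (\<Sum>p\<in>T. C p * (- of_nat s * Z p i j))"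
          by (simp add: Y_def sum_distrib_left sum_negf mult_ac)
        show ?thesis
          unfolding 0 1 2 sylv_def by (simp only: sum_subtractf sum.distrib distrib_left right_diff_distrib)
      qed
      show ?thesis by (simp only: 4) (simp add: sylv_def 3 algebra_simps)
    qed
    have "sylv n s (fm A) (\<lambda>i j. X i j - Y i j) i j = 0" if ij: "i < n" "j < n" for i j
    proof -
      have "(\<Sum>p\<in>T. C p * sylv n s (fm A) (Z p) i j) = (\<Sum>p\<in>T. if (i, j) = p then C p else 0)"
        using Z[OF ij] by (intro sum.cong) auto
      also have "\<dots> = sylv n s (fm A) X i j" using ij by (simp add: T_def C_def)
      finally show ?thesis unfolding lin by simp
    qed
    hence XY: "X i j = Y i j" if "i < n" "j < n" for i j
      using sylv_inj[of "\<lambda>i j. X i j - Y i j"] that by simp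
    have "mn n X = mn n Y" by (intro mn_cong XY)
    also have "\<dots> \<le> (\<Sum>p\<in>T. mn n (\<lambda>i j. C p * Z p i j))"
      unfolding Y_def by (rule mn_sum_le)
    also have "\<dots> \<le> (\<Sum>p\<in>T. mn n (sylv n s (fm A) X) * mn n (Z p))"
      unfolding mn_scale C_def by (intro sum_mono mult_right_mono entry_le_mn) (auto simp: T_def)
    also have "\<dots> = \<kappa> * mn n (sylv n s (fm A) X)" by (simp add: \<kappa>_def sum_distrib_right mult.commute)
    finally show ?thesis .
  qed
  moreover have "0 \<le> \<kappa>" by (simp add: \<kappa>_def sum_nonneg)
  ultimately show ?thesis by blast
qed

end

text \<open>For s above 4 a the term - s X dominates the commutator with A'. The finitely many
  remaining s are handled by perturbing the bounds for A itself. The resulting \<kappa> is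
  independent of s and serves a whole neighbourhood of A.\<close>

lemma sylv_uniform_bound:
  assumes A: "A \<in> carrier_mat n n" and J: "jordan_reduction A Q R bs" and nr: "nonresonant A"
  obtains \<kappa> \<delta> where "0 < \<kappa>" "0 < \<delta>"
    "\<And>A' s X. mn n (\<lambda>i j. A' i j - A $$ (i, j)) \<le> \<delta> \<Longrightarrow> 1 \<le> s \<Longrightarrow> real s * mn n X \<le> \<kappa> * mn n (sylv n s A' X)"
proof -
  define a where "a = mn n (fm A) + 1"
  define N where "N = nat \<lceil>4 * a\<rceil>"
  have "\<forall>s. \<exists>\<kappa>. 0 \<le> \<kappa> \<and> (1 \<le> s \<longrightarrow> (\<forall>X. mn n X \<le> \<kappa> * mn n (sylv n s (fm A) X)))"
  proof
    fix s show "\<exists>\<kappa>. 0 \<le> \<kappa> \<and> (1 \<le> s \<longrightarrow> (\<forall>X. mn n X \<le> \<kappa> * mn n (sylv n s (fm A) X)))"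
      using sylv_bound[OF A J nr, of s] by (cases "1 \<le> s") auto
  qed
  then obtain k where k: "\<And>s. 0 \<le> k s" "\<And>s X. 1 \<le> s \<Longrightarrow> mn n X \<le> k s * mn n (sylv n s (fm A) X)" by metis
  define K where "K = (\<Sum>s\<le>N. k s)"
  have K: "0 \<le> K" unfolding K_def by (intro sum_nonneg k)
  have kK: "k s \<le> K" if "s \<le> N" for s unfolding K_def using that k(1) by (intro member_le_sum) auto
  \<comment> \<open>The bound 1 keeps |A'| \<le> a; the other one makes 2 K \<delta> \<le> 1/2, so
    that the perturbation is absorbed.\<close>
  define \<delta> where "\<delta> = min 1 (1 / (4 * (K + 1)))"
  \<comment> \<open>The summand 2 comes from s > N, where half of s |X| is absorbed, and 2 N K from
    s \<le> N.\<close>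
  define \<kappa> where "\<kappa> = 2 + 2 * real N * K"
  show ?thesis
  proof (rule that[of \<kappa> \<delta>])
    show "0 < \<kappa>" using K by (simp add: \<kappa>_def add_pos_nonneg)
    show d0: "0 < \<delta>" using K by (simp add: \<delta>_def)
    fix A' X and s :: nat assume d: "mn n (\<lambda>i j. A' i j - A $$ (i, j)) \<le> \<delta>" and s: "1 \<le> s"
    define S where "S = mn n (sylv n s A' X)"
    have S0: "0 \<le> S" by (simp add: S_def)
    have X0: "0 \<le> mn n X" by simp
    show "real s * mn n X \<le> \<kappa> * mn n (sylv n s A' X)"
    proof (cases "s \<le> N")
      case True
      have "mn n (sylv n s (fm A) X) = mn n (\<lambda>i j. sylv n s A' X i j
          + (mm n (\<lambda>i j. A' i j - A $$ (i, j)) X i j - mm n X (\<lambda>i j. A' i j - A $$ (i, j)) i j))"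
        by (intro mn_cong) (simp add: sylv_def mm_def left_diff_distrib right_diff_distrib sum_subtractf)
      also have "\<dots> \<le> S + (mn n (\<lambda>i j. A' i j - A $$ (i, j)) * mn n X + mn n X * mn n (\<lambda>i j. A' i j - A $$ (i, j)))"
        unfolding S_def by (intro order_trans[OF mn_add_le] add_mono order_refl order_trans[OF mn_diff_le] mn_mm_le)
      also have "\<dots> \<le> S + (\<delta> * mn n X + mn n X * \<delta>)"
        using d X0 d0 by (intro add_mono mult_mono) auto
      finally have 1: "mn n (sylv n s (fm A) X) \<le> S + 2 * \<delta> * mn n X" by simp
      have "mn n X \<le> k s * mn n (sylv n s (fm A) X)" by (rule k(2)[OF s])
      also have "\<dots> \<le> K * (S + 2 * \<delta> * mn n X)"
        using 1 kK[OF True] K by (intro mult_mono) auto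
      also have "\<dots> = K * S + 2 * (K * \<delta>) * mn n X" by (simp add: algebra_simps)
      also have "2 * (K * \<delta>) * mn n X \<le> 1 / 2 * mn n X"
      proof (intro mult_right_mono X0)
        have "K * \<delta> \<le> K * (1 / (4 * (K + 1)))" using K by (intro mult_left_mono) (auto simp: \<delta>_def)
        also have "\<dots> \<le> 1 / 4" using K by (simp add: field_simps)
        finally show "2 * (K * \<delta>) \<le> 1 / 2" by simp
      qed
      finally have "mn n X \<le> 2 * K * S" by simp
      hence "real s * mn n X \<le> real N * (2 * K * S)" using True X0 by (intro mult_mono) auto
      also have "\<dots> \<le> \<kappa> * S" using S0 by (simp add: \<kappa>_def algebra_simps)
      finally show ?thesis by (simp add: S_def)
    next
      case False
      have sa: "4 * a \<le> real s" using False by (simp add: N_def) linarith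
      have A'a: "mn n A' \<le> a"
      proof -
        have "mn n A' = mn n (\<lambda>i j. A $$ (i, j) + (A' i j - A $$ (i, j)))" by simp
        also have "\<dots> \<le> mn n (fm A) + mn n (\<lambda>i j. A' i j - A $$ (i, j))" by (rule mn_add_le)
        also have "\<dots> \<le> a" using d by (simp add: a_def \<delta>_def)
        finally show ?thesis .
      qed
      have "real s * mn n X = mn n (\<lambda>i j. of_nat s * X i j)" by (simp add: mn_scale)
      also have "\<dots> = mn n (\<lambda>i j. (mm n X A' i j - mm n A' X i j) - sylv n s A' X i j)"
        by (intro mn_cong) (simp add: sylv_def)
      also have "\<dots> \<le> (mn n X * mn n A' + mn n A' * mn n X) + S"
        unfolding S_def by (intro order_trans[OF mn_diff_le] add_mono order_refl mn_mm_le)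
      also have "\<dots> \<le> (mn n X * a + a * mn n X) + S"
        using A'a X0 by (intro add_mono mult_mono order_refl) (auto simp: a_def)
      also have "\<dots> = (2 * a) * mn n X + S" by simp
      also have "(2 * a) * mn n X \<le> (real s / 2) * mn n X" using sa X0 by (intro mult_right_mono) auto
      finally have "real s * mn n X \<le> 2 * S" by simp
      also have "\<dots> \<le> \<kappa> * S" using S0 K by (intro mult_right_mono) (auto simp: \<kappa>_def)
      finally show ?thesis by (simp add: S_def)
    qed
  qed
qed

section \<open>Rational functions on the sphere\<close>

abbreviation rnum :: "complex poly fract \<Rightarrow> complex poly" where "rnum r \<equiv> fst (quot_of_fract r)"
abbreviation rden :: "complex poly fract \<Rightarrow> complex poly" where "rden r \<equiv> snd (quot_of_fract r)"

lemma rf_pole_Some: "rf_pole r (Some x) \<longleftrightarrow> poly (rden r) x = 0"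
  by (simp add: rf_pole_def case_prod_unfold)

lemma rf_pole_None: "rf_pole r None \<longleftrightarrow> degree (rden r) < degree (rnum r)"
  by (simp add: rf_pole_def case_prod_unfold)

lemma rf_eval_Some: "rf_eval r (Some x) = poly (rnum r) x / poly (rden r) x"
  by (simp add: rf_eval_def case_prod_unfold)

lemma rf_eval_None: "rf_eval r None = coeff (rnum r) (degree (rden r)) / lead_coeff (rden r)"
  by (simp add: rf_eval_def case_prod_unfold)

lemma finite_rf_poles: "finite {x. rf_pole r (Some x)}"
  unfolding rf_pole_Some by (intro poly_roots_finite) simp

lemma poly_analytic_on: "poly p analytic_on (S :: complex set)"
proof -
  have "poly p holomorphic_on UNIV"
    by (rule holomorphic_onI) (meson field_differentiable_at_within field_differentiable_def poly_DERIV)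
  thus ?thesis using analytic_on_open analytic_on_subset open_UNIV by blast
qed

lemma rf_eval_analytic_at: "\<not> rf_pole r (Some x) \<Longrightarrow> (\<lambda>x. rf_eval r (Some x)) analytic_on {x}"
  unfolding rf_eval_Some rf_pole_Some by (intro analytic_on_divide poly_analytic_on) auto

lemma rf_eval_meromorphic: "(\<lambda>x. rf_eval r (Some x)) meromorphic_on UNIV"
  unfolding rf_eval_Some by (intro meromorphic_on_divide analytic_on_imp_meromorphic_on poly_analytic_on)

lemma rf_eval_tendsto_None:
  assumes "\<not> rf_pole r None"
  shows "((\<lambda>x. rf_eval r (Some x)) \<longlongrightarrow> rf_eval r None) at_infinity"
proof -
  define a b where "a = rnum r" and "b = rden r"
  define d where "d = degree b"
  have b0: "b \<noteq> 0" by (simp add: b_def)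
  have da: "degree a \<le> d" using assms by (simp add: rf_pole_None a_def b_def d_def)
  have Lb: "((\<lambda>x. poly b x / x ^ d) \<longlongrightarrow> lead_coeff b) at_infinity"
    unfolding d_def by (rule poly_divide_tendsto_aux)
  have La: "((\<lambda>x. poly a x / x ^ d) \<longlongrightarrow> coeff a d) at_infinity"
  proof -
    have inv: "((\<lambda>x::complex. inverse x ^ k) \<longlongrightarrow> (if k = 0 then 1 else 0)) at_infinity" for k
    proof (cases "k = 0")
      case False
      have "((\<lambda>x::complex. inverse x ^ k) \<longlongrightarrow> 0 ^ k) at_infinity"
        by (intro tendsto_power tendsto_inverse_0)
      thus ?thesis using False by (simp add: power_0_left)
    qed simp
    have 1: "((\<lambda>x. \<Sum>k\<le>d. coeff a k * inverse x ^ (d - k)) \<longlongrightarrow> (\<Sum>k\<le>d. coeff a k * (if d - k = 0 then 1 else 0))) at_infinity"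
      by (intro tendsto_sum tendsto_mult tendsto_const inv)
    have 2: "(\<Sum>k\<le>d. coeff a k * (if d - k = 0 then 1 else 0)) = coeff a d"
    proof -
      have "(\<Sum>k\<le>d. coeff a k * (if d - k = 0 then 1 else 0)) = (\<Sum>k\<in>{d}. coeff a k)"
        by (rule sum.mono_neutral_cong_right) auto
      thus ?thesis by simp
    qed
    have 3: "\<forall>\<^sub>F x in at_infinity. (\<Sum>k\<le>d. coeff a k * inverse x ^ (d - k)) = poly a x / x ^ d"
      using eventually_not_equal_at_infinity[of 0]
    proof eventually_elim
      case (elim x)
      have "poly a x = (\<Sum>k\<le>d. coeff a k * x ^ k)"
        unfolding poly_altdef using da by (intro sum.mono_neutral_left) (auto simp: coeff_eq_0)
      moreover have "coeff a k * x ^ k / x ^ d = coeff a k * inverse x ^ (d - k)" if "k \<le> d" for k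
        using elim that by (simp add: power_diff field_simps)
      ultimately show ?case by (simp add: sum_divide_distrib)
    qed
    show ?thesis using Lim_transform_eventually[OF 1 3] unfolding 2 .
  qed
  have "((\<lambda>x. (poly a x / x ^ d) / (poly b x / x ^ d)) \<longlongrightarrow> coeff a d / lead_coeff b) at_infinity"
    by (intro tendsto_divide La Lb) (use b0 in simp)
  moreover have "\<forall>\<^sub>F x in at_infinity. (poly a x / x ^ d) / (poly b x / x ^ d) = rf_eval r (Some x)"
    using eventually_not_equal_at_infinity[of 0]
    by eventually_elim (simp add: rf_eval_Some a_def b_def)
  ultimately have "((\<lambda>x. rf_eval r (Some x)) \<longlongrightarrow> coeff a d / lead_coeff b) at_infinity"
    by (rule Lim_transform_eventually)
  thus ?thesis by (simp add: rf_eval_None a_def b_def d_def)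
qed

definition sph_inv :: "complex \<Rightarrow> complex option" where
  "sph_inv w = (if w = 0 then None else Some (1 / w))"

text \<open>In the coordinate w = 1/x the point 0 is a removable singularity, because the value at
  infinity is the limit there; the other points of the disc correspond to x of modulus at least
  R.\<close>

lemma rf_eval_sph_inv_holomorphic:
  assumes "\<not> rf_pole r None" "\<And>x. R \<le> cmod x \<Longrightarrow> \<not> rf_pole r (Some x)" "0 < R"
  shows "(\<lambda>w. rf_eval r (sph_inv w)) holomorphic_on cball 0 (1 / R)"
proof -
  define P where "P = {x. rf_pole r (Some x)} - {0}"
  define S where "S = - ((\<lambda>z. 1 / z) ` P)"
  have "finite P" using finite_rf_poles by (simp add: P_def)
  hence S: "open S" unfolding S_def by (intro open_Compl finite_imp_closed finite_imageI)
  have np: "\<not> rf_pole r (Some (1 / w))" if "w \<in> S" "w \<noteq> 0" for w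
  proof
    assume "rf_pole r (Some (1 / w))"
    hence "1 / w \<in> P" using that by (simp add: P_def)
    hence "1 / (1 / w) \<in> (\<lambda>z. 1 / z) ` P" by (rule imageI)
    thus False using that by (simp add: S_def)
  qed
  have "(\<lambda>w. rf_eval r (sph_inv w)) holomorphic_on S"
  proof (rule no_isolated_singularity'[OF _ _ S, where K = "{0}"])
    have "(\<lambda>w. rf_eval r (Some (1 / w))) holomorphic_on S - {0}"
      using np unfolding rf_eval_Some rf_pole_Some by (intro holomorphic_intros) auto
    thus "(\<lambda>w. rf_eval r (sph_inv w)) holomorphic_on S - {0}"
      by (rule holomorphic_transform) (auto simp: sph_inv_def)
    fix z :: complex assume "z \<in> {0}"
    have "((\<lambda>w. rf_eval r (Some (inverse w))) \<longlongrightarrow> rf_eval r None) (at 0)"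
      by (rule filterlim_compose[OF rf_eval_tendsto_None[OF assms(1)] filterlim_inverse_at_infinity])
    hence "((\<lambda>w. rf_eval r (sph_inv w)) \<longlongrightarrow> rf_eval r None) (at 0)"
      by (rule Lim_transform_eventually)
         (auto simp: sph_inv_def eventually_at_filter divide_inverse)
    thus "((\<lambda>w. rf_eval r (sph_inv w)) \<longlongrightarrow> rf_eval r (sph_inv z)) (at z within S)"
      using \<open>z \<in> {0}\<close> by (auto simp: sph_inv_def intro: tendsto_within_subset)
  qed simp
  moreover have "cball 0 (1 / R) \<subseteq> S"
  proof
    fix w :: complex assume w: "w \<in> cball 0 (1 / R)"
    show "w \<in> S"
    proof (rule ccontr)
      assume "w \<notin> S"
      then obtain z where z: "z \<in> P" "w = 1 / z" by (auto simp: S_def)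
      have "R \<le> cmod z" using w z assms(3) by (auto simp: P_def norm_divide divide_simps split: if_splits)
      thus False using assms(2) z by (auto simp: P_def)
    qed
  qed
  ultimately show ?thesis by (rule holomorphic_on_subset)
qed

definition sph_ext :: "real \<Rightarrow> complex option set" where
  "sph_ext R = insert None (Some ` {x. R \<le> cmod x})"

lemma compactin_sph_Some: "compact K \<Longrightarrow> compactin riemann_sphere (Some ` K)"
  by (rule image_compactin[OF _ continuous_map_Some]) simp

lemma compactin_sph_ext: "compactin riemann_sphere (sph_ext R)"
proof (rule closedin_compact_space)
  have "openin riemann_sphere (Some ` ball 0 R)"
    by (simp add: openin_Alexandroff_compactification_image_Some)
  moreover have "topspace riemann_sphere - Some ` ball 0 R = sph_ext R"
    by (auto simp: sph_ext_def not_less image_iff notin_range_Some)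
  ultimately show "closedin riemann_sphere (sph_ext R)"
    by (metis closedin_diff closedin_topspace)
qed simp

lemma elements_matI2: "A \<in> carrier_mat n n \<Longrightarrow> i < n \<Longrightarrow> j < n \<Longrightarrow> A $$ (i, j) \<in> elements_mat A"
  by (rule elements_matI) auto

lemma rm_eval_carrier [simp]: "A \<in> carrier_mat n n \<Longrightarrow> rm_eval A p \<in> carrier_mat n n"
  by (simp add: rm_eval_def)

lemma rm_eval_index: "A \<in> carrier_mat n n \<Longrightarrow> i < n \<Longrightarrow> j < n \<Longrightarrow> rm_eval A p $$ (i, j) = rf_eval (A $$ (i, j)) p"
  by (simp add: rm_eval_def)

lemma not_rm_poleD: "A \<in> carrier_mat n n \<Longrightarrow> i < n \<Longrightarrow> j < n \<Longrightarrow> p \<notin> rm_poles A \<Longrightarrow> \<not> rf_pole (A $$ (i, j)) p"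
  using elements_matI2 by (auto simp: rm_poles_def)

lemma finite_rm_poles: "finite {a. Some a \<in> rm_poles A}"
proof -
  have "{a. Some a \<in> rm_poles A} = (\<Union>r\<in>elements_mat A. {a. rf_pole r (Some a)})"
    by (auto simp: rm_poles_def)
  moreover have "finite (elements_mat A)" unfolding elements_mat_def by (auto intro!: finite_image_set2)
  ultimately show ?thesis using finite_rf_poles by simp
qed

section \<open>The cut plane\<close>

lemma left_ray_closed: "closed (left_ray a)"
proof -
  have "left_ray a = {z. Im z = Im a} \<inter> {z. Re z \<le> Re a}" by (auto simp: left_ray_def)
  thus ?thesis
    by (auto intro!: closed_Int closed_Collect_eq closed_Collect_le continuous_intros)
qed

lemma left_ray_trans: "b \<in> left_ray a \<Longrightarrow> left_ray b \<subseteq> left_ray a"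
  by (auto simp: left_ray_def)

lemma open_Omega_plus: "open (Omega_plus A)"
  unfolding Omega_plus_def by (intro open_Compl closed_UN) (auto intro: finite_rm_poles left_ray_closed)

lemma Omega_plus_right: "x \<in> Omega_plus A \<Longrightarrow> 0 \<le> t \<Longrightarrow> x + of_real t \<in> Omega_plus A"
  unfolding Omega_plus_def left_ray_def by fastforce

lemma Omega_plus_nonpole: "x \<in> Omega_plus A \<Longrightarrow> x \<noteq> 0 \<and> Some x \<notin> rm_poles A"
  by (auto simp: Omega_plus_def left_ray_def)

lemma Omega_plus_half_plane:
  assumes "\<And>a. Some a \<in> rm_poles A \<Longrightarrow> cmod a \<le> R" "0 \<le> R"
  shows "{x. R < Re x} \<subseteq> Omega_plus A"
proof -
  have "Re a \<le> R" if "Some a \<in> rm_poles A" for a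
    using assms(1)[OF that] complex_Re_le_cmod order_trans by blast
  thus ?thesis using assms(2) by (fastforce simp: Omega_plus_def left_ray_def)
qed

lemma rm_poles_bound:
  obtains R where "0 < R" "\<And>a. Some a \<in> rm_poles A \<Longrightarrow> cmod a < R"
proof -
  have "bounded {a. Some a \<in> rm_poles A}" by (intro finite_imp_bounded finite_rm_poles)
  then obtain B where B: "\<And>a. Some a \<in> rm_poles A \<Longrightarrow> cmod a \<le> B" by (auto simp: bounded_iff)
  show ?thesis by (rule that[of "max 0 B + 1"]) (use B in fastforce)+
qed

text \<open>The region is mapped into itself by translations to the right, so a horizontal segment
  joins every point to one common half-plane.\<close>

lemma connected_Omega_plus: "connected (Omega_plus A)"
proof -
  obtain R where R: "0 < R" "\<And>a. Some a \<in> rm_poles A \<Longrightarrow> cmod a < R" by (rule rm_poles_bound[of A]) blast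
  define H where "H = {x. R < Re x}"
  have H: "H \<subseteq> Omega_plus A" unfolding H_def
    using R by (intro Omega_plus_half_plane) (auto intro: less_imp_le)
  define S where "S x = closed_segment x (x + of_real (R + 1 + \<bar>Re x\<bar>)) \<union> H" for x
  have seg: "closed_segment x (x + of_real T) \<subseteq> Omega_plus A" if "x \<in> Omega_plus A" "0 \<le> T" for x T
  proof
    fix y assume "y \<in> closed_segment x (x + of_real T)"
    then obtain u where u: "0 \<le> u" "u \<le> 1" "y = (1 - u) *\<^sub>R x + u *\<^sub>R (x + of_real T)" by (auto simp: closed_segment_def)
    hence "y = x + of_real (u * T)" by (simp add: scaleR_conv_of_real algebra_simps)
    thus "y \<in> Omega_plus A" using Omega_plus_right[OF that(1), of "u * T"] u that(2) by simp
  qed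
  have "Omega_plus A = (\<Union>x\<in>Omega_plus A. S x)"
  proof
    show "Omega_plus A \<subseteq> (\<Union>x\<in>Omega_plus A. S x)" by (auto simp: S_def)
    show "(\<Union>x\<in>Omega_plus A. S x) \<subseteq> Omega_plus A" proof (rule UN_least)
      fix x assume x: "x \<in> Omega_plus A"
      have "0 \<le> R + 1 + \<bar>Re x\<bar>" using R(1) by linarith
      thus "S x \<subseteq> Omega_plus A" unfolding S_def using seg[OF x] H by blast
    qed
  qed
  moreover have "connected (\<Union>x\<in>Omega_plus A. S x)"
  proof (rule connected_Union)
    fix s assume "s \<in> S ` Omega_plus A"
    then obtain x where s: "s = S x" by blast
    have "x + of_real (R + 1 + \<bar>Re x\<bar>) \<in> H" by (simp add: H_def)
    hence "closed_segment x (x + of_real (R + 1 + \<bar>Re x\<bar>)) \<inter> H \<noteq> {}" by auto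
    moreover have "connected H" unfolding H_def by (intro convex_connected convex_halfspace_Re_gt)
    ultimately show "connected s" unfolding s S_def by (intro connected_Un) auto
  next
    have "of_real (R + 1) \<in> \<Inter> (S ` Omega_plus A)" by (auto simp: S_def H_def)
    thus "\<Inter> (S ` Omega_plus A) \<noteq> {}" by blast
  qed
  ultimately show ?thesis by simp
qed

text \<open>With each point the complement contains the ray to its left, so each component of the
  complement is unbounded.\<close>

lemma simply_connected_Omega_plus: "simply_connected (Omega_plus A)"
proof -
  have "\<not> bounded C" if C: "C \<in> components (- Omega_plus A)" for C
  proof
    assume b: "bounded C"
    obtain x where x: "x \<in> C" using in_components_nonempty[OF C] by blast
    have "x \<in> - Omega_plus A" using C x in_components_subset by blast
    then obtain a where a: "a \<in> insert 0 {a. Some a \<in> rm_poles A}" "x \<in> left_ray a" by (auto simp: Omega_plus_def)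
    have sub: "left_ray x \<subseteq> - Omega_plus A" using left_ray_trans[OF a(2)] a(1) by (auto simp: Omega_plus_def)
    have "convex (left_ray x)"
    proof -
      have "left_ray x = {z. Im z = Im x} \<inter> {z. Re z \<le> Re x}" by (auto simp: left_ray_def)
      thus ?thesis
        using convex_hyperplane[of \<i> "Im x"] convex_halfspace_Re_le[of "Re x"] by (auto simp: inner_complex_def intro!: convex_Int)
    qed
    hence "left_ray x \<subseteq> C"
      using components_maximal[OF C convex_connected sub] x by (auto simp: left_ray_def)
    hence "bounded (left_ray x)" using b bounded_subset by blast
    then obtain B where B: "\<And>z. z \<in> left_ray x \<Longrightarrow> cmod z \<le> B" by (auto simp: bounded_iff)
    have "Complex (Re x - \<bar>B\<bar> - \<bar>Re x\<bar> - 1) (Im x) \<in> left_ray x" by (simp add: left_ray_def)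
    from B[OF this] have "\<bar>Re x - \<bar>B\<bar> - \<bar>Re x\<bar> - 1\<bar> \<le> B"
      using abs_Re_le_cmod order_trans by (metis complex.sel(1))
    thus False by linarith
  qed
  thus ?thesis
    using simply_connected_eq_unbounded_complement_components[OF open_Omega_plus[of A]] connected_Omega_plus by blast
qed

lemma Omega_plus_primitive:
  assumes "f holomorphic_on Omega_plus A"
  obtains g where "\<And>z. z \<in> Omega_plus A \<Longrightarrow> (g has_field_derivative f z) (at z)"
  using simply_connected_Omega_plus[of A] assms
  unfolding simply_connected_eq_global_primitive[OF open_Omega_plus] by blast

section \<open>Identity theorem for nicely meromorphic functions\<close>

text \<open>A meromorphic difference either vanishes or is nonzero outside a discrete set, and the
  half-plane excludes the latter. The normalised values at poles and removable singularities turn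
  this into equality everywhere.\<close>

lemma nicely_meromorphic_eqI:
  assumes f: "f nicely_meromorphic_on UNIV" and g: "g nicely_meromorphic_on UNIV"
    and eq: "\<And>x. c < Re x \<Longrightarrow> f x = g x"
  shows "f = g"
proof
  fix z
  have m: "(\<lambda>x. f x - g x) meromorphic_on UNIV"
    using f g by (intro meromorphic_intros) (auto simp: nicely_meromorphic_on_def)
  have "eventually (\<lambda>x. f x - g x = 0) (cosparse UNIV)"
  proof -
    consider "eventually (\<lambda>x. f x - g x = 0) (cosparse UNIV)" | "eventually (\<lambda>x. f x - g x \<noteq> 0) (cosparse UNIV)"
      using meromorphic_imp_constant_or_avoid[OF m, of 0] by auto
    thus ?thesis
    proof cases
      case 2
      define p where "p = complex_of_real (c + 1)"
      have "eventually (\<lambda>x. f x - g x \<noteq> 0) (at p)"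
        using 2 by (rule eventually_cosparse_imp_eventually_at) simp
      moreover have "eventually (\<lambda>x. x \<in> {x. c < Re x}) (at p)"
        by (intro eventually_at_in_open' open_halfspace_Re_gt) (simp add: p_def)
      ultimately have "eventually (\<lambda>x. False) (at p)"
        by eventually_elim (use eq in auto)
      thus ?thesis by simp
    qed
  qed
  hence ev: "eventually (\<lambda>x. f x = g x) (at z)"
    using eventually_cosparse_imp_eventually_at[of _ UNIV z] by fastforce
  have pole: "is_pole f z \<longleftrightarrow> is_pole g z" by (rule is_pole_cong[OF ev refl])
  show "f z = g z"
  proof (cases "is_pole f z")
    case True
    hence "f z = 0" "g z = 0"
      using f g pole unfolding nicely_meromorphic_on_def
      by (metis UNIV_I at_neq_bot is_pole_def not_tendsto_and_filterlim_at_infinity)+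
    thus ?thesis by simp
  next
    case False
    hence "f \<midarrow>z\<rightarrow> f z" "g \<midarrow>z\<rightarrow> g z"
      using f g pole unfolding nicely_meromorphic_on_def by auto
    moreover have "f \<midarrow>z\<rightarrow> g z"
      by (rule Lim_transform_eventually[OF calculation(2)]) (use ev in \<open>auto elim: eventually_mono\<close>)
    ultimately show ?thesis using tendsto_unique[OF at_neq_bot] by blast
  qed
qed

section \<open>Shifts of factorial series\<close>

text \<open>The products for w = x - h and for x share all factors but one: w^[s] (w + s h) = w (w +
  h)^[s].\<close>

lemma fe_delta:
  fixes x :: complex
  assumes "x \<noteq> of_real h" "\<And>k. x + of_nat k * of_real h \<noteq> 0" "h \<noteq> 0"
  shows "(x - of_real h) / of_real h * (fe h s x - fe h s (x - of_real h)) = - of_nat s * fe h s x"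
proof -
  define w where "w = x - complex_of_real h"
  have w0: "w \<noteq> 0" using assms(1) by (simp add: w_def)
  have xw: "x = w + of_real h" by (simp add: w_def)
  have r: "h_rising h s w * (w + of_nat s * of_real h) = w * h_rising h s x"
    using h_rising_add[of h 1 s w] h_rising_Suc[of h s w] by (simp add: xw h_rising_Suc)
  have x0: "h_rising h s x \<noteq> 0" using assms(2) by (auto simp: h_rising_def)
  show ?thesis
  proof (cases "s = 0")
    case False
    then obtain t where t: "s = Suc t" by (cases s) auto
    have nz: "w + of_nat s * of_real h \<noteq> 0"
      using assms(2)[of t] by (simp add: t xw algebra_simps)
    have w1: "h_rising h s w \<noteq> 0" using r x0 w0 by auto
    have a: "w * fe h s w = fe h s x * (w + of_nat s * of_real h)"
      using r x0 w1 by (simp add: fe_def divide_simps) (simp add: mult_ac)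
    have "w * (fe h s x - fe h s w) = - of_nat s * of_real h * fe h s x"
      unfolding right_diff_distrib a by (simp add: algebra_simps)
    thus ?thesis using assms(3) by (simp add: w_def[symmetric])
  qed simp
qed

text \<open>Moving the point by h gains a factor s. The constant \<rho>/h explodes as h tends to 0,
  so the lemma serves for summability at a fixed h and not for uniform bounds.\<close>

lemma fe_shift_weight:
  assumes "0 < h" "0 < \<rho>"
  shows "real s * fe h s (\<rho> + h) \<le> \<rho> / h * fe h s \<rho>"
proof -
  have f: "fe h s \<rho> * inverse (\<rho> + real s * h) = inverse \<rho> * fe h s (\<rho> + h)"
    using fe_add[of h 1 s \<rho>] fe_Suc[of h s \<rho>] by (simp add: fe_Suc)
  have p: "0 < \<rho> + real s * h" using assms by (simp add: add_pos_nonneg)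
  have e: "fe h s (\<rho> + h) = \<rho> / (\<rho> + real s * h) * fe h s \<rho>"
    using f assms p by (simp add: field_simps)
  have "real s * (\<rho> / (\<rho> + real s * h)) \<le> \<rho> / h"
    using assms p by (simp add: field_simps)
  from mult_right_mono[OF this less_imp_le[OF fe_pos[of h \<rho> s]]] assms
  show ?thesis unfolding e by (simp add: mult_ac)
qed

lemma fe_antimono:
  assumes "0 \<le> h" "0 < \<rho>" "\<rho> \<le> \<rho>'"
  shows "fe h s \<rho>' \<le> fe h s (\<rho> :: real)"
proof -
  have "hdom h \<rho> \<rho>'" using assms hdom_mono[OF hdom_real assms(3)] by simp
  from norm_fe_le[OF this assms(1,2), of s] fe_pos[of h \<rho>' s] assms show ?thesis by simp
qed

context fact_kernel
begin

lemma summable_mono_rho: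
  assumes "\<rho> \<le> \<rho>'" "summable (\<lambda>s. f s * fe h s \<rho>)" "\<And>s. 0 \<le> f s"
  shows "summable (\<lambda>s. f s * fe h s \<rho>')"
proof (rule summable_comparison_test'[OF assms(2), of 0])
  fix s
  have "0 \<le> fe h s \<rho>'" using fe_pos[of h \<rho>' s] h \<rho> assms(1) by simp
  thus "norm (f s * fe h s \<rho>') \<le> f s * fe h s \<rho>"
    using fe_antimono[OF h \<rho> assms(1), of s] assms(3)[of s] by (simp add: mult_left_mono)
qed

lemma fact_kernel_mono:
  assumes "\<rho> \<le> \<rho>'"
  shows "fact_kernel n h \<rho>' B" "fact_kernel.\<beta> n h \<rho>' B \<le> \<beta>"
proof -
  show k: "fact_kernel n h \<rho>' B"
    using h \<rho> B0 summable_mono_rho[OF assms Bsum] assms by unfold_locales auto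
  interpret k: fact_kernel n h \<rho>' B by (rule k)
  show "k.\<beta> \<le> \<beta>"
    unfolding k.\<beta>_def \<beta>_def
    by (intro suminf_le mult_left_mono fe_antimono h \<rho> assms k.Bsum Bsum) simp
qed

lemma ev_holomorphic:
  assumes U: "summable (\<lambda>s. mn n (U s) * fe h s \<rho>)" and ij: "i < n" "j < n"
  shows "(\<lambda>x. ev h U x i j) holomorphic_on {x. \<rho> < Re x}"
proof (rule holomorphic_uniform_sequence[where f = "\<lambda>N x. \<Sum>s<N. U s i j * fe h s x"])
  have ul: "uniform_limit {x. \<rho> < Re x} (\<lambda>N x. \<Sum>s<N. U s i j * fe h s x) (\<lambda>x. ev h U x i j) sequentially"
    unfolding ev_def
  proof (rule Weierstrass_m_test[OF _ entry_summable[OF U ij]])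
    fix s x assume "x \<in> {x. \<rho> < Re x}"
    hence "hdom h \<rho> x" by (intro hdom_Re) simp
    thus "norm (U s i j * fe h s x) \<le> cmod (U s i j) * fe h s \<rho>"
      using mult_left_mono[OF norm_fe_le[OF _ h \<rho>, of x s] norm_ge_zero[of "U s i j"]] by (simp add: norm_mult)
  qed
  fix x assume "x \<in> {x. \<rho> < Re x}"
  then obtain d where d: "0 < d" "cball x d \<subseteq> {x. \<rho> < Re x}"
    using open_contains_cball open_halfspace_Re_gt by blast
  show "\<exists>d>0. cball x d \<subseteq> {x. \<rho> < Re x} \<and>
      uniform_limit (cball x d) (\<lambda>N x. \<Sum>s<N. U s i j * fe h s x) (\<lambda>x. ev h U x i j) sequentially"
    using d uniform_limit_on_subset[OF ul d(2)] by blast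
next
  fix N
  have "h_rising h s x \<noteq> 0" if "x \<in> {x. \<rho> < Re x}" for s x
    using h_rising_nonzero[OF hdom_Re h \<rho>, of x s] that by simp
  thus "(\<lambda>x. \<Sum>s<N. U s i j * fe h s x) holomorphic_on {x. \<rho> < Re x}"
    unfolding fe_def h_rising_def by (intro holomorphic_intros) auto
qed (simp add: open_halfspace_Re_gt)

end

context gauge_system
begin

lemma gauge_system_mono:
  assumes "\<rho> \<le> \<rho>'"
  shows "gauge_system n h \<rho>' B \<kappa> A0"
proof -
  interpret k: fact_kernel n h \<rho>' B by (rule fact_kernel_mono[OF assms])
  have "\<kappa> * (k.\<beta> + h / (\<rho>' - h) * mn n A0) \<le> \<kappa> * (\<beta> + h / (\<rho> - h) * mn n A0)"
    using fact_kernel_mono(2)[OF assms] h h\<rho> assms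
    by (intro mult_left_mono \<kappa> add_mono mult_right_mono divide_left_mono) auto
  hence "\<kappa> * (k.\<beta> + h / (\<rho>' - h) * mn n A0) \<le> 1 / 2" using small by linarith
  thus ?thesis
    using h\<rho> assms \<kappa> sylv_ex sylv_bd by unfold_locales auto
qed

lemma dev_eq:
  assumes D: "summable (\<lambda>s. mn n (D s) * fe h s \<rho>)" and hp: "0 < h" and x: "\<rho> + h \<le> Re x" and ij: "i < n" "j < n"
  shows "dev D x i j = (x - of_real h) / of_real h * (ev h D x i j - ev h D (x - of_real h) i j)"
proof -
  have d: "hdom h \<rho> x" "hdom h \<rho> (x - of_real h)" using x hp by (auto intro!: hdom_Re)
  have ne: "x \<noteq> of_real h" using x h\<rho> \<rho> by auto
  have nz: "x + of_nat k * of_real h \<noteq> 0" for k using hdom_nonzero[OF d(1) h \<rho>] .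
  have "(\<lambda>s. (x - of_real h) / of_real h * (D s i j * fe h s x - D s i j * fe h s (x - of_real h))) sums
     ((x - of_real h) / of_real h * (ev h D x i j - ev h D (x - of_real h) i j))"
    by (intro sums_mult sums_diff ev_sums[OF D ij] d)
  moreover have "(x - of_real h) / of_real h * (D s i j * fe h s x - D s i j * fe h s (x - of_real h)) = - of_nat s * D s i j * fe h s x" for s
  proof -
    have "(x - of_real h) / of_real h * (D s i j * fe h s x - D s i j * fe h s (x - of_real h))
      = D s i j * ((x - of_real h) / of_real h * (fe h s x - fe h s (x - of_real h)))" by (simp add: algebra_simps)
    also have "\<dots> = D s i j * (- of_nat s * fe h s x)" using fe_delta[OF ne nz, of s] hp by simp
    finally show ?thesis by simp
  qed
  ultimately show ?thesis by (simp add: dev_def sums_iff)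
qed

lemma weighted_summable:
  assumes D: "summable (\<lambda>s. mn n (D s) * fe h s \<rho>)" and hp: "0 < h"
  shows "summable (\<lambda>s. real s * mn n (D s) * fe h s (\<rho> + h))"
proof (rule summable_comparison_test'[OF summable_mult[OF D, of "\<rho> / h"], of 0])
  fix s
  have "mn n (D s) * (real s * fe h s (\<rho> + h)) \<le> mn n (D s) * (\<rho> / h * fe h s \<rho>)"
    by (intro mult_left_mono fe_shift_weight hp \<rho>) simp
  moreover have "0 \<le> fe h s (\<rho> + h)" using fe_pos[of h "\<rho> + h" s] h \<rho> by simp
  ultimately show "norm (real s * mn n (D s) * fe h s (\<rho> + h)) \<le> \<rho> / h * (mn n (D s) * fe h s \<rho>)"
    by (simp add: abs_mult mult_ac)
qed

text \<open>From an identity on a real half-line to the recursion: at \<rho> + h and beyond the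
  weighted series converges, so \<open>gauge_sums\<close> applies there and
  \<open>fe_series_unique\<close> shows that the coefficients of the defect vanish.\<close>

lemma gauge_coeffs:
  assumes D: "summable (\<lambda>s. mn n (D s) * fe h s \<rho>)" and E: "summable (\<lambda>s. mn n (E s) * fe h s \<rho>)" and hp: "0 < h"
    and eq: "\<And>x i j. \<rho>1 \<le> x \<Longrightarrow> i < n \<Longrightarrow> j < n \<Longrightarrow>
      dev D (complex_of_real x) i j - mm n A0 (ev h D (of_real x)) i j + mm n (ev h D (of_real x)) A0 i j
        - (ev h E (of_real x) i j + mm n (ev h B (of_real x)) (ev h D (of_real x)) i j
           + of_real h / (of_real x - of_real h) * mm n (dev D (of_real x)) A0 i j) = 0"
    and ij: "i < n" "j < n"
  shows "sylv n s A0 (D s) i j = rhs E D s i j"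
proof -
  define r where "r = max (\<rho> + h) \<rho>1"
  have r: "\<rho> + h \<le> r" "\<rho>1 \<le> r" by (simp_all add: r_def)
  interpret g: gauge_system n h r B \<kappa> A0 using r(1) h by (intro gauge_system_mono) simp
  interpret g0: gauge_system n h "\<rho> + h" B \<kappa> A0 using h by (intro gauge_system_mono) simp
  have s1: "summable (\<lambda>s. real s * mn n (D s) * fe h s r)"
    by (rule g0.summable_mono_rho[OF r(1) weighted_summable[OF D hp]]) simp
  have s2: "summable (\<lambda>s. mn n (D s) * fe h s r)" "summable (\<lambda>s. mn n (E s) * fe h s r)"
  proof -
    have "\<rho> \<le> r" using r(1) h by linarith
    thus "summable (\<lambda>s. mn n (D s) * fe h s r)" "summable (\<lambda>s. mn n (E s) * fe h s r)"
      using summable_mono_rho[OF _ D] summable_mono_rho[OF _ E] by simp_all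
  qed
  note G = g.gauge_sums[OF s1 s2 ij]
  have "sylv n s A0 (D s) i j - rhs E D s i j = 0"
  proof (rule fe_series_unique[OF h g.\<rho> G(1)])
    fix x assume x: "r \<le> x"
    have d: "hdom h r (complex_of_real x)" using x by (intro hdom_Re) simp
    have "\<rho>1 \<le> x" using x r(2) by linarith
    note z = eq[OF this ij]
    show "(\<lambda>s. (sylv n s A0 (D s) i j - rhs E D s i j) * fe h s (complex_of_real x)) sums 0"
      using G(2)[OF d] unfolding z .
  qed
  thus ?thesis by (simp only: right_minus_eq)
qed

lemma gauge_function:
  assumes sD: "summable (\<lambda>s. real s * mn n (D s) * fe h s \<rho>)"
    and sD': "summable (\<lambda>s. mn n (D s) * fe h s \<rho>)"
    and sE: "summable (\<lambda>s. mn n (E s) * fe h s \<rho>)"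
    and eq: "\<And>s. sylv n s A0 (D s) i j = rhs E D s i j"
    and ij: "i < n" "j < n" and x: "hdom h \<rho> x"
  shows "dev D x i j - mm n A0 (ev h D x) i j + mm n (ev h D x) A0 i j
        = ev h E x i j + mm n (ev h B x) (ev h D x) i j + of_real h / (x - of_real h) * mm n (dev D x) A0 i j"
proof -
  have "(\<lambda>s. (sylv n s A0 (D s) i j - rhs E D s i j) * fe h s x) sums 0" by (simp add: eq)
  from sums_unique2[OF gauge_sums(2)[OF sD sD' sE ij x] this]
  show ?thesis by (simp only: right_minus_eq)
qed

end

section \<open>The matrix characters\<close>

lemma h_char_entire: "(\<lambda>c. h_char h c x) holomorphic_on UNIV"
proof -
  have "(\<lambda>c. h_char h c x) = (\<lambda>c. of_real h powr c * Gamma (x / of_real h) * rGamma (x / of_real h - c))"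
    by (simp add: h_char_def rGamma_inverse_Gamma divide_inverse)
  moreover have "\<dots> holomorphic_on UNIV"
  proof (cases "h = 0")
    case True thus ?thesis by simp
  next
    case False
    have "(\<lambda>c. exp (c * Ln (of_real h)) * Gamma (x / of_real h) * rGamma (x / of_real h - c)) holomorphic_on UNIV"
      by (intro holomorphic_intros)
    thus ?thesis using False by (simp add: powr_def)
  qed
  ultimately show ?thesis by simp
qed

lemma h_exp_jordan_eq: "h_exp_jordan h bs x = mfun_jordan (\<lambda>c. h_char h c x) bs"
  unfolding h_exp_jordan_def mfun_jordan_def h_exp_block_def h_log_def ..

text \<open>Frees the value from the arbitrary Jordan reduction in its definition; from here on it
  is handled as a power series in A.\<close>

lemma h_exp_mat_eq:
  assumes A: "A \<in> carrier_mat n n" and J: "jordan_reduction A Q R bs"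
  shows "h_exp_mat h A x = mfun n (\<lambda>c. h_char h c x) A"
proof -
  have "\<exists>E Q R bs. jordan_reduction A Q R bs \<and> E = Q * h_exp_jordan h bs x * R" using J by blast
  from someI_ex[OF this] obtain Q' R' bs' where
    "jordan_reduction A Q' R' bs'" "h_exp_mat h A x = Q' * h_exp_jordan h bs' x * R'"
    unfolding h_exp_mat_def by blast
  thus ?thesis
    using mfun_eq_jordan(1)[OF A _ h_char_entire] h_exp_jordan_eq by metis
qed

text \<open>The scalar functional equation says that \<open>h_char h c\<close> at x - h is 1 - c
  h/(x - h) times its value at x. It is an identity between entire functions of c, and
  \<open>mfun_lin\<close> and \<open>mfun_times\<close> carry it over to matrices.\<close>

lemma h_exp_mat_shift:
  assumes A: "A \<in> carrier_mat n n" and J: "jordan_reduction A Q R bs" and h: "0 < h" and x: "h < Re x"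
    and ij: "i < n" "j < n"
  shows "h_exp_mat h A (x - of_real h) $$ (i, j)
     = h_exp_mat h A x $$ (i, j) - of_real h / (x - of_real h) * mm n (fm A) (fm (h_exp_mat h A x)) i j"
proof -
  define z where "z = x / of_real h - 1"
  have xz: "x / of_real h = z + 1" "(x - of_real h) / of_real h = z" using h by (auto simp: z_def field_simps)
  have z0: "0 < Re z" using x h by (simp add: z_def)
  have ne: "x - of_real h \<noteq> 0" using x by auto
  have "h_char h c (x - of_real h) = h_char h c x + (- (of_real h / (x - of_real h))) * (c * h_char h c x)" for c
  proof -
    have G: "Gamma (z + 1) = z * Gamma z" using z0 by (intro Gamma_plus1) (auto dest: not_nonpos_Int_Re)
    have zz: "z \<noteq> 0" using z0 by auto
    have "rGamma (z - c) = (z - c) * rGamma (z - c + 1)" using rGamma_plus1[of "z - c"] by simp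
    hence R: "rGamma (z - c) = (z - c) * rGamma (z + 1 - c)" by (simp add: algebra_simps)
    have "h_char h c (x - of_real h) = of_real h powr c * Gamma z * rGamma (z - c)"
      by (simp add: h_char_def rGamma_inverse_Gamma divide_inverse xz[unfolded divide_inverse])
    also have "\<dots> = (of_real h powr c * Gamma (z + 1) * rGamma (z + 1 - c)) * ((z - c) / z)"
      unfolding R G using zz by (simp add: field_simps)
    also have "of_real h powr c * Gamma (z + 1) * rGamma (z + 1 - c) = h_char h c x"
      by (simp add: h_char_def rGamma_inverse_Gamma divide_inverse xz[unfolded divide_inverse])
    also have "(z - c) / z = 1 - c * (of_real h / (x - of_real h))"
      using zz ne h xz(2) by (auto simp: field_simps)
    finally show ?thesis by (simp add: algebra_simps)
  qed
  hence "h_exp_mat h A (x - of_real h) $$ (i, j) = mfun n (\<lambda>c. h_char h c x + (- (of_real h / (x - of_real h))) * (c * h_char h c x)) A $$ (i, j)"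
    unfolding h_exp_mat_eq[OF A J] by simp
  also have "\<dots> = mfun n (\<lambda>c. h_char h c x) A $$ (i, j) + (- (of_real h / (x - of_real h))) * mfun n (\<lambda>c. c * h_char h c x) A $$ (i, j)"
    by (rule mfun_lin[OF A J h_char_entire _ ij]) (rule holomorphic_on_mult[OF holomorphic_on_ident h_char_entire])
  finally show ?thesis
    unfolding mfun_times[OF A J h_char_entire ij] h_exp_mat_eq[OF A J] by simp
qed

lemma mfun_carrier [simp]: "mfun n f A \<in> carrier_mat n n"
  by (simp add: mfun_def)

text \<open>To the right of all h |c| the arguments x/h and x/h - c have positive real part, where
  neither Gamma nor 1/Gamma vanishes.\<close>

lemma h_exp_mat_det:
  assumes A: "A \<in> carrier_mat n n" and J: "jordan_reduction A Q R bs" and h: "0 < h"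
    and x: "\<And>m c. (m, c) \<in> set bs \<Longrightarrow> h * cmod c < Re x" "0 < Re x"
  shows "det (h_exp_mat h A x) \<noteq> 0"
  unfolding h_exp_mat_eq[OF A J]
proof (rule mfun_det_nonzero[OF A J h_char_entire])
  fix m c assume mc: "(m, c) \<in> set bs"
  have "cmod c < Re x / h" using x(1)[OF mc] h by (simp add: field_simps)
  hence "0 < Re (x / of_real h - c)" using complex_Re_le_cmod[of c] by simp
  moreover have "0 < Re (x / of_real h)" using x(2) h by simp
  ultimately show "h_char h c x \<noteq> 0"
    using h not_nonpos_Int_Re by (auto simp: h_char_def Gamma_eq_zero_iff)
qed

lemma higher_deriv_reflect:
  fixes K a :: complex
  assumes "\<psi> holomorphic_on UNIV"
  shows "(deriv ^^ k) (\<lambda>c. K * \<psi> (a - c)) = (\<lambda>c. K * (-1) ^ k * (deriv ^^ k) \<psi> (a - c))"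
proof (induction k)
  case (Suc k)
  have "((deriv ^^ k) \<psi> has_field_derivative (deriv ^^ Suc k) \<psi> w) (at w)" for w
  proof -
    have "(deriv ^^ k) \<psi> holomorphic_on UNIV" by (rule holomorphic_higher_deriv[OF assms open_UNIV])
    thus ?thesis using holomorphic_derivI[OF _ open_UNIV UNIV_I] by simp
  qed
  hence "((\<lambda>c. K * (-1) ^ k * (deriv ^^ k) \<psi> (a - c)) has_field_derivative K * (-1) ^ k * ((deriv ^^ Suc k) \<psi> (a - c) * (-1))) (at c)" for c
    by (intro DERIV_cmult DERIV_chain2[where f = "(deriv ^^ k) \<psi>"]) (auto intro!: derivative_eq_intros simp del: funpow.simps)
  hence "deriv (\<lambda>c. K * (-1) ^ k * (deriv ^^ k) \<psi> (a - c)) = (\<lambda>c. K * (-1) ^ Suc k * (deriv ^^ Suc k) \<psi> (a - c))"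
    by (intro ext DERIV_imp_deriv) (simp add: mult_ac del: funpow.simps)
  thus ?case using Suc by simp
qed simp

text \<open>\<open>h_char\<close> splits as a function of x alone times a function of x/h - c.
  Derivatives in c thus become derivatives of one entire function, evaluated at a point depending
  holomorphically on x.\<close>

lemma h_log_holomorphic:
  assumes h: "0 < h"
  shows "(\<lambda>x. h_log h k c x) holomorphic_on {x. 0 < Re x}"
proof -
  define \<psi> where "\<psi> w = exp (- w * of_real (ln h)) * rGamma w" for w :: complex
  have \<psi>: "\<psi> holomorphic_on UNIV" unfolding \<psi>_def by (intro holomorphic_intros)
  define K where "K x = Gamma (x / of_real h) * exp (x / of_real h * of_real (ln h))" for x :: complex
  have "h_char h c x = K x * \<psi> (x / of_real h - c)" for c x
  proof -
    have "complex_of_real h powr c = exp (x / of_real h * of_real (ln h)) * exp (- (x / of_real h - c) * of_real (ln h))"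
      using h unfolding exp_add[symmetric] by (simp add: powr_def Ln_of_real algebra_simps)
    thus ?thesis by (simp add: h_char_def K_def \<psi>_def rGamma_inverse_Gamma divide_inverse)
  qed
  hence "h_log h k c x = K x * (-1) ^ k * (deriv ^^ k) \<psi> (x / of_real h - c) / fact k" for x
    by (simp add: h_log_def higher_deriv_reflect[OF \<psi>])
  moreover have "(\<lambda>x. K x * (-1) ^ k * (deriv ^^ k) \<psi> (x / of_real h - c) / fact k) holomorphic_on {x. 0 < Re x}"
  proof -
    have 1: "(\<lambda>x. (deriv ^^ k) \<psi> (x / of_real h - c)) holomorphic_on {x. 0 < Re x}"
      by (rule holomorphic_on_compose_gen[OF _ holomorphic_higher_deriv[OF \<psi> open_UNIV], unfolded o_def])
         (auto intro!: holomorphic_intros simp: h less_imp_neq[symmetric])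
    have 2: "(\<lambda>x. Gamma (x / complex_of_real h)) holomorphic_on {x. 0 < Re x}"
      by (rule holomorphic_on_compose_gen[OF _ holomorphic_Gamma[of "{z. 0 < Re z}"], unfolded o_def])
         (use h not_nonpos_Int_Re in \<open>auto intro!: holomorphic_intros\<close>)
    show ?thesis unfolding K_def using h by (intro holomorphic_intros 1 2) auto
  qed
  ultimately show ?thesis by simp
qed

lemma diag_block_mat_holomorphic:
  assumes "\<And>x b. b \<in> set bs \<Longrightarrow> G x b \<in> carrier_mat (fst b) (fst b)"
    and "\<And>b i j. b \<in> set bs \<Longrightarrow> i < fst b \<Longrightarrow> j < fst b \<Longrightarrow> (\<lambda>x. G x b $$ (i, j)) holomorphic_on S"
    and "i < sum_list (map fst bs)" "j < sum_list (map fst bs)"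
  shows "(\<lambda>x. diag_block_mat (map (G x) bs) $$ (i, j)) holomorphic_on S"
  using assms
proof (induction bs arbitrary: i j)
  case Nil thus ?case by simp
next
  case (Cons b bs)
  have bF': "dim_row (G x b') = fst b'" "dim_col (G x b') = fst b'" if "b' \<in> set (b # bs)" for x b'
    using carrier_matD[OF Cons.prems(1)[OF that]] by simp_all
  have dF: "dim_row (diag_block_mat (map (G x) bs)) = sum_list (map fst bs)"
     "dim_col (diag_block_mat (map (G x) bs)) = sum_list (map fst bs)" for x
  proof -
    have "map dim_row (map (G x) bs) = map fst bs" "map dim_col (map (G x) bs) = map fst bs"
      using bF' by simp_all
    thus "dim_row (diag_block_mat (map (G x) bs)) = sum_list (map fst bs)"
      "dim_col (diag_block_mat (map (G x) bs)) = sum_list (map fst bs)"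
      unfolding dim_diag_block_mat by (simp_all only:)
  qed
  have bF: "dim_row (G x b) = fst b" "dim_col (G x b) = fst b" for x using bF'[of b x] by auto
  have IH: "(\<lambda>x. diag_block_mat (map (G x) bs) $$ (i, j)) holomorphic_on S"
    if "i < sum_list (map fst bs)" "j < sum_list (map fst bs)" for i j
    using Cons.prems that by (intro Cons.IH) auto
  show ?case
    using Cons.prems(2)[of b i j] IH[of "i - fst b" "j - fst b"] Cons.prems(3,4)
    by (cases "i < fst b"; cases "j < fst b") (auto simp: Let_def dF bF)
qed

lemma h_exp_mat_holomorphic:
  assumes A: "A \<in> carrier_mat n n" and J: "jordan_reduction A Q R bs" and h: "0 < h" and ij: "i < n" "j < n"
  shows "(\<lambda>x. h_exp_mat h A x $$ (i, j)) holomorphic_on {x. 0 < Re x}"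
proof -
  note D = jordan_reductionD[OF J A]
  have c: "h_exp_jordan h bs x \<in> carrier_mat n n" for x
    unfolding h_exp_jordan_eq using mfun_jordan_carrier[of _ bs] D(5) by simp
  have "(\<lambda>x. h_exp_jordan h bs x $$ (p, q)) holomorphic_on {x. 0 < Re x}" if "p < n" "q < n" for p q
    unfolding h_exp_jordan_def
  proof (rule diag_block_mat_holomorphic)
    fix b :: "nat \<times> complex" and i j assume ij: "i < fst b" "j < fst b"
    obtain m c where b: "b = (m, c)" by (cases b)
    show "(\<lambda>x. (case b of (m, c) \<Rightarrow> h_exp_block h m c x) $$ (i, j)) holomorphic_on {x. 0 < Re x}"
      using ij h_log_holomorphic[OF h, of "j - i" c] by (cases "i \<le> j") (simp_all add: b h_exp_block_def)
  qed (use that D(5) in \<open>auto simp: h_exp_block_def\<close>)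
  hence "(\<lambda>x. \<Sum>q<n. \<Sum>p<n. Q $$ (i, p) * h_exp_jordan h bs x $$ (p, q) * R $$ (q, j)) holomorphic_on {x. 0 < Re x}"
    by (intro holomorphic_on_sum holomorphic_on_mult holomorphic_on_const) auto
  moreover have "h_exp_mat h A x $$ (i, j) = (\<Sum>q<n. \<Sum>p<n. Q $$ (i, p) * h_exp_jordan h bs x $$ (p, q) * R $$ (q, j))" for x
    unfolding h_exp_mat_eq[OF A J] mfun_eq_jordan(1)[OF A J h_char_entire] h_exp_jordan_eq[symmetric]
    by (rule mat_triple_index[OF D(1) c D(2) ij])
  ultimately show ?thesis by simp
qed

lemma mm_one:
  assumes "i < n" "j < n"
  shows "mm n (\<lambda>i j. if i = j then 1 else 0) X i j = X i j" "mm n X (\<lambda>i j. if i = j then 1 else 0) i j = X i j"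
  using assms by (simp_all add: mm_def if_distrib if_distribR cong: if_cong)

lemma mm_holomorphic:
  assumes "\<And>i j. i < n \<Longrightarrow> j < n \<Longrightarrow> (\<lambda>x. X x i j) holomorphic_on S" "\<And>i j. i < n \<Longrightarrow> j < n \<Longrightarrow> (\<lambda>x. Y x i j) holomorphic_on S"
    and "i < n" "j < n"
  shows "(\<lambda>x. mm n (X x) (Y x) i j) holomorphic_on S"
  unfolding mm_def using assms by (intro holomorphic_on_sum holomorphic_on_mult) auto

lemma cancel_right_factor:
  assumes M: "M \<in> carrier_mat n n" "det M \<noteq> 0" and X: "\<And>i j. i < n \<Longrightarrow> j < n \<Longrightarrow> mm n X (fm M) i j = 0"
    and ij: "i < n" "j < n"
  shows "X i j = 0"
proof -
  note adj = adj_mat[OF M(1)]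
  have "mm n (fm M) (fm (adj_mat M)) i j = det M * (if i = j then 1 else 0)" if "i < n" "j < n" for i j
    using mat_mult_mm[OF M(1) adj(1) that] that by (simp add: adj(2))
  hence "mm n X (mm n (fm M) (fm (adj_mat M))) i j = mm n X (\<lambda>i j. det M * (if i = j then 1 else 0)) i j"
    by (intro mm_cong) (use ij in auto)
  hence "mm n (mm n X (fm M)) (fm (adj_mat M)) i j = det M * X i j"
    by (simp only: mm_lin mm_assoc mm_one[OF ij])
  moreover have "mm n (mm n X (fm M)) (fm (adj_mat M)) i j = 0"
    using X ij by (simp add: mm_def[of n "mm n X (fm M)"])
  ultimately show ?thesis using M(2) by simp
qed

section \<open>The canonical solution\<close>

text \<open>\<open>small2\<close> forces the norm of U to be at most 1/2, so that 1 + U is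
  invertible among factorial series.\<close>

locale canonical_system = gauge_system +
  fixes A :: "complex poly fract mat" and Q R :: "complex mat" and bs :: "(nat \<times> complex) list"
  assumes A: "A \<in> carrier_mat n n"
    and hp: "0 < h"
    and J: "jordan_reduction (rm_eval A None) Q R bs"
    and A0_eq: "\<And>i j. i < n \<Longrightarrow> j < n \<Longrightarrow> A0 i j = rm_eval A None $$ (i, j)"
    and A_series: "\<And>x i j. hdom h \<rho> x \<Longrightarrow> i < n \<Longrightarrow> j < n \<Longrightarrow> (\<lambda>s. B s i j * fe h s x) sums (rm_eval A (Some x) $$ (i, j) - A0 i j)"
    and nopole: "\<And>x. \<rho> \<le> cmod x \<Longrightarrow> Some x \<notin> rm_poles A"
    and small2: "\<kappa> * \<beta> \<le> 1 / 4"
begin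

abbreviation a :: "complex \<Rightarrow> nat \<Rightarrow> nat \<Rightarrow> complex" where
  "a x i j \<equiv> rm_eval A (Some x) $$ (i, j)"

abbreviation Ainf :: "complex mat" where "Ainf \<equiv> rm_eval A None"

lemma Ainf: "Ainf \<in> carrier_mat n n" by (rule rm_eval_carrier[OF A])

lemma evB: "hdom h \<rho> x \<Longrightarrow> i < n \<Longrightarrow> j < n \<Longrightarrow> ev h B x i j = a x i j - A0 i j"
  using A_series[of x i j] by (simp add: ev_def sums_iff)

definition U :: "nat \<Rightarrow> nat \<Rightarrow> nat \<Rightarrow> complex" where
  "U = (SOME U. (\<forall>i j. U 0 i j = 0) \<and> (\<forall>s i j. 1 \<le> s \<longrightarrow> i < n \<longrightarrow> j < n \<longrightarrow> sylv n s A0 (U s) i j = rhs B U s i j))"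

lemma U: "U 0 i j = 0" "1 \<le> s \<Longrightarrow> i < n \<Longrightarrow> j < n \<Longrightarrow> sylv n s A0 (U s) i j = rhs B U s i j"
proof -
  have "\<exists>U. (\<forall>i j. U 0 i j = 0) \<and> (\<forall>s i j. 1 \<le> s \<longrightarrow> i < n \<longrightarrow> j < n \<longrightarrow> sylv n s A0 (U s) i j = rhs B U s i j)"
    by (rule solution_exists) blast
  from someI_ex[OF this] show "U 0 i j = 0" "1 \<le> s \<Longrightarrow> i < n \<Longrightarrow> j < n \<Longrightarrow> sylv n s A0 (U s) i j = rhs B U s i j"
    unfolding U_def[symmetric] by blast+
qed

lemma U_all: "i < n \<Longrightarrow> j < n \<Longrightarrow> sylv n s A0 (U s) i j = rhs B U s i j"
proof (cases "s = 0")
  case True thus ?thesis by (simp add: U(1) sylv_def mm_def rhs_def B0 conv_def gterm_def)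
qed (simp add: U(2))

lemma U_summable:
  "summable (\<lambda>s. real s * mn n (U s) * fe h s \<rho>)" "summable (\<lambda>s. mn n (U s) * fe h s \<rho>)"
  "(\<Sum>s. mn n (U s) * fe h s \<rho>) \<le> 1 / 2"
proof -
  note S = stability_summable[of U B, OF U(1) U(2) Bsum]
  show "summable (\<lambda>s. real s * mn n (U s) * fe h s \<rho>)" "summable (\<lambda>s. mn n (U s) * fe h s \<rho>)"
    by (rule S(1,2); simp)+
  have "(\<Sum>s. mn n (U s) * fe h s \<rho>) \<le> 2 * \<kappa> * (\<Sum>s. mn n (B s) * fe h s \<rho>)" by (rule S(3); simp)
  thus "(\<Sum>s. mn n (U s) * fe h s \<rho>) \<le> 1 / 2" using small2 unfolding \<beta>_def by linarith
qed

definition F :: "complex \<Rightarrow> nat \<Rightarrow> nat \<Rightarrow> complex" where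
  "F x i j = (if i = j then 1 else 0) + ev h U x i j"

definition E :: "complex \<Rightarrow> nat \<Rightarrow> nat \<Rightarrow> complex" where
  "E x i j = h_exp_mat h Ainf x $$ (i, j)"

text \<open>
  For \<open>c = 1\<close> both sides vanish when \<open>1 + D\<close> is the regular factor; \<open>c = 0\<close> is the linear
  equation for a difference of two regular factors.
\<close>

lemma gauge_shift:
  assumes x: "\<rho> + h \<le> Re x" and D: "summable (\<lambda>s. mn n (D s) * fe h s \<rho>)"
    and G: "\<And>x i j. i < n \<Longrightarrow> j < n \<Longrightarrow> G x i j = c * (if i = j then 1 else 0) + ev h D x i j"
    and ij: "i < n" "j < n"
  shows "dev D x i j - mm n A0 (ev h D x) i j + mm n (ev h D x) A0 i j
          - (c * ev h B x i j + mm n (ev h B x) (ev h D x) i j + of_real h / (x - of_real h) * mm n (dev D x) A0 i j)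
    = (x - of_real h) / of_real h * (G x i j - G (x - of_real h) i j) - mm n (a x) (G x) i j + mm n (G (x - of_real h)) A0 i j"
proof -
  define w where "w = x - complex_of_real h"
  have w0: "w \<noteq> 0" using x h\<rho> \<rho> hp by (auto simp: w_def)
  have d: "hdom h \<rho> x" using x hp by (intro hdom_Re) simp
  have V: "dev D x i j = w / of_real h * (G x i j - G w i j)" if "i < n" "j < n" for i j
    using dev_eq[OF D hp x that] that by (simp add: G w_def)
  have GV: "mm n (G w) A0 i j = mm n (G x) A0 i j - of_real h / w * mm n (dev D x) A0 i j"
  proof -
    have "mm n (G w) A0 i j = mm n (\<lambda>i j. G x i j - of_real h / w * dev D x i j) A0 i j"
      by (rule mm_cong) (use ij w0 hp V in \<open>auto simp: field_simps\<close>)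
    thus ?thesis by (simp only: mm_lin)
  qed
  have G': "mm n X (G x) i j = c * X i j + mm n X (ev h D x) i j" "mm n (G x) X i j = c * X i j + mm n (ev h D x) X i j" for X
  proof -
    have "mm n X (G x) i j = mm n X (\<lambda>i j. c * (if i = j then 1 else 0) + ev h D x i j) i j"
      by (rule mm_cong) (use ij G in auto)
    thus "mm n X (G x) i j = c * X i j + mm n X (ev h D x) i j" by (simp only: mm_lin mm_one[OF ij])
    have "mm n (G x) X i j = mm n (\<lambda>i j. c * (if i = j then 1 else 0) + ev h D x i j) X i j"
      by (rule mm_cong) (use ij G in auto)
    thus "mm n (G x) X i j = c * X i j + mm n (ev h D x) X i j" by (simp only: mm_lin mm_one[OF ij])
  qed
  have aB: "mm n (a x) (ev h D x) i j = mm n (ev h B x) (ev h D x) i j + mm n A0 (ev h D x) i j"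
  proof -
    have "mm n (a x) (ev h D x) i j = mm n (\<lambda>i j. ev h B x i j + A0 i j) (ev h D x) i j"
      by (rule mm_cong) (use ij evB[OF d] in auto)
    thus ?thesis by (simp add: mm_lin)
  qed
  show ?thesis
    unfolding w_def[symmetric] GV G' aB V[OF ij, symmetric] evB[OF d ij] by (simp add: algebra_simps)
qed

lemma F_shift:
  assumes x: "\<rho> + h \<le> Re x" and ij: "i < n" "j < n"
  shows "(x - of_real h) / of_real h * (F x i j - F (x - of_real h) i j) - mm n (a x) (F x) i j + mm n (F (x - of_real h)) A0 i j = 0"
proof -
  have d: "hdom h \<rho> x" using x hp by (intro hdom_Re) simp
  have 1: "F x i j = 1 * (if i = j then 1 else 0) + ev h U x i j" for x i j by (simp add: F_def)
  show ?thesis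
    using gauge_shift[OF x U_summable(2) 1 ij] gauge_function[OF U_summable(1,2) Bsum U_all[OF ij] ij d]
    by simp
qed

definition Y0 :: "complex \<Rightarrow> nat \<Rightarrow> nat \<Rightarrow> complex" where "Y0 x = mm n (F x) (E x)"

lemma E_shift:
  assumes "h < Re x" "i < n" "j < n"
  shows "E (x - of_real h) i j = E x i j - of_real h / (x - of_real h) * mm n A0 (E x) i j"
proof -
  have "mm n (fm Ainf) (fm (h_exp_mat h Ainf x)) i j = mm n A0 (E x) i j"
    by (rule mm_cong) (use assms A0_eq in \<open>auto simp: E_def\<close>)
  thus ?thesis using h_exp_mat_shift[OF Ainf J hp assms] by (simp add: E_def)
qed

text \<open>Leibniz rule: for any G, the defect of G E in the difference system is the gauge defect
  of G times E, up to the factor h/(x - h). It is used with the constructed F and with the regular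
  factor of an arbitrary competitor.\<close>

lemma product_shift:
  assumes x: "h < Re x" and ij: "i < n" "j < n"
  shows "mm n (G x) (E x) i j - mm n (G (x - of_real h)) (E (x - of_real h)) i j - of_real h / (x - of_real h) * mm n (a x) (mm n (G x) (E x)) i j
    = of_real h / (x - of_real h) * mm n (\<lambda>i j. (x - of_real h) / of_real h * (G x i j - G (x - of_real h) i j) - mm n (a x) (G x) i j + mm n (G (x - of_real h)) A0 i j) (E x) i j"
proof -
  define w where "w = x - complex_of_real h"
  have w0: "w \<noteq> 0" using x hp by (auto simp: w_def)
  have "mm n (G w) (E w) i j = mm n (G w) (\<lambda>i j. E x i j - of_real h / w * mm n A0 (E x) i j) i j"
    by (rule mm_cong) (use ij E_shift[OF x] in \<open>auto simp: w_def\<close>)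
  hence 1: "mm n (G w) (E w) i j = mm n (G w) (E x) i j - of_real h / w * mm n (mm n (G w) A0) (E x) i j"
    by (simp only: mm_lin mm_assoc)
  define u v where "u = of_real h / w" and "v = w / of_real h"
  have uv: "u * v = 1" using w0 hp by (simp add: u_def v_def)
  have alg: "p - (q - u * r) - u * s = u * (v * (p - q) - s + r)" for p q r s
  proof -
    have "u * (v * (p - q) - s + r) = (u * v) * (p - q) - u * s + u * r" by (simp add: algebra_simps)
    thus ?thesis using uv by simp
  qed
  show ?thesis
    unfolding w_def[symmetric] 1 mm_lin mm_assoc[symmetric] u_def[symmetric] v_def[symmetric] by (rule alg)
qed

lemma Y0_rec:
  assumes x: "\<rho> \<le> Re x" and ij: "i < n" "j < n"
  shows "Y0 x i j = Y0 (x + of_real h) i j - of_real h / x * mm n (a (x + of_real h)) (Y0 (x + of_real h)) i j"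
proof -
  define x' where "x' = x + complex_of_real h"
  have x': "\<rho> + h \<le> Re x'" "h < Re x'" using x \<rho> by (auto simp: x'_def)
  have "mm n (\<lambda>i j. (x' - of_real h) / of_real h * (F x' i j - F (x' - of_real h) i j) - mm n (a x') (F x') i j + mm n (F (x' - of_real h)) A0 i j) (E x') i j = 0"
    using F_shift[OF x'(1)] ij by (simp add: mm_def[of n "\<lambda>i j. _ i j - _ i j + _ i j"])
  with product_shift[OF x'(2) ij, of F] have "Y0 x' i j - Y0 (x' - of_real h) i j - of_real h / (x' - of_real h) * mm n (a x') (Y0 x') i j = 0"
    unfolding Y0_def by simp
  thus ?thesis by (simp add: x'_def algebra_simps)
qed

section \<open>Analyticity and continuation to the left\<close>

lemma E_holomorphic: "i < n \<Longrightarrow> j < n \<Longrightarrow> (\<lambda>x. E x i j) holomorphic_on {x. 0 < Re x}"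
  unfolding E_def by (rule h_exp_mat_holomorphic[OF Ainf J hp])

lemma F_holomorphic: "i < n \<Longrightarrow> j < n \<Longrightarrow> (\<lambda>x. F x i j) holomorphic_on {x. \<rho> < Re x}"
  unfolding F_def by (intro holomorphic_on_add holomorphic_on_const ev_holomorphic[OF U_summable(2)])

lemma mm_analytic:
  assumes "\<And>i j. i < n \<Longrightarrow> j < n \<Longrightarrow> (\<lambda>x. X x i j) analytic_on S" "\<And>i j. i < n \<Longrightarrow> j < n \<Longrightarrow> (\<lambda>x. Y x i j) analytic_on S"
    and "i < n" "j < n"
  shows "(\<lambda>x. mm n (X x) (Y x) i j) analytic_on S"
  unfolding mm_def using assms by (intro analytic_on_sum analytic_on_mult) auto

lemma mm_meromorphic:
  assumes "\<And>i j. i < n \<Longrightarrow> j < n \<Longrightarrow> (\<lambda>x. X x i j) meromorphic_on S" "\<And>i j. i < n \<Longrightarrow> j < n \<Longrightarrow> (\<lambda>x. Y x i j) meromorphic_on S"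
    and "i < n" "j < n"
  shows "(\<lambda>x. mm n (X x) (Y x) i j) meromorphic_on S"
  unfolding mm_def using assms by (intro meromorphic_on_sum meromorphic_on_mult) auto

lemma Y0_holomorphic: "i < n \<Longrightarrow> j < n \<Longrightarrow> (\<lambda>x. Y0 x i j) holomorphic_on {x. \<rho> < Re x}"
  unfolding Y0_def
  by (rule mm_holomorphic[OF F_holomorphic holomorphic_on_subset[OF E_holomorphic]]) (use \<rho> in auto)

lemma Y0_analytic: "i < n \<Longrightarrow> j < n \<Longrightarrow> \<rho> < Re z \<Longrightarrow> (\<lambda>x. Y0 x i j) analytic_on {z}"
  using analytic_at open_halfspace_Re_gt[of \<rho>] Y0_holomorphic by blast

text \<open>\<open>Ys N x\<close> starts with \<open>Y0\<close> at x + N h and takes N steps of the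
  recursion to the left. At singular points met on the way the convention y/0 = 0 produces
  meaningless values, which \<open>Ycan\<close> repairs.\<close>

primrec Ys :: "nat \<Rightarrow> complex \<Rightarrow> nat \<Rightarrow> nat \<Rightarrow> complex" where
  "Ys 0 x = Y0 x"
| "Ys (Suc N) x = (\<lambda>i j. Ys N (x + of_real h) i j - of_real h / x * mm n (a (x + of_real h)) (Ys N (x + of_real h)) i j)"

lemma Ys_Suc_eq:
  assumes "\<rho> \<le> Re x + real N * h" "i < n" "j < n"
  shows "Ys (Suc N) x i j = Ys N x i j"
  using assms
proof (induction N arbitrary: x i j)
  case 0
  thus ?case using Y0_rec[of x i j] by simp
next
  case (Suc N)
  have "Ys (Suc N) (x + of_real h) i j = Ys N (x + of_real h) i j" if "i < n" "j < n" for i j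
    using Suc.prems(1) that by (intro Suc.IH) (auto simp: algebra_simps)
  moreover from this have "mm n (a (x + of_real h)) (Ys (Suc N) (x + of_real h)) i j = mm n (a (x + of_real h)) (Ys N (x + of_real h)) i j"
    by (intro mm_cong) (use Suc.prems in auto)
  ultimately show ?case using Suc.prems(2,3) by (simp only: Ys.simps(2)[of "Suc N"] Ys.simps(2)[of N x])
qed

lemma Ys_eq:
  assumes "\<rho> \<le> Re x + real N * h" "N \<le> M" "i < n" "j < n"
  shows "Ys M x i j = Ys N x i j"
  using assms(2)
proof (induction M rule: dec_induct)
  case (step M)
  have "\<rho> \<le> Re x + real M * h"
  proof -
    have "real N * h \<le> real M * h" by (intro mult_right_mono) (use step(1) hp in auto)
    thus ?thesis using assms(1) by linarith
  qed
  thus ?case using Ys_Suc_eq[of x M] step assms by simp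
qed simp

text \<open>The number of steps is enough to reach Re x \<ge> \<rho>; by \<open>Ys_eq\<close> any
  larger number gives the same value.\<close>

definition Yraw :: "complex \<Rightarrow> nat \<Rightarrow> nat \<Rightarrow> complex" where
  "Yraw x = Ys (nat \<lceil>(\<rho> - Re x) / h\<rceil>) x"

lemma Yraw_eq:
  assumes "\<rho> \<le> Re x + real N * h" "i < n" "j < n"
  shows "Yraw x i j = Ys N x i j"
proof -
  define K where "K = nat \<lceil>(\<rho> - Re x) / h\<rceil>"
  have "(\<rho> - Re x) / h \<le> real K" unfolding K_def by linarith
  hence K: "\<rho> \<le> Re x + real K * h" using hp by (simp add: field_simps)
  show ?thesis
  proof (cases "K \<le> N")
    case True thus ?thesis using Ys_eq[OF K True assms(2,3)] by (simp add: Yraw_def K_def)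
  next
    case False
    hence "N \<le> K" by simp
    from Ys_eq[OF assms(1) this assms(2,3)] show ?thesis by (simp only: Yraw_def K_def)
  qed
qed

lemma ex_shift: "\<exists>N. c < Re x + real N * h"
proof -
  obtain N where "(c - Re x) / h < real N" using reals_Archimedean2 by blast
  thus ?thesis using hp by (intro exI[of _ N]) (simp add: field_simps)
qed

text \<open>Valid at every x, even at singular points, because it unfolds the recursion
  literally.\<close>

lemma Yraw_rec:
  assumes "i < n" "j < n"
  shows "Yraw x i j = Yraw (x + of_real h) i j - of_real h / x * mm n (a (x + of_real h)) (Yraw (x + of_real h)) i j"
proof -
  obtain N where N: "\<rho> < Re x + real N * h" using ex_shift by blast
  have e: "Yraw (x + of_real h) i j = Ys N (x + of_real h) i j" if "i < n" "j < n" for i j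
    using N hp that by (intro Yraw_eq) auto
  have "Yraw x i j = Ys (Suc N) x i j"
    using N hp assms by (intro Yraw_eq) (auto simp: algebra_simps)
  moreover have "mm n (a (x + of_real h)) (Yraw (x + of_real h)) i j = mm n (a (x + of_real h)) (Ys N (x + of_real h)) i j"
    by (rule mm_cong) (use e assms in auto)
  ultimately show ?thesis using e[OF assms] by simp
qed

lemma Yraw_right: "\<rho> \<le> Re x \<Longrightarrow> i < n \<Longrightarrow> j < n \<Longrightarrow> Yraw x i j = Y0 x i j"
  using Yraw_eq[of x 0 i j] by simp

lemma a_meromorphic: "i < n \<Longrightarrow> j < n \<Longrightarrow> (\<lambda>x. a x i j) meromorphic_on S"
  using meromorphic_on_subset[OF rf_eval_meromorphic] by (simp add: rm_eval_index[OF A])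

lemma a_analytic: "i < n \<Longrightarrow> j < n \<Longrightarrow> Some z \<notin> rm_poles A \<Longrightarrow> (\<lambda>x. a x i j) analytic_on {z}"
  using rf_eval_analytic_at[OF not_rm_poleD[OF A]] by (simp add: rm_eval_index[OF A])

lemma shift_analytic: "(\<lambda>x. x + complex_of_real h) analytic_on S"
  by (intro analytic_intros)

lemma analytic_shift: "f analytic_on {z + of_real h} \<Longrightarrow> (\<lambda>x. f (x + complex_of_real h)) analytic_on {z}"
proof -
  assume "f analytic_on {z + of_real h}"
  hence "(f \<circ> (\<lambda>x. x + complex_of_real h)) analytic_on {z}"
    by (rule analytic_on_compose_gen[OF shift_analytic]) simp
  thus ?thesis by (simp add: o_def)
qed

lemma meromorphic_shift: "f meromorphic_on {z + of_real h} \<Longrightarrow> (\<lambda>x. f (x + complex_of_real h)) meromorphic_on {z}"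
  by (rule meromorphic_on_compose[OF _ shift_analytic]) auto

text \<open>The step from x + (k + 1) h to x + k h evaluates A at the former point and divides by
  the latter; hence the two differently indexed conditions.\<close>

lemma Ys_analytic:
  assumes "\<rho> < Re z + real N * h" "i < n" "j < n"
    and "\<And>k. k < N \<Longrightarrow> z + of_nat k * of_real h \<noteq> 0" "\<And>k. k < N \<Longrightarrow> Some (z + of_nat (Suc k) * of_real h) \<notin> rm_poles A"
  shows "(\<lambda>x. Ys N x i j) analytic_on {z}"
  using assms
proof (induction N arbitrary: z i j)
  case 0 thus ?case using Y0_analytic by simp
next
  case (Suc N)
  have z0: "z \<noteq> 0" using Suc.prems(4)[of 0] by simp
  have IH: "(\<lambda>x. Ys N x i j) analytic_on {z + of_real h}" if "i < n" "j < n" for i j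
  proof (rule Suc.IH[OF _ that])
    show "\<rho> < Re (z + of_real h) + real N * h" using Suc.prems(1) by (simp add: algebra_simps)
    show "z + of_real h + of_nat k * of_real h \<noteq> 0" if "k < N" for k
      using Suc.prems(4)[of "Suc k"] that by (simp add: algebra_simps)
    show "Some (z + of_real h + of_nat (Suc k) * of_real h) \<notin> rm_poles A" if "k < N" for k
      using Suc.prems(5)[of "Suc k"] that by (simp add: algebra_simps)
  qed
  have an: "(\<lambda>x. a x i j) analytic_on {z + of_real h}" if "i < n" "j < n" for i j
    using a_analytic[OF that] Suc.prems(5)[of 0] by simp
  show ?case unfolding Ys.simps
    by (intro analytic_on_diff analytic_on_mult analytic_on_divide analytic_on_const analytic_on_ident
          mm_analytic analytic_shift IH an Suc.prems) (use z0 in auto)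
qed

lemma Ys_meromorphic:
  assumes "\<rho> < Re z + real N * h" "i < n" "j < n"
  shows "(\<lambda>x. Ys N x i j) meromorphic_on {z}"
  using assms
proof (induction N arbitrary: z i j)
  case 0 thus ?case using Y0_analytic by (simp add: analytic_on_imp_meromorphic_on)
next
  case (Suc N)
  have IH: "(\<lambda>x. Ys N x i j) meromorphic_on {z + of_real h}" if "i < n" "j < n" for i j
    using Suc.prems(1) by (intro Suc.IH[OF _ that]) (simp add: algebra_simps)
  show ?case unfolding Ys.simps
    by (intro meromorphic_on_diff meromorphic_on_mult meromorphic_on_divide meromorphic_on_const
          analytic_on_imp_meromorphic_on[OF analytic_on_ident]
          mm_meromorphic meromorphic_shift IH a_meromorphic Suc.prems)
qed

lemma Yraw_near:
  assumes "\<rho> < Re z + real N * h" "i < n" "j < n"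
  shows "\<forall>\<^sub>F w in nhds z. Yraw w i j = Ys N w i j"
proof -
  have "\<forall>\<^sub>F w in nhds z. w \<in> {w. \<rho> - real N * h < Re w}"
    using assms by (intro eventually_nhds_in_open open_halfspace_Re_gt) auto
  thus ?thesis by eventually_elim (use Yraw_eq assms in auto)
qed

lemma Yraw_meromorphic:
  assumes "i < n" "j < n"
  shows "(\<lambda>x. Yraw x i j) meromorphic_on UNIV"
proof (subst meromorphic_on_meromorphic_at, intro ballI)
  fix z
  obtain N where N: "\<rho> < Re z + real N * h" using ex_shift by blast
  have "(\<lambda>x. Yraw x i j) meromorphic_on {z} \<longleftrightarrow> (\<lambda>x. Ys N x i j) meromorphic_on {z}"
    using Yraw_near[OF N assms] by (intro meromorphic_on_cong) (auto simp: eventually_at_filter elim: eventually_mono)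
  thus "(\<lambda>x. Yraw x i j) meromorphic_on {z}" using Ys_meromorphic[OF N assms] by simp
qed

lemma Yraw_analytic:
  assumes ij: "i < n" "j < n"
    and "\<And>k. Re z + real k * h \<le> \<rho> \<Longrightarrow> z + of_nat k * of_real h \<noteq> 0"
    and "\<And>k. Re z + real k * h \<le> \<rho> \<Longrightarrow> Some (z + of_nat (Suc k) * of_real h) \<notin> rm_poles A"
  shows "(\<lambda>x. Yraw x i j) analytic_on {z}"
proof -
  \<comment> \<open>The least N restricts the conditions to those k for which z + k h is not yet to
    the right of \<rho>.\<close>
  define N where "N = (LEAST N. \<rho> < Re z + real N * h)"
  have N: "\<rho> < Re z + real N * h" unfolding N_def using ex_shift LeastI_ex by fast
  have k: "Re z + real k * h \<le> \<rho>" if "k < N" for k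
    using not_less_Least[OF that[unfolded N_def]] by simp
  have "(\<lambda>x. Ys N x i j) analytic_on {z}" by (rule Ys_analytic[OF N ij]) (use k assms in auto)
  thus ?thesis using analytic_at_cong[OF Yraw_near[OF N ij] refl] by simp
qed

definition Ycan :: "complex \<Rightarrow> complex mat" where
  "Ycan x = Matrix.mat n n (\<lambda>(i, j). remove_sings (\<lambda>x. Yraw x i j) x)"

lemma Ycan_eq_Yraw:
  assumes "i < n" "j < n"
    and "\<And>k. Re z + real k * h \<le> \<rho> \<Longrightarrow> z + of_nat k * of_real h \<noteq> 0"
    and "\<And>k. Re z + real k * h \<le> \<rho> \<Longrightarrow> Some (z + of_nat (Suc k) * of_real h) \<notin> rm_poles A"
  shows "Ycan z $$ (i, j) = Yraw z i j"
  unfolding Ycan_def using remove_sings_at_analytic[OF Yraw_analytic[OF assms]] assms(1,2) by simp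

lemma Ycan_right:
  assumes "i < n" "j < n" "\<rho> < Re z"
  shows "Ycan z $$ (i, j) = Y0 z i j"
proof -
  have "\<not> Re z + real k * h \<le> \<rho>" for k using assms(3) hp mult_nonneg_nonneg[of "real k" h] by linarith
  hence "Ycan z $$ (i, j) = Yraw z i j" by (intro Ycan_eq_Yraw assms(1,2)) simp_all
  thus ?thesis using Yraw_right[of z i j] assms by simp
qed

section \<open>The continued solution is canonical, and the only one\<close>

definition Fmat :: "complex \<Rightarrow> complex mat" where "Fmat x = Matrix.mat n n (\<lambda>(i, j). F x i j)"

lemma h_exp_Ainf: "h_exp_mat h Ainf x \<in> carrier_mat n n"
  unfolding h_exp_mat_eq[OF Ainf J] by simp

lemma Ycan_right_mat:
  assumes "\<rho> < Re z"
  shows "Ycan z = Fmat z * h_exp_mat h Ainf z"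
proof (rule eq_matI)
  have F: "Fmat z \<in> carrier_mat n n" by (simp add: Fmat_def)
  have c: "Fmat z * h_exp_mat h Ainf z \<in> carrier_mat n n" using F h_exp_Ainf by (rule mult_carrier_mat)
  fix i j assume "i < dim_row (Fmat z * h_exp_mat h Ainf z)" "j < dim_col (Fmat z * h_exp_mat h Ainf z)"
  hence ij: "i < n" "j < n" using carrier_matD[OF c] by auto
  have "mm n (fm (Fmat z)) (fm (h_exp_mat h Ainf z)) i j = mm n (F z) (E z) i j"
    by (rule mm_cong) (use ij in \<open>auto simp: Fmat_def E_def\<close>)
  thus "Ycan z $$ (i, j) = (Fmat z * h_exp_mat h Ainf z) $$ (i, j)"
    using Ycan_right[OF ij assms] mat_mult_mm[OF F h_exp_Ainf ij] by (simp add: Y0_def)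
qed (use carrier_matD[OF h_exp_Ainf] in \<open>auto simp: Ycan_def Fmat_def\<close>)

lemma series_has_fact_series:
  assumes D: "summable (\<lambda>s. mn n (D s) * fe h s \<rho>)" and ij: "i < n" "j < n"
  shows "has_fact_series h (\<lambda>s. (if s = 0 then c else 0) + D s i j) (\<lambda>x. c + ev h D x i j)"
  unfolding has_fact_series_def
proof (intro exI[of _ \<rho>] conjI allI impI)
  show "0 \<le> \<rho>" using \<rho> by simp
  fix x :: complex assume "\<rho> < Re x"
  hence d: "hdom h \<rho> x" by (intro hdom_Re) simp
  have "(\<lambda>s. if s = 0 then c else 0) sums c" using sums_single[of 0 "\<lambda>_. c"] by simp
  hence "(\<lambda>s. (if s = 0 then c else 0) + D s i j * fe h s x) sums (c + ev h D x i j)"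
    by (intro sums_add ev_sums[OF D ij d])
  moreover have "(if s = 0 then c else 0) + D s i j * fe h s x = ((if s = 0 then c else 0) + D s i j) * inverse (h_rising h s x)" for s
    by (simp add: fe_def algebra_simps)
  ultimately show "(\<lambda>s. ((if s = 0 then c else 0) + D s i j) * inverse (h_rising h s x)) sums (c + ev h D x i j)"
    by simp
qed

lemma Fmat_GL:
  shows "Fmat \<in> GL_O_fact n h"
    and "mat_has_fact_series n h (\<lambda>s. Matrix.mat n n (\<lambda>(i, j). (if s = 0 then (if i = j then 1 else 0) else 0) + U s i j)) Fmat"
proof -
  \<comment> \<open>The locale of factorial kernels with U in the role of B; its
    \<open>inverse_series\<close> inverts 1 + U.\<close>
  interpret K: fact_kernel n h \<rho> U
    using h \<rho> U(1) U_summable(2) by unfold_locales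
  have "K.\<beta> \<le> 1 / 2" using U_summable(3) by (simp add: K.\<beta>_def)
  then obtain W where W: "\<And>i j. W 0 i j = 0" "summable (\<lambda>s. mn n (W s) * fe h s \<rho>)"
    "\<And>x i j. hdom h \<rho> x \<Longrightarrow> i < n \<Longrightarrow> j < n \<Longrightarrow> ev h U x i j + ev h W x i j + mm n (ev h U x) (ev h W x) i j = 0"
    by (rule K.inverse_series) blast
  define G where "G x = Matrix.mat n n (\<lambda>(i, j). (if i = j then 1 else 0) + ev h W x i j)" for x
  have f1: "has_fact_series h (\<lambda>s. (if s = 0 then (if i = j then 1 else 0) else 0) + U s i j) (\<lambda>x. F x i j)" if "i < n" "j < n" for i j
    unfolding F_def by (rule series_has_fact_series[OF U_summable(2) that])
  have "Fmat \<in> M_O_fact n h"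
    unfolding M_O_fact_def O_fact_def Fmat_def using f1 by auto
  moreover have "G \<in> M_O_fact n h"
  proof -
    have "has_fact_series h (\<lambda>s. (if s = 0 then (if i = j then 1 else 0) else 0) + W s i j) (\<lambda>x. G x $$ (i, j))"
      if "i < n" "j < n" for i j
      using series_has_fact_series[OF W(2) that, of "if i = j then 1 else 0"] that by (simp add: G_def)
    hence "\<exists>a. has_fact_series h a (\<lambda>x. G x $$ (i, j))" if "i < n" "j < n" for i j
      using that by blast
    thus ?thesis by (simp add: M_O_fact_def O_fact_def) (simp add: G_def)
  qed
  moreover have "Fmat x * G x = 1\<^sub>m n \<and> G x * Fmat x = 1\<^sub>m n" if x: "\<rho> < Re x" for x
  proof -
    have d: "hdom h \<rho> x" using x by (intro hdom_Re) simp
    have c: "Fmat x \<in> carrier_mat n n" "G x \<in> carrier_mat n n" by (simp_all add: Fmat_def G_def)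
    have "Fmat x * G x = 1\<^sub>m n"
    proof (rule eq_matI)
      fix i j assume "i < dim_row (1\<^sub>m n :: complex mat)" "j < dim_col (1\<^sub>m n :: complex mat)"
      hence ij: "i < n" "j < n" by auto
      have "(Fmat x * G x) $$ (i, j) = mm n (fm (Fmat x)) (fm (G x)) i j" by (rule mat_mult_mm[OF c ij])
      also have "\<dots> = mm n (\<lambda>i j. (if i = j then 1 else 0) + ev h U x i j) (\<lambda>i j. (if i = j then 1 else 0) + ev h W x i j) i j"
        by (rule mm_cong) (use ij in \<open>auto simp: Fmat_def G_def F_def\<close>)
      also have "\<dots> = (if i = j then 1 else 0) + (ev h U x i j + ev h W x i j + mm n (ev h U x) (ev h W x) i j)"
        unfolding mm_lin(1) mm_lin(4) mm_one[OF ij] by (simp add: algebra_simps)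
      finally show "(Fmat x * G x) $$ (i, j) = 1\<^sub>m n $$ (i, j)" using W(3)[OF d ij] ij by simp
    qed (use carrier_matD[OF c(1)] carrier_matD[OF c(2)] in auto)
    thus ?thesis using mat_mult_left_right_inverse[OF c] by simp
  qed
  ultimately show "Fmat \<in> GL_O_fact n h" unfolding GL_O_fact_def by blast
  show "mat_has_fact_series n h (\<lambda>s. Matrix.mat n n (\<lambda>(i, j). (if s = 0 then (if i = j then 1 else 0) else 0) + U s i j)) Fmat"
    unfolding mat_has_fact_series_def using f1 by (auto simp: Fmat_def)
qed

lemma cosparse_shift:
  assumes "\<forall>\<^sub>\<approx>x\<in>UNIV. P (x :: complex)"
  shows "\<forall>\<^sub>\<approx>x\<in>UNIV. P (x - of_real h)"
proof -
  have "eventually P (at (x - of_real h))" for x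
    using assms by (rule eventually_cosparse_imp_eventually_at) simp
  hence "eventually (\<lambda>x. P (x - of_real h)) (at x)" for x
    using eventually_filtermap[of P "\<lambda>x. x - of_real h" "at x"] filtermap_at_shift[of "complex_of_real h" x] by simp
  thus ?thesis by (subst eventually_cosparse_open_eq) auto
qed

lemma Ycan_cosparse: "\<forall>\<^sub>\<approx>x\<in>UNIV. \<forall>i<n. \<forall>j<n. Ycan x $$ (i, j) = Yraw x i j"
proof -
  have "\<forall>\<^sub>\<approx>x\<in>UNIV. \<forall>i\<in>{..<n}. \<forall>j\<in>{..<n}. remove_sings (\<lambda>x. Yraw x i j) x = Yraw x i j"
    by (intro eventually_ball_finite ballI eventually_remove_sings_eq Yraw_meromorphic) auto
  thus ?thesis by (rule eventually_mono) (auto simp: Ycan_def)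
qed

lemma neq_cosparse: "\<forall>\<^sub>\<approx>x\<in>UNIV. x \<noteq> (p :: complex)"
  by (subst eventually_cosparse_open_eq) (auto intro: eventually_neq_at_within)

lemma Ycan_canonical: "is_canonical_solution n h A Ycan"
  unfolding is_canonical_solution_def
proof (intro conjI allI impI)
  show "Ycan x \<in> carrier_mat n n" for x by (simp add: Ycan_def)
  show "(\<lambda>x. Ycan x $$ (i, j)) nicely_meromorphic_on UNIV" if "i < n" "j < n" for i j
    using remove_sings_nicely_meromorphic[OF Yraw_meromorphic[OF that]] that by (simp add: Ycan_def)
  show "\<forall>\<^sub>\<approx>x\<in>UNIV. delta h Ycan x = rm_eval A (Some x) * Ycan x"
    using Ycan_cosparse cosparse_shift[OF Ycan_cosparse] neq_cosparse[of "of_real h"]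
  proof eventually_elim
    case (elim x)
    have c: "Ycan x \<in> carrier_mat n n" "Ycan (x - of_real h) \<in> carrier_mat n n" "rm_eval A (Some x) \<in> carrier_mat n n"
      using A by (auto simp: Ycan_def)
    have w0: "x - of_real h \<noteq> 0" using elim(3) by simp
    show ?case
    proof (rule eq_matI)
      fix i j assume "i < dim_row (rm_eval A (Some x) * Ycan x)" "j < dim_col (rm_eval A (Some x) * Ycan x)"
      hence ij: "i < n" "j < n" using carrier_matD[OF c(1)] carrier_matD[OF c(3)] by auto
      have "(rm_eval A (Some x) * Ycan x) $$ (i, j) = mm n (a x) (fm (Ycan x)) i j" by (rule mat_mult_mm[OF c(3,1) ij])
      also have "\<dots> = mm n (a x) (Yraw x) i j" by (rule mm_cong) (use elim ij in auto)
      finally have r: "(rm_eval A (Some x) * Ycan x) $$ (i, j) = mm n (a x) (Yraw x) i j" .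
      have "delta h Ycan x $$ (i, j) = (x - of_real h) / of_real h * (Ycan x $$ (i, j) - Ycan (x - of_real h) $$ (i, j))"
        using ij carrier_matD[OF c(1)] carrier_matD[OF c(2)] by (simp add: delta_def)
      also have "\<dots> = (x - of_real h) / of_real h * (Yraw x i j - Yraw (x - of_real h) i j)"
        using elim(1,2) ij by simp
      also have "\<dots> = mm n (a x) (Yraw x) i j"
        using Yraw_rec[OF ij, of "x - of_real h"] w0 hp by simp
      finally show "delta h Ycan x $$ (i, j) = (rm_eval A (Some x) * Ycan x) $$ (i, j)" using r by simp
    qed (use carrier_matD[OF c(1)] carrier_matD[OF c(2)] carrier_matD[OF c(3)] in \<open>auto simp: delta_def\<close>)
  qed
  show "\<exists>F Fs. F \<in> GL_O_fact n h \<and> mat_has_fact_series n h Fs F \<and> Fs 0 = 1\<^sub>m n \<and> (\<exists>c. \<forall>x. c < Re x \<longrightarrow> Ycan x = F x * h_exp_mat h Ainf x)"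
  proof (intro exI conjI allI impI)
    show "Fmat \<in> GL_O_fact n h" by (rule Fmat_GL)
    show "mat_has_fact_series n h (\<lambda>s. Matrix.mat n n (\<lambda>(i, j). (if s = 0 then (if i = j then 1 else 0) else 0) + U s i j)) Fmat"
      by (rule Fmat_GL)
    show "Matrix.mat n n (\<lambda>(i, j). (if (0::nat) = 0 then (if i = j then 1 else 0) else 0) + U 0 i j) = 1\<^sub>m n"
      by (rule eq_matI) (auto simp: U(1))
    show "Ycan x = Fmat x * h_exp_mat h Ainf x" if "\<rho> < Re x" for x by (rule Ycan_right_mat[OF that])
  qed
qed

text \<open>The regular factors of Y and \<open>Ycan\<close> have the same constant term. Their
  difference satisfies the gauge equation with zero right-hand side, so stability makes it vanish;
  equality on a half-plane then extends by the identity theorem.\<close>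

lemma canonical_unique_aux:
  assumes Yc: "\<And>x. Y x \<in> carrier_mat n n"
    and Ym: "\<And>i j. i < n \<Longrightarrow> j < n \<Longrightarrow> (\<lambda>x. Y x $$ (i, j)) nicely_meromorphic_on UNIV"
    and Yeq: "\<forall>\<^sub>\<approx>x\<in>UNIV. delta h Y x = rm_eval A (Some x) * Y x"
    and F'c: "\<And>x. F' x \<in> carrier_mat n n" and Fs0: "Fs 0 = 1\<^sub>m n"
    and Fsum: "\<And>i j. i < n \<Longrightarrow> j < n \<Longrightarrow> summable (\<lambda>s. cmod (Fs s $$ (i, j)) * fe h s \<rho>)"
    and Fser: "\<And>x i j. i < n \<Longrightarrow> j < n \<Longrightarrow> \<rho> \<le> Re x \<Longrightarrow> (\<lambda>s. Fs s $$ (i, j) * fe h s x) sums (F' x $$ (i, j))"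
    and YF: "\<And>x. \<rho> \<le> Re x \<Longrightarrow> Y x = F' x * h_exp_mat h Ainf x"
    and bsb: "\<And>m c. (m, c) \<in> set bs \<Longrightarrow> h * cmod c < \<rho>"
  shows "Y = Ycan"
proof -
  define G where "G x i j = F' x $$ (i, j)" for x i j
  define D where "D s i j = (if s = 0 then 0 else Fs s $$ (i, j) - U s i j)" for s i j
  have Dsum: "summable (\<lambda>s. mn n (D s) * fe h s \<rho>)"
  proof -
    have "summable (\<lambda>s. \<Sum>i<n. \<Sum>j<n. cmod (Fs s $$ (i, j)) * fe h s \<rho> + cmod (U s i j) * fe h s \<rho>)"
      by (intro summable_sum summable_add Fsum entry_summable[OF U_summable(2)]) auto
    thus ?thesis
    proof (rule summable_comparison_test')
      fix s
      have "mn n (D s) * fe h s \<rho> = (\<Sum>i<n. \<Sum>j<n. cmod (D s i j) * fe h s \<rho>)"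
        by (simp add: mn_def sum_distrib_right)
      also have "\<dots> \<le> (\<Sum>i<n. \<Sum>j<n. cmod (Fs s $$ (i, j)) * fe h s \<rho> + cmod (U s i j) * fe h s \<rho>)"
        unfolding distrib_right[symmetric] D_def
        by (intro sum_mono mult_right_mono fe0) (auto intro: norm_triangle_ineq4)
      finally show "norm (mn n (D s) * fe h s \<rho>) \<le> (\<Sum>i<n. \<Sum>j<n. cmod (Fs s $$ (i, j)) * fe h s \<rho> + cmod (U s i j) * fe h s \<rho>)"
        by (simp add: abs_mult fe0)
    qed
  qed
  have evD: "ev h D x i j = G x i j - F x i j" if x: "\<rho> \<le> Re x" and ij: "i < n" "j < n" for x i j
  proof -
    have d: "hdom h \<rho> x" using x by (rule hdom_Re)
    have "(\<lambda>s. if s = 0 then (if i = j then 1 else 0) else 0) sums (if i = j then 1 else (0::complex))"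
      using sums_single[of 0 "\<lambda>_. if i = j then 1 else (0::complex)"] by simp
    hence "(\<lambda>s. Fs s $$ (i, j) * fe h s x - ((if s = 0 then (if i = j then 1 else 0) else 0) + U s i j * fe h s x)) sums (G x i j - F x i j)"
      unfolding G_def F_def by (intro sums_diff sums_add Fser[OF ij x] ev_sums[OF U_summable(2) ij d])
    moreover have "Fs s $$ (i, j) * fe h s x - ((if s = 0 then (if i = j then 1 else 0) else 0) + U s i j * fe h s x) = D s i j * fe h s x" for s
      using ij by (auto simp: D_def Fs0 U(1) algebra_simps)
    ultimately show ?thesis by (simp add: ev_def sums_iff)
  qed
  define \<Phi> where "\<Phi> G x i j = (x - of_real h) / of_real h * (G x i j - G (x - of_real h) i j) - mm n (a x) (G x) i j + mm n (G (x - of_real h)) A0 i j"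
    for G :: "complex \<Rightarrow> nat \<Rightarrow> nat \<Rightarrow> complex" and x i j
  have Gan: "(\<lambda>x. G x i j) analytic_on {z}" if z: "\<rho> < Re z" and ij: "i < n" "j < n" for z i j
  proof -
    have "(\<lambda>x. F x i j + ev h D x i j) holomorphic_on {x. \<rho> < Re x}"
      by (intro holomorphic_on_add F_holomorphic ev_holomorphic[OF Dsum] ij)
    hence "(\<lambda>x. G x i j) holomorphic_on {x. \<rho> < Re x}"
      by (rule holomorphic_transform) (use evD ij in auto)
    thus ?thesis using z analytic_at open_halfspace_Re_gt by blast
  qed
  \<comment> \<open>The difference equation is known off a discrete set only; there the invertible
    character is cancelled from \<open>product_shift\<close>.\<close>
  have ev0: "\<forall>\<^sub>\<approx>x\<in>UNIV. \<rho> + h < Re x \<longrightarrow> (\<forall>i<n. \<forall>j<n. \<Phi> G x i j = 0)"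
    using Yeq
  proof (rule eventually_mono, intro impI allI)
    fix x i j assume eqx: "delta h Y x = rm_eval A (Some x) * Y x" and x: "\<rho> + h < Re x" and ij: "i < n" "j < n"
    have x1: "h < Re x" "\<rho> \<le> Re x" "\<rho> \<le> Re (x - of_real h)" using x \<rho> hp by auto
    have w0: "x - of_real h \<noteq> 0" using x \<rho> by auto
    have Yx: "Y x $$ (i, j) = mm n (G x) (E x) i j" if "\<rho> \<le> Re x" "i < n" "j < n" for x i j
      unfolding YF[OF that(1)] mat_mult_mm[OF F'c h_exp_Ainf that(2,3)] G_def E_def ..
    have "mm n (\<Phi> G x) (fm (h_exp_mat h Ainf x)) i j = 0" if ij: "i < n" "j < n" for i j
    proof -
      have aY: "mm n (a x) (mm n (G x) (E x)) i j = (rm_eval A (Some x) * Y x) $$ (i, j)"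
        unfolding mat_mult_mm[OF rm_eval_carrier[OF A] Yc ij] by (rule mm_cong) (use ij Yx[OF x1(2)] in auto)
      have "delta h Y x $$ (i, j) = (x - of_real h) / of_real h * (mm n (G x) (E x) i j - mm n (G (x - of_real h)) (E (x - of_real h)) i j)"
        unfolding Yx[OF x1(2) ij, symmetric] Yx[OF x1(3) ij, symmetric]
        using ij carrier_matD[OF Yc[of x]] carrier_matD[OF Yc[of "x - of_real h"]] by (simp add: delta_def)
      hence "mm n (G x) (E x) i j - mm n (G (x - of_real h)) (E (x - of_real h)) i j - of_real h / (x - of_real h) * mm n (a x) (mm n (G x) (E x)) i j = 0"
        unfolding aY eqx[symmetric] using w0 hp by simp
      hence "of_real h / (x - of_real h) * mm n (\<Phi> G x) (E x) i j = 0"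
        unfolding product_shift[OF x1(1) ij] \<Phi>_def .
      thus ?thesis using w0 hp by (simp add: E_def[abs_def])
    qed
    moreover have "det (h_exp_mat h Ainf x) \<noteq> 0"
    proof (rule h_exp_mat_det[OF Ainf J hp])
      show "h * cmod c < Re x" if "(m, c) \<in> set bs" for m c using bsb[OF that] x1(2) by linarith
      show "0 < Re x" using x1(2) \<rho> by linarith
    qed
    ultimately show "\<Phi> G x i j = 0" by (intro cancel_right_factor[OF h_exp_Ainf _ _ ij])
  qed
  \<comment> \<open>Continuity of the gauge defect removes the exceptional points.\<close>
  have \<Phi>0: "\<Phi> G x i j = 0" if x: "\<rho> + h < Re x" and ij: "i < n" "j < n" for x i j
  proof -
    have xs: "\<rho> < Re x" "\<rho> < Re (x - of_real h)" using x hp by auto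
    have p: "Some x \<notin> rm_poles A" using nopole[of x] complex_Re_le_cmod[of x] xs(1) by linarith
    have sh: "(\<lambda>x. G (x - of_real h) i j) analytic_on {x}" if "i < n" "j < n" for i j
    proof -
      have "((\<lambda>x. G x i j) \<circ> (\<lambda>x. x - of_real h)) analytic_on {x}"
        by (rule analytic_on_compose_gen[OF _ Gan[OF xs(2) that]]) (auto intro!: analytic_intros)
      thus ?thesis by (simp add: o_def)
    qed
    have A0an: "(\<lambda>x. A0 i j) analytic_on {x}" for i j by (rule analytic_on_const)
    have "(\<lambda>x. \<Phi> G x i j) analytic_on {x}"
      unfolding \<Phi>_def using hp
      by (intro analytic_on_diff analytic_on_add analytic_on_mult analytic_on_divide analytic_on_const analytic_on_ident
          mm_analytic Gan[OF xs(1)] sh a_analytic[OF _ _ p] A0an ij) auto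
    hence "(\<lambda>x. \<Phi> G x i j) \<midarrow>x\<rightarrow> \<Phi> G x i j"
      using analytic_at_imp_isCont isContD by blast
    moreover have "\<forall>\<^sub>F w in at x. \<Phi> G w i j = 0"
    proof -
      have "\<forall>\<^sub>F w in at x. \<rho> + h < Re w \<longrightarrow> (\<forall>i<n. \<forall>j<n. \<Phi> G w i j = 0)"
        using ev0 by (rule eventually_cosparse_imp_eventually_at) simp
      moreover have "\<forall>\<^sub>F w in at x. w \<in> {w. \<rho> + h < Re w}"
        by (intro eventually_at_in_open' open_halfspace_Re_gt) (use x in simp)
      ultimately show ?thesis by eventually_elim (use ij in auto)
    qed
    hence "(\<lambda>x. \<Phi> G x i j) \<midarrow>x\<rightarrow> 0" by (rule tendsto_eventually)
    ultimately show ?thesis using tendsto_unique[OF at_neq_bot] by blast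
  qed
  have coeffs: "sylv n s A0 (D s) i j = rhs (\<lambda>s i j. 0) D s i j" if ij: "i < n" "j < n" for s i j
  proof (rule gauge_coeffs[OF Dsum _ hp _ ij])
    show "summable (\<lambda>s. mn n (\<lambda>i j. 0) * fe h s \<rho>)" by (simp add: mn_def)
    fix x i j assume x: "\<rho> + h + 1 \<le> x" and ij: "i < n" "j < n"
    define z where "z = complex_of_real x"
    have z: "\<rho> + h < Re z" "\<rho> + h \<le> Re z" "\<rho> \<le> Re z" "\<rho> \<le> Re (z - of_real h)" using x hp by (auto simp: z_def)
    have 1: "ev h D x i j = 0 * (if i = j then 1 else 0) + ev h D x i j" for x i j by simp
    have "\<Phi> (ev h D) z i j = \<Phi> G z i j - \<Phi> F z i j"
    proof -
      have m: "mm n (a z) (ev h D z) i j = mm n (a z) (\<lambda>i j. G z i j - F z i j) i j"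
        "mm n (ev h D (z - of_real h)) A0 i j = mm n (\<lambda>i j. G (z - of_real h) i j - F (z - of_real h) i j) A0 i j"
        by (rule mm_cong; use ij evD z in auto)+
      have alg: "k * (g - f - (g' - f')) - (p - q) + (p' - q') = k * (g - g') - p + p' - (k * (f - f') - q + q')"
        for k g f g' f' p q p' q' :: complex by (simp add: algebra_simps)
      show ?thesis unfolding \<Phi>_def m mm_lin evD[OF z(3) ij] evD[OF z(4) ij] by (rule alg)
    qed
    also have "\<dots> = 0"
    proof -
      have "\<Phi> F z i j = 0" unfolding \<Phi>_def by (rule F_shift[OF z(2) ij])
      thus ?thesis using \<Phi>0[OF z(1) ij] by simp
    qed
    finally have \<Phi>D: "\<Phi> (ev h D) z i j = 0" .
    have "dev D z i j - mm n A0 (ev h D z) i j + mm n (ev h D z) A0 i j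
          - (0 * ev h B z i j + mm n (ev h B z) (ev h D z) i j + of_real h / (z - of_real h) * mm n (dev D z) A0 i j) = 0"
      using gauge_shift[OF z(2) Dsum 1 ij] \<Phi>D[unfolded \<Phi>_def] by (simp only:)
    thus "dev D (complex_of_real x) i j - mm n A0 (ev h D (of_real x)) i j + mm n (ev h D (of_real x)) A0 i j
        - (ev h (\<lambda>s i j. 0) (of_real x) i j + mm n (ev h B (of_real x)) (ev h D (of_real x)) i j
           + of_real h / (of_real x - of_real h) * mm n (dev D (of_real x)) A0 i j) = 0"
      by (simp add: z_def ev_def[of h "\<lambda>s i j. 0"])
  qed
  have D0: "D s i j = 0" if ij: "i < n" "j < n" for s i j
  proof (cases "s = 0")
    case False
    have "(\<Sum>t\<le>s. real t * mn n (D t) * fe h t \<rho>) \<le> 2 * \<kappa> * (\<Sum>t\<le>s. mn n (\<lambda>i j. 0) * fe h t \<rho>)"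
      by (rule stability) (use coeffs in \<open>auto simp: D_def\<close>)
    moreover have "real s * mn n (D s) * fe h s \<rho> \<le> (\<Sum>t\<le>s. real t * mn n (D t) * fe h t \<rho>)"
      by (rule member_le_sum) (auto intro!: mult_nonneg_nonneg fe0)
    ultimately have "real s * mn n (D s) * fe h s \<rho> \<le> 0" by (simp add: mn_def)
    hence "mn n (D s) \<le> 0" using False fe_pos[OF h \<rho>, of s] by (simp add: mult_le_0_iff)
    hence "cmod (D s i j) \<le> 0" by (rule order_trans[OF entry_le_mn[OF ij]])
    thus ?thesis by simp
  qed (simp add: D_def)
  show ?thesis
  proof (rule ext, rule eq_matI)
    fix x i j assume "i < dim_row (Ycan x)" "j < dim_col (Ycan x)"
    hence ij: "i < n" "j < n" by (auto simp: Ycan_def)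
    have "(\<lambda>x. Y x $$ (i, j)) = (\<lambda>x. Ycan x $$ (i, j))"
    proof (rule nicely_meromorphic_eqI[OF Ym[OF ij], where c = \<rho>])
      show "(\<lambda>x. Ycan x $$ (i, j)) nicely_meromorphic_on UNIV"
        using Ycan_canonical ij unfolding is_canonical_solution_def by blast
      fix x assume x: "\<rho> < Re x"
      have "G x i j = F x i j" if "i < n" "j < n" for i j
        using evD[of x i j] x that D0[OF that] by (simp add: ev_def)
      hence "mm n (G x) (E x) i j = Y0 x i j" unfolding Y0_def by (intro mm_cong) (use ij in auto)
      moreover have "Y x $$ (i, j) = mm n (G x) (E x) i j"
        using YF[of x] x mat_mult_mm[OF F'c h_exp_Ainf ij, of x] by (simp add: G_def[abs_def] E_def[abs_def])
      ultimately show "Y x $$ (i, j) = Ycan x $$ (i, j)" using Ycan_right[OF ij x] by simp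
    qed
    from fun_cong[OF this, of x] show "Y x $$ (i, j) = Ycan x $$ (i, j)" .
  qed (use carrier_matD[OF Yc] in \<open>auto simp: Ycan_def\<close>)
qed

lemma canonical_system_mono:
  assumes "\<rho> \<le> r"
  shows "canonical_system n h r B \<kappa> A0 A Q R bs"
proof -
  interpret g: gauge_system n h r B \<kappa> A0 by (rule gauge_system_mono[OF assms])
  have "\<kappa> * g.\<beta> \<le> \<kappa> * \<beta>" by (intro mult_left_mono fact_kernel_mono(2)[OF assms] \<kappa>)
  hence "\<kappa> * g.\<beta> \<le> 1 / 4" using small2 by linarith
  moreover have "(\<lambda>s. B s i j * fe h s x) sums (rm_eval A (Some x) $$ (i, j) - A0 i j)" if "hdom h r x" "i < n" "j < n" for x i j
    by (rule A_series[OF hdom_mono[OF that(1) assms] that(2,3)])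
  ultimately show ?thesis using A hp J A0_eq nopole assms by unfold_locales auto
qed

text \<open>The series of an arbitrary solution may converge only far to the right, so the
  comparison is made with the solution constructed from a larger point r and the same B.\<close>

lemma canonical_eventually:
  assumes Y: "is_canonical_solution n h A Y"
  shows "\<exists>c. \<forall>r\<ge>c. \<rho> \<le> r \<longrightarrow> Y = canonical_system.Ycan n h r B A0 A"
proof -
  from Y obtain F' Fs c0 where F': "F' \<in> GL_O_fact n h" "mat_has_fact_series n h Fs F'" "Fs 0 = 1\<^sub>m n"
    and c0: "\<And>x. c0 < Re x \<Longrightarrow> Y x = F' x * h_exp_mat h Ainf x"
    unfolding is_canonical_solution_def by blast
  define P where "P i j c \<longleftrightarrow> 0 < c \<and> (i < n \<longrightarrow> j < n \<longrightarrow> (\<forall>r>c. summable (\<lambda>s. cmod (Fs s $$ (i, j)) * fe h s r)) \<and>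
     (\<forall>x. c < Re x \<longrightarrow> (\<lambda>s. Fs s $$ (i, j) * fe h s x) sums (F' x $$ (i, j))))" for i j c
  have exP: "\<exists>c. P i j c" for i j
  proof (cases "i < n \<and> j < n")
    case True
    hence hs: "has_fact_series h (\<lambda>s. Fs s $$ (i, j)) (\<lambda>x. F' x $$ (i, j))"
      using F'(2) by (auto simp: mat_has_fact_series_def)
    obtain c where "0 < c" "\<And>\<rho>. c < \<rho> \<Longrightarrow> summable (\<lambda>s. cmod (Fs s $$ (i, j)) * fe h s \<rho>)"
      "\<And>x. c < Re x \<Longrightarrow> (\<lambda>s. Fs s $$ (i, j) * fe h s x) sums (F' x $$ (i, j))"
      by (rule has_fact_series_abs_summable[OF hp hs]) blast
    thus ?thesis unfolding P_def by blast
  next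
    case False
    thus ?thesis unfolding P_def by (intro exI[of _ 1]) auto
  qed
  define c where "c i j = (SOME c. P i j c)" for i j
  have cP: "P i j (c i j)" for i j unfolding c_def using exP by (rule someI_ex)
  have c: "0 < c i j" "i < n \<Longrightarrow> j < n \<Longrightarrow> c i j < r \<Longrightarrow> summable (\<lambda>s. cmod (Fs s $$ (i, j)) * fe h s r)"
     "i < n \<Longrightarrow> j < n \<Longrightarrow> c i j < Re x \<Longrightarrow> (\<lambda>s. Fs s $$ (i, j) * fe h s x) sums (F' x $$ (i, j))" for i j r x
    using cP[of i j] unfolding P_def by blast+
  have cn: "0 \<le> c i j" for i j by (rule less_imp_le[OF c(1)])
  define c1 where "c1 = (\<Sum>i<n. \<Sum>j<n. c i j)"
  have c1: "c i j \<le> c1" if "i < n" "j < n" for i j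
    unfolding c1_def using that
    by (intro order_trans[OF member_le_sum[of j "{..<n}" "c i"] member_le_sum[of i "{..<n}" "\<lambda>i. \<Sum>j<n. c i j"]])
       (auto intro!: sum_nonneg cn)
  \<comment> \<open>Keeps r beyond h |c| for all eigenvalues c, where \<open>h_exp_mat_det\<close>
    gives an invertible character.\<close>
  define c2 where "c2 = (\<Sum>b\<in>set bs. h * cmod (snd b))"
  have c2: "h * cmod e \<le> c2" if "(m, e) \<in> set bs" for m e
    unfolding c2_def using member_le_sum[of "(m, e)" "set bs" "\<lambda>b. h * cmod (snd b)"] that hp by simp
  show ?thesis
  proof (intro exI[of _ "max (max c0 c1) c2 + 1"] allI impI)
    fix r assume r: "max (max c0 c1) c2 + 1 \<le> r" "\<rho> \<le> r"
    interpret g: canonical_system n h r B \<kappa> A0 A Q R bs by (rule canonical_system_mono[OF r(2)])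
    show "Y = g.Ycan"
    proof (rule g.canonical_unique_aux[where F' = F' and Fs = Fs])
      show "Y x \<in> carrier_mat n n" for x using Y by (auto simp: is_canonical_solution_def)
      show "(\<lambda>x. Y x $$ (i, j)) nicely_meromorphic_on UNIV" if "i < n" "j < n" for i j
        using Y that by (auto simp: is_canonical_solution_def)
      show "\<forall>\<^sub>\<approx>x\<in>UNIV. delta h Y x = rm_eval A (Some x) * Y x" using Y by (auto simp: is_canonical_solution_def)
      show "F' x \<in> carrier_mat n n" for x using F'(2) by (auto simp: mat_has_fact_series_def)
      show "Fs 0 = 1\<^sub>m n" by fact
      show "summable (\<lambda>s. cmod (Fs s $$ (i, j)) * fe h s r)" if "i < n" "j < n" for i j
        using c(2)[OF that] c1[OF that] r(1) by simp
      show "(\<lambda>s. Fs s $$ (i, j) * fe h s x) sums (F' x $$ (i, j))" if "i < n" "j < n" "r \<le> Re x" for x i j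
        using c(3)[OF that(1,2)] c1[OF that(1,2)] r(1) that(3) by simp
      show "Y x = F' x * h_exp_mat h Ainf x" if "r \<le> Re x" for x using c0 r(1) that by simp
      show "h * cmod e < r" if "(m, e) \<in> set bs" for m e using c2[OF that] r(1) by simp
    qed
  qed
qed

text \<open>The construction depends formally on \<rho>. \<open>canonical_eventually\<close> equates
  both an arbitrary solution and \<open>Ycan\<close> with the solution constructed at one large
  point r.\<close>

theorem canonical_solution_eq: "canonical_solution n h A = Ycan"
  unfolding canonical_solution_def
proof (rule the_equality)
  show "is_canonical_solution n h A Ycan" by (rule Ycan_canonical)
  fix Y assume "is_canonical_solution n h A Y"
  then obtain c where c: "\<And>r. c \<le> r \<Longrightarrow> \<rho> \<le> r \<Longrightarrow> Y = canonical_system.Ycan n h r B A0 A"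
    using canonical_eventually by blast
  obtain c' where c': "\<And>r. c' \<le> r \<Longrightarrow> \<rho> \<le> r \<Longrightarrow> Ycan = canonical_system.Ycan n h r B A0 A"
    using canonical_eventually[OF Ycan_canonical] by blast
  show "Y = Ycan" using c[of "max (max c c') \<rho>"] c'[of "max (max c c') \<rho>"] by simp
qed

end

section \<open>Setting up the gauge equation\<close>

text \<open>Origin of the constants: with K = n^2 R M the sum \<beta> is at most K/(\<rho> - R), so
  the summand 8 \<kappa> K in \<rho> gives \<kappa> \<beta> \<le> 1/8. The summand 2 ensures \<rho>
  - h \<ge> 1, so the h-term is at most \<kappa> h \<alpha> \<le> 1/4. The condition on \<rho> does
  not involve h, and h = 0 is allowed.\<close>

lemma gauge_system_of_bounds:
  fixes A :: "complex poly fract mat"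
  assumes A: "A \<in> carrier_mat n n" and inf: "None \<notin> rm_poles A" and np: "\<And>x. R \<le> cmod x \<Longrightarrow> Some x \<notin> rm_poles A"
    and R: "0 < R" and M: "\<And>x i j. cmod x = R \<Longrightarrow> i < n \<Longrightarrow> j < n \<Longrightarrow> cmod (rm_eval A (Some x) $$ (i, j)) \<le> M" and M0: "0 \<le> M"
    and sylv_ex: "\<And>s C. 1 \<le> s \<Longrightarrow> \<exists>X. \<forall>i<n. \<forall>j<n. sylv n s (fm (rm_eval A None)) X i j = C i j"
    and sylv_bd: "\<And>s X. 1 \<le> s \<Longrightarrow> real s * mn n X \<le> \<kappa> * mn n (sylv n s (fm (rm_eval A None)) X)"
    and \<kappa>: "0 < \<kappa>" and \<alpha>: "mn n (fm (rm_eval A None)) \<le> \<alpha>"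
    and \<rho>: "R + 2 + 8 * \<kappa> * (real n * real n * R * M) \<le> \<rho>"
    and h: "0 \<le> h" "h \<le> 1" "4 * \<kappa> * \<alpha> * h \<le> 1"
  obtains B where "gauge_system n h \<rho> B \<kappa> (fm (rm_eval A None))"
    "\<And>r x i j. R < r \<Longrightarrow> hdom h r x \<Longrightarrow> i < n \<Longrightarrow> j < n \<Longrightarrow> (\<lambda>s. B s i j * fe h s x) sums (rm_eval A (Some x) $$ (i, j) - rm_eval A None $$ (i, j))"
    "\<kappa> * fact_kernel.\<beta> n h \<rho> B \<le> 1 / 4"
    "\<And>s i j. i < n \<Longrightarrow> j < n \<Longrightarrow> cmod (B (Suc s) i j) \<le> R * M * h_rising h s R"
proof -
  define K where "K = real n * real n * R * M"
  have K0: "0 \<le> K" using R M0 by (simp add: K_def)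
  have rho: "R + 2 \<le> \<rho>" "R < \<rho>" "0 < \<rho>" "1 \<le> \<rho> - h" "h < \<rho>"
    using \<rho>[folded K_def] K0 \<kappa> R h(2) mult_nonneg_nonneg[of "8 * \<kappa>" K] by linarith+
  define Q where "Q i j a \<longleftrightarrow> (\<forall>s. cmod (a (Suc s)) \<le> R * M * h_rising h s R) \<and>
    (\<forall>r x. R < r \<longrightarrow> hdom h r x \<longrightarrow> (\<lambda>s. a s * fe h s x) sums (rm_eval A (Some x) $$ (i, j))) \<and> a 0 = rm_eval A None $$ (i, j)"
    for i j and a :: "nat \<Rightarrow> complex"
  have exQ: "\<exists>a. Q i j a" if ij: "i < n" "j < n" for i j
  proof -
    define r where "r = A $$ (i, j)"
    have np': "\<not> rf_pole r None" "\<And>x. R \<le> cmod x \<Longrightarrow> \<not> rf_pole r (Some x)"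
      unfolding r_def using not_rm_poleD[OF A ij] inf np by auto
    have Mr: "cmod (rf_eval r (sph_inv w)) \<le> M" if "cmod w = 1 / R" for w
    proof -
      have "w \<noteq> 0" using that R by auto
      moreover have "cmod (1 / w) = R" using that R by (simp add: norm_divide)
      ultimately show ?thesis using M[OF _ ij, of "1 / w"] by (simp add: sph_inv_def r_def rm_eval_index[OF A ij])
    qed
    obtain a where a: "a 0 = rf_eval r (sph_inv 0)" "\<And>s. cmod (a (Suc s)) \<le> R * M * h_rising h s R"
      "\<And>\<rho> x. R < \<rho> \<Longrightarrow> hdom h \<rho> x \<Longrightarrow> (\<lambda>s. a s * fe h s x) sums rf_eval r (sph_inv (1 / x))"
      by (rule holomorphic_at_infinity_fe_expansion[OF h(1) R rf_eval_sph_inv_holomorphic[OF np' R] Mr]) blast+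
    have "(\<lambda>s. a s * fe h s x) sums rf_eval r (Some x)" if "R < t" "hdom h t x" for t x
    proof -
      have "x \<noteq> 0" using hdom_nonzero[OF that(2) h(1), of 0] that(1) R by simp
      thus ?thesis using a(3)[OF that] by (simp add: sph_inv_def)
    qed
    thus ?thesis using a(1,2) by (intro exI[of _ a]) (simp add: Q_def r_def rm_eval_index[OF A ij] sph_inv_def)
  qed
  define a where "a i j = (SOME a. Q i j a)" for i j
  have aQ: "Q i j (a i j)" if "i < n" "j < n" for i j unfolding a_def using exQ[OF that] by (rule someI_ex)
  have a: "cmod (a i j (Suc s)) \<le> R * M * h_rising h s R" "a i j 0 = rm_eval A None $$ (i, j)"
    "R < r \<Longrightarrow> hdom h r x \<Longrightarrow> (\<lambda>s. a i j s * fe h s x) sums (rm_eval A (Some x) $$ (i, j))" if "i < n" "j < n" for i j s r x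
    using aQ[OF that] unfolding Q_def by blast+
  define B where "B s i j = (if s = 0 then 0 else a i j s)" for s i j
  have Bb: "cmod (B (Suc s) i j) \<le> R * M * h_rising h s R" if "i < n" "j < n" for s i j
    using a(1)[OF that] by (simp add: B_def)
  have B0: "B 0 i j = 0" for i j by (simp add: B_def)
  have mB: "\<bar>mn n (B (Suc s))\<bar> \<le> R * (real n * real n * M) * h_rising h s R" for s
    using mn_le[of n "B (Suc s)" "R * M * h_rising h s R"] Bb by (simp add: mult_ac)
  have mB0: "mn n (B 0) = 0" by (simp add: mn_def B0)
  note Bs = fe_coeffs_bound[of h R \<rho> "\<lambda>s. mn n (B s)", OF h(1) R rho(2) mB mB0, unfolded abs_of_nonneg[OF mn_nonneg]]
  interpret k: fact_kernel n h \<rho> B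
    by unfold_locales (rule h(1) rho(3) B0 Bs(1))+
  have \<beta>: "k.\<beta> \<le> K / (\<rho> - R)" using Bs(2) by (simp add: k.\<beta>_def K_def mult_ac)
  have "\<kappa> * k.\<beta> \<le> \<kappa> * (K / (\<rho> - R))" using \<beta> \<kappa> by (intro mult_left_mono) auto
  also have "\<dots> \<le> 1 / 8"
  proof -
    have "8 * (\<kappa> * K) \<le> \<rho> - R" using \<rho> by (simp add: K_def)
    thus ?thesis using rho(2) by (simp add: field_simps)
  qed
  finally have \<kappa>\<beta>: "\<kappa> * k.\<beta> \<le> 1 / 8" .
  have "\<kappa> * (h / (\<rho> - h) * mn n (fm (rm_eval A None))) \<le> \<kappa> * (h * \<alpha>)"
  proof (intro mult_left_mono mult_mono \<alpha>)
    show "h / (\<rho> - h) \<le> h" using rho(4) h(1) mult_left_mono[of 1 "\<rho> - h" h] by (simp add: divide_le_eq)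
  qed (use \<kappa> h in auto)
  also have "\<dots> \<le> 1 / 4" using h(3) by (simp add: mult_ac)
  finally have small: "\<kappa> * (k.\<beta> + h / (\<rho> - h) * mn n (fm (rm_eval A None))) \<le> 1 / 2"
    using \<kappa>\<beta> by (simp add: distrib_left)
  show ?thesis
  proof (rule that[of B])
    show "gauge_system n h \<rho> B \<kappa> (fm (rm_eval A None))"
      using rho(5) \<kappa> sylv_ex sylv_bd small by unfold_locales auto
    show "\<kappa> * k.\<beta> \<le> 1 / 4" using \<kappa>\<beta> by simp
    show "cmod (B (Suc s) i j) \<le> R * M * h_rising h s R" if "i < n" "j < n" for s i j by (rule Bb[OF that])
    fix r x i j assume rx: "R < r" "hdom h r (x::complex)" and ij: "i < n" "j < n"
    have "(\<lambda>s. if s = 0 then a i j 0 else 0) sums a i j 0" using sums_single[of 0 "\<lambda>_. a i j 0"] by simp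
    from sums_diff[OF a(3)[OF ij rx] this]
    have "(\<lambda>s. a i j s * fe h s x - (if s = 0 then a i j 0 else 0)) sums (rm_eval A (Some x) $$ (i, j) - rm_eval A None $$ (i, j))"
      using a(2)[OF ij] by simp
    moreover have "a i j s * fe h s x - (if s = 0 then a i j 0 else 0) = B s i j * fe h s x" for s
      by (simp add: B_def)
    ultimately show "(\<lambda>s. B s i j * fe h s x) sums (rm_eval A (Some x) $$ (i, j) - rm_eval A None $$ (i, j))"
      by simp
  qed
qed

section \<open>Difference quotients\<close>

lemma compact_neighbourhood:
  fixes K :: "complex set"
  assumes "compact K" "open S" "K \<subseteq> S"
  obtains d where "0 < d" "compact (\<Union>x\<in>K. cball x d)" "(\<Union>x\<in>K. cball x d) \<subseteq> S"
proof (cases "K = {}")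
  case True thus ?thesis using that[of 1] by simp
next
  case False
  obtain d where d: "0 < d" "(\<Union>x\<in>K. cball x d) \<subseteq> S"
    using compact_subset_open_imp_cball_epsilon_subset[OF assms] by blast
  have e: "(\<Union>x\<in>K. cball x d) = {x + y |x y. x \<in> K \<and> y \<in> cball 0 d}"
  proof (rule equalityI; rule subsetI)
    fix z assume "z \<in> (\<Union>x\<in>K. cball x d)"
    then obtain x where "x \<in> K" "dist x z \<le> d" by auto
    thus "z \<in> {x + y |x y. x \<in> K \<and> y \<in> cball 0 d}"
      by (intro CollectI exI[of _ x] exI[of _ "z - x"]) (auto simp: dist_norm norm_minus_commute)
  next
    fix z assume "z \<in> {x + y |x y. x \<in> K \<and> y \<in> cball 0 d}"
    then obtain x y where "x \<in> K" "cmod y \<le> d" "z = x + y" by auto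
    thus "z \<in> (\<Union>x\<in>K. cball x d)" by (intro UN_I[of x]) (auto simp: dist_norm)
  qed
  have "compact (\<Union>x\<in>K. cball x d)" unfolding e by (intro compact_sums assms(1) compact_cball)
  thus ?thesis using that d by blast
qed

text \<open>Mean value inequality for f(y) - f'(x) y on the segment from x - h to x, with f'
  uniformly continuous on a compact neighbourhood of K.\<close>

lemma difference_quotient_uniform:
  assumes S: "open S" and f: "\<And>x. x \<in> S \<Longrightarrow> (f has_field_derivative f' x) (at x)" and cf': "continuous_on S f'"
    and K: "compact K" "K \<subseteq> S" and e: "0 < \<epsilon>"
  shows "\<forall>\<^sub>F h in at_right 0. \<forall>x\<in>K. x - of_real h \<in> S \<and> cmod ((f x - f (x - of_real h)) / of_real h - f' x) \<le> \<epsilon>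
     \<and> cmod (f (x - of_real h) - f x) \<le> \<epsilon>"
proof -
  obtain d where d: "0 < d" "compact (\<Union>x\<in>K. cball x d)" "(\<Union>x\<in>K. cball x d) \<subseteq> S"
    by (rule compact_neighbourhood[OF K(1) S K(2)])
  define N where "N = (\<Union>x\<in>K. cball x d)"
  have "uniformly_continuous_on N f'"
    unfolding N_def by (intro compact_uniformly_continuous continuous_on_subset[OF cf'] d)
  then obtain \<delta> where \<delta>: "0 < \<delta>" "\<And>x y. x \<in> N \<Longrightarrow> y \<in> N \<Longrightarrow> dist y x < \<delta> \<Longrightarrow> dist (f' y) (f' x) < \<epsilon>"
    using e unfolding uniformly_continuous_on_def by meson
  have cf: "continuous_on S f" by (intro continuous_at_imp_continuous_on ballI DERIV_isCont[OF f])
  hence "uniformly_continuous_on N f"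
    unfolding N_def by (intro compact_uniformly_continuous continuous_on_subset[OF cf] d)
  then obtain \<delta>' where \<delta>': "0 < \<delta>'" "\<And>x y. x \<in> N \<Longrightarrow> y \<in> N \<Longrightarrow> dist y x < \<delta>' \<Longrightarrow> dist (f y) (f x) < \<epsilon>"
    using e unfolding uniformly_continuous_on_def by meson
  have "\<forall>\<^sub>F h in at_right 0. h \<in> {0<..<min d (min \<delta> \<delta>')}"
    using d \<delta> \<delta>' by (intro eventually_at_right_real) simp
  thus ?thesis
  proof eventually_elim
    case (elim h)
    hence h: "0 < h" "h < d" "h < \<delta>" "h < \<delta>'" by auto
    show ?case
    proof (intro ballI conjI)
      fix x assume x: "x \<in> K"
      define w where "w = x - complex_of_real h"
      have wd: "dist w x = h" using h by (simp add: w_def dist_norm)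
      have xN: "x \<in> N" "w \<in> N" using x wd h(2) d(1) by (auto simp: N_def dist_commute intro!: bexI[of _ x])
      show "x - of_real h \<in> S" using xN(2) d(3) unfolding N_def w_def by blast
      show "cmod (f (x - of_real h) - f x) \<le> \<epsilon>"
        using \<delta>'(2)[OF xN] wd h(4) by (simp add: w_def dist_norm)
      have seg: "y \<in> N \<and> y \<in> S \<and> dist y x < \<delta>" if "y \<in> closed_segment w x" for y
      proof -
        have "dist y x \<le> h" using segment_bound(2)[OF that] wd by (simp add: dist_norm norm_minus_commute)
        hence "y \<in> N" using x h(2) by (auto simp: N_def dist_commute intro!: bexI[of _ x])
        thus ?thesis using d(3) \<open>dist y x \<le> h\<close> h(3) unfolding N_def by (intro conjI) (blast, blast, linarith)
      qed
      have "cmod ((f x - f' x * x) - (f w - f' x * w)) \<le> \<epsilon> * cmod (x - w)"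
      proof (rule field_differentiable_bound[OF convex_closed_segment[of w x], where f = "\<lambda>y. f y - f' x * y" and f' = "\<lambda>y. f' y - f' x"])
        fix y assume y: "y \<in> closed_segment w x"
        show "((\<lambda>y. f y - f' x * y) has_field_derivative f' y - f' x) (at y within closed_segment w x)"
        proof -
          have "((\<lambda>y. f y - f' x * y) has_field_derivative f' y - f' x * 1) (at y)"
            by (intro DERIV_diff f DERIV_cmult DERIV_ident) (use seg[OF y] in blast)
          thus ?thesis using has_field_derivative_at_within by simp
        qed
        show "cmod (f' y - f' x) \<le> \<epsilon>"
          using \<delta>(2)[OF xN(1), of y] seg[OF y] by (simp add: dist_norm)
      qed auto
      hence b: "cmod ((f x - f w) - f' x * of_real h) \<le> \<epsilon> * h"
        using h(1) by (simp add: w_def algebra_simps)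
      have "(f x - f w) / of_real h - f' x = ((f x - f w) - f' x * of_real h) / of_real h"
        using h(1) by (simp add: field_simps)
      thus "cmod ((f x - f (x - of_real h)) / of_real h - f' x) \<le> \<epsilon>"
        using b h(1) by (simp add: w_def norm_divide divide_le_eq)
    qed
  qed
qed

section \<open>Linear differential systems\<close>

text \<open>Integrating the bound for one iterate along the segment gives that for the next. The
  parameter m admits iterates that start at p with values of size m^k/k!, so estimates along
  consecutive segments can be chained.\<close>

lemma picard_segment:
  fixes f :: "nat \<Rightarrow> complex \<Rightarrow> nat \<Rightarrow> nat \<Rightarrow> complex" and b :: "complex \<Rightarrow> nat \<Rightarrow> nat \<Rightarrow> complex"
  assumes der: "\<And>k x i j. x \<in> closed_segment p q \<Longrightarrow> i < n \<Longrightarrow> j < n \<Longrightarrow> ((\<lambda>x. f (Suc k) x i j) has_field_derivative mm n (b x) (f k x) i j) (at x)"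
    and bb: "\<And>x i j. x \<in> closed_segment p q \<Longrightarrow> i < n \<Longrightarrow> j < n \<Longrightarrow> cmod (b x i j) \<le> M"
    and f0: "\<And>x i j. x \<in> closed_segment p q \<Longrightarrow> i < n \<Longrightarrow> j < n \<Longrightarrow> cmod (f 0 x i j) \<le> C"
    and init: "\<And>k i j. i < n \<Longrightarrow> j < n \<Longrightarrow> cmod (f (Suc k) p i j) \<le> C * m ^ Suc k / fact (Suc k)"
    and nn: "0 \<le> m" "0 \<le> M" "0 \<le> C"
    and t: "0 \<le> t" "t \<le> 1" and ij: "i < n" "j < n"
  shows "cmod (f k (p + of_real t * (q - p)) i j) \<le> C * (m + real n * M * cmod (q - p) * t) ^ k / fact k"
  using t ij
proof (induction k arbitrary: t i j)
  case 0
  have "p + of_real t * (q - p) \<in> closed_segment p q"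
    unfolding closed_segment_def using 0 by (intro CollectI exI[of _ t]) (auto simp: scaleR_conv_of_real algebra_simps)
  thus ?case using f0 0 by simp
next
  case (Suc k)
  define L where "L = real n * M * cmod (q - p)"
  have L0: "0 \<le> L" using nn by (simp add: L_def)
  define \<gamma> where "\<gamma> \<tau> = p + of_real \<tau> * (q - p)" for \<tau> :: real
  have \<gamma>S: "\<gamma> \<tau> \<in> closed_segment p q" if "0 \<le> \<tau>" "\<tau> \<le> 1" for \<tau>
    unfolding closed_segment_def \<gamma>_def using that by (intro CollectI exI[of _ \<tau>]) (auto simp: scaleR_conv_of_real algebra_simps)
  show ?case
  proof (cases "t = 0")
    case True thus ?thesis using init Suc.prems by simp
  next
    case False
    hence t: "0 < t" "t \<le> 1" using Suc.prems by auto
    define \<phi> where "\<phi> \<tau> = C * (m + L * \<tau>) ^ Suc k / fact (Suc k)" for \<tau>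
    have vd: "((\<lambda>\<tau>. f (Suc k) (\<gamma> \<tau>) i j) has_vector_derivative (q - p) * mm n (b (\<gamma> \<tau>)) (f k (\<gamma> \<tau>)) i j) (at \<tau>)" if "0 \<le> \<tau>" "\<tau> \<le> 1" for \<tau>
    proof -
      have "(\<gamma> has_vector_derivative (q - p)) (at \<tau>)"
        unfolding \<gamma>_def by (auto intro!: derivative_eq_intros)
      from field_vector_diff_chain_at[OF this der[OF \<gamma>S[OF that] Suc.prems(3,4), of k]]
      show ?thesis by (simp add: o_def)
    qed
    have "norm (f (Suc k) (\<gamma> t) i j - f (Suc k) (\<gamma> 0) i j) \<le> \<phi> t - \<phi> 0"
    proof (rule differentiable_bound_general[OF t(1)])
      show "continuous_on {0..t} (\<lambda>\<tau>. f (Suc k) (\<gamma> \<tau>) i j)"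
        by (intro continuous_at_imp_continuous_on ballI has_vector_derivative_continuous[OF vd]) (use t in auto)
      show "continuous_on {0..t} \<phi>" unfolding \<phi>_def by (intro continuous_intros) auto
      fix \<tau> assume \<tau>: "0 < \<tau>" "\<tau> < t"
      show "((\<lambda>\<tau>. f (Suc k) (\<gamma> \<tau>) i j) has_vector_derivative (q - p) * mm n (b (\<gamma> \<tau>)) (f k (\<gamma> \<tau>)) i j) (at \<tau>)"
        by (rule vd) (use \<tau> t in auto)
      have "(\<phi> has_field_derivative C * (real (Suc k) * (m + L * \<tau>) ^ k * L) / fact (Suc k)) (at \<tau>)"
        unfolding \<phi>_def by (rule derivative_eq_intros refl | simp)+
      moreover have "C * (real (Suc k) * (m + L * \<tau>) ^ k * L) / fact (Suc k) = L * (C * (m + L * \<tau>) ^ k / fact k)"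
        by (simp add: field_simps del: of_nat_Suc)
      ultimately show "(\<phi> has_vector_derivative L * (C * (m + L * \<tau>) ^ k / fact k)) (at \<tau>)"
        by (simp add: has_real_derivative_iff_has_vector_derivative mult_ac)
      have "cmod (mm n (b (\<gamma> \<tau>)) (f k (\<gamma> \<tau>)) i j) \<le> (\<Sum>l<n. M * (C * (m + L * \<tau>) ^ k / fact k))"
        unfolding mm_def
      proof (rule sum_norm_le)
        fix l assume "l \<in> {..<n}"
        hence "cmod (f k (\<gamma> \<tau>) l j) \<le> C * (m + L * \<tau>) ^ k / fact k"
          unfolding \<gamma>_def L_def using \<tau> t Suc.prems by (intro Suc.IH) auto
        moreover have "cmod (b (\<gamma> \<tau>) i l) \<le> M" using \<gamma>S[of \<tau>] \<tau> t Suc.prems \<open>l \<in> {..<n}\<close> by (intro bb) auto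
        ultimately show "cmod (b (\<gamma> \<tau>) i l * f k (\<gamma> \<tau>) l j) \<le> M * (C * (m + L * \<tau>) ^ k / fact k)"
          unfolding norm_mult using nn by (intro mult_mono) auto
      qed
      hence "cmod (q - p) * cmod (mm n (b (\<gamma> \<tau>)) (f k (\<gamma> \<tau>)) i j) \<le> cmod (q - p) * (real n * (M * (C * (m + L * \<tau>) ^ k / fact k)))"
        by (intro mult_left_mono) auto
      thus "norm ((q - p) * mm n (b (\<gamma> \<tau>)) (f k (\<gamma> \<tau>)) i j) \<le> L * (C * (m + L * \<tau>) ^ k / fact k)"
        by (simp add: norm_mult L_def mult_ac)
    qed
    moreover have "norm (f (Suc k) (\<gamma> 0) i j) \<le> \<phi> 0"
      using init[OF Suc.prems(3,4), of k] by (simp add: \<gamma>_def \<phi>_def)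
    moreover have "norm (f (Suc k) (\<gamma> t) i j) \<le> norm (f (Suc k) (\<gamma> t) i j - f (Suc k) (\<gamma> 0) i j) + norm (f (Suc k) (\<gamma> 0) i j)"
      by (metis diff_add_cancel norm_triangle_ineq)
    ultimately have "norm (f (Suc k) (\<gamma> t) i j) \<le> \<phi> t" by linarith
    thus ?thesis by (simp add: \<gamma>_def \<phi>_def L_def)
  qed
qed

text \<open>A solution with zero initial value is a fixed point of the Picard step, so
  \<open>picard_segment\<close> applies to the constant sequence D with m = 0 and bounds it by C
  L^k/k! for all k.\<close>

lemma linear_ode_unique_convex:
  fixes D b :: "complex \<Rightarrow> nat \<Rightarrow> nat \<Rightarrow> complex"
  assumes S: "convex S" and der: "\<And>x i j. x \<in> S \<Longrightarrow> i < n \<Longrightarrow> j < n \<Longrightarrow> ((\<lambda>x. D x i j) has_field_derivative mm n (b x) (D x) i j) (at x)"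
    and cb: "\<And>i j. i < n \<Longrightarrow> j < n \<Longrightarrow> continuous_on S (\<lambda>x. b x i j)"
    and p: "p \<in> S" "\<And>i j. i < n \<Longrightarrow> j < n \<Longrightarrow> D p i j = 0" and x: "x \<in> S" and ij: "i < n" "j < n"
  shows "D x i j = 0"
proof -
  have seg: "closed_segment p x \<subseteq> S" using S p(1) x closed_segment_subset by blast
  have cD: "continuous_on S (\<lambda>x. D x i j)" if "i < n" "j < n" for i j
    by (intro continuous_at_imp_continuous_on ballI DERIV_isCont[OF der[OF _ that]])
  have bnd: "\<exists>M\<ge>0. \<forall>y\<in>closed_segment p x. \<forall>i<n. \<forall>j<n. cmod (g y i j) \<le> M"
    if "\<And>i j. i < n \<Longrightarrow> j < n \<Longrightarrow> continuous_on S (\<lambda>x. g x i j)" for g :: "complex \<Rightarrow> nat \<Rightarrow> nat \<Rightarrow> complex"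
  proof -
    have "continuous_on (closed_segment p x) (\<lambda>y. mn n (g y))"
      unfolding mn_def by (intro continuous_intros continuous_on_subset[OF that seg]) auto
    hence "bounded ((\<lambda>y. mn n (g y)) ` closed_segment p x)" by (intro compact_imp_bounded compact_continuous_image compact_segment)
    then obtain M where M: "\<And>y. y \<in> closed_segment p x \<Longrightarrow> mn n (g y) \<le> M" by (auto simp: bounded_iff)
    have "0 \<le> M" using M[of p] mn_nonneg[of n "g p"] by (simp del: mn_nonneg)
    thus ?thesis using M entry_le_mn order_trans by (intro exI[of _ M]) blast
  qed
  obtain M where M: "0 \<le> M" "\<And>y i j. y \<in> closed_segment p x \<Longrightarrow> i < n \<Longrightarrow> j < n \<Longrightarrow> cmod (b y i j) \<le> M" using bnd[of b, OF cb] by blast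
  obtain C where C: "0 \<le> C" "\<And>y i j. y \<in> closed_segment p x \<Longrightarrow> i < n \<Longrightarrow> j < n \<Longrightarrow> cmod (D y i j) \<le> C" using bnd[of D, OF cD] by blast
  define L where "L = real n * M * cmod (x - p)"
  have le: "cmod (D x i j) \<le> C * (L ^ k / fact k)" for k
  proof -
    have "cmod ((\<lambda>_. D) k (p + of_real 1 * (x - p)) i j) \<le> C * (0 + real n * M * cmod (x - p) * 1) ^ k / fact k"
    proof (rule picard_segment[where b = b and f = "\<lambda>_. D" and n = n])
      show "((\<lambda>x. D x i j) has_field_derivative mm n (b y) (D y) i j) (at y)"
        if "y \<in> closed_segment p x" "i < n" "j < n" for y i j using der[of y i j] that seg by blast
    qed (use M C p(2) ij in simp_all)
    thus ?thesis by (simp add: L_def)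
  qed
  have "(\<lambda>k. L ^ k / fact k) \<longlonglongrightarrow> 0"
    using summable_LIMSEQ_zero[OF summable_exp[of L]] by (simp add: divide_inverse mult.commute)
  hence "(\<lambda>k. C * (L ^ k / fact k)) \<longlonglongrightarrow> 0" using tendsto_mult_left[of _ 0 _ C] by fastforce
  hence "cmod (D x i j) \<le> 0" by (rule tendsto_lowerbound) (use le in auto)
  thus ?thesis by simp
qed

text \<open>Picard iteration with primitives on the whole region, which exist since it is simply
  connected. Being single-valued, the iterates can be estimated along any convenient path:
  vertically from r to the height of x, then horizontally.\<close>

lemma linear_ode_exists_Omega_plus:
  fixes b :: "complex \<Rightarrow> nat \<Rightarrow> nat \<Rightarrow> complex" and A :: "complex poly fract mat"
  assumes b: "\<And>i j. i < n \<Longrightarrow> j < n \<Longrightarrow> (\<lambda>x. b x i j) holomorphic_on Omega_plus A"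
    and R: "{x. R < Re x} \<subseteq> Omega_plus A" "R < r"
  obtains Y where "\<And>x i j. x \<in> Omega_plus A \<Longrightarrow> i < n \<Longrightarrow> j < n \<Longrightarrow> ((\<lambda>x. Y x i j) has_field_derivative mm n (b x) (Y x) i j) (at x)"
    "\<And>i j. i < n \<Longrightarrow> j < n \<Longrightarrow> Y (complex_of_real r) i j = C i j"
proof -
  define S where "S = Omega_plus A"
  have S: "open S" by (simp add: S_def open_Omega_plus)
  define p where "p = complex_of_real r"
  have pS: "p \<in> S" using R by (auto simp: p_def S_def)
  \<comment> \<open>One Picard step, with the primitive normalised to vanish at p; the initial
    matrix C enters as the zeroth iterate.\<close>
  define Q where "Q f g \<longleftrightarrow> (\<forall>x i j. x \<in> S \<longrightarrow> i < n \<longrightarrow> j < n \<longrightarrow> ((\<lambda>x. g x i j) has_field_derivative mm n (b x) (f x) i j) (at x)) \<and> (\<forall>i j. g p i j = 0)"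
    for f g :: "complex \<Rightarrow> nat \<Rightarrow> nat \<Rightarrow> complex"
  have exQ: "\<exists>g. Q f g" if f: "\<And>i j. i < n \<Longrightarrow> j < n \<Longrightarrow> (\<lambda>x. f x i j) holomorphic_on S" for f
  proof -
    have "\<exists>g. (\<forall>x\<in>S. (g has_field_derivative mm n (b x) (f x) i j) (at x)) \<and> g p = 0" if ij: "i < n" "j < n" for i j
    proof -
      have "(\<lambda>x. mm n (b x) (f x) i j) holomorphic_on S"
        unfolding mm_def S_def using b f ij by (intro holomorphic_on_sum holomorphic_on_mult) (auto simp: S_def)
      then obtain g where g: "\<And>z. z \<in> S \<Longrightarrow> (g has_field_derivative mm n (b z) (f z) i j) (at z)"
        unfolding S_def by (rule Omega_plus_primitive) blast
      show ?thesis by (rule exI[of _ "\<lambda>x. g x - g p"]) (auto intro!: derivative_eq_intros g)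
    qed
    hence "\<forall>i j. \<exists>g. i < n \<longrightarrow> j < n \<longrightarrow> (\<forall>x\<in>S. (g has_field_derivative mm n (b x) (f x) i j) (at x)) \<and> g p = 0" by blast
    then obtain g where g: "\<And>i j. i < n \<Longrightarrow> j < n \<Longrightarrow> (\<forall>x\<in>S. (g i j has_field_derivative mm n (b x) (f x) i j) (at x)) \<and> g i j p = 0"
      by metis
    show ?thesis
      by (rule exI[of _ "\<lambda>x i j. if i < n \<and> j < n then g i j x else 0"]) (use g in \<open>auto simp: Q_def\<close>)
  qed
  define f where "f = rec_nat (\<lambda>x. C) (\<lambda>k g. SOME g'. Q g g')"
  have f0: "f 0 = (\<lambda>x. C)" by (simp add: f_def)
  have hol: "(\<forall>i j. i < n \<longrightarrow> j < n \<longrightarrow> (\<lambda>x. f k x i j) holomorphic_on S) \<and> Q (f k) (f (Suc k))" for k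
  proof (induction k)
    case 0
    have "\<exists>g. Q (f 0) g" by (rule exQ) (simp add: f0)
    hence "Q (f 0) (f (Suc 0))" unfolding f_def by (simp add: someI_ex)
    thus ?case by (simp add: f0)
  next
    case (Suc k)
    have h: "(\<lambda>x. f (Suc k) x i j) holomorphic_on S" if "i < n" "j < n" for i j
      using Suc that unfolding Q_def holomorphic_on_open[OF S] by blast
    hence "\<exists>g. Q (f (Suc k)) g" by (rule exQ)
    hence "Q (f (Suc k)) (f (Suc (Suc k)))" unfolding f_def by (simp add: someI_ex)
    thus ?case using h by blast
  qed
  have fder: "((\<lambda>x. f (Suc k) x i j) has_field_derivative mm n (b x) (f k x) i j) (at x)" if "x \<in> S" "i < n" "j < n" for k x i j
    using hol[of k] that unfolding Q_def by blast
  have fp: "f (Suc k) p i j = 0" for k i j using hol[of k] unfolding Q_def by blast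
  define C0 where "C0 = mn n C"
  have bound: "\<exists>L\<ge>0. \<forall>x\<in>K. \<forall>k. \<forall>i<n. \<forall>j<n. cmod (f k x i j) \<le> C0 * L ^ k / fact k" if K: "compact K" "K \<subseteq> S" for K
  proof -
    define c where "c x = Complex r (Im x)" for x
    \<comment> \<open>K1 and K2 are swept by the vertical and the horizontal segments as x varies in
      K: compact subsets of the region, because translations to the right preserve it.\<close>
    define K1 where "K1 = (\<lambda>(t, x). p + of_real t * (c x - p)) ` ({0..1} \<times> K)"
    define K2 where "K2 = (\<lambda>(t, x). c x + of_real t * (x - c x)) ` ({0..1} \<times> K)"
    have cc: "continuous_on UNIV c" unfolding c_def by (simp add: complex_eq_iff Complex_eq) (intro continuous_intros)
    have cp: "compact ({0..1::real} \<times> K)" by (intro compact_Times K compact_Icc)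
    have "continuous_on ({0..1} \<times> K) (\<lambda>p. c (snd p))"
      by (rule continuous_on_compose2[OF cc continuous_on_snd[OF continuous_on_id]]) simp
    hence "compact K1" "compact K2"
      unfolding K1_def K2_def case_prod_unfold by (intro compact_continuous_image cp continuous_intros; simp)+
    moreover have "K1 \<subseteq> S" using R by (force simp: K1_def p_def c_def S_def)
    moreover have "K2 \<subseteq> S"
    proof
      fix y assume "y \<in> K2"
      then obtain t x where tx: "0 \<le> t" "t \<le> 1" "x \<in> K" and y: "y = c x + of_real t * (x - c x)" by (auto simp: K2_def)
      show "y \<in> S"
      proof (cases "Re x \<le> r")
        case True
        have "y = x + of_real ((1 - t) * (r - Re x))"
          by (simp add: y c_def complex_eq_iff algebra_simps)
        moreover have "0 \<le> (1 - t) * (r - Re x)" using tx True by simp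
        ultimately show ?thesis using Omega_plus_right K(2) tx(3) unfolding S_def by blast
      next
        case False
        have "Re y = r + t * (Re x - r)" by (simp add: y c_def)
        moreover have "0 \<le> t * (Re x - r)" using False tx by simp
        ultimately show ?thesis using R unfolding S_def by (auto intro!: subsetD[OF R(1)])
      qed
    qed
    ultimately have KK: "compact (K1 \<union> K2)" "K1 \<union> K2 \<subseteq> S" by auto
    have "continuous_on (K1 \<union> K2) (\<lambda>y. mn n (b y))"
      unfolding mn_def
      by (intro continuous_on_sum continuous_on_norm continuous_on_subset[OF holomorphic_on_imp_continuous_on[OF b]])
         (use KK(2) in \<open>auto simp: S_def\<close>)
    hence "bounded ((\<lambda>y. mn n (b y)) ` (K1 \<union> K2))" by (intro compact_imp_bounded compact_continuous_image KK)
    then obtain M where "\<forall>y\<in>(\<lambda>y. mn n (b y)) ` (K1 \<union> K2). norm y \<le> M" by (auto simp: bounded_iff)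
    hence M: "mn n (b y) \<le> M" if "y \<in> K1 \<union> K2" for y using that by auto
    define M' where "M' = \<bar>M\<bar>"
    have M': "cmod (b y i j) \<le> M'" if "y \<in> K1 \<union> K2" "i < n" "j < n" for y i j
      using order_trans[OF entry_le_mn[OF that(2,3)] M[OF that(1)]] by (simp add: M'_def)
    have "bounded K" using K(1) by (rule compact_imp_bounded)
    then obtain T where T: "\<And>x. x \<in> K \<Longrightarrow> cmod x \<le> T" by (auto simp: bounded_iff)
    define T' where "T' = \<bar>T\<bar> + \<bar>r\<bar>"
    define L where "L = real n * M' * T' + real n * M' * T'"
    have L0: "0 \<le> L" by (simp add: L_def M'_def T'_def)
    have "cmod (f k x i j) \<le> C0 * L ^ k / fact k" if x: "x \<in> K" and ij: "i < n" "j < n" for x k i j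
    proof -
      have s1: "closed_segment p (c x) \<subseteq> K1"
        unfolding closed_segment_def K1_def using x by (force simp: scaleR_conv_of_real algebra_simps image_iff)
      have s2: "closed_segment (c x) x \<subseteq> K2"
        unfolding closed_segment_def K2_def using x by (force simp: scaleR_conv_of_real algebra_simps image_iff)
      define m where "m = real n * M' * cmod (c x - p)"
      have C0: "cmod (f 0 y i j) \<le> C0" if "i < n" "j < n" for y i j
        using entry_le_mn[OF that, of C] by (simp add: f0 C0_def)
      have 1: "cmod (f k (c x) i j) \<le> C0 * m ^ k / fact k" if ij: "i < n" "j < n" for k i j
      proof -
        have "cmod (f k (p + of_real 1 * (c x - p)) i j) \<le> C0 * (0 + real n * M' * cmod (c x - p) * 1) ^ k / fact k"
        proof (rule picard_segment[where b = b and f = f and n = n])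
          fix y i j assume y: "y \<in> closed_segment p (c x)" and ij: "i < n" "j < n"
          show "((\<lambda>x. f (Suc k) x i j) has_field_derivative mm n (b y) (f k y) i j) (at y)" for k
            using fder[of y i j k] y ij s1 KK(2) by blast
          show "cmod (b y i j) \<le> M'" using M'[of y i j] y ij s1 by blast
          show "cmod (f 0 y i j) \<le> C0" by (rule C0[OF ij])
        qed (use ij in \<open>simp_all add: fp M'_def C0_def\<close>)
        thus ?thesis by (simp add: m_def)
      qed
      have "cmod (f k (c x + of_real 1 * (x - c x)) i j) \<le> C0 * (m + real n * M' * cmod (x - c x) * 1) ^ k / fact k"
      proof (rule picard_segment[where b = b and f = f and n = n])
        fix y i j assume y: "y \<in> closed_segment (c x) x" and ij: "i < n" "j < n"
        show "((\<lambda>x. f (Suc k) x i j) has_field_derivative mm n (b y) (f k y) i j) (at y)" for k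
          using fder[of y i j k] y ij s2 KK(2) by blast
        show "cmod (b y i j) \<le> M'" using M'[of y i j] y ij s2 by blast
        show "cmod (f 0 y i j) \<le> C0" by (rule C0[OF ij])
      next
        fix i j assume ij: "i < n" "j < n"
        show "cmod (f (Suc k) (c x) i j) \<le> C0 * m ^ Suc k / fact (Suc k)" for k by (rule 1[OF ij])
      qed (use ij in \<open>simp_all add: M'_def C0_def m_def\<close>)
      also have "\<dots> \<le> C0 * L ^ k / fact k"
      proof (intro divide_right_mono mult_left_mono power_mono)
        have "cmod (c x - p) \<le> T'"
        proof -
          have "c x - p = \<i> * of_real (Im x)" by (simp add: c_def p_def complex_eq_iff)
          hence "cmod (c x - p) = \<bar>Im x\<bar>" by (simp add: norm_mult)
          thus ?thesis using abs_Im_le_cmod[of x] T[OF x] by (simp add: T'_def)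
        qed
        moreover have "cmod (x - c x) \<le> T'"
        proof -
          have "x - c x = of_real (Re x - r)" by (simp add: c_def complex_eq_iff)
          hence "cmod (x - c x) = \<bar>Re x - r\<bar>" by (simp only: norm_of_real)
          thus ?thesis using abs_Re_le_cmod[of x] T[OF x] by (simp add: T'_def)
        qed
        ultimately show "m + real n * M' * cmod (x - c x) * 1 \<le> L"
          unfolding m_def L_def by (intro add_mono) (auto intro!: mult_left_mono simp: M'_def)
        show "0 \<le> m + real n * M' * cmod (x - c x) * 1" by (simp add: m_def M'_def)
      qed (auto simp: C0_def)
      finally show ?thesis by simp
    qed
    thus ?thesis using L0 by blast
  qed
  define Y where "Y x i j = (\<Sum>k. f k x i j)" for x i j
  have ul: "uniform_limit K (\<lambda>N x. \<Sum>k<N. f k x i j) (\<lambda>x. Y x i j) sequentially" if K: "compact K" "K \<subseteq> S" and ij: "i < n" "j < n" for K i j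
  proof -
    obtain L where L: "0 \<le> L" "\<And>x k. x \<in> K \<Longrightarrow> cmod (f k x i j) \<le> C0 * L ^ k / fact k" using bound[OF K] ij by blast
    have "summable (\<lambda>k. C0 * (L ^ k / fact k))"
      using summable_exp[of L] by (intro summable_mult) (simp add: divide_inverse mult.commute)
    thus ?thesis unfolding Y_def using L(2) by (intro Weierstrass_m_test[where M = "\<lambda>k. C0 * (L ^ k / fact k)"]) auto
  qed
  have pt: "(\<lambda>k. f k x i j) sums Y x i j" if "x \<in> S" "i < n" "j < n" for x i j
    using tendsto_uniform_limitI[OF ul[of "{x}" i j]] that by (simp add: sums_def)
  have Yder: "((\<lambda>x. Y x i j) has_field_derivative mm n (b x) (Y x) i j) (at x)" if x: "x \<in> S" and ij: "i < n" "j < n" for x i j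
  proof -
    \<comment> \<open>The zeroth iterate is constant, so the derivative of the partial sum with N +
      1 terms is b times the one with N terms; hence \<open>Suc N\<close> on one side.\<close>
    have "\<exists>g'. \<forall>x\<in>S. ((\<lambda>x. Y x i j) has_field_derivative g' x) (at x) \<and>
       ((\<lambda>N. mm n (b x) (\<lambda>i j. \<Sum>k<N. f k x i j) i j) \<longlongrightarrow> g' x) sequentially"
    proof (rule has_complex_derivative_uniform_sequence[OF S])
      fix N x assume x: "x \<in> S"
      have "((\<lambda>x. C i j + (\<Sum>k<N. f (Suc k) x i j)) has_field_derivative (\<Sum>k<N. mm n (b x) (f k x) i j)) (at x)"
        by (auto intro!: derivative_eq_intros fder x ij)
      moreover have "(\<Sum>k<N. mm n (b x) (f k x) i j) = mm n (b x) (\<lambda>i j. \<Sum>k<N. f k x i j) i j"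
        unfolding mm_def by (subst sum.swap) (simp add: sum_distrib_left)
      moreover have "(\<lambda>x. C i j + (\<Sum>k<N. f (Suc k) x i j)) = (\<lambda>x. \<Sum>k<Suc N. f k x i j)"
        by (simp add: sum.lessThan_Suc_shift f0 del: sum.lessThan_Suc)
      ultimately show "((\<lambda>x. \<Sum>k<Suc N. f k x i j) has_field_derivative mm n (b x) (\<lambda>i j. \<Sum>k<N. f k x i j) i j) (at x)"
        by (simp only:)
    next
      fix x assume "x \<in> S"
      then obtain d where d: "0 < d" "cball x d \<subseteq> S" using S open_contains_cball by blast
      have "uniform_limit (cball x d) (\<lambda>N x. \<Sum>k<Suc N. f k x i j) (\<lambda>x. Y x i j) sequentially"
        using ul[OF compact_cball d(2) ij] by (rule filterlim_compose[OF _ filterlim_Suc])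
      thus "\<exists>d>0. cball x d \<subseteq> S \<and> uniform_limit (cball x d) (\<lambda>N x. \<Sum>k<Suc N. f k x i j) (\<lambda>x. Y x i j) sequentially"
        using d by blast
    qed
    then obtain g' where g': "((\<lambda>x. Y x i j) has_field_derivative g' x) (at x)"
       "((\<lambda>N. mm n (b x) (\<lambda>i j. \<Sum>k<N. f k x i j) i j) \<longlongrightarrow> g' x) sequentially" using x by blast
    have "((\<lambda>N. mm n (b x) (\<lambda>i j. \<Sum>k<N. f k x i j) i j) \<longlongrightarrow> mm n (b x) (Y x) i j) sequentially"
      unfolding mm_def by (intro tendsto_sum tendsto_mult tendsto_const) (use pt x ij in \<open>auto simp: sums_def\<close>)
    hence "g' x = mm n (b x) (Y x) i j" using g'(2) LIMSEQ_unique by blast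
    thus ?thesis using g'(1) by simp
  qed
  show ?thesis
  proof (rule that[of Y])
    show "((\<lambda>x. Y x i j) has_field_derivative mm n (b x) (Y x) i j) (at x)" if "x \<in> Omega_plus A" "i < n" "j < n" for x i j
      using Yder that by (simp add: S_def)
    show "Y (complex_of_real r) i j = C i j" if "i < n" "j < n" for i j
    proof -
      have "(\<lambda>k. f k p i j) sums (\<Sum>k\<in>{0}. f k p i j)"
      proof (rule sums_finite)
        show "f k p i j = 0" if "k \<notin> {0}" for k using that fp by (cases k) auto
      qed simp
      hence "Y p i j = C i j" using sums_unique2[OF pt[OF pS that]] by (simp add: f0)
      thus ?thesis by (simp add: p_def)
    qed
  qed
qed

section \<open>The Frobenius solution\<close>

lemma fe_0_eq: "fe 0 s x = inverse x ^ s"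
  by (simp add: fe_def h_rising_def power_inverse)

lemma inverse_powser_derivative:
  fixes f :: "complex \<Rightarrow> complex"
  assumes f: "\<And>x. R < cmod x \<Longrightarrow> (\<lambda>k. c k * inverse x ^ k) sums f x" and R: "0 \<le> R" and x: "R < cmod x"
  shows "(f has_field_derivative (\<Sum>k. - of_nat k * c k * inverse x ^ k) / x) (at x)"
proof -
  define g where "g w = (\<Sum>k. c k * w ^ k)" for w
  have fg: "f y = g (inverse y)" if "R < cmod y" for y using f[OF that] by (simp add: g_def sums_iff)
  define y where "y = (R + cmod x) / 2"
  have y: "R < y" "y < cmod x" "0 < y" using x R by (auto simp: y_def)
  have x0: "x \<noteq> 0" using x R by auto
  have wy: "cmod (inverse x) < inverse y" using y by (simp add: norm_inverse less_imp_inverse_less)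
  have sw: "summable (\<lambda>k. c k * w ^ k)" if w: "cmod w < inverse y" for w
  proof -
    have "summable (\<lambda>k. c k * inverse (complex_of_real y) ^ k)" using f[of "complex_of_real y"] y by (simp add: sums_iff)
    moreover have "cmod w < cmod (inverse (complex_of_real y))" using w y by (simp add: norm_inverse)
    ultimately show ?thesis by (rule powser_inside)
  qed
  have sd: "summable (\<lambda>k. diffs c k * inverse x ^ k)" by (rule termdiff_converges[OF wy sw])
  have dg: "(g has_field_derivative (\<Sum>k. diffs c k * inverse x ^ k)) (at (inverse x))"
    unfolding g_def using y wy by (intro termdiffs_strong[OF sw[of "of_real ((cmod (inverse x) + inverse y) / 2)"]])
      (auto simp: abs_of_pos simp del: of_real_add of_real_divide of_real_inverse)
  have "((\<lambda>x. g (inverse x)) has_field_derivative (\<Sum>k. diffs c k * inverse x ^ k) * - (inverse x * 1 * inverse x)) (at x)"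
    by (rule DERIV_chain2[where f = g and g = inverse, OF dg]) (rule DERIV_inverse'[OF DERIV_ident x0])
  moreover have "(\<Sum>k. diffs c k * inverse x ^ k) * - (inverse x * 1 * inverse x) = (\<Sum>k. - of_nat k * c k * inverse x ^ k) / x"
  proof -
    have "(\<lambda>k. - inverse x * (of_nat k * c k * inverse x ^ (k - Suc 0))) sums (- inverse x * (\<Sum>k. diffs c k * inverse x ^ k))"
      by (rule sums_mult[OF diffs_equiv[OF sd]])
    moreover have "- inverse x * (of_nat k * c k * inverse x ^ (k - Suc 0)) = - of_nat k * c k * inverse x ^ k" for k
      by (cases k) (simp_all add: algebra_simps)
    ultimately have "(\<Sum>k. - of_nat k * c k * inverse x ^ k) = - inverse x * (\<Sum>k. diffs c k * inverse x ^ k)"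
      by (simp only: sums_iff)
    thus ?thesis by (simp add: divide_inverse)
  qed
  ultimately have "((\<lambda>x. g (inverse x)) has_field_derivative (\<Sum>k. - of_nat k * c k * inverse x ^ k) / x) (at x)" by simp
  moreover have "open {x. R < cmod x}" by (intro open_Collect_less continuous_intros)
  ultimately show ?thesis
    by (rule has_field_derivative_transform_within_open[where S = "{x. R < cmod x}"]) (use x fg in auto)
qed

lemma rm_eval_bounded_sphere:
  assumes A: "A \<in> carrier_mat n n" and K: "compact K" "\<And>x. x \<in> K \<Longrightarrow> Some x \<notin> rm_poles A"
  obtains M where "0 \<le> M" "\<And>x i j. x \<in> K \<Longrightarrow> i < n \<Longrightarrow> j < n \<Longrightarrow> cmod (rm_eval A (Some x) $$ (i, j)) \<le> M"
proof -
  have "continuous_on K (\<lambda>x. rm_eval A (Some x) $$ (i, j))" if ij: "i < n" "j < n" for i j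
    unfolding rm_eval_index[OF A ij]
    by (intro continuous_at_imp_continuous_on ballI analytic_at_imp_isCont rf_eval_analytic_at not_rm_poleD[OF A ij] K(2))
  hence "continuous_on K (\<lambda>x. mn n (fm (rm_eval A (Some x))))"
    unfolding mn_def by (intro continuous_on_sum continuous_on_norm) auto
  hence "bounded ((\<lambda>x. mn n (fm (rm_eval A (Some x)))) ` K)" by (intro compact_imp_bounded compact_continuous_image K)
  then obtain M where M: "\<And>x. x \<in> K \<Longrightarrow> mn n (fm (rm_eval A (Some x))) \<le> M" by (auto simp: bounded_iff)
  show ?thesis
  proof (rule that[of "max 0 M"])
    fix x i j assume "x \<in> K" "i < n" "j < n"
    thus "cmod (rm_eval A (Some x) $$ (i, j)) \<le> max 0 M"
      using entry_le_mn[of i n j "fm (rm_eval A (Some x))"] M[of x] by linarith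
  qed simp
qed

text \<open>The gauge equation for \<open>h = 0\<close>, where \<open>fe 0 s x = x^{-s}\<close>.\<close>

lemma frobenius_local:
  assumes A: "A \<in> carrier_mat n n" and inf: "None \<notin> rm_poles A" and nr: "nonresonant (rm_eval A None)"
    and J: "jordan_reduction (rm_eval A None) Q R0 bs"
  obtains \<rho> U F where "0 < \<rho>" "\<And>a. Some a \<in> rm_poles A \<Longrightarrow> cmod a \<le> \<rho>"
    "\<And>i j. U 0 i j = (if i = j then 1 else 0)"
    "\<And>x i j. \<rho> < cmod x \<Longrightarrow> i < n \<Longrightarrow> j < n \<Longrightarrow> (\<lambda>s. U s i j * inverse x ^ s) sums F x i j"
    "\<And>x i j. \<rho> < cmod x \<Longrightarrow> i < n \<Longrightarrow> j < n \<Longrightarrow> ((\<lambda>x. F x i j) has_field_derivative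
        (mm n (fm (rm_eval A (Some x))) (F x) i j - mm n (F x) (fm (rm_eval A None)) i j) / x) (at x)"
proof -
  define A0 where "A0 = rm_eval A None"
  have A0c: "A0 \<in> carrier_mat n n" using A by (simp add: A0_def)
  obtain R where R: "0 < R" "\<And>a. Some a \<in> rm_poles A \<Longrightarrow> cmod a < R" by (rule rm_poles_bound[of A]) blast
  have np: "Some x \<notin> rm_poles A" if "R \<le> cmod x" for x using R(2)[of x] that by auto
  obtain M where M: "0 \<le> M" "\<And>x i j. x \<in> sphere 0 R \<Longrightarrow> i < n \<Longrightarrow> j < n \<Longrightarrow> cmod (rm_eval A (Some x) $$ (i, j)) \<le> M"
    by (rule rm_eval_bounded_sphere[OF A compact_sphere[of 0 R]]) (use np in auto)
  obtain \<kappa> \<delta> where k: "0 < \<kappa>" "0 < \<delta>"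
    "\<And>A' s X. mn n (\<lambda>i j. A' i j - A0 $$ (i, j)) \<le> \<delta> \<Longrightarrow> 1 \<le> s \<Longrightarrow> real s * mn n X \<le> \<kappa> * mn n (sylv n s A' X)"
    using sylv_uniform_bound[OF A0c J[folded A0_def] nr[folded A0_def]] by metis
  have kk: "real s * mn n X \<le> \<kappa> * mn n (sylv n s (fm A0) X)" if "1 \<le> s" for s X
    by (rule k(3)[OF _ that]) (use k(2) in \<open>simp add: mn_def\<close>)
  define \<rho> where "\<rho> = R + 2 + 8 * \<kappa> * (real n * real n * R * M)"
  have R\<rho>: "R < \<rho>" using k(1) R(1) M(1) by (simp add: \<rho>_def add_pos_nonneg)
  obtain B where B: "gauge_system n 0 \<rho> B \<kappa> (fm A0)"
    "\<And>r x i j. R < r \<Longrightarrow> hdom 0 r x \<Longrightarrow> i < n \<Longrightarrow> j < n \<Longrightarrow> (\<lambda>s. B s i j * fe 0 s x) sums (rm_eval A (Some x) $$ (i, j) - A0 $$ (i, j))"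
  proof -
    have MM: "cmod (rm_eval A (Some x) $$ (i, j)) \<le> M" if "cmod x = R" "i < n" "j < n" for x i j using M(2) that by simp
    have sx: "\<exists>X. \<forall>i<n. \<forall>j<n. sylv n s (fm A0) X i j = C i j" if "1 \<le> s" for s C
      by (rule sylv_surj[OF A0c J[folded A0_def] nr[folded A0_def] that])
    have h3: "4 * \<kappa> * mn n (fm A0) * 0 \<le> 1" by simp
    show ?thesis
      by (rule gauge_system_of_bounds[OF A inf np R(1) MM M(1) sx[unfolded A0_def] kk[unfolded A0_def] k(1) order_refl
            eq_refl[OF \<rho>_def[symmetric]] order_refl zero_le_one h3[unfolded A0_def], folded A0_def]) (assumption | rule that)+
  qed
  interpret g: gauge_system n 0 \<rho> B \<kappa> "fm A0" by (rule B(1))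
  obtain U where U: "\<And>i j. U 0 i j = 0" "\<And>s i j. 1 \<le> s \<Longrightarrow> i < n \<Longrightarrow> j < n \<Longrightarrow> sylv n s (fm A0) (U s) i j = g.rhs B U s i j"
    by (rule g.solution_exists) blast
  note S = g.stability_summable[of U B, OF U(1) U(2) g.Bsum]
  have Ua: "sylv n s (fm A0) (U s) i j = g.rhs B U s i j" if "i < n" "j < n" for s i j
  proof (cases "s = 0")
    case True thus ?thesis by (simp add: U(1) sylv_def mm_def g.rhs_def g.B0 g.conv_def g.gterm_def)
  qed (simp add: U(2) that)
  define F where "F x i j = (if i = j then 1 else 0) + ev 0 U x i j" for x i j
  define V where "V s i j = (if s = 0 then (if i = j then 1 else 0) else 0) + U s i j" for s i j
  \<comment> \<open>For h = 0 the region \<open>hdom\<close> is the exterior of a disc, so F is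
    obtained all around infinity.\<close>
  have hd: "hdom 0 \<rho> x" if "\<rho> < cmod x" for x :: complex using that by (simp add: hdom_def)
  have sF: "(\<lambda>s. V s i j * inverse x ^ s) sums F x i j" if x: "\<rho> < cmod x" and ij: "i < n" "j < n" for x i j
  proof -
    define c :: complex where "c = (if i = j then 1 else 0)"
    have "(\<lambda>s. if s = 0 then c else 0) sums c" using sums_single[of 0 "\<lambda>_. c"] by simp
    from sums_add[OF this g.ev_sums[OF S(2) ij hd[OF x]]]
    have "(\<lambda>s. (if s = 0 then c else 0) + U s i j * inverse x ^ s) sums F x i j"
      by (simp add: F_def c_def fe_0_eq)
    moreover have "(if s = 0 then c else 0) + U s i j * inverse x ^ s = V s i j * inverse x ^ s" for s
      by (simp add: V_def c_def)
    ultimately show ?thesis by simp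
  qed
  show ?thesis
  proof (rule that[of \<rho> V F])
    show "0 < \<rho>" using R(1) R\<rho> by linarith
    show "cmod a \<le> \<rho>" if "Some a \<in> rm_poles A" for a using R(2)[OF that] R\<rho> by linarith
    show "V 0 i j = (if i = j then 1 else 0)" for i j by (simp add: V_def U(1))
    show "(\<lambda>s. V s i j * inverse x ^ s) sums F x i j" if "\<rho> < cmod x" "i < n" "j < n" for x i j by (rule sF[OF that])
    fix x i j assume x: "\<rho> < cmod x" and ij: "i < n" "j < n"
    have d: "hdom 0 \<rho> x" by (rule hd[OF x])
    have "((\<lambda>x. F x i j) has_field_derivative (\<Sum>k. - of_nat k * V k i j * inverse x ^ k) / x) (at x)"
      using R(1) R\<rho> x by (intro inverse_powser_derivative[where R = \<rho>] sF ij) auto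
    moreover have "(\<Sum>k. - of_nat k * V k i j * inverse x ^ k) = g.dev U x i j"
      unfolding g.dev_def fe_0_eq by (rule suminf_cong) (simp add: V_def)
    moreover have "g.dev U x i j = mm n (fm (rm_eval A (Some x))) (F x) i j - mm n (F x) (fm A0) i j"
    proof -
      define E where "E = ev 0 U x"
      have G: "g.dev U x i j = mm n (fm A0) E i j - mm n E (fm A0) i j + ev 0 B x i j + mm n (ev 0 B x) E i j"
        using g.gauge_function[OF S(1,2) g.Bsum Ua[OF ij] ij d] by (simp add: E_def algebra_simps)
      have eB: "ev 0 B x i j = rm_eval A (Some x) $$ (i, j) - A0 $$ (i, j)" if "i < n" "j < n" for i j
        using B(2)[OF R\<rho> d that] by (simp add: ev_def sums_iff)
      have "mm n (ev 0 B x) E i j = mm n (\<lambda>i j. rm_eval A (Some x) $$ (i, j) - A0 $$ (i, j)) E i j"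
        by (rule mm_cong) (use eB ij in auto)
      hence e1: "mm n (ev 0 B x) E i j = mm n (fm (rm_eval A (Some x))) E i j - mm n (fm A0) E i j" by (simp only: mm_lin)
      have 1: "mm n (\<lambda>i j. if i = j then 1 else 0) X i j = X i j" "mm n X (\<lambda>i j. if i = j then 1 else 0) i j = X i j" for X
        using ij by (simp_all add: mm_def if_distrib if_distribR sum.delta cong: if_cong)
      have "F x = (\<lambda>i j. (if i = j then 1 else 0) + E i j)" by (simp add: F_def E_def fun_eq_iff)
      hence "mm n (fm (rm_eval A (Some x))) (F x) i j - mm n (F x) (fm A0) i j
        = rm_eval A (Some x) $$ (i, j) + mm n (fm (rm_eval A (Some x))) E i j - (A0 $$ (i, j) + mm n E (fm A0) i j)"
        by (simp only: mm_lin 1)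
      thus ?thesis unfolding G e1 eB[OF ij] by simp
    qed
    ultimately show "((\<lambda>x. F x i j) has_field_derivative
        (mm n (fm (rm_eval A (Some x))) (F x) i j - mm n (F x) (fm (rm_eval A None)) i j) / x) (at x)"
      by (simp add: A0_def)
  qed
qed

lemma mm_has_field_derivative:
  assumes "\<And>i j. i < n \<Longrightarrow> j < n \<Longrightarrow> ((\<lambda>x. X x i j) has_field_derivative X' i j) (at x)"
    and "\<And>i j. i < n \<Longrightarrow> j < n \<Longrightarrow> ((\<lambda>x. Y x i j) has_field_derivative Y' i j) (at x)" and ij: "i < n" "j < n"
  shows "((\<lambda>x. mm n (X x) (Y x) i j) has_field_derivative mm n X' (Y x) i j + mm n (X x) Y' i j) (at x)"
proof -
  have "((\<lambda>x. \<Sum>k<n. X x i k * Y x k j) has_field_derivative (\<Sum>k<n. X x i k * Y' k j + X' i k * Y x k j)) (at x)"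
    by (intro DERIV_sum DERIV_mult' assms) (use ij in auto)
  thus ?thesis unfolding mm_def by (simp add: sum.distrib add.commute)
qed

lemma mm_divide: "mm n (\<lambda>i j. X i j / c) Z i j = mm n X Z i j / c" "mm n Z (\<lambda>i j. X i j / c) i j = mm n Z X i j / c"
  by (simp_all add: mm_def sum_divide_distrib)

lemma frobenius_product_derivative:
  assumes A: "A \<in> carrier_mat n n" and J: "jordan_reduction (rm_eval A None) Q R0 bs" and x: "x \<notin> \<real>\<^sub>\<le>\<^sub>0"
    and F: "\<And>i j. i < n \<Longrightarrow> j < n \<Longrightarrow> ((\<lambda>x. F x i j) has_field_derivative F' i j) (at x)" and ij: "i < n" "j < n"
  shows "((\<lambda>x. mm n (F x) (fm (mat_cpow n x (rm_eval A None))) i j) has_field_derivative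
    mm n (\<lambda>i j. F' i j + mm n (F x) (fm (rm_eval A None)) i j / x) (fm (mat_cpow n x (rm_eval A None))) i j) (at x)"
proof -
  have A0: "rm_eval A None \<in> carrier_mat n n" using A by simp
  show ?thesis
    using mm_has_field_derivative[of n F F' x "\<lambda>x. fm (mat_cpow n x (rm_eval A None))", OF F mat_cpow_has_field_derivative[OF A0 J _ _ x] ij]
    by (simp add: mm_lin mm_divide mm_assoc)
qed

lemma rm_eval_holomorphic_Omega:
  assumes A: "A \<in> carrier_mat n n" and ij: "i < n" "j < n"
  shows "(\<lambda>x. rm_eval A (Some x) $$ (i, j)) holomorphic_on Omega_plus A"
  unfolding rm_eval_index[OF A ij]
proof (rule analytic_imp_holomorphic)
  have "(\<lambda>x. rf_eval (A $$ (i, j)) (Some x)) analytic_on {x}" if "x \<in> Omega_plus A" for x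
    using Omega_plus_nonpole[OF that] by (intro rf_eval_analytic_at not_rm_poleD[OF A ij]) simp
  thus "(\<lambda>x. rf_eval (A $$ (i, j)) (Some x)) analytic_on Omega_plus A" using analytic_on_analytic_at by blast
qed

text \<open>The continuation is the solution of the linear system on the cut plane that takes the
  value of the local solution at one point; uniqueness on a half-plane, which is convex, identifies
  the two there.\<close>

lemma frobenius_continuation_exists:
  assumes A: "A \<in> carrier_mat n n" and inf: "None \<notin> rm_poles A" and nr: "nonresonant (rm_eval A None)"
    and J: "jordan_reduction (rm_eval A None) Q R0 bs"
  shows "\<exists>Y. is_frobenius_continuation n A Y"
proof -
  define E where "E x = fm (mat_cpow n x (rm_eval A None))" for x
  obtain \<rho> U F where F: "0 < \<rho>" "\<And>a. Some a \<in> rm_poles A \<Longrightarrow> cmod a \<le> \<rho>" "\<And>i j. U 0 i j = (if i = j then 1 else 0)"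
    "\<And>x i j. \<rho> < cmod x \<Longrightarrow> i < n \<Longrightarrow> j < n \<Longrightarrow> (\<lambda>s. U s i j * inverse x ^ s) sums F x i j"
    "\<And>x i j. \<rho> < cmod x \<Longrightarrow> i < n \<Longrightarrow> j < n \<Longrightarrow> ((\<lambda>x. F x i j) has_field_derivative
        (mm n (fm (rm_eval A (Some x))) (F x) i j - mm n (F x) (fm (rm_eval A None)) i j) / x) (at x)"
    by (rule frobenius_local[OF assms]) blast
  have dFE: "((\<lambda>x. mm n (F x) (E x) i j) has_field_derivative mm n (fm (rm_eval A (Some x))) (mm n (F x) (E x)) i j / x) (at x)"
    if x: "\<rho> < cmod x" "x \<notin> \<real>\<^sub>\<le>\<^sub>0" and ij: "i < n" "j < n" for x i j
  proof -
    have "((\<lambda>x. mm n (F x) (E x) i j) has_field_derivative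
       mm n (\<lambda>i j. (mm n (fm (rm_eval A (Some x))) (F x) i j - mm n (F x) (fm (rm_eval A None)) i j) / x
          + mm n (F x) (fm (rm_eval A None)) i j / x) (E x) i j) (at x)"
      unfolding E_def by (rule frobenius_product_derivative[OF A J x(2) F(5)[OF x(1)] ij])
    moreover have "(\<lambda>i j. (mm n (fm (rm_eval A (Some x))) (F x) i j - mm n (F x) (fm (rm_eval A None)) i j) / x
          + mm n (F x) (fm (rm_eval A None)) i j / x) = (\<lambda>i j. mm n (fm (rm_eval A (Some x))) (F x) i j / x)"
      by (simp add: fun_eq_iff diff_divide_distrib)
    ultimately show ?thesis by (simp only: mm_divide mm_assoc)
  qed
  have half: "{x. \<rho> < Re x} \<subseteq> Omega_plus A" using F(1,2) by (intro Omega_plus_half_plane) auto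
  define b where "b x i j = rm_eval A (Some x) $$ (i, j) / x" for x i j
  have b: "(\<lambda>x. b x i j) holomorphic_on Omega_plus A" if "i < n" "j < n" for i j
    unfolding b_def by (intro holomorphic_on_divide rm_eval_holomorphic_Omega[OF A that] holomorphic_on_ident)
      (use Omega_plus_nonpole in blast)
  define r where "r = \<rho> + 1"
  obtain Y where Y: "\<And>x i j. x \<in> Omega_plus A \<Longrightarrow> i < n \<Longrightarrow> j < n \<Longrightarrow> ((\<lambda>x. Y x i j) has_field_derivative mm n (b x) (Y x) i j) (at x)"
    "\<And>i j. i < n \<Longrightarrow> j < n \<Longrightarrow> Y (complex_of_real r) i j = mm n (F (of_real r)) (E (of_real r)) i j"
  proof (rule linear_ode_exists_Omega_plus[where b = b and A = A and r = r and C = "mm n (F (of_real r)) (E (of_real r))"])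
    show "(\<lambda>x. b x i j) holomorphic_on Omega_plus A" if "i < n" "j < n" for i j by (rule b[OF that])
    show "\<rho> < r" by (simp add: r_def)
  qed (use half that in blast)+
  have right: "\<rho> < cmod x" "x \<notin> \<real>\<^sub>\<le>\<^sub>0" if "\<rho> < Re x" for x
    using that F(1) complex_Re_le_cmod[of x] by (auto simp: complex_nonpos_Reals_iff)
  have YFE: "Y x i j = mm n (F x) (E x) i j" if x: "\<rho> < Re x" and ij: "i < n" "j < n" for x i j
  proof -
    have "Y x i j - mm n (F x) (E x) i j = 0"
    proof (rule linear_ode_unique_convex[where S = "{x. \<rho> < Re x}" and b = b and p = "of_real r" and D = "\<lambda>x i j. Y x i j - mm n (F x) (E x) i j" and n = n])
      show "((\<lambda>x. Y x i j - mm n (F x) (E x) i j) has_field_derivative mm n (b x) (\<lambda>i j. Y x i j - mm n (F x) (E x) i j) i j) (at x)"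
        if x: "x \<in> {x. \<rho> < Re x}" and ij: "i < n" "j < n" for x i j
      proof -
        have "mm n (b x) (mm n (F x) (E x)) i j = mm n (fm (rm_eval A (Some x))) (mm n (F x) (E x)) i j / x"
          unfolding b_def mm_divide ..
        thus ?thesis unfolding mm_lin
          using DERIV_diff[OF Y(1)[OF subsetD[OF half x] ij] dFE[OF right ij]] x by simp
      qed
      show "continuous_on {x. \<rho> < Re x} (\<lambda>x. b x i j)" if "i < n" "j < n" for i j
        by (rule continuous_on_subset[OF holomorphic_on_imp_continuous_on[OF b[OF that]] half])
    qed (use x ij Y(2) in \<open>auto simp: convex_halfspace_Re_gt r_def\<close>)
    thus ?thesis by simp
  qed
  define Fm where "Fm x = Matrix.mat n n (\<lambda>(i, j). F x i j)" for x
  have Fm: "Fm x \<in> carrier_mat n n" for x by (simp add: Fm_def)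
  have cE: "mat_cpow n x (rm_eval A None) \<in> carrier_mat n n" for x by (simp add: mat_cpow_def)
  have prod: "(Fm x * mat_cpow n x (rm_eval A None)) $$ (i, j) = mm n (F x) (E x) i j" if ij: "i < n" "j < n" for x i j
    unfolding mat_mult_mm[OF Fm cE ij] E_def by (rule mm_cong) (use ij in \<open>auto simp: Fm_def\<close>)
  have prod3: "(rm_eval A (Some x) * (Fm x * mat_cpow n x (rm_eval A None))) $$ (i, j) = mm n (fm (rm_eval A (Some x))) (mm n (F x) (E x)) i j"
    if ij: "i < n" "j < n" for x i j
  proof -
    have c: "Fm x * mat_cpow n x (rm_eval A None) \<in> carrier_mat n n" using Fm cE by (rule mult_carrier_mat)
    show ?thesis unfolding mat_mult_mm[OF rm_eval_carrier[OF A] c ij] by (rule mm_cong) (use prod ij in auto)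
  qed
  define Ym where "Ym x = Matrix.mat n n (\<lambda>(i, j). Y x i j)" for x
  have "is_frobenius_continuation n A Ym"
    unfolding is_frobenius_continuation_def
  proof (intro conjI exI[of _ "\<lambda>s. Matrix.mat n n (\<lambda>(i, j). U s i j)"] exI[of _ Fm] exI[of _ \<rho>] allI impI)
    show "(\<lambda>x. Ym x $$ (i, j)) holomorphic_on Omega_plus A" if "i < n" "j < n" for i j
      using Y(1) that by (auto simp: Ym_def holomorphic_on_open[OF open_Omega_plus])
    show "((\<lambda>z. (Fm z * mat_cpow n z (rm_eval A None)) $$ (i, j)) has_field_derivative
               (rm_eval A (Some x) * (Fm x * mat_cpow n x (rm_eval A None))) $$ (i, j) / x) (at x)"
      if "\<rho> < cmod x" "x \<notin> \<real>\<^sub>\<le>\<^sub>0" "i < n" "j < n" for x i j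
      unfolding prod[OF that(3,4)] prod3[OF that(3,4)] by (rule dFE[OF that])
    show "Ym x = Fm x * mat_cpow n x (rm_eval A None)" if x: "\<rho> < Re x" for x
    proof (rule eq_matI)
      have c: "Fm x * mat_cpow n x (rm_eval A None) \<in> carrier_mat n n" using Fm cE by (rule mult_carrier_mat)
      fix i j assume "i < dim_row (Fm x * mat_cpow n x (rm_eval A None))" "j < dim_col (Fm x * mat_cpow n x (rm_eval A None))"
      hence ij: "i < n" "j < n" using carrier_matD[OF c] by auto
      show "Ym x $$ (i, j) = (Fm x * mat_cpow n x (rm_eval A None)) $$ (i, j)"
        unfolding prod[OF ij] YFE[OF x ij, symmetric] using ij by (simp add: Ym_def)
    qed (use cE[of x] Fm[of x] in \<open>auto simp: Ym_def\<close>)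
  qed (use F in \<open>auto simp: Ym_def Fm_def intro!: eq_matI\<close>)
  thus ?thesis by blast
qed

text \<open>Derived from the defining property alone, so that it applies to the solution picked by
  \<open>SOME\<close>. Cancelling the invertible matrix x^A0 gives the gauge equation for F, and
  analytic continuation from the half-plane gives the differential system for Y.\<close>

lemma frobenius_continuationD:
  assumes A: "A \<in> carrier_mat n n" and J: "jordan_reduction (rm_eval A None) Q R0 bs"
    and Y: "is_frobenius_continuation n A Y"
  obtains R U F where "0 < R" "\<And>a. Some a \<in> rm_poles A \<Longrightarrow> cmod a \<le> R"
    "\<And>i j. i < n \<Longrightarrow> j < n \<Longrightarrow> U 0 i j = (if i = j then 1 else 0)"
    "\<And>x i j. R < cmod x \<Longrightarrow> i < n \<Longrightarrow> j < n \<Longrightarrow> (\<lambda>s. U s i j * inverse x ^ s) sums F x i j"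
    "\<And>x i j. R < cmod x \<Longrightarrow> i < n \<Longrightarrow> j < n \<Longrightarrow> ((\<lambda>x. F x i j) has_field_derivative
        (mm n (fm (rm_eval A (Some x))) (F x) i j - mm n (F x) (fm (rm_eval A None)) i j) / x) (at x)"
    "\<And>x i j. x \<in> Omega_plus A \<Longrightarrow> i < n \<Longrightarrow> j < n \<Longrightarrow> ((\<lambda>x. Y x $$ (i, j)) has_field_derivative
        mm n (fm (rm_eval A (Some x))) (fm (Y x)) i j / x) (at x)"
    "\<And>x i j. R < Re x \<Longrightarrow> i < n \<Longrightarrow> j < n \<Longrightarrow> Y x $$ (i, j) = mm n (F x) (fm (mat_cpow n x (rm_eval A None))) i j"
proof -
  have Yc: "Y x \<in> carrier_mat n n" for x using Y unfolding is_frobenius_continuation_def by blast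
  have hol: "(\<lambda>x. Y x $$ (i, j)) holomorphic_on Omega_plus A" if "i < n" "j < n" for i j
    using Y that unfolding is_frobenius_continuation_def by blast
  obtain Fs Fm R where P: "R > 0 \<and>
        (\<forall>k. Fs k \<in> carrier_mat n n) \<and> Fs 0 = 1\<^sub>m n \<and> (\<forall>x. Fm x \<in> carrier_mat n n) \<and>
        (\<forall>a. Some a \<in> rm_poles A \<longrightarrow> cmod a \<le> R) \<and>
        (\<forall>x. cmod x > R \<longrightarrow>
          (\<forall>i<n. \<forall>j<n. (\<lambda>k. Fs k $$ (i, j) * inverse x ^ k) sums (Fm x $$ (i, j)))) \<and>
        (\<forall>x. cmod x > R \<longrightarrow> x \<notin> \<real>\<^sub>\<le>\<^sub>0 \<longrightarrow>
          (\<forall>i<n. \<forall>j<n.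
            ((\<lambda>z. (Fm z * mat_cpow n z (rm_eval A None)) $$ (i, j)) has_field_derivative
               (rm_eval A (Some x) * (Fm x * mat_cpow n x (rm_eval A None))) $$ (i, j) / x)
              (at x))) \<and>
        (\<forall>x. Re x > R \<longrightarrow> Y x = Fm x * mat_cpow n x (rm_eval A None))"
    using Y[unfolded is_frobenius_continuation_def, THEN conjunct2, THEN conjunct2] by (elim exE) (rule that)
  have R: "0 < R" and Fs: "Fs 0 = 1\<^sub>m n" and Fm: "\<And>x. Fm x \<in> carrier_mat n n" and pb: "\<And>a. Some a \<in> rm_poles A \<Longrightarrow> cmod a \<le> R"
    and ser: "\<And>x i j. R < cmod x \<Longrightarrow> i < n \<Longrightarrow> j < n \<Longrightarrow> (\<lambda>k. Fs k $$ (i, j) * inverse x ^ k) sums (Fm x $$ (i, j))"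
    and right: "\<And>x. R < Re x \<Longrightarrow> Y x = Fm x * mat_cpow n x (rm_eval A None)"
    and der: "\<And>x i j. R < cmod x \<Longrightarrow> x \<notin> \<real>\<^sub>\<le>\<^sub>0 \<Longrightarrow> i < n \<Longrightarrow> j < n \<Longrightarrow>
            ((\<lambda>z. (Fm z * mat_cpow n z (rm_eval A None)) $$ (i, j)) has_field_derivative
               (rm_eval A (Some x) * (Fm x * mat_cpow n x (rm_eval A None))) $$ (i, j) / x) (at x)"
    using P by blast+
  define A0 where "A0 = rm_eval A None"
  have A0: "A0 \<in> carrier_mat n n" using A by (simp add: A0_def)
  define a where "a x = fm (rm_eval A (Some x))" for x
  define F where "F x = fm (Fm x)" for x
  define E where "E x = fm (mat_cpow n x A0)" for x
  have cE: "mat_cpow n x A0 \<in> carrier_mat n n" for x by (simp add: mat_cpow_def)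
  have prod: "(Fm x * mat_cpow n x A0) $$ (i, j) = mm n (F x) (E x) i j" if ij: "i < n" "j < n" for x i j
    unfolding mat_mult_mm[OF Fm cE ij] E_def F_def ..
  have prod3: "(rm_eval A (Some x) * (Fm x * mat_cpow n x A0)) $$ (i, j) = mm n (a x) (mm n (F x) (E x)) i j"
    if ij: "i < n" "j < n" for x i j
  proof -
    have c: "Fm x * mat_cpow n x A0 \<in> carrier_mat n n" using Fm cE by (rule mult_carrier_mat)
    show ?thesis unfolding mat_mult_mm[OF rm_eval_carrier[OF A] c ij] a_def by (rule mm_cong) (use prod ij in auto)
  qed
  define F' where "F' x i j = deriv (\<lambda>x. F x i j) x" for x i j
  have oR: "open {x. R < cmod x}" by (intro open_Collect_less continuous_intros)
  have dF: "((\<lambda>x. F x i j) has_field_derivative F' x i j) (at x)" if x: "R < cmod x" and ij: "i < n" "j < n" for x i j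
  proof -
    have "((\<lambda>x. F x i j) has_field_derivative (\<Sum>k. - of_nat k * Fs k $$ (i, j) * inverse x ^ k) / x) (at x)"
      unfolding F_def using R x ser[OF _ ij] by (intro inverse_powser_derivative[where R = R]) auto
    thus ?thesis unfolding F'_def using DERIV_imp_deriv by metis
  qed
  have holF: "(\<lambda>x. F x i j) holomorphic_on {x. R < cmod x}" if "i < n" "j < n" for i j
    using dF that by (auto simp: holomorphic_on_open[OF oR])
  define \<Phi> where "\<Phi> x i j = F' x i j * x + mm n (F x) (fm A0) i j - mm n (a x) (F x) i j" for x i j
  have \<Phi>0: "\<Phi> x i j = 0" if x: "R < cmod x" "x \<notin> \<real>\<^sub>\<le>\<^sub>0" and ij: "i < n" "j < n" for x i j
  proof (rule cancel_right_factor[OF cE])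
    have x0: "x \<noteq> 0" using x by auto
    show "det (mat_cpow n x A0) \<noteq> 0"
      unfolding mat_cpow_mfun
    proof (rule mfun_det_nonzero[OF A0 J[folded A0_def]])
      show "(\<lambda>c. exp (c * Ln x)) holomorphic_on UNIV" by (intro holomorphic_intros)
    qed simp
    fix i j assume ij: "i < n" "j < n"
    have d1: "((\<lambda>x. mm n (F x) (E x) i j) has_field_derivative mm n (\<lambda>i j. F' x i j + mm n (F x) (fm A0) i j / x) (E x) i j) (at x)"
      unfolding E_def A0_def by (rule frobenius_product_derivative[OF A J x(2) dF[OF x(1)] ij])
    have "((\<lambda>x. mm n (F x) (E x) i j) has_field_derivative mm n (a x) (mm n (F x) (E x)) i j / x) (at x)"
      using der[OF x ij] unfolding A0_def[symmetric] prod[OF ij] prod3[OF ij] .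
    from DERIV_unique[OF d1 this] have "mm n (\<lambda>i j. F' x i j + mm n (F x) (fm A0) i j / x) (E x) i j * x = mm n (mm n (a x) (F x)) (E x) i j"
      using x0 by (simp add: mm_assoc)
    moreover have "\<Phi> x = (\<lambda>i j. x * (F' x i j + mm n (F x) (fm A0) i j / x) - mm n (a x) (F x) i j)"
      using x0 by (simp add: \<Phi>_def fun_eq_iff algebra_simps)
    ultimately show "mm n (\<Phi> x) (fm (mat_cpow n x A0)) i j = 0"
      unfolding E_def[symmetric] by (simp add: mm_lin mult.commute)
  qed (use ij in auto)
  have an: "(\<lambda>x. a x i j) analytic_on {x}" if x: "R < cmod x" and ij: "i < n" "j < n" for x i j
    unfolding a_def rm_eval_index[OF A ij]
    by (intro rf_eval_analytic_at not_rm_poleD[OF A ij]) (use pb x in force)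
  have \<Phi>_all: "\<Phi> x i j = 0" if x: "R < cmod x" and ij: "i < n" "j < n" for x i j
  proof (cases "x \<in> \<real>\<^sub>\<le>\<^sub>0")
    \<comment> \<open>On the cut the logarithm jumps but F does not: the equation is the limit of
      the one at x + i t with t > 0.\<close>
    case True
    hence Im: "Im x = 0" by (simp add: complex_nonpos_Reals_iff)
    have cF: "isCont (\<lambda>x. F x i j) x" if "i < n" "j < n" for i j using dF[OF x that] by (rule DERIV_isCont)
    have "isCont (\<lambda>x. F' x i j) x"
      using holomorphic_on_imp_continuous_on[OF holomorphic_deriv[OF holF[OF ij] oR]] x oR
      by (simp add: continuous_on_eq_continuous_at F'_def)
    moreover have "isCont (\<lambda>x. mm n (F x) (fm A0) i j) x"
      unfolding mm_def by (intro isCont_sum ballI isCont_mult cF continuous_const) (use ij in auto)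
    moreover have "isCont (\<lambda>x. mm n (a x) (F x) i j) x"
      unfolding mm_def by (intro isCont_sum ballI isCont_mult cF analytic_at_imp_isCont[OF an[OF x]]) (use ij in auto)
    ultimately have "isCont (\<lambda>x. \<Phi> x i j) x"
      unfolding \<Phi>_def by (intro isCont_diff isCont_add isCont_mult DERIV_isCont[OF DERIV_ident])
    moreover have "((\<lambda>t. x + \<i> * of_real t) \<longlongrightarrow> x + \<i> * of_real 0) (at_right 0)"
      by (intro tendsto_intros)
    ultimately have lim: "((\<lambda>t. \<Phi> (x + \<i> * of_real t) i j) \<longlongrightarrow> \<Phi> x i j) (at_right 0)"
      using isCont_tendsto_compose[of x "\<lambda>x. \<Phi> x i j"] by simp
    have "\<forall>\<^sub>F t in at_right 0. \<Phi> (x + \<i> * of_real t) i j = 0"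
    proof (rule eventually_mono[OF eventually_at_right_less])
      fix t :: real assume t: "0 < t"
      have "x + \<i> * of_real t \<notin> \<real>\<^sub>\<le>\<^sub>0" using t Im by (simp add: complex_nonpos_Reals_iff)
      moreover have "cmod x \<le> cmod (x + \<i> * of_real t)"
        using Im unfolding cmod_def by (intro real_sqrt_le_mono) simp
      ultimately show "\<Phi> (x + \<i> * of_real t) i j = 0" using x by (intro \<Phi>0 ij) auto
    qed
    hence "((\<lambda>t. \<Phi> (x + \<i> * of_real t) i j) \<longlongrightarrow> 0) (at_right 0)" by (rule tendsto_eventually)
    thus ?thesis using tendsto_unique[OF _ lim] by simp
  next
    case False thus ?thesis by (rule \<Phi>0[OF x _ ij])
  qed
  have rr: "R < cmod x" "x \<notin> \<real>\<^sub>\<le>\<^sub>0" if "R < Re x" for x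
    using that R complex_Re_le_cmod[of x] by (auto simp: complex_nonpos_Reals_iff)
  have half: "{x. R < Re x} \<subseteq> Omega_plus A" using R pb by (intro Omega_plus_half_plane) auto
  have YF: "Y x $$ (i, j) = mm n (F x) (E x) i j" if "R < Re x" "i < n" "j < n" for x i j
    unfolding right[OF that(1)] A0_def[symmetric] by (rule prod[OF that(2,3)])
  have dY: "((\<lambda>x. Y x $$ (i, j)) has_field_derivative mm n (a x) (fm (Y x)) i j / x) (at x)" if x: "x \<in> Omega_plus A" and ij: "i < n" "j < n" for x i j
  proof -
    define \<Psi> where "\<Psi> x = deriv (\<lambda>x. Y x $$ (i, j)) x * x - mm n (a x) (fm (Y x)) i j" for x
    have aO: "(\<lambda>x. a x i j) holomorphic_on Omega_plus A" if "i < n" "j < n" for i j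
      unfolding a_def by (rule rm_eval_holomorphic_Omega[OF A that])
    have "(\<lambda>x. deriv (\<lambda>x. Y x $$ (i, j)) x * x) holomorphic_on Omega_plus A"
      by (intro holomorphic_on_mult holomorphic_deriv hol ij open_Omega_plus holomorphic_on_ident)
    moreover have "(\<lambda>x. mm n (a x) (fm (Y x)) i j) holomorphic_on Omega_plus A"
      by (rule mm_holomorphic[OF aO hol ij])
    ultimately have h\<Psi>: "\<Psi> holomorphic_on Omega_plus A"
      unfolding \<Psi>_def by (rule holomorphic_on_diff)
    have z: "\<Psi> y = 0" if y: "y \<in> {x. R < Re x}" for y
    proof -
      have "((\<lambda>x. mm n (F x) (E x) i j) has_field_derivative mm n (a y) (mm n (F y) (E y)) i j / y) (at y)"
        using der[OF rr ij] y unfolding A0_def[symmetric] prod[OF ij] prod3[OF ij] by simp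
      hence "((\<lambda>x. Y x $$ (i, j)) has_field_derivative mm n (a y) (mm n (F y) (E y)) i j / y) (at y)"
        by (rule has_field_derivative_transform_within_open[OF _ open_halfspace_Re_gt[of R]]) (use y YF ij in auto)
      moreover have "mm n (a y) (mm n (F y) (E y)) i j = mm n (a y) (fm (Y y)) i j"
        by (rule mm_cong) (use y YF ij in auto)
      moreover have "y \<noteq> 0" using y R by auto
      ultimately show ?thesis unfolding \<Psi>_def using DERIV_imp_deriv by fastforce
    qed
    have "\<Psi> x = 0"
    proof (rule analytic_continuation_open[where s = "{x. R < Re x}" and s' = "Omega_plus A" and f = \<Psi> and g = "\<lambda>_. 0"])
      have "complex_of_real (R + 1) \<in> {x. R < Re x}" by simp
      thus "{x. R < Re x} \<noteq> {}" by blast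
    qed (use h\<Psi> z x half in \<open>auto simp: open_halfspace_Re_gt open_Omega_plus connected_Omega_plus\<close>)
    moreover have "x \<noteq> 0" using Omega_plus_nonpole[OF x] by simp
    ultimately have "deriv (\<lambda>x. Y x $$ (i, j)) x = mm n (a x) (fm (Y x)) i j / x"
      by (simp add: \<Psi>_def field_simps)
    thus ?thesis using holomorphic_derivI[OF hol[OF ij] open_Omega_plus x] by simp
  qed
  show ?thesis
  proof (rule that[of R "\<lambda>s. fm (Fs s)" F])
    fix x i j assume x: "R < cmod x" and ij: "i < n" "j < n"
    have "x \<noteq> 0" using x R by auto
    hence "F' x i j = (mm n (a x) (F x) i j - mm n (F x) (fm A0) i j) / x"
      using \<Phi>_all[OF x ij] by (simp add: \<Phi>_def field_simps)
    thus "((\<lambda>x. F x i j) has_field_derivative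
        (mm n (fm (rm_eval A (Some x))) (F x) i j - mm n (F x) (fm (rm_eval A None)) i j) / x) (at x)"
      using dF[OF x ij] by (simp add: a_def A0_def)
  next
    fix x i j assume x: "R < cmod x" and ij: "i < n" "j < n"
    show "(\<lambda>s. fm (Fs s) i j * inverse x ^ s) sums F x i j" unfolding F_def by (rule ser[OF x ij])
  next
    fix x i j assume "x \<in> Omega_plus A" "i < n" "j < n"
    thus "((\<lambda>x. Y x $$ (i, j)) has_field_derivative mm n (fm (rm_eval A (Some x))) (fm (Y x)) i j / x) (at x)"
      using dY by (simp add: a_def)
  next
    fix x i j assume "R < Re x" "i < n" "j < n"
    thus "Y x $$ (i, j) = mm n (F x) (fm (mat_cpow n x (rm_eval A None))) i j"
      using YF by (simp add: E_def A0_def)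
  qed (use R pb in \<open>auto simp: Fs\<close>)
qed

section \<open>Comparison of the regular factors\<close>

context canonical_system
begin

text \<open>
  The residual \<open>\<eta>\<close> is only assumed on one circle: as a function of \<open>1/x\<close> it is holomorphic and
  vanishes at 0, so Cauchy's formula bounds all its coefficients.
\<close>

lemma F_close:
  assumes V0: "\<And>i j. i < n \<Longrightarrow> j < n \<Longrightarrow> V 0 i j = (if i = j then 1 else 0)"
    and ser: "\<And>x i j. r < cmod x \<Longrightarrow> i < n \<Longrightarrow> j < n \<Longrightarrow> (\<lambda>s. V s i j * inverse x ^ s) sums G x i j"
    and r: "0 < r" "r + 2 < \<rho>" and h1: "h \<le> 1"
    and np: "\<And>x. r + 1 \<le> cmod x \<Longrightarrow> Some x \<notin> rm_poles A" and inf: "None \<notin> rm_poles A"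
    and \<eta>: "\<And>x i j. cmod x = r + 2 \<Longrightarrow> i < n \<Longrightarrow> j < n \<Longrightarrow>
      cmod (mm n (a x) (G x) i j - mm n (G (x - of_real h)) A0 i j - (x - of_real h) / of_real h * (G x i j - G (x - of_real h) i j)) \<le> \<eta>"
    and x: "hdom h \<rho> x"
  shows "mn n (\<lambda>i j. G x i j - F x i j) \<le> 2 * \<kappa> * ((r + 2) * (real n * real n * \<eta>) / (\<rho> - (r + 2)))"
proof -
  define r2 where "r2 = r + 2"
  have r2: "0 < r2" "r2 < \<rho>" using r by (auto simp: r2_def)
  \<comment> \<open>The regular factor G in the coordinate w = 1/x at infinity.\<close>
  define g where "g i j w = (if w = 0 then (if i = j then 1 else 0) else G (1 / w) i j)" for i j :: nat and w :: complex
  have hg: "g i j holomorphic_on ball 0 (1 / r)" if ij: "i < n" "j < n" for i j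
  proof (rule power_series_holomorphic[where a = "\<lambda>s. V s i j"])
    fix w :: complex assume w: "w \<in> ball 0 (1 / r)"
    show "(\<lambda>s. V s i j * (w - 0) ^ s) sums g i j w"
    proof (cases "w = 0")
      case True thus ?thesis using powser_sums_zero[of "\<lambda>s. V s i j"] V0[OF ij] by (simp add: g_def)
    next
      case False
      have "r < cmod (1 / w)" using w False r by (simp add: norm_divide field_simps)
      from ser[OF this ij] False show ?thesis by (simp add: g_def)
    qed
  qed
  define S where "S = ball (0::complex) (1 / (r + 1))"
  \<comment> \<open>For w = 1/x this is 1/(x - h), the coordinate of the shifted point.\<close>
  define v where "v w = w / (1 - of_real h * w)" for w :: complex
  have vS: "1 - of_real h * w \<noteq> 0" "v w \<in> ball 0 (1 / r)" if "w \<in> S" for w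
  proof -
    have wr: "cmod w * r + cmod w < 1" using that r by (simp add: S_def field_simps)
    have "cmod (of_real h * w) \<le> cmod w" using h1 hp by (simp add: norm_mult mult_left_le_one_le)
    hence b: "1 - cmod w \<le> cmod (1 - of_real h * w)" using norm_triangle_ineq2[of 1 "of_real h * w"] by simp
    have "0 \<le> cmod w * r" using r by simp
    hence p: "0 < cmod (1 - of_real h * w)" "cmod w * r < cmod (1 - of_real h * w)" using wr b by linarith+
    show "1 - of_real h * w \<noteq> 0" using p(1) by auto
    show "v w \<in> ball 0 (1 / r)" using p r by (simp add: v_def norm_divide field_simps)
  qed
  have SB: "S \<subseteq> ball 0 (1 / r)" using r unfolding S_def by (intro subset_ball) (simp add: field_simps)
  have hv: "v holomorphic_on S" unfolding v_def using vS(1) by (intro holomorphic_intros) auto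
  have hgv: "(\<lambda>w. g i j (v w)) holomorphic_on S" if ij: "i < n" "j < n" for i j
  proof -
    have "v ` S \<subseteq> ball 0 (1 / r)" using vS(2) by blast
    from holomorphic_on_compose_gen[OF hv hg[OF ij] this] show ?thesis by (simp add: o_def)
  qed
  have S0: "0 \<in> S" "open S" using r by (auto simp: S_def)
  have v0: "v 0 = 0" by (simp add: v_def)
  \<comment> \<open>As v has derivative 1 at 0, the numerator vanishes to second order; hence q is
    holomorphic at 0 with the value 0.\<close>
  define q where "q i j w = (if w = 0 then 0 else (g i j w - g i j (v w)) / w)" for i j w
  have hq: "q i j holomorphic_on S" if ij: "i < n" "j < n" for i j
  proof -
    have hf: "(\<lambda>w. g i j w - g i j (v w)) holomorphic_on S"
      by (rule holomorphic_on_diff[OF holomorphic_on_subset[OF hg[OF ij] SB] hgv[OF ij]])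
    have d0: "(g i j has_field_derivative deriv (g i j) 0) (at 0)"
      using r by (intro holomorphic_derivI[OF hg[OF ij] open_ball]) auto
    have "(v has_field_derivative (1 * (1 - of_real h * 0) - 0 * (0 - of_real h * 1)) / ((1 - of_real h * 0) * (1 - of_real h * 0))) (at 0)"
      unfolding v_def by (intro DERIV_divide DERIV_ident DERIV_diff DERIV_const DERIV_cmult) simp
    hence "(v has_field_derivative 1) (at 0)" by simp
    from DERIV_chain2[where f = "g i j" and g = v and x = 0, OF _ this] d0
    have "((\<lambda>w. g i j (v w)) has_field_derivative deriv (g i j) 0 * 1) (at 0)" by (simp add: v0)
    from DERIV_diff[OF d0 this] have "((\<lambda>w. g i j w - g i j (v w)) has_field_derivative 0) (at 0)" by simp
    hence "deriv (\<lambda>w. g i j w - g i j (v w)) 0 = 0" by (rule DERIV_imp_deriv)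
    with pole_lemma[OF hf, of 0] S0 show ?thesis
      by (simp add: interior_open v0 q_def[abs_def] cong: if_cong)
  qed
  define e where "e i j w = (\<Sum>k<n. rf_eval (A $$ (i, k)) (sph_inv w) * g k j w) - (\<Sum>k<n. g i k (v w) * A0 k j)
     - (1 - of_real h * w) / of_real h * q i j w" for i j w
  have "1 / r2 < 1 / (r + 1)" using r by (simp add: r2_def field_simps)
  hence c2: "cball 0 (1 / r2) \<subseteq> S" by (auto simp: S_def)
  have he: "e i j holomorphic_on cball 0 (1 / r2)" if ij: "i < n" "j < n" for i j
  proof (rule holomorphic_on_subset[OF _ c2])
    have ra: "(\<lambda>w. rf_eval (A $$ (i, k)) (sph_inv w)) holomorphic_on S" if k: "k < n" for k
      using r by (intro holomorphic_on_subset[OF rf_eval_sph_inv_holomorphic[of _ "r + 1"]] not_rm_poleD[OF A ij(1) k] inf np)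
        (auto simp: S_def)
    have 1: "(\<lambda>w. \<Sum>k<n. rf_eval (A $$ (i, k)) (sph_inv w) * g k j w) holomorphic_on S"
      by (intro holomorphic_on_sum holomorphic_on_mult ra holomorphic_on_subset[OF hg SB]) (use ij in auto)
    have 2: "(\<lambda>w. \<Sum>k<n. g i k (v w) * A0 k j) holomorphic_on S"
      by (intro holomorphic_on_sum holomorphic_on_mult hgv holomorphic_on_const) (use ij in auto)
    have 3: "(\<lambda>w. (1 - of_real h * w) / of_real h * q i j w) holomorphic_on S"
      using hp by (intro holomorphic_on_mult[OF _ hq[OF ij]] holomorphic_on_divide holomorphic_on_diff holomorphic_on_mult
          holomorphic_on_const holomorphic_on_ident) auto
    show "e i j holomorphic_on S" unfolding e_def by (intro holomorphic_on_diff 1 2 3)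
  qed
  have e0: "e i j 0 = 0" if ij: "i < n" "j < n" for i j
  proof -
    have "(\<Sum>k<n. rf_eval (A $$ (i, k)) (sph_inv 0) * g k j 0) = (\<Sum>k<n. A0 i k * (if k = j then 1 else 0))"
      using ij by (intro sum.cong refl) (simp add: sph_inv_def g_def A0_eq rm_eval_index[OF A])
    moreover have "(\<Sum>k<n. g i k (v 0) * A0 k j) = (\<Sum>k<n. (if i = k then 1 else 0) * A0 k j)"
      by (simp add: g_def v0)
    ultimately show ?thesis using ij unfolding e_def
      by (simp add: q_def if_distrib if_distribR cong: if_cong)
  qed
  have ex: "e i j (1 / x) = mm n (a x) (G x) i j - mm n (G (x - of_real h)) A0 i j - (x - of_real h) / of_real h * (G x i j - G (x - of_real h) i j)"
    if x: "r + 1 < cmod x" and ij: "i < n" "j < n" for x i j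
  proof -
    have x0: "x \<noteq> 0" using x r by auto
    have xh: "x - of_real h \<noteq> 0"
    proof
      assume "x - of_real h = 0"
      hence "cmod x = \<bar>h\<bar>" by (metis eq_iff_diff_eq_0 norm_of_real)
      thus False using x r h1 hp by simp
    qed
    have v: "v (1 / x) = 1 / (x - of_real h)" using x0 xh by (simp add: v_def field_simps)
    have g1: "g k l (1 / x) = G x k l" "g k l (v (1 / x)) = G (x - of_real h) k l" for k l
      using x0 xh by (simp_all add: g_def v)
    have "(1 - of_real h * (1 / x)) / of_real h * q i j (1 / x) = (x - of_real h) / of_real h * (G x i j - G (x - of_real h) i j)"
    proof -
      have "(1 - of_real h * (1 / x)) * x = x - of_real h" using x0 by (simp add: left_diff_distrib)
      moreover have "(1 - of_real h * (1 / x)) / of_real h * (d / (1 / x)) = ((1 - of_real h * (1 / x)) * x) / of_real h * d" for d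
        by simp
      ultimately show ?thesis using x0 by (simp only: q_def g1) simp
    qed
    moreover have "rf_eval (A $$ (i, k)) (sph_inv (1 / x)) = a x i k" if "k < n" for k
      using x0 ij that by (simp add: sph_inv_def rm_eval_index[OF A])
    ultimately show ?thesis unfolding e_def mm_def by (simp add: g1)
  qed
  define P where "P f M c \<longleftrightarrow> c 0 = f 0 \<and> (\<forall>s. cmod (c (Suc s)) \<le> r2 * M * h_rising h s r2)
     \<and> (\<forall>x. hdom h \<rho> x \<longrightarrow> (\<lambda>s. c s * fe h s x) sums f (1 / x))" for f :: "complex \<Rightarrow> complex" and M :: real and c :: "nat \<Rightarrow> complex"
  have exP: "\<exists>c. P f M c" if f: "f holomorphic_on cball 0 (1 / r2)" and M: "\<And>w. cmod w = 1 / r2 \<Longrightarrow> cmod (f w) \<le> M" for f M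
  proof -
    obtain c where "c 0 = f 0" "\<And>s. cmod (c (Suc s)) \<le> r2 * M * h_rising h s r2"
      "\<And>\<rho> x. r2 < \<rho> \<Longrightarrow> hdom h \<rho> x \<Longrightarrow> (\<lambda>s. c s * fe h s x) sums f (1 / x)"
      by (rule holomorphic_at_infinity_fe_expansion[OF h r2(1) f M]) blast+
    thus ?thesis unfolding P_def using r2(2) by blast
  qed
  have "\<exists>c. P (e i j) \<eta> c" if ij: "i < n" "j < n" for i j
  proof (rule exP[OF he[OF ij]])
    fix w :: complex assume w: "cmod w = 1 / r2"
    have "cmod (1 / w) = r2" "w \<noteq> 0" using w r2 by (auto simp: norm_divide)
    thus "cmod (e i j w) \<le> \<eta>" using ex[of "1 / w", OF _ ij] \<eta>[of "1 / w", OF _ ij] by (simp add: r2_def)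
  qed
  hence "\<forall>i j. \<exists>c. i < n \<longrightarrow> j < n \<longrightarrow> P (e i j) \<eta> c" by blast
  then obtain ec where ec: "\<And>i j. i < n \<Longrightarrow> j < n \<Longrightarrow> P (e i j) \<eta> (ec i j)" by metis
  have "\<exists>M c. P (g i j) M c" if ij: "i < n" "j < n" for i j
  proof -
    have hg2: "g i j holomorphic_on cball 0 (1 / r2)" using hg[OF ij] c2 SB by (blast intro: holomorphic_on_subset)
    have "bounded (g i j ` cball 0 (1 / r2))"
      by (intro compact_imp_bounded compact_continuous_image holomorphic_on_imp_continuous_on hg2 compact_cball)
    then obtain M where M: "\<forall>w\<in>cball 0 (1 / r2). cmod (g i j w) \<le> M" by (auto simp: bounded_iff)
    have "\<exists>c. P (g i j) M c" by (rule exP[OF hg2]) (use M in simp)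
    thus ?thesis by blast
  qed
  hence "\<forall>i j. \<exists>M c. i < n \<longrightarrow> j < n \<longrightarrow> P (g i j) M c" by blast
  then obtain gM gc where gc: "\<And>i j. i < n \<Longrightarrow> j < n \<Longrightarrow> P (g i j) (gM i j) (gc i j)" by metis
  \<comment> \<open>The coefficients of G - 1: the power series in 1/x is re-expanded in inverse
    rising factorials of step h.\<close>
  define W where "W s i j = (if s = 0 then 0 else gc i j s)" for s i j
  define Em where "Em s i j = - ec i j s" for s i j
  have sW: "summable (\<lambda>s. mn n (W s) * fe h s \<rho>)"
    unfolding mn_def sum_distrib_right
  proof (intro summable_sum)
    fix i j assume "i \<in> {..<n}" "j \<in> {..<n}"
    hence "\<bar>cmod (W (Suc s) i j)\<bar> \<le> r2 * gM i j * h_rising h s r2" for s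
      using gc[of i j] by (simp add: P_def W_def)
    from fe_coeffs_bound(1)[OF h r2 this] show "summable (\<lambda>s. cmod (W s i j) * fe h s \<rho>)" by (simp add: W_def)
  qed
  have E0: "mn n (Em 0) = 0"
    using ec e0 by (simp add: mn_def Em_def P_def)
  have "\<bar>mn n (Em (Suc s))\<bar> \<le> r2 * (real n * real n * \<eta>) * h_rising h s r2" for s
    using mn_le[of n "Em (Suc s)" "r2 * \<eta> * h_rising h s r2"] ec by (simp add: P_def Em_def mult_ac)
  note sE = fe_coeffs_bound[of h r2 \<rho> "\<lambda>s. mn n (Em s)", OF h r2 this E0, unfolded abs_of_nonneg[OF mn_nonneg]]
  have evW: "ev h W y i j = G y i j - (if i = j then 1 else 0)" if y: "hdom h \<rho> y" and ij: "i < n" "j < n" for y i j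
  proof -
    define c :: complex where "c = (if i = j then 1 else 0)"
    have y0: "y \<noteq> 0" using hdom_nonzero[OF y h \<rho>, of 0] by simp
    have "(\<lambda>s. if s = 0 then c else 0) sums c" using sums_single[of 0 "\<lambda>_. c"] by simp
    moreover have "(\<lambda>s. gc i j s * fe h s y) sums g i j (1 / y)" using gc[OF ij] y by (simp add: P_def)
    ultimately have "(\<lambda>s. gc i j s * fe h s y - (if s = 0 then c else 0)) sums (g i j (1 / y) - c)" using sums_diff by blast
    moreover have "gc i j s * fe h s y - (if s = 0 then c else 0) = W s i j * fe h s y" for s
      using gc[OF ij] by (simp add: W_def P_def g_def c_def)
    ultimately show ?thesis using y0 by (simp add: ev_def sums_iff g_def c_def)
  qed
  define D where "D s i j = W s i j - U s i j" for s i j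
  have sD: "summable (\<lambda>s. mn n (D s) * fe h s \<rho>)"
  proof (rule summable_comparison_test'[OF summable_add[OF sW U_summable(2)], of 0])
    fix s
    have "mn n (D s) * fe h s \<rho> \<le> (mn n (W s) + mn n (U s)) * fe h s \<rho>"
      unfolding D_def by (intro mult_right_mono mn_diff_le fe0)
    thus "norm (mn n (D s) * fe h s \<rho>) \<le> mn n (W s) * fe h s \<rho> + mn n (U s) * fe h s \<rho>"
      using fe0[of s] by (simp add: distrib_right)
  qed
  have evD: "ev h D y i j = G y i j - F y i j" if y: "hdom h \<rho> y" and ij: "i < n" "j < n" for y i j
  proof -
    have "(\<lambda>s. W s i j * fe h s y - U s i j * fe h s y) sums (ev h W y i j - ev h U y i j)"
      by (intro sums_diff ev_sums sW U_summable(2) ij y)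
    hence "ev h D y i j = ev h W y i j - ev h U y i j" by (simp add: ev_def D_def left_diff_distrib sums_iff)
    thus ?thesis by (simp add: evW[OF y ij] F_def)
  qed
  have eq: "sylv n s A0 (D s) i j = rhs Em D s i j" if ij: "i < n" "j < n" for s i j
  proof (rule gauge_coeffs[OF sD sE(1) hp _ ij, where ?\<rho>1.0 = "\<rho> + h"])
    fix x :: real and i j assume x: "\<rho> + h \<le> x" and ij: "i < n" "j < n"
    define y where "y = complex_of_real x"
    have y: "\<rho> + h \<le> Re y" using x by (simp add: y_def)
    have d: "hdom h \<rho> y" "hdom h \<rho> (y - of_real h)" using y hp by (auto intro!: hdom_Re)
    have cy: "r + 1 < cmod y" using y complex_Re_le_cmod[of y] r hp by linarith
    have "(\<lambda>s. ec i j s * fe h s y) sums e i j (1 / y)" using ec[OF ij] d(1) by (simp add: P_def)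
    hence "(\<lambda>s. Em s i j * fe h s y) sums - e i j (1 / y)" using sums_minus by (fastforce simp: Em_def)
    hence evE: "ev h Em y i j = - e i j (1 / y)" by (simp add: ev_def sums_iff)
    have m1: "mm n (a y) (ev h D y) i j = mm n (a y) (G y) i j - mm n (a y) (F y) i j"
    proof -
      have "mm n (a y) (ev h D y) i j = mm n (a y) (\<lambda>i j. G y i j - F y i j) i j" by (rule mm_cong) (use evD[OF d(1)] ij in auto)
      thus ?thesis by (simp only: mm_lin)
    qed
    have m2: "mm n (ev h D (y - of_real h)) A0 i j = mm n (G (y - of_real h)) A0 i j - mm n (F (y - of_real h)) A0 i j"
    proof -
      have "mm n (ev h D (y - of_real h)) A0 i j = mm n (\<lambda>i j. G (y - of_real h) i j - F (y - of_real h) i j) A0 i j" by (rule mm_cong) (use evD[OF d(2)] ij in auto)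
      thus ?thesis by (simp only: mm_lin)
    qed
    have gs: "dev D y i j - mm n A0 (ev h D y) i j + mm n (ev h D y) A0 i j
          - (0 * ev h B y i j + mm n (ev h B y) (ev h D y) i j + of_real h / (y - of_real h) * mm n (dev D y) A0 i j)
       = (y - of_real h) / of_real h * (ev h D y i j - ev h D (y - of_real h) i j) - mm n (a y) (ev h D y) i j + mm n (ev h D (y - of_real h)) A0 i j"
      by (rule gauge_shift[OF y sD _ ij]) simp
    have "\<dots> = ((y - of_real h) / of_real h * (G y i j - G (y - of_real h) i j) - mm n (a y) (G y) i j + mm n (G (y - of_real h)) A0 i j)
        - ((y - of_real h) / of_real h * (F y i j - F (y - of_real h) i j) - mm n (a y) (F y) i j + mm n (F (y - of_real h)) A0 i j)"
      unfolding m1 m2 evD[OF d(1) ij] evD[OF d(2) ij] by (simp add: algebra_simps)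
    also have "\<dots> = - e i j (1 / y)" unfolding F_shift[OF y ij] ex[OF cy ij] by simp
    finally have sh: "(y - of_real h) / of_real h * (ev h D y i j - ev h D (y - of_real h) i j) - mm n (a y) (ev h D y) i j + mm n (ev h D (y - of_real h)) A0 i j = - e i j (1 / y)" .
    have alg: "p - (0 * b + c + d) = - e \<Longrightarrow> p - (- e + c + d) = 0" for p b c d e :: complex
      by (simp add: algebra_simps)
    show "dev D (complex_of_real x) i j - mm n A0 (ev h D (of_real x)) i j + mm n (ev h D (of_real x)) A0 i j
        - (ev h Em (of_real x) i j + mm n (ev h B (of_real x)) (ev h D (of_real x)) i j
           + of_real h / (of_real x - of_real h) * mm n (dev D (of_real x)) A0 i j) = 0"
      unfolding y_def[symmetric] evE by (rule alg[OF trans[OF gs sh]])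
  qed
  have "(\<Sum>s. mn n (D s) * fe h s \<rho>) \<le> 2 * \<kappa> * (\<Sum>s. mn n (Em s) * fe h s \<rho>)"
    by (rule stability_summable(3)[OF _ eq sE(1)]) (simp_all add: D_def W_def U(1))
  also have "\<dots> \<le> 2 * \<kappa> * (r2 * (real n * real n * \<eta>) / (\<rho> - r2))"
    by (intro mult_left_mono sE(2)) (use \<kappa> in auto)
  finally have "mn n (ev h D x) \<le> 2 * \<kappa> * (r2 * (real n * real n * \<eta>) / (\<rho> - r2))"
    using mn_ev_le[OF sD x] by linarith
  moreover have "mn n (ev h D x) = mn n (\<lambda>i j. G x i j - F x i j)" by (rule mn_cong) (rule evD[OF x])
  ultimately show ?thesis by (simp add: r2_def)
qed

text \<open>Discrete Gronwall: the error e satisfies e(z) \<le> (1 + h L) e(z + h) + h \<tau>. The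
  number N need only be large enough to reach Re z \<ge> \<rho>1, where the bound \<epsilon> takes
  over.\<close>

lemma euler_close:
  assumes step: "\<And>z. z \<in> S \<Longrightarrow> Re z < \<rho>1 \<Longrightarrow> z + of_real h \<in> S"
    and start: "\<And>z. z \<in> S \<Longrightarrow> \<rho>1 \<le> Re z \<Longrightarrow> mn n (\<lambda>i j. Yraw z i j - Yt z i j) \<le> \<epsilon>"
    and L: "\<And>z. z \<in> S \<Longrightarrow> z + of_real h \<in> S \<Longrightarrow> mn n (a (z + of_real h)) / cmod z \<le> L"
    and \<tau>: "\<And>z. z \<in> S \<Longrightarrow> z + of_real h \<in> S \<Longrightarrow>
      mn n (\<lambda>i j. Yt (z + of_real h) i j - of_real h / z * mm n (a (z + of_real h)) (Yt (z + of_real h)) i j - Yt z i j) \<le> h * \<tau>"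
    and nn: "0 \<le> L" "0 \<le> \<tau>" "0 \<le> \<epsilon>"
    and z: "z \<in> S" "\<rho>1 \<le> Re z + real N * h"
  shows "mn n (\<lambda>i j. Yraw z i j - Yt z i j) \<le> (1 + h * L) ^ N * (\<epsilon> + real N * (h * \<tau>))"
  using z
proof (induction N arbitrary: z)
  case 0 thus ?case using start[of z] by simp
next
  case (Suc N)
  have hL: "0 \<le> h * L" "0 \<le> h * \<tau>" using hp nn by simp_all
  show ?case
  proof (cases "\<rho>1 \<le> Re z")
    case True
    have "1 * (\<epsilon> + 0) \<le> (1 + h * L) ^ Suc N * (\<epsilon> + real (Suc N) * (h * \<tau>))"
      using hL nn by (intro mult_mono add_left_mono one_le_power) auto
    thus ?thesis using start[OF Suc.prems(1) True] by simp
  next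
    case False
    define y where "y = z + complex_of_real h"
    have y: "y \<in> S" using step[OF Suc.prems(1)] False by (simp add: y_def)
    define X where "X = (\<lambda>i j. Yraw y i j - Yt y i j)"
    have IH: "mn n X \<le> (1 + h * L) ^ N * (\<epsilon> + real N * (h * \<tau>))"
      unfolding X_def by (rule Suc.IH[OF y]) (use Suc.prems(2) in \<open>simp add: y_def algebra_simps\<close>)
    define Z where "Z = (\<lambda>i j. Yt y i j - of_real h / z * mm n (a y) (Yt y) i j - Yt z i j)"
    have Z: "mn n Z \<le> h * \<tau>" unfolding Z_def y_def by (rule \<tau>) (use Suc.prems(1) y in \<open>simp_all add: y_def\<close>)
    have "mn n (\<lambda>i j. Yraw z i j - Yt z i j) = mn n (\<lambda>i j. (X i j - of_real h / z * mm n (a y) X i j) + Z i j)"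
      by (rule mn_cong) (simp add: Yraw_rec[of _ _ z] X_def Z_def y_def[symmetric] mm_lin algebra_simps)
    also have "\<dots> \<le> mn n (\<lambda>i j. X i j - of_real h / z * mm n (a y) X i j) + mn n Z" by (rule mn_add_le)
    also have "\<dots> \<le> (mn n X + mn n (\<lambda>i j. of_real h / z * mm n (a y) X i j)) + h * \<tau>" by (intro add_mono mn_diff_le Z)
    also have "mn n (\<lambda>i j. of_real h / z * mm n (a y) X i j) \<le> h * L * mn n X"
    proof -
      have "mn n (\<lambda>i j. of_real h / z * mm n (a y) X i j) = h / cmod z * mn n (mm n (a y) X)"
        using mn_scale[of n "of_real h / z" "mm n (a y) X"] by (simp only: norm_divide norm_of_real abs_of_pos[OF hp])
      also have "\<dots> \<le> h / cmod z * (mn n (a y) * mn n X)" by (intro mult_left_mono mn_mm_le) (use hp in simp)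
      also have "\<dots> = h * (mn n (a y) / cmod z) * mn n X" by simp
      also have "\<dots> \<le> h * L * mn n X"
        using L[OF Suc.prems(1) y[unfolded y_def]] hp by (intro mult_right_mono mult_left_mono) (simp_all add: y_def)
      finally show ?thesis .
    qed
    finally have "mn n (\<lambda>i j. Yraw z i j - Yt z i j) \<le> (1 + h * L) * mn n X + h * \<tau>" by (simp add: algebra_simps)
    also have "\<dots> \<le> (1 + h * L) * ((1 + h * L) ^ N * (\<epsilon> + real N * (h * \<tau>))) + h * \<tau>"
      using hL nn hp by (intro add_mono mult_left_mono IH) auto
    also have "\<dots> \<le> (1 + h * L) * ((1 + h * L) ^ N * (\<epsilon> + real N * (h * \<tau>))) + (1 + h * L) ^ Suc N * (h * \<tau>)"
      using mult_right_mono[of 1 "(1 + h * L) ^ Suc N" "h * \<tau>"] one_le_power[of "1 + h * L" "Suc N"] hL by simp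
    also have "\<dots> = (1 + h * L) ^ Suc N * (\<epsilon> + real (Suc N) * (h * \<tau>))" by (simp add: algebra_simps)
    finally show ?thesis .
  qed
qed

end

section \<open>Uniform limits of matrix functions\<close>

lemma ul_mult:
  fixes f g :: "real \<Rightarrow> complex \<Rightarrow> complex"
  assumes K: "compact K" and f: "uniform_limit K f f0 F" and g: "uniform_limit K g g0 F"
    and c: "continuous_on K f0" "continuous_on K g0"
  shows "uniform_limit K (\<lambda>h x. f h x * g h x) (\<lambda>x. f0 x * g0 x) F"
  by (intro uniform_lim_mult f g compact_imp_bounded compact_continuous_image c K)

lemma ul_sum:
  fixes f :: "'b \<Rightarrow> 'c \<Rightarrow> 'd \<Rightarrow> complex"
  assumes "\<And>k. k \<in> I \<Longrightarrow> uniform_limit K (f k) (f0 k) F"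
  shows "uniform_limit K (\<lambda>h x. \<Sum>k\<in>I. f k h x) (\<lambda>x. \<Sum>k\<in>I. f0 k x) F"
  using assms
proof (induction I rule: infinite_finite_induct)
  case (insert k I)
  have "uniform_limit K (\<lambda>h x. f k h x + (\<Sum>k\<in>I. f k h x)) (\<lambda>x. f0 k x + (\<Sum>k\<in>I. f0 k x)) F"
    by (intro uniform_limit_add insert) simp_all
  thus ?case using insert.hyps by simp
qed (simp_all add: uniform_limit_const)

lemma ul_mm:
  fixes X Y :: "real \<Rightarrow> complex \<Rightarrow> nat \<Rightarrow> nat \<Rightarrow> complex"
  assumes K: "compact K"
    and X: "\<And>i j. i < n \<Longrightarrow> j < n \<Longrightarrow> uniform_limit K (\<lambda>h x. X h x i j) (\<lambda>x. X0 x i j) F"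
    and Y: "\<And>i j. i < n \<Longrightarrow> j < n \<Longrightarrow> uniform_limit K (\<lambda>h x. Y h x i j) (\<lambda>x. Y0 x i j) F"
    and c: "\<And>i j. i < n \<Longrightarrow> j < n \<Longrightarrow> continuous_on K (\<lambda>x. X0 x i j)" "\<And>i j. i < n \<Longrightarrow> j < n \<Longrightarrow> continuous_on K (\<lambda>x. Y0 x i j)"
    and ij: "i < n" "j < n"
  shows "uniform_limit K (\<lambda>h x. mm n (X h x) (Y h x) i j) (\<lambda>x. mm n (X0 x) (Y0 x) i j) F"
  unfolding mm_def by (intro ul_sum ul_mult K X Y c) (use ij in auto)

lemma ul_mn:
  fixes X :: "'a \<Rightarrow> 'b \<Rightarrow> nat \<Rightarrow> nat \<Rightarrow> complex"
  assumes X: "\<And>i j. i < n \<Longrightarrow> j < n \<Longrightarrow> uniform_limit K (\<lambda>h x. X h x i j) (\<lambda>x. X0 x i j) F" and e: "0 < \<epsilon>"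
  shows "\<forall>\<^sub>F h in F. \<forall>x\<in>K. mn n (\<lambda>i j. X h x i j - X0 x i j) \<le> \<epsilon>"
proof -
  define e' where "e' = \<epsilon> / (real n * real n + 1)"
  have p: "0 < real n * real n + 1" by (simp add: add_nonneg_pos)
  have e': "0 < e'" using e p by (simp add: e'_def)
  have "\<forall>\<^sub>F h in F. \<forall>i\<in>{..<n}. \<forall>j\<in>{..<n}. \<forall>x\<in>K. dist (X h x i j) (X0 x i j) < e'"
  proof (rule eventually_ball_finite[OF finite_lessThan], rule ballI, rule eventually_ball_finite[OF finite_lessThan], rule ballI)
    fix i j assume "i \<in> {..<n}" "j \<in> {..<n}"
    thus "\<forall>\<^sub>F h in F. \<forall>x\<in>K. dist (X h x i j) (X0 x i j) < e'" by (intro uniform_limitD[OF X e']) auto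
  qed
  thus ?thesis
  proof eventually_elim
    case (elim h)
    show ?case
    proof
      fix x assume x: "x \<in> K"
      have "mn n (\<lambda>i j. X h x i j - X0 x i j) \<le> real n * real n * e'"
      proof (rule mn_le)
        fix i j assume "i < n" "j < n"
        hence "dist (X h x i j) (X0 x i j) < e'" using elim x by blast
        thus "cmod (X h x i j - X0 x i j) \<le> e'" by (simp add: dist_norm)
      qed
      also have "\<dots> \<le> (real n * real n + 1) * e'" using e' by (intro mult_right_mono) auto
      also have "\<dots> = \<epsilon>" using p by (simp add: e'_def)
      finally show "mn n (\<lambda>i j. X h x i j - X0 x i j) \<le> \<epsilon>" .
    qed
  qed
qed

lemma ulI_le:
  fixes f :: "'a \<Rightarrow> 'b \<Rightarrow> complex"
  assumes "\<And>\<epsilon>. 0 < \<epsilon> \<Longrightarrow> \<forall>\<^sub>F h in F. \<forall>x\<in>K. cmod (f h x - f0 x) \<le> \<epsilon>"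
  shows "uniform_limit K f f0 F"
proof (rule uniform_limitI)
  fix e :: real assume "0 < e"
  hence "\<forall>\<^sub>F h in F. \<forall>x\<in>K. cmod (f h x - f0 x) \<le> e / 2" by (intro assms) simp
  thus "\<forall>\<^sub>F h in F. \<forall>x\<in>K. dist (f h x) (f0 x) < e"
    by eventually_elim (use \<open>0 < e\<close> in \<open>force simp: dist_norm\<close>)
qed

lemma compact_mn_bound:
  fixes g :: "complex \<Rightarrow> nat \<Rightarrow> nat \<Rightarrow> complex"
  assumes "compact K" "\<And>i j. i < n \<Longrightarrow> j < n \<Longrightarrow> continuous_on K (\<lambda>x. g x i j)"
  obtains M where "0 \<le> M" "\<And>x. x \<in> K \<Longrightarrow> mn n (g x) \<le> M"
proof -
  have "continuous_on K (\<lambda>x. mn n (g x))"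
    unfolding mn_def by (intro continuous_on_sum continuous_on_norm assms(2)) auto
  hence "bounded ((\<lambda>x. mn n (g x)) ` K)" by (intro compact_imp_bounded compact_continuous_image assms(1))
  then obtain M where M: "\<And>x. x \<in> K \<Longrightarrow> mn n (g x) \<le> M" by (auto simp: bounded_iff)
  show ?thesis
  proof (rule that[of "max 0 M"])
    show "mn n (g x) \<le> max 0 M" if "x \<in> K" for x using M[OF that] by simp
  qed simp
qed

section \<open>Comparison with entrywise sums\<close>

text \<open>Expansion in matrix units and the triangle inequality; the constant is the sum of the
  norms of the units.\<close>

lemma algebra_norm_le_mn:
  assumes "algebra_norm n nrm"
  obtains c where "0 \<le> c" "\<And>X. X \<in> carrier_mat n n \<Longrightarrow> nrm X \<le> c * mn n (fm X)"
proof -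
  note N = assms[unfolded algebra_norm_def]
  define u where "u p = Matrix.mat n n (\<lambda>q. if q = p then 1 else (0::complex))" for p :: "nat \<times> nat"
  have uc: "u p \<in> carrier_mat n n" for p by (simp add: u_def)
  have nu: "0 \<le> nrm (u p)" for p using N uc by blast
  define I where "I = {..<n} \<times> {..<n}"
  have I: "finite I" by (simp add: I_def)
  have step: "nrm (Matrix.mat n n (\<lambda>q. if q \<in> T then X $$ q else 0)) \<le> (\<Sum>q\<in>T. cmod (X $$ q) * nrm (u q))" if "finite T" for T and X :: "complex mat"
    using that
  proof (induction T)
    case empty
    have "Matrix.mat n n (\<lambda>q. if q \<in> {} then X $$ q else 0) = 0\<^sub>m n n" by (intro eq_matI) auto
    moreover have "nrm (0\<^sub>m n n) = 0" using N zero_carrier_mat[of n n] by blast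
    ultimately show ?case by simp
  next
    case (insert p T)
    define Z where "Z = Matrix.mat n n (\<lambda>q. if q \<in> T then X $$ q else 0)"
    have Zc: "Z \<in> carrier_mat n n" by (simp add: Z_def)
    have sc: "X $$ p \<cdot>\<^sub>m u p \<in> carrier_mat n n" using uc by simp
    have "Matrix.mat n n (\<lambda>q. if q \<in> insert p T then X $$ q else 0) = X $$ p \<cdot>\<^sub>m u p + Z"
      using insert.hyps by (intro eq_matI) (auto simp: Z_def u_def)
    hence "nrm (Matrix.mat n n (\<lambda>q. if q \<in> insert p T then X $$ q else 0)) \<le> nrm (X $$ p \<cdot>\<^sub>m u p) + nrm Z"
      using N Zc sc by simp
    also have "nrm (X $$ p \<cdot>\<^sub>m u p) = cmod (X $$ p) * nrm (u p)" using N uc by blast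
    finally show ?case using insert by (simp add: Z_def)
  qed
  show ?thesis
  proof (rule that[of "\<Sum>p\<in>I. nrm (u p)"])
    show "0 \<le> (\<Sum>p\<in>I. nrm (u p))" by (intro sum_nonneg nu)
    fix X :: "complex mat" assume X: "X \<in> carrier_mat n n"
    have "Matrix.mat n n (\<lambda>q. if q \<in> I then X $$ q else 0) = X" using X by (intro eq_matI) (auto simp: I_def)
    hence "nrm X \<le> (\<Sum>q\<in>I. cmod (X $$ q) * nrm (u q))" using step[OF I, of X] by simp
    also have "\<dots> \<le> (\<Sum>q\<in>I. mn n (fm X) * nrm (u q))"
      by (intro sum_mono mult_right_mono nu) (auto simp: I_def intro: entry_le_mn[where X = "fm X"])
    also have "\<dots> = (\<Sum>p\<in>I. nrm (u p)) * mn n (fm X)" by (simp add: sum_distrib_right mult.commute)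
    finally show "nrm X \<le> (\<Sum>p\<in>I. nrm (u p)) * mn n (fm X)" .
  qed
qed

section \<open>The family of difference systems\<close>

lemma eigenvalue_jordan_diagonal:
  assumes J: "jordan_reduction A Q R bs" and A: "A \<in> carrier_mat n n" and e: "eigenvalue A c"
  shows "\<exists>k<n. c = jordan_matrix bs $$ (k, k)"
proof -
  note D = jordan_reductionD[OF J A]
  have "similar_mat A (jordan_matrix bs)" using J by (auto simp: jordan_reduction_def similar_mat_def)
  hence "poly (char_poly (jordan_matrix bs)) c = 0"
    using e eigenvalue_root_char_poly[OF A] char_poly_similar by metis
  moreover have "upper_triangular (jordan_matrix bs)"
    using jordan_matrix_lower_zero[OF D(7)] D(7) by (intro upper_triangularI) auto
  ultimately have "poly (\<Prod>a\<leftarrow>diag_mat (jordan_matrix bs). [:- a, 1:]) c = 0"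
    using char_poly_upper_triangular[OF D(7)] by simp
  hence "c \<in> set (diag_mat (jordan_matrix bs))" by (auto simp: poly_prod_list prod_list_zero_iff o_def)
  then obtain k where "k < dim_row (jordan_matrix bs)" "c = jordan_matrix bs $$ (k, k)"
    unfolding diag_mat_def by auto
  thus ?thesis using carrier_matD(1)[OF D(7)] by auto
qed

locale unfolding_family =
  fixes n :: nat and h0 :: real and At :: "complex poly fract mat" and A :: "real \<Rightarrow> complex poly fract mat"
    and Qt Qtinv :: "complex mat" and bst :: "(nat \<times> complex) list"
    and Q Qinv :: "real \<Rightarrow> complex mat" and bs :: "real \<Rightarrow> (nat \<times> complex) list"
  assumes h0: "0 < h0" and At: "At \<in> carrier_mat n n" and A: "\<And>h. h \<in> {0<..<h0} \<Longrightarrow> A h \<in> carrier_mat n n"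
    and holo_inf: "None \<notin> rm_poles At" and nonres: "nonresonant (rm_eval At None)"
    and no_poles: "\<And>p. p \<notin> rm_poles At \<Longrightarrow>
      \<exists>U. openin riemann_sphere U \<and> p \<in> U \<and> (\<forall>\<^sub>F h in at_right 0. U \<inter> rm_poles (A h) = {})"
    and conv: "\<And>K i j. compactin riemann_sphere K \<Longrightarrow> K \<inter> rm_poles At = {} \<Longrightarrow> i < n \<Longrightarrow> j < n \<Longrightarrow>
      uniform_limit K (\<lambda>h p. rm_eval (A h) p $$ (i, j)) (\<lambda>p. rm_eval At p $$ (i, j)) (at_right 0)"
    and Jt: "jordan_reduction (rm_eval At None) Qt Qtinv bst"
    and J: "\<And>h. h \<in> {0<..<h0} \<Longrightarrow> jordan_reduction (rm_eval (A h) None) (Q h) (Qinv h) (bs h)"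
    and J_lim: "\<And>i j. i < n \<Longrightarrow> j < n \<Longrightarrow> ((\<lambda>h. jordan_matrix (bs h) $$ (i, j)) \<longlongrightarrow> jordan_matrix bst $$ (i, j)) (at_right 0)"
begin

abbreviation A0 :: "complex mat" where "A0 \<equiv> rm_eval At None"

abbreviation Ah0 :: "real \<Rightarrow> complex mat" where "Ah0 h \<equiv> rm_eval (A h) None"

lemma A0: "A0 \<in> carrier_mat n n" using At by simp

lemma small_h:
  assumes "0 < (c :: real)"
  shows "\<forall>\<^sub>F h in at_right 0. h \<in> {0<..<h0} \<and> h < c"
proof -
  have "\<forall>\<^sub>F h in at_right 0. h \<in> {0<..<min h0 c}" using h0 assms by (intro eventually_at_right_real) simp
  thus ?thesis by eventually_elim simp
qed

text \<open>A finite subcover turns the pointwise smallness conditions on h into one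
  threshold.\<close>

lemma no_poles_compact:
  assumes K: "compactin riemann_sphere K" "K \<inter> rm_poles At = {}"
  shows "\<forall>\<^sub>F h in at_right 0. K \<inter> rm_poles (A h) = {}"
proof -
  define \<U> where "\<U> = {U. openin riemann_sphere U \<and> (\<forall>\<^sub>F h in at_right 0. U \<inter> rm_poles (A h) = {})}"
  have "K \<subseteq> \<Union>\<U>" using no_poles K(2) unfolding \<U>_def by blast
  moreover have "\<And>U. U \<in> \<U> \<Longrightarrow> openin riemann_sphere U" by (simp add: \<U>_def)
  ultimately obtain \<F> where F: "finite \<F>" "\<F> \<subseteq> \<U>" "K \<subseteq> \<Union>\<F>" using compactinD[OF K(1), of \<U>] by blast
  have "\<forall>\<^sub>F h in at_right 0. \<forall>U\<in>\<F>. U \<inter> rm_poles (A h) = {}"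
    using F(2) by (intro eventually_ball_finite F(1)) (auto simp: \<U>_def)
  thus ?thesis by eventually_elim (use F(3) in blast)
qed

lemma conv_Some:
  assumes K: "compact K" "\<And>x. x \<in> K \<Longrightarrow> Some x \<notin> rm_poles At" and ij: "i < n" "j < n"
  shows "uniform_limit K (\<lambda>h x. rm_eval (A h) (Some x) $$ (i, j)) (\<lambda>x. rm_eval At (Some x) $$ (i, j)) (at_right 0)"
proof (rule uniform_limit_compose'[OF conv[OF compactin_sph_Some[OF K(1)] _ ij]])
  show "Some ` K \<inter> rm_poles At = {}" using K(2) by auto
qed auto

lemma conv_None: "i < n \<Longrightarrow> j < n \<Longrightarrow> ((\<lambda>h. Ah0 h $$ (i, j)) \<longlongrightarrow> A0 $$ (i, j)) (at_right 0)"
  using conv[of "{None}" i j] holo_inf by simp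

lemma conv_None_mn: "0 < \<epsilon> \<Longrightarrow> \<forall>\<^sub>F h in at_right 0. mn n (\<lambda>i j. Ah0 h $$ (i, j) - A0 $$ (i, j)) \<le> \<epsilon>"
  using ul_mn[where K = "{0::nat}" and n = n and X = "\<lambda>h _ i j. Ah0 h $$ (i, j)" and ?X0.0 = "\<lambda>_ i j. A0 $$ (i, j)"
      and F = "at_right 0" and \<epsilon> = \<epsilon>] conv_None by simp

text \<open>The eigenvalues are the diagonal entries of the Jordan matrices and converge. A
  difference with limit 0 is eventually smaller than 1, so it is an integer only if it is 0; any
  other difference has a non-integer limit, and the complement of the integers is open.\<close>

lemma nonresonant_eventually: "\<forall>\<^sub>F h in at_right 0. nonresonant (Ah0 h)"
proof -
  define d where "d h k = jordan_matrix (bs h) $$ (k, k)" for h k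
  define dt where "dt k = jordan_matrix bst $$ (k, k)" for k
  have lim: "((\<lambda>h. d h k - d h l) \<longlongrightarrow> dt k - dt l) (at_right 0)" if "k < n" "l < n" for k l
    unfolding d_def dt_def by (intro tendsto_diff J_lim that)
  have ev: "\<forall>\<^sub>F h in at_right 0. d h k - d h l \<in> \<int> \<longrightarrow> d h k = d h l" if kl: "k < n" "l < n" for k l
  proof (cases "dt k = dt l")
    case True
    have "\<forall>\<^sub>F h in at_right 0. dist (d h k - d h l) (dt k - dt l) < 1" by (rule tendstoD[OF lim[OF kl]]) simp
    thus ?thesis
    proof eventually_elim
      case (elim h)
      show ?case
      proof
        assume "d h k - d h l \<in> \<int>"
        then obtain z where z: "d h k - d h l = of_int z" by (auto elim: Ints_cases)
        have "\<bar>real_of_int z\<bar> < 1" using elim True z by simp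
        hence "z = 0" by linarith
        thus "d h k = d h l" using z by simp
      qed
    qed
  next
    case False
    have "eigenvalue A0 (dt k)" "eigenvalue A0 (dt l)"
      unfolding dt_def by (rule jordan_reduction_eigenvalue[OF Jt A0] kl)+
    hence "dt k - dt l \<in> - \<int>" using nonres False by (auto simp: nonresonant_def)
    hence "\<forall>\<^sub>F h in at_right 0. d h k - d h l \<in> - \<int>"
      by (intro topological_tendstoD[OF lim[OF kl]] open_Compl closed_Ints)
    thus ?thesis by eventually_elim simp
  qed
  have "\<forall>\<^sub>F h in at_right 0. \<forall>k\<in>{..<n}. \<forall>l\<in>{..<n}. d h k - d h l \<in> \<int> \<longrightarrow> d h k = d h l"
    using ev by (intro eventually_ball_finite ballI finite_lessThan) auto
  with small_h[OF less_numeral_extra(1)] show ?thesis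
  proof eventually_elim
    case (elim h)
    show ?case unfolding nonresonant_def
    proof (intro allI impI)
      fix x y assume x: "eigenvalue (Ah0 h) x" and y: "eigenvalue (Ah0 h) y" and i: "x - y \<in> \<int>"
      have c: "Ah0 h \<in> carrier_mat n n" using A elim by simp
      have Jh: "jordan_reduction (Ah0 h) (Q h) (Qinv h) (bs h)" by (rule J) (use elim in simp)
      obtain k where "k < n" "x = d h k" using eigenvalue_jordan_diagonal[OF Jh c x] unfolding d_def by blast
      moreover obtain l where "l < n" "y = d h l" using eigenvalue_jordan_diagonal[OF Jh c y] unfolding d_def by blast
      ultimately show "x = y" using elim i by auto
    qed
  qed
qed

text \<open>The constants are taken from the limit system with a margin: the circle of radius r + 1
  avoids its poles, M exceeds its bound there by 1, and \<kappa> tolerates a perturbation of the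
  residue matrix. So one \<rho> works for all small h.\<close>

lemma canonical_system_eventually:
  assumes r: "0 < r" "\<And>a. Some a \<in> rm_poles At \<Longrightarrow> cmod a \<le> r"
  obtains \<rho> \<kappa> \<alpha> M where "0 < \<kappa>" "r + 3 \<le> \<rho>" "0 \<le> M" "mn n (fm A0) \<le> \<alpha>"
    "\<forall>\<^sub>F h in at_right 0. h \<in> {0<..<h0} \<and> h < 1 \<and> nonresonant (Ah0 h) \<and> mn n (fm (Ah0 h)) \<le> \<alpha> \<and> None \<notin> rm_poles (A h)
      \<and> (\<forall>x. r + 1 \<le> cmod x \<longrightarrow> Some x \<notin> rm_poles (A h))
      \<and> (\<exists>B. canonical_system n h \<rho> B \<kappa> (fm (Ah0 h)) (A h) (Q h) (Qinv h) (bs h)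
           \<and> (\<forall>s i j. i < n \<longrightarrow> j < n \<longrightarrow> cmod (B (Suc s) i j) \<le> (r + 1) * M * h_rising h s (r + 1)))"
proof -
  define R where "R = r + 1"
  have R: "0 < R" using r by (simp add: R_def)
  have npt: "Some x \<notin> rm_poles At" if "R \<le> cmod x" for x using r(2)[of x] that by (auto simp: R_def)
  have np: "\<forall>\<^sub>F h in at_right 0. sph_ext R \<inter> rm_poles (A h) = {}"
    by (rule no_poles_compact[OF compactin_sph_ext]) (use npt holo_inf in \<open>auto simp: sph_ext_def\<close>)
  obtain M0 where M0: "0 \<le> M0" "\<And>x i j. x \<in> sphere 0 R \<Longrightarrow> i < n \<Longrightarrow> j < n \<Longrightarrow> cmod (rm_eval At (Some x) $$ (i, j)) \<le> M0"
    by (rule rm_eval_bounded_sphere[OF At compact_sphere[of 0 R]]) (use npt in auto)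
  define M where "M = M0 + 1"
  have M: "0 \<le> M" using M0 by (simp add: M_def)
  have "\<forall>\<^sub>F h in at_right 0. \<forall>x\<in>sphere 0 R. mn n (\<lambda>i j. rm_eval (A h) (Some x) $$ (i, j) - rm_eval At (Some x) $$ (i, j)) \<le> 1"
    by (intro ul_mn conv_Some) (use npt in auto)
  hence Mh: "\<forall>\<^sub>F h in at_right 0. \<forall>x i j. cmod x = R \<longrightarrow> i < n \<longrightarrow> j < n \<longrightarrow> cmod (rm_eval (A h) (Some x) $$ (i, j)) \<le> M"
  proof eventually_elim
    case (elim h)
    show ?case
    proof (intro allI impI)
      fix x i j assume x: "cmod x = R" and ij: "i < n" "j < n"
      define D where "D = (\<lambda>i j. rm_eval (A h) (Some x) $$ (i, j) - rm_eval At (Some x) $$ (i, j))"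
      have "cmod (D i j) \<le> 1"
        using entry_le_mn[OF ij, of D] elim x by (force simp: D_def)
      moreover have "cmod (rm_eval At (Some x) $$ (i, j)) \<le> M0" using M0(2) x ij by simp
      moreover have "rm_eval (A h) (Some x) $$ (i, j) = D i j + rm_eval At (Some x) $$ (i, j)" by (simp add: D_def)
      ultimately show "cmod (rm_eval (A h) (Some x) $$ (i, j)) \<le> M"
        unfolding M_def by (metis add.commute add_mono norm_triangle_le)
    qed
  qed
  obtain \<kappa> \<delta> where k: "0 < \<kappa>" "0 < \<delta>"
    "\<And>A' s X. mn n (\<lambda>i j. A' i j - A0 $$ (i, j)) \<le> \<delta> \<Longrightarrow> 1 \<le> s \<Longrightarrow> real s * mn n X \<le> \<kappa> * mn n (sylv n s A' X)"
    by (rule sylv_uniform_bound[OF A0 Jt nonres]) (rule that, assumption+)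
  define \<alpha> where "\<alpha> = mn n (fm A0) + 1"
  have \<alpha>: "0 < \<alpha>" using mn_nonneg[of n "fm A0"] by (simp add: \<alpha>_def add_nonneg_pos del: mn_nonneg)
  define \<rho> where "\<rho> = R + 2 + 8 * \<kappa> * (real n * real n * R * M)"
  have \<rho>: "R + 2 \<le> \<rho>" using k(1) R M by (simp add: \<rho>_def)
  have hs: "0 < 1 / (4 * \<kappa> * \<alpha>)" using k(1) \<alpha> by simp
  show ?thesis
  proof (rule that[of \<kappa> \<rho> M \<alpha>])
    show "r + 3 \<le> \<rho>" using \<rho> by (simp add: R_def)
    show "mn n (fm A0) \<le> \<alpha>" by (simp add: \<alpha>_def)
    from nonresonant_eventually np Mh small_h[OF hs] small_h[OF less_numeral_extra(1)] conv_None_mn[OF k(2)] conv_None_mn[OF less_numeral_extra(1)]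
    show "\<forall>\<^sub>F h in at_right 0. h \<in> {0<..<h0} \<and> h < 1 \<and> nonresonant (Ah0 h) \<and> mn n (fm (Ah0 h)) \<le> \<alpha> \<and> None \<notin> rm_poles (A h)
      \<and> (\<forall>x. r + 1 \<le> cmod x \<longrightarrow> Some x \<notin> rm_poles (A h))
      \<and> (\<exists>B. canonical_system n h \<rho> B \<kappa> (fm (Ah0 h)) (A h) (Q h) (Qinv h) (bs h)
           \<and> (\<forall>s i j. i < n \<longrightarrow> j < n \<longrightarrow> cmod (B (Suc s) i j) \<le> (r + 1) * M * h_rising h s (r + 1)))"
    proof eventually_elim
      case (elim h)
      have h: "h \<in> {0<..<h0}" "0 < h" "h < 1" "h < 1 / (4 * \<kappa> * \<alpha>)" and nr: "nonresonant (Ah0 h)"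
        using elim by auto
      have Ac: "A h \<in> carrier_mat n n" by (rule A[OF h(1)])
      have Ac0: "Ah0 h \<in> carrier_mat n n" using Ac by simp
      note Jh = J[OF h(1)]
      have inf: "None \<notin> rm_poles (A h)" using elim(2) by (auto simp: sph_ext_def)
      have nph: "Some x \<notin> rm_poles (A h)" if "R \<le> cmod x" for x using elim(2) that by (auto simp: sph_ext_def)
      have \<alpha>h: "mn n (fm (Ah0 h)) \<le> \<alpha>"
      proof -
        have "mn n (fm (Ah0 h)) = mn n (\<lambda>i j. (Ah0 h $$ (i, j) - A0 $$ (i, j)) + A0 $$ (i, j))" by simp
        also have "\<dots> \<le> mn n (\<lambda>i j. Ah0 h $$ (i, j) - A0 $$ (i, j)) + mn n (fm A0)" by (rule mn_add_le)
        finally show ?thesis using elim(7) by (simp add: \<alpha>_def)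
      qed
      have sx: "\<exists>X. \<forall>i<n. \<forall>j<n. sylv n s (fm (Ah0 h)) X i j = C i j" if "1 \<le> s" for s C
        by (rule sylv_surj[OF Ac0 Jh nr that])
      have sb: "real s * mn n X \<le> \<kappa> * mn n (sylv n s (fm (Ah0 h)) X)" if "1 \<le> s" for s X
        by (rule k(3)[OF elim(6) that])
      have h3: "4 * \<kappa> * \<alpha> * h \<le> 1" using h(4) k(1) \<alpha> by (simp add: field_simps)
      have MM: "cmod (rm_eval (A h) (Some x) $$ (i, j)) \<le> M" if "cmod x = R" "i < n" "j < n" for x i j using elim(3) that by blast
      obtain B where B: "gauge_system n h \<rho> B \<kappa> (fm (Ah0 h))"
        "\<And>r x i j. R < r \<Longrightarrow> hdom h r x \<Longrightarrow> i < n \<Longrightarrow> j < n \<Longrightarrow> (\<lambda>s. B s i j * fe h s x) sums (rm_eval (A h) (Some x) $$ (i, j) - Ah0 h $$ (i, j))"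
        "\<kappa> * fact_kernel.\<beta> n h \<rho> B \<le> 1 / 4"
        "\<And>s i j. i < n \<Longrightarrow> j < n \<Longrightarrow> cmod (B (Suc s) i j) \<le> R * M * h_rising h s R"
        by (rule gauge_system_of_bounds[OF Ac inf nph R MM M sx sb k(1) \<alpha>h eq_refl[OF \<rho>_def[symmetric]] less_imp_le[OF h(2)] less_imp_le[OF h(3)] h3])
           (assumption | rule that)+
      interpret g: gauge_system n h \<rho> B \<kappa> "fm (Ah0 h)" by (rule B(1))
      have "canonical_system n h \<rho> B \<kappa> (fm (Ah0 h)) (A h) (Q h) (Qinv h) (bs h)"
      proof (unfold_locales, goal_cases)
        case 1 show ?case by (rule Ac)
      next
        case 2 show ?case by (rule h(2))
      next
        case 3 show ?case by (rule Jh)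
      next
        case (4 i j) show ?case ..
      next
        case (5 x i j) thus ?case using \<rho> by (intro B(2)[of \<rho>]) auto
      next
        case (6 x) thus ?case using \<rho> by (intro nph) auto
      next
        case 7 show ?case by (rule B(3))
      qed
      thus ?case using h nr \<alpha>h inf nph B(4) unfolding R_def by auto
    qed
  qed (use k M in auto)
qed

text \<open>Cauchy's bound on the circle of radius r + 1 has the form required by type (C,
  \<lambda>) with \<lambda> = r + 1; n^2 and the constant c convert entries into the given
  norm.\<close>

lemma fuchsian_eventually:
  assumes nrm: "algebra_norm n nrm"
  shows "\<exists>h1\<in>{0<..<h0}. \<forall>h0'\<in>{0<..h1}.
            (\<exists>C lam. fuchsian_family n nrm h0' (\<lambda>h x. rm_eval (A h) (Some x)) C lam) \<and>
            (\<forall>h\<in>{0<..<h0'}. nonresonant (rm_eval (A h) None))"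
proof -
  obtain c where c: "0 \<le> c" "\<And>X. X \<in> carrier_mat n n \<Longrightarrow> nrm X \<le> c * mn n (fm X)"
    by (rule algebra_norm_le_mn[OF nrm]) blast
  obtain r where r: "0 < r" "\<And>a. Some a \<in> rm_poles At \<Longrightarrow> cmod a < r" by (rule rm_poles_bound[of At]) blast
  obtain \<rho> \<kappa> \<alpha> M where p: "0 < \<kappa>" "r + 3 \<le> \<rho>" "0 \<le> M"
    and ev: "\<forall>\<^sub>F h in at_right 0. h \<in> {0<..<h0} \<and> h < 1 \<and> nonresonant (Ah0 h) \<and> mn n (fm (Ah0 h)) \<le> \<alpha> \<and> None \<notin> rm_poles (A h)
      \<and> (\<forall>x. r + 1 \<le> cmod x \<longrightarrow> Some x \<notin> rm_poles (A h))
      \<and> (\<exists>B. canonical_system n h \<rho> B \<kappa> (fm (Ah0 h)) (A h) (Q h) (Qinv h) (bs h)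
           \<and> (\<forall>s i j. i < n \<longrightarrow> j < n \<longrightarrow> cmod (B (Suc s) i j) \<le> (r + 1) * M * h_rising h s (r + 1)))"
    by (rule canonical_system_eventually[OF r(1) less_imp_le[OF r(2)]]) (assumption | rule that)+
  define P where "P h B \<longleftrightarrow> canonical_system n h \<rho> B \<kappa> (fm (Ah0 h)) (A h) (Q h) (Qinv h) (bs h)
           \<and> (\<forall>s i j. i < n \<longrightarrow> j < n \<longrightarrow> cmod (B (Suc s) i j) \<le> (r + 1) * M * h_rising h s (r + 1))" for h B
  obtain b where b: "0 < b" "\<And>h. 0 < h \<Longrightarrow> h < b \<Longrightarrow> h \<in> {0<..<h0} \<and> nonresonant (Ah0 h) \<and> mn n (fm (Ah0 h)) \<le> \<alpha> \<and> (\<exists>B. P h B)"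
    using ev unfolding eventually_at_right_field P_def by blast
  define B where "B h = (SOME B. P h B)" for h
  have PB: "P h (B h)" if "0 < h" "h < b" for h
  proof -
    have "\<exists>B. P h B" using b(2)[OF that] by blast
    from someI_ex[OF this] show ?thesis by (simp only: B_def)
  qed
  define As where "As h s = (if s = 0 then Ah0 h else Matrix.mat n n (\<lambda>(i, j). B h s i j))" for h s
  have Ash: "mat_has_fact_series n h (As h) (\<lambda>x. rm_eval (A h) (Some x))" if h: "0 < h" "h < b" for h
  proof -
    interpret canonical_system n h \<rho> "B h" \<kappa> "fm (Ah0 h)" "A h" "Q h" "Qinv h" "bs h"
      using PB[OF h] by (simp add: P_def)
    have "has_fact_series h (\<lambda>s. As h s $$ (i, j)) (\<lambda>x. rm_eval (A h) (Some x) $$ (i, j))" if ij: "i < n" "j < n" for i j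
      unfolding has_fact_series_def
    proof (intro exI[of _ \<rho>] conjI allI impI)
      show "0 \<le> \<rho>" using p r by simp
      fix x :: complex assume "\<rho> < Re x"
      hence d: "hdom h \<rho> x" by (intro hdom_Re) simp
      define e where "e = Ah0 h $$ (i, j)"
      have "(\<lambda>s. if s = 0 then e else 0) sums e" using sums_single[of 0 "\<lambda>_. e"] by simp
      from sums_add[OF this A_series[OF d ij]]
      have "(\<lambda>s. (if s = 0 then e else 0) + B h s i j * fe h s x) sums rm_eval (A h) (Some x) $$ (i, j)" by (simp add: e_def)
      moreover have "(if s = 0 then e else 0) + B h s i j * fe h s x = As h s $$ (i, j) * inverse (h_rising h s x)" for s
        using ij by (simp add: As_def e_def fe_def B0)
      ultimately show "(\<lambda>s. As h s $$ (i, j) * inverse (h_rising h s x)) sums rm_eval (A h) (Some x) $$ (i, j)" by simp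
    qed
    thus ?thesis unfolding mat_has_fact_series_def using A Ainf by (auto simp: As_def)
  qed
  have nb: "nrm (As h s) \<le> c * (real n * real n * ((r + 1) * M)) * h_rising h (s - 1) (r + 1)" if h: "0 < h" "h < b" and s: "1 \<le> s" for h s
  proof -
    obtain t where t: "s = Suc t" using s by (cases s) auto
    have "nrm (As h s) \<le> c * mn n (fm (As h s))" by (rule c(2)) (use t in \<open>simp add: As_def\<close>)
    also have "\<dots> \<le> c * (real n * real n * ((r + 1) * M * h_rising h t (r + 1)))"
      using PB[OF h] by (intro mult_left_mono mn_le c(1)) (simp add: As_def t P_def)
    finally show ?thesis by (simp add: t mult_ac)
  qed
  define h1 where "h1 = min b h0 / 2"
  have h1: "h1 \<in> {0<..<h0}" "h1 < b" using b(1) h0 by (auto simp: h1_def)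
  show ?thesis
  proof (intro bexI[OF _ h1(1)] ballI conjI)
    fix h0' assume "h0' \<in> {0<..h1}"
    hence h0': "0 < h0'" "h0' < b" using h1 by auto
    show "nonresonant (rm_eval (A h) None)" if "h \<in> {0<..<h0'}" for h using b(2)[of h] that h0' by simp
    show "\<exists>C lam. fuchsian_family n nrm h0' (\<lambda>h x. rm_eval (A h) (Some x)) C lam"
    proof (rule exI[of _ "c * (real n * real n * ((r + 1) * M))"], rule exI[of _ "r + 1"], unfold fuchsian_family_def,
        intro exI[of _ As] conjI ballI bexI[of _ "h0' / 2"] allI impI)
      show "0 \<le> c * (real n * real n * ((r + 1) * M))" using c(1) p(3) r(1) by simp
      show "0 \<le> r + 1" using r(1) by simp
      show "mat_has_fact_series n h (As h) (\<lambda>x. rm_eval (A h) (Some x))" if "h \<in> {0<..<h0'}" for h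
        using that h0' by (intro Ash) auto
      show "nrm (As h s) \<le> c * (real n * real n * ((r + 1) * M)) * h_rising h (s - 1) (r + 1)" if "h \<in> {0<..<h0' / 2}" "1 \<le> s" for h s
        using that h0' by (intro nb) auto
      have "cmod (complex_of_real (nrm (As h 0))) \<le> c * \<alpha>" if h: "h \<in> {0<..<h0'}" for h
      proof -
        have hb: "0 < h" "h < b" using h h0' by auto
        have Ac: "Ah0 h \<in> carrier_mat n n" using A b(2)[OF hb] by simp
        hence "0 \<le> nrm (Ah0 h)" using nrm unfolding algebra_norm_def by blast
        moreover have "nrm (Ah0 h) \<le> c * \<alpha>"
          using c(2)[OF Ac] mult_left_mono[OF _ c(1), of "mn n (fm (Ah0 h))" \<alpha>] b(2)[OF hb] by linarith
        ultimately show ?thesis by (simp add: As_def)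
      qed
      thus "bounded ((\<lambda>h. nrm (As h 0)) ` {0<..<h0'})" by (auto simp: bounded_iff intro!: exI[of _ "c * \<alpha>"])
    qed (use h0' in auto)
  qed
qed

end

lemma ul_const_tendsto:
  fixes f :: "'a \<Rightarrow> complex"
  assumes "(f \<longlongrightarrow> l) F"
  shows "uniform_limit K (\<lambda>h x. f h) (\<lambda>x. l) F"
proof (rule uniform_limitI)
  fix e :: real assume "0 < e"
  from tendstoD[OF assms this] show "\<forall>\<^sub>F h in F. \<forall>x\<in>K. dist (f h) l < e" by eventually_elim simp
qed

lemma ul_difference_quotient:
  fixes f f' :: "complex \<Rightarrow> complex"
  assumes S: "open S" and f: "\<And>x. x \<in> S \<Longrightarrow> (f has_field_derivative f' x) (at x)" and cf': "continuous_on S f'"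
    and K: "compact K" "K \<subseteq> S"
  shows "uniform_limit K (\<lambda>h x. (f x - f (x - of_real h)) / of_real h) f' (at_right 0)"
    and "uniform_limit K (\<lambda>h x. f (x - of_real h)) f (at_right 0)"
proof -
  note D = difference_quotient_uniform[OF S f cf' K]
  show "uniform_limit K (\<lambda>h x. (f x - f (x - of_real h)) / of_real h) f' (at_right 0)"
    by (rule ulI_le, rule eventually_mono[OF D]) auto
  show "uniform_limit K (\<lambda>h x. f (x - of_real h)) f (at_right 0)"
    by (rule ulI_le, rule eventually_mono[OF D]) auto
qed

lemma rm_eval_continuous_on:
  assumes A: "A \<in> carrier_mat n n" and K: "\<And>x. x \<in> K \<Longrightarrow> Some x \<notin> rm_poles A" and ij: "i < n" "j < n"
  shows "continuous_on K (\<lambda>x. rm_eval A (Some x) $$ (i, j))"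
  unfolding rm_eval_index[OF A ij]
  by (intro continuous_at_imp_continuous_on ballI analytic_at_imp_isCont rf_eval_analytic_at not_rm_poleD[OF A ij] K)

lemma mm_continuous_on:
  assumes "\<And>i j. i < n \<Longrightarrow> j < n \<Longrightarrow> continuous_on K (\<lambda>x. X x i j)" "\<And>i j. i < n \<Longrightarrow> j < n \<Longrightarrow> continuous_on K (\<lambda>x. Y x i j)"
    and "i < n" "j < n"
  shows "continuous_on K (\<lambda>x. mm n (X x) (Y x) i j)"
  unfolding mm_def using assms by (intro continuous_on_sum continuous_on_mult) auto

context unfolding_family
begin

text \<open>The error has two sources, the scalar characters and the residue matrix;
  \<open>mfun_perturbation\<close> separates them, and each gets half of \<epsilon>.\<close>

lemma h_exp_mat_uniform:
  assumes K: "compact K" "\<And>x. x \<in> K \<Longrightarrow> 0 < Re x"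
    and \<alpha>: "mn n (fm A0) \<le> \<alpha>" "\<forall>\<^sub>F h in at_right 0. mn n (fm (Ah0 h)) \<le> \<alpha>" and ij: "i < n" "j < n"
  shows "uniform_limit K (\<lambda>h x. h_exp_mat h (Ah0 h) x $$ (i, j)) (\<lambda>x. mat_cpow n x A0 $$ (i, j)) (at_right 0)"
proof (rule ulI_le)
  fix \<epsilon> :: real assume e: "0 < \<epsilon>"
  have \<alpha>0: "0 \<le> \<alpha>" using \<alpha>(1) mn_nonneg order_trans by blast
  \<comment> \<open>A radius at least twice the norm bound, as \<open>mfun_perturbation\<close>
    asks, and positive also for \<alpha> = 0.\<close>
  define m where "m = 2 * \<alpha> + 1"
  have m: "0 < m" "0 \<le> m" "2 * \<alpha> \<le> m" using \<alpha>0 by (auto simp: m_def)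
  have nr: "x \<notin> \<real>\<^sub>\<le>\<^sub>0" if "x \<in> K" for x using K(2)[OF that] by (auto simp: complex_nonpos_Reals_iff)
  have "continuous_on K Ln" using nr by (intro continuous_on_Ln continuous_on_id) auto
  hence "bounded (Ln ` K)" by (intro compact_imp_bounded compact_continuous_image K(1))
  then obtain l where l: "\<forall>x\<in>K. cmod (Ln x) \<le> l" by (auto simp: bounded_iff)
  define g where "g = exp (m * l)"
  have g: "cmod (exp (c * Ln x)) \<le> g" if "x \<in> K" "cmod c \<le> m" for c x
  proof -
    have "cmod (exp (c * Ln x)) \<le> exp (cmod (c * Ln x))" by (rule norm_exp)
    also have "cmod (c * Ln x) \<le> m * l" unfolding norm_mult using l that m by (intro mult_mono) auto
    finally show ?thesis by (simp add: g_def)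
  qed
  define e1 where "e1 = \<epsilon> / (4 * (real n + 1))"
  define C where "C = 4 * real n / m * g"
  have C: "0 \<le> C" using m by (simp add: C_def g_def)
  define e2 where "e2 = \<epsilon> / (2 * (C + 1))"
  have e12: "0 < e1" "0 < e2" using e C by (auto simp: e1_def e2_def)
  have b1: "2 * real n * e1 \<le> \<epsilon> / 2"
  proof -
    have "2 * real n * e1 \<le> 2 * (real n + 1) * e1" using e12 by (intro mult_right_mono) auto
    also have "\<dots> = \<epsilon> / 2" by (simp add: e1_def field_simps)
    finally show ?thesis .
  qed
  have b2: "C * e2 \<le> \<epsilon> / 2"
  proof -
    have "C * e2 \<le> (C + 1) * e2" using e12 by (intro mult_right_mono) auto
    also have "\<dots> = \<epsilon> / 2" using C by (simp add: e2_def field_simps)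
    finally show ?thesis .
  qed
  have "\<forall>\<^sub>F h in at_right 0. \<forall>x\<in>K. \<forall>c. cmod c \<le> m \<longrightarrow> cmod (h_char h c x - exp (c * Ln x)) \<le> e1"
    by (rule h_char_tendsto[OF K m(2) e12(1)])
  from this conv_None_mn[OF e12(2)] \<alpha>(2) small_h[OF less_numeral_extra(1)]
  show "\<forall>\<^sub>F h in at_right 0. \<forall>x\<in>K. cmod (h_exp_mat h (Ah0 h) x $$ (i, j) - mat_cpow n x A0 $$ (i, j)) \<le> \<epsilon>"
  proof eventually_elim
    case (elim h)
    have h: "h \<in> {0<..<h0}" using elim by blast
    have c: "Ah0 h \<in> carrier_mat n n" using A[OF h] by simp
    show ?case
    proof
      fix x assume x: "x \<in> K"
      have "cmod (mfun n (\<lambda>c. h_char h c x) (Ah0 h) $$ (i, j) - mfun n (\<lambda>c. exp (c * Ln x)) A0 $$ (i, j))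
        \<le> 2 * real n * e1 + 4 * real n / m * g * mn n (\<lambda>i j. Ah0 h $$ (i, j) - A0 $$ (i, j))"
      proof (rule mfun_perturbation[OF h_char_entire _ m(1) _ _ c elim(3) A0 \<alpha>(1) m(3) J[OF h] Jt ij])
        show "(\<lambda>c. exp (c * Ln x)) holomorphic_on UNIV" by (intro holomorphic_intros)
        show "cmod (h_char h c x - exp (c * Ln x)) \<le> e1" if "cmod c \<le> m" for c using elim(1) x that by blast
        show "cmod (exp (c * Ln x)) \<le> g" if "cmod c \<le> m" for c using g[OF x that] .
      qed
      also have "\<dots> \<le> \<epsilon> / 2 + C * e2"
        unfolding C_def[symmetric] using elim(2) C by (intro add_mono b1 mult_left_mono)
      finally show "cmod (h_exp_mat h (Ah0 h) x $$ (i, j) - mat_cpow n x A0 $$ (i, j)) \<le> \<epsilon>"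
        unfolding h_exp_mat_eq[OF c J[OF h]] mat_cpow_mfun using b2 by simp
    qed
  qed
qed

text \<open>As h tends to 0 the residual converges to the defect of the differential gauge equation
  x G' = a G - G A0, which is zero.\<close>

lemma residual_uniform:
  assumes r: "0 < r" "\<And>a. Some a \<in> rm_poles At \<Longrightarrow> cmod a \<le> r"
    and dG: "\<And>x i j. r < cmod x \<Longrightarrow> i < n \<Longrightarrow> j < n \<Longrightarrow> ((\<lambda>x. G x i j) has_field_derivative
        (mm n (fm (rm_eval At (Some x))) (G x) i j - mm n (G x) (fm A0) i j) / x) (at x)"
    and ij: "i < n" "j < n"
  shows "uniform_limit (sphere 0 (r + 2)) (\<lambda>h x. mm n (fm (rm_eval (A h) (Some x))) (G x) i j - mm n (G (x - of_real h)) (fm (Ah0 h)) i j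
      - (x - of_real h) / of_real h * (G x i j - G (x - of_real h) i j)) (\<lambda>x. 0) (at_right 0)"
proof -
  define S where "S = {x. r < cmod x}"
  define K where "K = sphere (0::complex) (r + 2)"
  have S: "open S" unfolding S_def by (intro open_Collect_less continuous_intros)
  have K: "compact K" "K \<subseteq> S" using r by (auto simp: K_def S_def)
  have np: "Some x \<notin> rm_poles At" "x \<noteq> 0" if "x \<in> S" for x using r that by (auto simp: S_def dest: r(2))
  define a where "a x = fm (rm_eval At (Some x))" for x
  define G' where "G' i j x = (mm n (a x) (G x) i j - mm n (G x) (fm A0) i j) / x" for i j x
  have dG': "((\<lambda>x. G x i j) has_field_derivative G' i j x) (at x)" if "x \<in> S" "i < n" "j < n" for x i j
    using dG that unfolding G'_def a_def S_def by simp
  have cG: "continuous_on S (\<lambda>x. G x i j)" if "i < n" "j < n" for i j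
    by (intro continuous_at_imp_continuous_on ballI DERIV_isCont[OF dG'[OF _ that]])
  have ca: "continuous_on S (\<lambda>x. a x i j)" if "i < n" "j < n" for i j
    unfolding a_def by (rule rm_eval_continuous_on[OF At np(1) that])
  have cG': "continuous_on S (G' i j)" if "i < n" "j < n" for i j
    unfolding G'_def using np(2)
    by (intro continuous_on_divide continuous_on_diff mm_continuous_on ca cG that continuous_on_const continuous_on_id) auto
  note on_K = continuous_on_subset[OF _ K(2)]
  have Q1: "uniform_limit K (\<lambda>h x. (G x i j - G (x - of_real h) i j) / of_real h) (G' i j) (at_right 0)" if ij: "i < n" "j < n" for i j
    by (rule ul_difference_quotient(1)[OF S dG'[OF _ ij] cG'[OF ij] K])
  have Q2: "uniform_limit K (\<lambda>h x. G (x - of_real h) i j) (\<lambda>x. G x i j) (at_right 0)" if ij: "i < n" "j < n" for i j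
    by (rule ul_difference_quotient(2)[OF S dG'[OF _ ij] cG'[OF ij] K])
  have u4: "uniform_limit K (\<lambda>h x. rm_eval (A h) (Some x) $$ (i, j)) (\<lambda>x. a x i j) (at_right 0)" if "i < n" "j < n" for i j
    unfolding a_def by (rule conv_Some[OF K(1) _ that]) (use np(1) K(2) in blast)
  have u5: "uniform_limit K (\<lambda>h x. Ah0 h $$ (i, j)) (\<lambda>x. A0 $$ (i, j)) (at_right 0)" if "i < n" "j < n" for i j
    by (rule ul_const_tendsto[OF conv_None[OF that]])
  have u3: "uniform_limit K (\<lambda>h x. x - complex_of_real h) (\<lambda>x. x) (at_right 0)"
    by (rule ul_difference_quotient(2)[where f' = "\<lambda>_. 1" and S = UNIV]) (auto simp: K)
  have "uniform_limit K (\<lambda>h x. mm n (fm (rm_eval (A h) (Some x))) (G x) i j - mm n (G (x - of_real h)) (fm (Ah0 h)) i j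
      - (x - of_real h) * ((G x i j - G (x - of_real h) i j) / of_real h))
     (\<lambda>x. mm n (a x) (G x) i j - mm n (G x) (fm A0) i j - x * G' i j x) (at_right 0)"
  proof (intro uniform_limit_minus)
    show "uniform_limit K (\<lambda>h x. mm n (fm (rm_eval (A h) (Some x))) (G x) i j) (\<lambda>x. mm n (a x) (G x) i j) (at_right 0)"
      by (rule ul_mm[OF K(1) u4 uniform_limit_const on_K[OF ca] on_K[OF cG] ij])
    show "uniform_limit K (\<lambda>h x. mm n (G (x - of_real h)) (fm (Ah0 h)) i j) (\<lambda>x. mm n (G x) (fm A0) i j) (at_right 0)"
      by (rule ul_mm[OF K(1) Q2 u5 on_K[OF cG] continuous_on_const ij])
    show "uniform_limit K (\<lambda>h x. (x - of_real h) * ((G x i j - G (x - of_real h) i j) / of_real h)) (\<lambda>x. x * G' i j x) (at_right 0)"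
      by (rule ul_mult[OF K(1) u3 Q1[OF ij] continuous_on_id on_K[OF cG'[OF ij]]])
  qed
  moreover have "mm n (a x) (G x) i j - mm n (G x) (fm A0) i j - x * G' i j x = 0" if "x \<in> K" for x
    using np(2) that K(2) by (auto simp: G'_def)
  ultimately show ?thesis unfolding K_def
    by (subst uniform_limit_cong') (auto simp: K_def times_divide_eq_right)
qed

text \<open>Consistency of the Euler scheme: one step from x to x - h misses the exact solution by
  o(h), uniformly on K.\<close>

lemma euler_residual_uniform:
  assumes K: "compact K" "K \<subseteq> Omega_plus At"
    and dY: "\<And>x i j. x \<in> Omega_plus At \<Longrightarrow> i < n \<Longrightarrow> j < n \<Longrightarrow> ((\<lambda>x. Y x i j) has_field_derivative
        mm n (fm (rm_eval At (Some x))) (Y x) i j / x) (at x)"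
    and ij: "i < n" "j < n"
  shows "uniform_limit K (\<lambda>h x. (Y x i j - Y (x - of_real h) i j) / of_real h
      - inverse (x - of_real h) * mm n (fm (rm_eval (A h) (Some x))) (Y x) i j) (\<lambda>x. 0) (at_right 0)"
proof -
  define S where "S = Omega_plus At"
  have S: "open S" by (simp add: S_def open_Omega_plus)
  have KS: "K \<subseteq> S" using K by (simp add: S_def)
  have np: "Some x \<notin> rm_poles At" "x \<noteq> 0" if "x \<in> S" for x using Omega_plus_nonpole that by (auto simp: S_def)
  define a where "a x = fm (rm_eval At (Some x))" for x
  define Y' where "Y' i j x = mm n (a x) (Y x) i j / x" for i j x
  have dY': "((\<lambda>x. Y x i j) has_field_derivative Y' i j x) (at x)" if "x \<in> S" "i < n" "j < n" for x i j
    using dY that unfolding Y'_def a_def S_def by simp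
  have cY: "continuous_on S (\<lambda>x. Y x i j)" if "i < n" "j < n" for i j
    by (intro continuous_at_imp_continuous_on ballI DERIV_isCont[OF dY'[OF _ that]])
  have ca: "continuous_on S (\<lambda>x. a x i j)" if "i < n" "j < n" for i j
    unfolding a_def by (rule rm_eval_continuous_on[OF At np(1) that])
  have caY: "continuous_on S (\<lambda>x. mm n (a x) (Y x) i j)" by (rule mm_continuous_on[OF ca cY ij])
  have cY': "continuous_on S (Y' i j)"
    unfolding Y'_def using np(2) by (intro continuous_on_divide caY continuous_on_id) auto
  note on_K = continuous_on_subset[OF _ KS]
  have ci: "continuous_on S inverse" using np(2) by (intro continuous_on_inverse continuous_on_id) auto
  have u1: "uniform_limit K (\<lambda>h x. inverse (x - complex_of_real h)) inverse (at_right 0)"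
  proof (rule ul_difference_quotient(2)[OF S _ _ K(1) KS])
    show "(inverse has_field_derivative - (inverse x * 1 * inverse x)) (at x)" if "x \<in> S" for x
      by (rule DERIV_inverse'[OF DERIV_ident np(2)[OF that]])
    show "continuous_on S (\<lambda>x. - (inverse x * 1 * inverse x))"
      by (intro continuous_on_minus continuous_on_mult ci continuous_on_const)
  qed
  have u2: "uniform_limit K (\<lambda>h x. rm_eval (A h) (Some x) $$ (i, j)) (\<lambda>x. a x i j) (at_right 0)" if "i < n" "j < n" for i j
    unfolding a_def by (rule conv_Some[OF K(1) _ that]) (use np(1) KS in blast)
  have "uniform_limit K (\<lambda>h x. (Y x i j - Y (x - of_real h) i j) / of_real h
      - inverse (x - of_real h) * mm n (fm (rm_eval (A h) (Some x))) (Y x) i j)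
      (\<lambda>x. Y' i j x - inverse x * mm n (a x) (Y x) i j) (at_right 0)"
  proof (rule uniform_limit_minus)
    show "uniform_limit K (\<lambda>h x. (Y x i j - Y (x - of_real h) i j) / of_real h) (Y' i j) (at_right 0)"
      by (rule ul_difference_quotient(1)[OF S dY'[OF _ ij] cY' K(1) KS])
    have "uniform_limit K (\<lambda>h x. mm n (fm (rm_eval (A h) (Some x))) (Y x) i j) (\<lambda>x. mm n (a x) (Y x) i j) (at_right 0)"
      by (rule ul_mm[OF K(1) u2 uniform_limit_const on_K[OF ca] on_K[OF cY] ij])
    thus "uniform_limit K (\<lambda>h x. inverse (x - of_real h) * mm n (fm (rm_eval (A h) (Some x))) (Y x) i j)
      (\<lambda>x. inverse x * mm n (a x) (Y x) i j) (at_right 0)"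
      by (rule ul_mult[OF K(1) u1 _ on_K[OF ci] on_K[OF caY]])
  qed
  moreover have "Y' i j x - inverse x * mm n (a x) (Y x) i j = 0" for x
    by (simp add: Y'_def divide_inverse)
  ultimately show ?thesis by simp
qed

text \<open>In the right part of the swept region both solutions are products of a regular factor
  and a character and are compared factor by factor; \<open>euler_close\<close> carries the estimate
  back to K.\<close>

theorem canonical_converges:
  assumes Y: "is_frobenius_continuation n At Y" and K: "compact K" "K \<subseteq> Omega_plus At" and e: "0 < \<epsilon>"
  shows "\<forall>\<^sub>F h in at_right 0. \<forall>x\<in>K. mn n (\<lambda>i j. canonical_solution n h (A h) x $$ (i, j) - Y x $$ (i, j)) \<le> \<epsilon>"
proof -
  obtain r V G where r: "0 < r" "\<And>a. Some a \<in> rm_poles At \<Longrightarrow> cmod a \<le> r"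
    and V0: "\<And>i j. i < n \<Longrightarrow> j < n \<Longrightarrow> V 0 i j = (if i = j then 1 else 0)"
    and ser: "\<And>x i j. r < cmod x \<Longrightarrow> i < n \<Longrightarrow> j < n \<Longrightarrow> (\<lambda>s. V s i j * inverse x ^ s) sums G x i j"
    and dG: "\<And>x i j. r < cmod x \<Longrightarrow> i < n \<Longrightarrow> j < n \<Longrightarrow> ((\<lambda>x. G x i j) has_field_derivative
        (mm n (fm (rm_eval At (Some x))) (G x) i j - mm n (G x) (fm A0) i j) / x) (at x)"
    and dY: "\<And>x i j. x \<in> Omega_plus At \<Longrightarrow> i < n \<Longrightarrow> j < n \<Longrightarrow> ((\<lambda>x. Y x $$ (i, j)) has_field_derivative
        mm n (fm (rm_eval At (Some x))) (fm (Y x)) i j / x) (at x)"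
    and right: "\<And>x i j. r < Re x \<Longrightarrow> i < n \<Longrightarrow> j < n \<Longrightarrow> Y x $$ (i, j) = mm n (G x) (fm (mat_cpow n x A0)) i j"
    by (rule frobenius_continuationD[OF At Jt Y]) (assumption | rule that)+
  obtain \<rho> \<kappa> \<alpha> M where \<kappa>: "0 < \<kappa>" and \<rho>: "r + 3 \<le> \<rho>" and \<alpha>: "mn n (fm A0) \<le> \<alpha>"
    and ev: "\<forall>\<^sub>F h in at_right 0. h \<in> {0<..<h0} \<and> h < 1 \<and> nonresonant (Ah0 h) \<and> mn n (fm (Ah0 h)) \<le> \<alpha> \<and> None \<notin> rm_poles (A h)
      \<and> (\<forall>x. r + 1 \<le> cmod x \<longrightarrow> Some x \<notin> rm_poles (A h))
      \<and> (\<exists>B. canonical_system n h \<rho> B \<kappa> (fm (Ah0 h)) (A h) (Q h) (Qinv h) (bs h)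
           \<and> (\<forall>s i j. i < n \<longrightarrow> j < n \<longrightarrow> cmod (B (Suc s) i j) \<le> (r + 1) * M * h_rising h s (r + 1)))"
    by (rule canonical_system_eventually[OF r]) (assumption | rule that)+
  define \<rho>1 where "\<rho>1 = \<rho> + 1"
  have "bounded K" using K(1) by (rule compact_imp_bounded)
  then obtain b where b: "\<forall>x\<in>K. cmod x \<le> b" by (auto simp: bounded_iff)
  \<comment> \<open>A translation by T brings every point of K to Re x \<ge> \<rho>1.\<close>
  define T where "T = \<rho>1 + \<bar>b\<bar>"
  have T0: "0 < T" using \<rho> r by (simp add: T_def \<rho>1_def)
  have T: "\<rho>1 \<le> Re x + T" if "x \<in> K" for x
    using b that abs_Re_le_cmod[of x] by (force simp: T_def)
  \<comment> \<open>K swept to the right; the extra 1 leaves room for a last step of length h < 1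
    that overshoots.\<close>
  define S where "S = (\<lambda>p. fst p + complex_of_real (snd p)) ` (K \<times> {0..T + 1})"
  have SI: "x + complex_of_real t \<in> S" if "x \<in> K" "0 \<le> t" "t \<le> T + 1" for x t
    unfolding S_def using that by (intro image_eqI[of _ _ "(x, t)"]) auto
  have SE: "\<exists>x\<in>K. \<exists>t. 0 \<le> t \<and> t \<le> T + 1 \<and> z = x + complex_of_real t" if "z \<in> S" for z
    using that unfolding S_def by force
  have KS: "x \<in> S" if "x \<in> K" for x using SI[OF that, of 0] T0 by simp
  have S: "compact S" unfolding S_def
    by (intro compact_continuous_image compact_Times K compact_Icc continuous_intros)
  have SO: "S \<subseteq> Omega_plus At" using SE K(2) Omega_plus_right by blast
  have npS: "Some x \<notin> rm_poles At" "x \<noteq> 0" if "x \<in> S" for x using Omega_plus_nonpole SO that by blast+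
  define SR where "SR = S \<inter> {x. \<rho>1 \<le> Re x}"
  have SR: "compact SR" unfolding SR_def by (intro compact_Int_closed S closed_halfspace_Re_ge)
  have SRp: "0 < Re x" "r < Re x" "\<rho> \<le> Re x" if "x \<in> SR" for x using that \<rho> r by (auto simp: SR_def \<rho>1_def)
  define Yt where "Yt x = fm (Y x)" for x
  define Et where "Et x = fm (mat_cpow n x A0)" for x
  have rc: "r < cmod x" if "r < Re x" for x using that complex_Re_le_cmod[of x] by linarith
  have cG: "continuous_on SR (\<lambda>x. G x i j)" if "i < n" "j < n" for i j
    by (intro continuous_at_imp_continuous_on ballI DERIV_isCont[OF dG[OF _ that]] rc SRp)
  have cE: "continuous_on SR (\<lambda>x. Et x i j)" if "i < n" "j < n" for i j
  proof (intro continuous_at_imp_continuous_on ballI)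
    fix x assume "x \<in> SR"
    hence "x \<notin> \<real>\<^sub>\<le>\<^sub>0" using SRp(1)[of x] by (auto simp: complex_nonpos_Reals_iff)
    from DERIV_isCont[OF mat_cpow_has_field_derivative[OF A0 Jt that this]]
    show "isCont (\<lambda>x. Et x i j) x" by (simp add: Et_def)
  qed
  obtain g1 where g1: "0 \<le> g1" "\<And>x. x \<in> SR \<Longrightarrow> mn n (G x) \<le> g1" by (rule compact_mn_bound[where g = G, OF SR cG]) auto
  obtain g2 where g2: "0 \<le> g2" "\<And>x. x \<in> SR \<Longrightarrow> mn n (Et x) \<le> g2" by (rule compact_mn_bound[where g = Et, OF SR cE]) auto
  obtain l1 where l1: "0 \<le> l1" "\<And>x. x \<in> S \<Longrightarrow> mn n (fm (rm_eval At (Some x))) \<le> l1"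
    by (rule compact_mn_bound[where g = "\<lambda>x. fm (rm_eval At (Some x))", OF S rm_eval_continuous_on[OF At npS(1)]]) auto
  have "continuous_on S inverse" using npS(2) by (intro continuous_on_inverse continuous_on_id) auto
  hence "bounded (inverse ` S)" by (intro compact_imp_bounded compact_continuous_image S)
  then obtain l2 where l2: "\<forall>x\<in>S. inverse (cmod x) \<le> l2" by (auto simp: bounded_iff norm_inverse)
  \<comment> \<open>Bounds |A(z + h)|/|z|; the summand 1 pays for replacing the limit system by that
    of step h.\<close>
  define L where "L = (l1 + 1) * \<bar>l2\<bar>"
  have L: "0 \<le> L" using l1(1) by (simp add: L_def)
  \<comment> \<open>Bounds (1 + h L)^N for N h \<le> T + 2.\<close>
  define C where "C = exp (L * (T + 2))"
  have C: "0 < C" by (simp add: C_def)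
  \<comment> \<open>The starting error e0 and the local error \<tau> are chosen so that C (e0 + (T +
    2) \<tau>) = \<epsilon>.\<close>
  define e0 where "e0 = \<epsilon> / (2 * C)"
  define \<tau> where "\<tau> = \<epsilon> / (2 * C * (T + 2))"
  have e0\<tau>: "0 < e0" "0 < \<tau>" using e C T0 by (auto simp: e0_def \<tau>_def)
  have sumC: "C * (e0 + (T + 2) * \<tau>) = \<epsilon>"
  proof -
    have "2 * C * (T + 2) \<noteq> 0" using C T0 by simp
    hence "(T + 2) * \<tau> = \<epsilon> / (2 * C)" by (simp add: \<tau>_def)
    thus ?thesis using C by (simp add: e0_def)
  qed
  \<comment> \<open>The stability constant of \<open>F_close\<close>, without its factor
    \<eta>.\<close>
  define c1 where "c1 = 2 * \<kappa> * ((r + 2) * (real n * real n) / (\<rho> - (r + 2)))"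
  have c1: "0 \<le> c1" using \<kappa> r \<rho> by (simp add: c1_def)
  \<comment> \<open>\<eta> and e1 each account for one half of the starting error; g2 + 1 bounds the
    character of step h, because e1 \<le> 1.\<close>
  define \<eta> where "\<eta> = e0 / (2 * (c1 * (g2 + 1) + 1))"
  define e1 where "e1 = min 1 (e0 / (2 * (g1 + 1)))"
  have p1: "0 < c1 * (g2 + 1) + 1" using c1 g2 by (simp add: add_nonneg_pos)
  have \<eta>: "0 < \<eta>" using e0\<tau> p1 by (simp add: \<eta>_def)
  have e1: "0 < e1" "e1 \<le> 1" using e0\<tau> g1 by (auto simp: e1_def)
  have half: "d * (e0 / (2 * d)) = e0 / 2" if "0 < d" for d using that by simp
  have b1: "c1 * \<eta> * (g2 + 1) \<le> e0 / 2"
  proof -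
    have "c1 * \<eta> * (g2 + 1) = (c1 * (g2 + 1)) * \<eta>" by simp
    also have "\<dots> \<le> (c1 * (g2 + 1) + 1) * \<eta>" using \<eta> by (intro mult_right_mono) auto
    also have "\<dots> = e0 / 2" unfolding \<eta>_def by (rule half[OF p1])
    finally show ?thesis .
  qed
  have b2: "g1 * e1 \<le> e0 / 2"
  proof -
    have "g1 * e1 \<le> (g1 + 1) * (e0 / (2 * (g1 + 1)))" using g1 e1 by (intro mult_mono) (auto simp: e1_def)
    also have "\<dots> = e0 / 2" using g1 by (intro half) simp
    finally show ?thesis .
  qed
  have \<alpha>h: "\<forall>\<^sub>F h in at_right 0. mn n (fm (Ah0 h)) \<le> \<alpha>" using ev by eventually_elim blast
  have R1: "\<forall>\<^sub>F h in at_right 0. \<forall>x\<in>sphere 0 (r + 2). mn n (\<lambda>i j. (mm n (fm (rm_eval (A h) (Some x))) (G x) i j - mm n (G (x - of_real h)) (fm (Ah0 h)) i j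
      - (x - of_real h) / of_real h * (G x i j - G (x - of_real h) i j)) - 0) \<le> \<eta>"
    by (rule ul_mn[where ?X0.0 = "\<lambda>_ _ _. 0", OF _ \<eta>], rule residual_uniform[OF r dG])
  have R2: "\<forall>\<^sub>F h in at_right 0. \<forall>x\<in>SR. mn n (\<lambda>i j. h_exp_mat h (Ah0 h) x $$ (i, j) - Et x i j) \<le> e1"
    unfolding Et_def by (rule ul_mn[OF _ e1(1)], rule h_exp_mat_uniform[OF SR SRp(1) \<alpha> \<alpha>h])
  have R3: "\<forall>\<^sub>F h in at_right 0. \<forall>x\<in>S. mn n (\<lambda>i j. ((Yt x i j - Yt (x - of_real h) i j) / of_real h
      - inverse (x - of_real h) * mm n (fm (rm_eval (A h) (Some x))) (Yt x) i j) - 0) \<le> \<tau>"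
    unfolding Yt_def by (rule ul_mn[where ?X0.0 = "\<lambda>_ _ _. 0", OF _ e0\<tau>(2)], rule euler_residual_uniform[OF S SO dY])
  have R4: "\<forall>\<^sub>F h in at_right 0. \<forall>x\<in>S. mn n (\<lambda>i j. rm_eval (A h) (Some x) $$ (i, j) - rm_eval At (Some x) $$ (i, j)) \<le> 1"
    by (rule ul_mn[OF _ less_numeral_extra(1)], rule conv_Some[OF S npS(1)])
  have R5: "\<forall>\<^sub>F h in at_right 0. Some ` S \<inter> rm_poles (A h) = {}"
    by (rule no_poles_compact[OF compactin_sph_Some[OF S]]) (use npS(1) in auto)
  from ev R1 R2 R3 R4 R5 show ?thesis
  proof eventually_elim
    case (elim h)
    have h: "0 < h" "h < 1" using elim(1) by auto
    have inf: "None \<notin> rm_poles (A h)" and np: "\<And>x. r + 1 \<le> cmod x \<Longrightarrow> Some x \<notin> rm_poles (A h)" using elim(1) by blast+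
    obtain B where B: "canonical_system n h \<rho> B \<kappa> (fm (Ah0 h)) (A h) (Q h) (Qinv h) (bs h)" using elim(1) by blast
    interpret g: canonical_system n h \<rho> B \<kappa> "fm (Ah0 h)" "A h" "Q h" "Qinv h" "bs h" by (rule B)
    have F: "mn n (\<lambda>i j. G x i j - g.F x i j) \<le> c1 * \<eta>" if x: "x \<in> SR" for x
    proof -
      have "mn n (\<lambda>i j. G x i j - g.F x i j) \<le> 2 * \<kappa> * ((r + 2) * (real n * real n * \<eta>) / (\<rho> - (r + 2)))"
      proof (rule g.F_close[OF V0 ser r(1) _ _ np inf])
        show "r + 2 < \<rho>" "h \<le> 1" using \<rho> h by auto
        show "hdom h \<rho> x" using SRp(3)[OF x] by (intro hdom_Re)
        fix x i j assume x: "cmod x = r + 2" and ij: "i < n" "j < n"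
        define X where "X = (\<lambda>i j. (mm n (fm (rm_eval (A h) (Some x))) (G x) i j - mm n (G (x - of_real h)) (fm (Ah0 h)) i j
          - (x - of_real h) / of_real h * (G x i j - G (x - of_real h) i j)) - 0)"
        have "mn n X \<le> \<eta>" using elim(2) x unfolding X_def by simp
        hence "cmod (X i j) \<le> \<eta>" using entry_le_mn[OF ij, of X] by linarith
        thus "cmod (mm n (fm (rm_eval (A h) (Some x))) (G x) i j - mm n (G (x - of_real h)) (fm (Ah0 h)) i j
          - (x - of_real h) / of_real h * (G x i j - G (x - of_real h) i j)) \<le> \<eta>" by (simp add: X_def)
      qed
      thus ?thesis by (simp add: c1_def mult_ac)
    qed
    have start: "mn n (\<lambda>i j. g.Yraw x i j - Yt x i j) \<le> e0" if x: "x \<in> SR" for x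
    proof -
      define D where "D = (\<lambda>i j. G x i j - g.F x i j)"
      define H where "H = (\<lambda>i j. g.E x i j - Et x i j)"
      have D: "mn n D \<le> c1 * \<eta>" unfolding D_def by (rule F[OF x])
      have H: "mn n H \<le> e1" using elim(3) x unfolding H_def g.E_def by simp
      have E: "mn n (g.E x) \<le> g2 + 1"
      proof -
        have "mn n (g.E x) = mn n (\<lambda>i j. H i j + Et x i j)" by (simp add: H_def)
        also have "\<dots> \<le> mn n H + mn n (Et x)" by (rule mn_add_le)
        finally show ?thesis using H e1(2) g2(2)[OF x] by linarith
      qed
      \<comment> \<open>F E - G E' = G (E - E') - (G - F) E, where E' is the limit
        character.\<close>
      have "mn n (\<lambda>i j. g.Yraw x i j - Yt x i j) = mn n (\<lambda>i j. mm n (G x) H i j - mm n D (g.E x) i j)"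
      proof (rule mn_cong)
        fix i j assume ij: "i < n" "j < n"
        have "g.Yraw x i j = mm n (g.F x) (g.E x) i j"
          using g.Yraw_right[OF SRp(3)[OF x] ij] by (simp add: g.Y0_def)
        moreover have "Yt x i j = mm n (G x) (Et x) i j"
          using right[OF SRp(2)[OF x] ij] by (simp add: Yt_def Et_def)
        ultimately show "g.Yraw x i j - Yt x i j = mm n (G x) H i j - mm n D (g.E x) i j"
          by (simp add: D_def H_def mm_lin)
      qed
      also have "\<dots> \<le> mn n (mm n (G x) H) + mn n (mm n D (g.E x))" by (rule mn_diff_le)
      also have "\<dots> \<le> mn n (G x) * mn n H + mn n D * mn n (g.E x)" by (intro add_mono mn_mm_le)
      also have "\<dots> \<le> g1 * e1 + c1 * \<eta> * (g2 + 1)"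
        using g1 g2 c1 \<eta> by (intro add_mono mult_mono D E H g1(2)[OF x]) auto
      finally show ?thesis using b1 b2 by simp
    qed
    have NN: "mn n (\<lambda>i j. g.Yraw z i j - Yt z i j) \<le> (1 + h * L) ^ N * (e0 + real N * (h * \<tau>))"
      if z: "z \<in> S" "\<rho>1 \<le> Re z + real N * h" for z N
    proof (rule g.euler_close[where S = S and ?\<rho>1.0 = \<rho>1, OF _ _ _ _ L less_imp_le[OF e0\<tau>(2)] less_imp_le[OF e0\<tau>(1)] z])
      fix z assume zS: "z \<in> S" and "Re z < \<rho>1"
      then obtain x t where x: "x \<in> K" "0 \<le> t" "z = x + complex_of_real t" using SE by blast
      hence "t + h \<le> T + 1" using T[OF x(1)] \<open>Re z < \<rho>1\<close> h by simp
      from SI[OF x(1) _ this] show "z + of_real h \<in> S" using x h by (simp add: add.assoc)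
    next
      fix z assume "z \<in> S" "\<rho>1 \<le> Re z"
      thus "mn n (\<lambda>i j. g.Yraw z i j - Yt z i j) \<le> e0" by (intro start) (simp add: SR_def)
    next
      fix z assume z: "z \<in> S" and y: "z + of_real h \<in> S"
      define y where "y = z + complex_of_real h"
      have yS: "y \<in> S" using y by (simp add: y_def)
      have "mn n (fm (rm_eval (A h) (Some y))) \<le> l1 + 1"
      proof -
        have "mn n (fm (rm_eval (A h) (Some y))) = mn n (\<lambda>i j. (rm_eval (A h) (Some y) $$ (i, j) - rm_eval At (Some y) $$ (i, j)) + rm_eval At (Some y) $$ (i, j))" by simp
        also have "\<dots> \<le> mn n (\<lambda>i j. rm_eval (A h) (Some y) $$ (i, j) - rm_eval At (Some y) $$ (i, j)) + mn n (fm (rm_eval At (Some y)))"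
          by (rule mn_add_le)
        also have "\<dots> \<le> 1 + l1" by (intro add_mono l1(2)[OF yS]) (use elim(5) yS in blast)
        finally show ?thesis by simp
      qed
      moreover have "inverse (cmod z) \<le> \<bar>l2\<bar>" using l2 z by force
      ultimately show "mn n (fm (rm_eval (A h) (Some (z + of_real h)))) / cmod z \<le> L"
        unfolding L_def divide_inverse y_def[symmetric] using l1(1) by (intro mult_mono) auto
      define X where "X = (\<lambda>i j. ((Yt y i j - Yt (y - of_real h) i j) / of_real h
        - inverse (y - of_real h) * mm n (fm (rm_eval (A h) (Some y))) (Yt y) i j) - 0)"
      have X: "mn n X \<le> \<tau>" using elim(4) yS unfolding X_def by blast
      have "mn n (\<lambda>i j. Yt (z + of_real h) i j - of_real h / z * mm n (fm (rm_eval (A h) (Some (z + of_real h)))) (Yt (z + of_real h)) i j - Yt z i j)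
        = mn n (\<lambda>i j. of_real h * X i j)"
      proof (rule mn_cong)
        fix i j
        have "y - of_real h = z" by (simp add: y_def)
        thus "Yt (z + of_real h) i j - of_real h / z * mm n (fm (rm_eval (A h) (Some (z + of_real h)))) (Yt (z + of_real h)) i j - Yt z i j
          = of_real h * X i j"
          unfolding y_def[symmetric] X_def using h by (simp add: right_diff_distrib divide_inverse)
      qed
      also have "\<dots> \<le> h * \<tau>" unfolding mn_scale using X h by (simp add: mult_left_mono)
      finally show "mn n (\<lambda>i j. Yt (z + of_real h) i j - of_real h / z * mm n (fm (rm_eval (A h) (Some (z + of_real h)))) (Yt (z + of_real h)) i j - Yt z i j)
        \<le> h * \<tau>" .
    qed
    \<comment> \<open>Rounding up adds at most one step, so N h stays below T + 2.\<close>
    define N where "N = nat \<lceil>(T + 1) / h\<rceil>"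
    have Nh: "T + 1 \<le> real N * h" "real N * h \<le> T + 2"
    proof -
      have "0 \<le> (T + 1) / h" using T0 h by simp
      hence "(T + 1) / h \<le> real N" "real N \<le> (T + 1) / h + 1" unfolding N_def by linarith+
      thus "T + 1 \<le> real N * h" "real N * h \<le> T + 2" using h by (auto simp: field_simps)
    qed
    have "(1 + h * L) ^ N \<le> exp (h * L) ^ N" using h L by (intro power_mono exp_ge_add_one_self) simp
    also have "\<dots> = exp (L * (real N * h))" by (simp add: exp_of_nat_mult[symmetric] mult_ac)
    also have "\<dots> \<le> C" unfolding C_def using Nh(2) L by (simp add: mult_left_mono)
    finally have pw: "(1 + h * L) ^ N \<le> C" .
    have "real N * (h * \<tau>) = (real N * h) * \<tau>" by simp
    also have "\<dots> \<le> (T + 2) * \<tau>" using Nh(2) e0\<tau> by (intro mult_right_mono) auto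
    finally have "e0 + real N * (h * \<tau>) \<le> e0 + (T + 2) * \<tau>" by simp
    hence "(1 + h * L) ^ N * (e0 + real N * (h * \<tau>)) \<le> C * (e0 + (T + 2) * \<tau>)"
      using C e0\<tau> h by (intro mult_mono[OF pw]) auto
    hence fin: "(1 + h * L) ^ N * (e0 + real N * (h * \<tau>)) \<le> \<epsilon>" by (simp only: sumC)
    show ?case
    proof
      fix x assume x: "x \<in> K"
      have "mn n (\<lambda>i j. canonical_solution n h (A h) x $$ (i, j) - Y x $$ (i, j)) = mn n (\<lambda>i j. g.Yraw x i j - Yt x i j)"
        unfolding g.canonical_solution_eq
      proof (rule mn_cong)
        fix i j assume ij: "i < n" "j < n"
        \<comment> \<open>No singular point is met on the way to the right: x + k h stays in the cut
          plane and is not 0, and x + (k + 1) h lies in S, where A has no pole for small h. Hence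
          removing singularities does not change the value at x.\<close>
        have "g.Ycan x $$ (i, j) = g.Yraw x i j"
        proof (rule g.Ycan_eq_Yraw[OF ij])
          fix k assume k: "Re x + real k * h \<le> \<rho>"
          have "x + of_real (real k * h) \<in> Omega_plus At"
            using K(2) x h by (intro Omega_plus_right) auto
          thus "x + of_nat k * of_real h \<noteq> 0" using Omega_plus_nonpole by fastforce
          have "real k * h \<le> T" using k T[OF x] by (simp add: \<rho>1_def)
          hence "real (Suc k) * h \<le> T + 1" using h by (simp add: algebra_simps)
          hence "x + of_real (real (Suc k) * h) \<in> S" using h by (intro SI x) auto
          hence "Some (x + of_real (real (Suc k) * h)) \<notin> rm_poles (A h)" using elim(6) by blast
          thus "Some (x + of_nat (Suc k) * of_real h) \<notin> rm_poles (A h)" by simp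
        qed
        thus "g.Ycan x $$ (i, j) - Y x $$ (i, j) = g.Yraw x i j - Yt x i j" by (simp add: Yt_def)
      qed
      also have "\<dots> \<le> (1 + h * L) ^ N * (e0 + real N * (h * \<tau>))"
        by (rule NN[OF KS[OF x]]) (use T[OF x] Nh(1) in simp)
      also note fin
      finally show "mn n (\<lambda>i j. canonical_solution n h (A h) x $$ (i, j) - Y x $$ (i, j)) \<le> \<epsilon>" .
    qed
  qed
qed

end

theorem mainTheorem4:
  fixes n :: nat
    and nrm :: "complex mat \<Rightarrow> real"
    and h0 :: real
    and At :: "complex poly fract mat"
    and A :: "real \<Rightarrow> complex poly fract mat"
  assumes norm: "algebra_norm n nrm"
    and h0: "0 < h0"
    and At: "At \<in> carrier_mat n n"
    and A: "\<And>h. h \<in> {0<..<h0} \<Longrightarrow> A h \<in> carrier_mat n n"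
    and holo_inf: "None \<notin> rm_poles At"
    and nonres: "nonresonant (rm_eval At None)"
    and no_poles: "\<And>p. p \<notin> rm_poles At \<Longrightarrow>
      \<exists>U. openin riemann_sphere U \<and> p \<in> U \<and>
          (\<forall>\<^sub>F h in at_right 0. U \<inter> rm_poles (A h) = {})"
    and conv: "\<And>K i j. compactin riemann_sphere K \<Longrightarrow> K \<inter> rm_poles At = {} \<Longrightarrow>
      i < n \<Longrightarrow> j < n \<Longrightarrow>
      uniform_limit K (\<lambda>h p. rm_eval (A h) p $$ (i, j)) (\<lambda>p. rm_eval At p $$ (i, j)) (at_right 0)"
    and unfold: "jordan_unfolds n h0 (rm_eval At None) (\<lambda>h. rm_eval (A h) None)"
  shows "(\<exists>h1 \<in> {0<..<h0}. \<forall>h0' \<in> {0<..h1}.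
            (\<exists>C lam. fuchsian_family n nrm h0' (\<lambda>h x. rm_eval (A h) (Some x)) C lam) \<and>
            (\<forall>h \<in> {0<..<h0'}. nonresonant (rm_eval (A h) None))) \<and>
         (\<forall>K i j. compact K \<longrightarrow> K \<subseteq> Omega_plus At \<longrightarrow> i < n \<longrightarrow> j < n \<longrightarrow>
            uniform_limit K (\<lambda>h x. canonical_solution n h (A h) x $$ (i, j))
              (\<lambda>x. frobenius_solution n At x $$ (i, j)) (at_right 0))"
proof -
  obtain Qt Qtinv bst Q Qinv bs where U: "jordan_reduction (rm_eval At None) Qt Qtinv bst"
    "\<forall>h \<in> {0<..<h0}. jordan_reduction (rm_eval (A h) None) (Q h) (Qinv h) (bs h)"
    "\<forall>i<n. \<forall>j<n. ((\<lambda>h. jordan_matrix (bs h) $$ (i, j)) \<longlongrightarrow> jordan_matrix bst $$ (i, j)) (at_right 0)"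
    using unfold unfolding jordan_unfolds_def by blast
  interpret unfolding_family n h0 At A Qt Qtinv bst Q Qinv bs
    by (rule unfolding_family.intro[OF h0 At A holo_inf nonres no_poles conv U(1)]) (use U in \<open>blast+\<close>)
  \<comment> \<open>\<open>canonical_converges\<close> holds for every continuation, so existence
    suffices to insert the one chosen by \<open>SOME\<close>.\<close>
  have Y: "is_frobenius_continuation n At (frobenius_solution n At)"
    unfolding frobenius_solution_def by (rule someI_ex[OF frobenius_continuation_exists[OF At holo_inf nonres U(1)]])
  show ?thesis
  proof (intro conjI fuchsian_eventually[OF norm] allI impI)
    fix K i j assume K: "compact K" "K \<subseteq> Omega_plus At" and ij: "i < n" "j < n"
    show "uniform_limit K (\<lambda>h x. canonical_solution n h (A h) x $$ (i, j)) (\<lambda>x. frobenius_solution n At x $$ (i, j)) (at_right 0)"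
    proof (rule ulI_le)
      fix \<epsilon> :: real assume "0 < \<epsilon>"
      from canonical_converges[OF Y K this]
      show "\<forall>\<^sub>F h in at_right 0. \<forall>x\<in>K. cmod (canonical_solution n h (A h) x $$ (i, j) - frobenius_solution n At x $$ (i, j)) \<le> \<epsilon>"
      proof eventually_elim
        case (elim h)
        show ?case
        proof
          fix x assume "x \<in> K"
          with elim have "mn n (\<lambda>i j. canonical_solution n h (A h) x $$ (i, j) - frobenius_solution n At x $$ (i, j)) \<le> \<epsilon>" by blast
          with entry_le_mn[OF ij, of "\<lambda>i j. canonical_solution n h (A h) x $$ (i, j) - frobenius_solution n At x $$ (i, j)"]
          show "cmod (canonical_solution n h (A h) x $$ (i, j) - frobenius_solution n At x $$ (i, j)) \<le> \<epsilon>" by linarith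
        qed
      qed
    qed
  qed
qed

end
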